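(* Let $R$ be a local Noetherian super-ring containing a field, with maximal superideal $\mathfrak{M}=\mathfrak{m}\oplus R_1$. If $\mathfrak{N}$ is a special $\mathfrak{M}$-primary superideal of $R$, then $$\mathrm{Ksdim}(\mathsf{bgr}_{\mathfrak{N}}(R))=\mathrm{Ksdim}(R).$$
   Context: A super-ring is a unital associative $\mathbb{Z}_2$-graded ring $R=R_0\oplus R_1$; all super-rings are super-commutative ($ab=(-1)^{|a||b|}ba$ for homogeneous $a,b$, and $a^2=0$ for odd $a$). Superideals are $\mathbb{Z}_2$-graded ideals $I=I_0\oplus I_1$. Noetherian means the ascending chain condition on superideals. $R$ is local if $R_0$ is local with maximal ideal $\mathfrak{m}$; then $\mathfrak{M}=\mathfrak{m}\oplus R_1$ is its maximal superideal. A superideal $\mathfrak{N}$ is $\mathfrak{M}$-primary if $\mathfrak{n}:=\mathfrak{N}_0$ is an $\mathfrak{m}$-primary ideal of $R_0$. An $\mathfrak{M}$-primary superideal $\mathfrak{N}$ is special if $\mathfrak{N}_1=R_1$ and there are $x_1,\dots,x_d\in R_0$ whose residue classes form a system of parameters of the local ring $\overline{R}=R_0/R_1^2$ and generate the ideal $(\mathfrak{n}+R_1^2)/R_1^2$ of $\overline{R}$. For a super-ring $S$ with $\mathrm{Kdim}(S_0)<\infty$, odd elements $y_1,\dots,y_s\in S_1$ ($s\ge1$) form a system of odd parameters if $\mathrm{Kdim}(S_0/\mathrm{Ann}_{S_0}(y_1\cdots y_s))=\mathrm{Kdim}(S_0)$. $\mathrm{Ksdim}(S)=n\mid l$, where $n=\mathrm{Ksdim}_0(S)=\mathrm{Kdim}(S_0)$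 and $l=\mathrm{Ksdim}_1(S)$ is the supremum of lengths of systems of odd parameters of $S$ ($0$ if there are none). For a superideal $I$, put $I_{k,l}=I_0^kI_1^lR$ ($k,l\ge0$, $I_{0,0}=R$); $\mathsf{bgr}_I(R)=\bigoplus_{k,l\ge0}I_{k,l}/(I_{k+1,l}+I_{k,l+1})$, a super-ring with multiplication induced from $R$. *)

theory Defs
  imports
    "HOL-Algebra.Algebra"
    "HOL-Library.Extended_Real"
begin

section \<open>Commutative algebra\<close>

text \<open>
  The supremum is taken in the extended reals, so the zero ring, which has no prime ideals, has
  dimension \<open>-\<infinity>\<close>.  The distinction from dimension \<open>0\<close> matters in \<open>odd_parameters\<close> below.
\<close>

definition Kdim :: "('a, 'm) ring_scheme \<Rightarrow> ereal" where
  "Kdim A = Sup {ereal (real n) | n.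
     \<exists>P :: nat \<Rightarrow> 'a set. (\<forall>i\<le>n. primeideal (P i) A) \<and> (\<forall>i<n. P i \<subset> P (Suc i))}"

definition local_ring :: "('a, 'm) ring_scheme \<Rightarrow> 'a set \<Rightarrow> bool" where
  "local_ring A \<mm> \<longleftrightarrow> cring A \<and> {I. maximalideal I A} = {\<mm>}"

definition primary_ideal :: "'a set \<Rightarrow> ('a, 'm) ring_scheme \<Rightarrow> bool" where
  "primary_ideal \<qq> A \<longleftrightarrow> ideal \<qq> A \<and> \<qq> \<noteq> carrier A \<and>
     (\<forall>a\<in>carrier A. \<forall>b\<in>carrier A.
        a \<otimes>\<^bsub>A\<^esub> b \<in> \<qq> \<longrightarrow> a \<in> \<qq> \<or> (\<exists>n::nat. b [^]\<^bsub>A\<^esub> n \<in> \<qq>))"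

definition radical :: "('a, 'm) ring_scheme \<Rightarrow> 'a set \<Rightarrow> 'a set" where
  "radical A \<qq> = {a \<in> carrier A. \<exists>n::nat. a [^]\<^bsub>A\<^esub> n \<in> \<qq>}"

text \<open>\<open>\<qq>\<close> is an \<open>\<mm>\<close>-primary ideal of \<open>A\<close>.\<close>

definition primary_to :: "('a, 'm) ring_scheme \<Rightarrow> 'a set \<Rightarrow> 'a set \<Rightarrow> bool" where
  "primary_to A \<mm> \<qq> \<longleftrightarrow> primary_ideal \<qq> A \<and> radical A \<qq> = \<mm>"

definition system_of_parameters :: "('a, 'm) ring_scheme \<Rightarrow> 'a list \<Rightarrow> bool" where
  "system_of_parameters A xs \<longleftrightarrow> set xs \<subseteq> carrier A \<and> ereal (real (length xs)) = Kdim A \<and>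
     (\<exists>\<mm>. local_ring A \<mm> \<and> primary_to A \<mm> (Idl\<^bsub>A\<^esub> (set xs)))"


section \<open>Super-rings\<close>

record 'a superring = "'a ring" +
  even_part :: "'a set"
  odd_part :: "'a set"

locale super_ring = ring R for R :: "('a, 'm) superring_scheme" (structure) +
  assumes even_subgroup: "additive_subgroup (even_part R) R"
    and odd_subgroup: "additive_subgroup (odd_part R) R"
    and parts_sum: "even_part R <+>\<^bsub>R\<^esub> odd_part R = carrier R"
    and parts_disjoint: "even_part R \<inter> odd_part R = {\<zero>}"
    and one_even: "\<one> \<in> even_part R"
    and even_even: "\<lbrakk>a \<in> even_part R; b \<in> even_part R\<rbrakk> \<Longrightarrow> a \<otimes> b \<in> even_part R"
    and even_odd: "\<lbrakk>a \<in> even_part R; b \<in> odd_part R\<rbrakk> \<Longrightarrow> a \<otimes> b \<in> odd_part R"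
    and odd_even: "\<lbrakk>a \<in> odd_part R; b \<in> even_part R\<rbrakk> \<Longrightarrow> a \<otimes> b \<in> odd_part R"
    and odd_odd: "\<lbrakk>a \<in> odd_part R; b \<in> odd_part R\<rbrakk> \<Longrightarrow> a \<otimes> b \<in> even_part R"
    and even_comm: "\<lbrakk>a \<in> even_part R; b \<in> even_part R \<union> odd_part R\<rbrakk> \<Longrightarrow> a \<otimes> b = b \<otimes> a"
    and odd_anticomm: "\<lbrakk>a \<in> odd_part R; b \<in> odd_part R\<rbrakk> \<Longrightarrow> a \<otimes> b = \<ominus> (b \<otimes> a)"
    and odd_square: "a \<in> odd_part R \<Longrightarrow> a \<otimes> a = \<zero>"

definition even_ring :: "('a, 'm) superring_scheme \<Rightarrow> ('a, 'm) superring_scheme" where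
  "even_ring R = R\<lparr>carrier := even_part R\<rparr>"

definition superideal :: "'a set \<Rightarrow> ('a, 'm) superring_scheme \<Rightarrow> bool" where
  "superideal I R \<longleftrightarrow> ideal I R \<and> I = (I \<inter> even_part R) <+>\<^bsub>R\<^esub> (I \<inter> odd_part R)"

definition super_noetherian :: "('a, 'm) superring_scheme \<Rightarrow> bool" where
  "super_noetherian R \<longleftrightarrow>
     (\<forall>I :: nat \<Rightarrow> 'a set. (\<forall>n. superideal (I n) R) \<and> (\<forall>n. I n \<subseteq> I (Suc n)) \<longrightarrow>
        (\<exists>N. \<forall>n\<ge>N. I n = I N))"

text \<open>
  \<open>R\<close> is local with maximal superideal \<open>\<MM> = \<mm> \<oplus> R\<^sub>1\<close>, where \<open>\<mm>\<close> is the maximal ideal of \<open>R\<^sub>0\<close>.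
\<close>

definition local_super_ring ::
    "('a, 'm) superring_scheme \<Rightarrow> 'a set \<Rightarrow> 'a set \<Rightarrow> bool" where
  "local_super_ring R \<mm> \<MM> \<longleftrightarrow>
     super_ring R \<and> local_ring (even_ring R) \<mm> \<and> \<MM> = \<mm> <+>\<^bsub>R\<^esub> odd_part R"

text \<open>
  \<open>\<NN>\<close> is \<open>\<MM>\<close>-primary; when \<open>\<MM> = \<mm> \<oplus> R\<^sub>1\<close> one has \<open>\<MM> \<inter> R\<^sub>0 = \<mm>\<close>.
\<close>

definition primary_superideal ::
    "('a, 'm) superring_scheme \<Rightarrow> 'a set \<Rightarrow> 'a set \<Rightarrow> bool" where
  "primary_superideal R \<MM> \<NN> \<longleftrightarrow>
     superideal \<NN> R \<and> primary_to (even_ring R) (\<MM> \<inter> even_part R) (\<NN> \<inter> even_part R)"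

text \<open>
  The ideal \<open>R\<^sub>1\<^sup>2\<close> of \<open>R\<^sub>0\<close>: \<^const>\<open>ideal_prod\<close> forms all finite sums of products, for arbitrary
  sets of factors.
\<close>

definition odd_sq :: "('a, 'm) superring_scheme \<Rightarrow> 'a set" where
  "odd_sq R = ideal_prod R (odd_part R) (odd_part R)"

definition bar_ring :: "('a, 'm) superring_scheme \<Rightarrow> 'a set ring" where
  "bar_ring R = even_ring R Quot odd_sq R"

definition residue :: "('a, 'm) superring_scheme \<Rightarrow> 'a \<Rightarrow> 'a set" where
  "residue R x = odd_sq R +>\<^bsub>even_ring R\<^esub> x"

definition special_superideal ::
    "('a, 'm) superring_scheme \<Rightarrow> 'a set \<Rightarrow> 'a set \<Rightarrow> bool" where
  "special_superideal R \<MM> \<NN> \<longleftrightarrow>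
     primary_superideal R \<MM> \<NN> \<and> \<NN> \<inter> odd_part R = odd_part R \<and>
     (\<exists>xs. set xs \<subseteq> even_part R \<and>
        system_of_parameters (bar_ring R) (map (residue R) xs) \<and>
        Idl\<^bsub>bar_ring R\<^esub> (set (map (residue R) xs)) =
          residue R ` ((\<NN> \<inter> even_part R) <+>\<^bsub>R\<^esub> odd_sq R))"


section \<open>Krull super-dimension\<close>

definition even_ann :: "('a, 'm) superring_scheme \<Rightarrow> 'a \<Rightarrow> 'a set" where
  "even_ann S a = {r \<in> even_part S. r \<otimes>\<^bsub>S\<^esub> a = \<zero>\<^bsub>S\<^esub>}"

definition odd_parameters :: "('a, 'm) superring_scheme \<Rightarrow> 'a list \<Rightarrow> bool" where
  "odd_parameters S ys \<longleftrightarrow> Kdim (even_ring S) < \<infinity> \<and> ys \<noteq> [] \<and> set ys \<subseteq> odd_part S \<and>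
     Kdim (even_ring S Quot even_ann S (foldr (\<otimes>\<^bsub>S\<^esub>) ys \<one>\<^bsub>S\<^esub>)) = Kdim (even_ring S)"

definition Ksdim0 :: "('a, 'm) superring_scheme \<Rightarrow> ereal" where
  "Ksdim0 S = Kdim (even_ring S)"

text \<open>The supremum of the empty set in \<^typ>\<open>enat\<close> is \<open>0\<close>.\<close>

definition Ksdim1 :: "('a, 'm) superring_scheme \<Rightarrow> enat" where
  "Ksdim1 S = Sup {enat (length ys) | ys. odd_parameters S ys}"

definition Ksdim :: "('a, 'm) superring_scheme \<Rightarrow> ereal \<times> enat" where
  "Ksdim S = (Ksdim0 S, Ksdim1 S)"


section \<open>The bigraded super-ring of a superideal\<close>

text \<open>\<open>I\<^sub>0\<^sup>k I\<^sub>1\<^sup>l R\<close>, where the powers are formed by repeated multiplication from the left.\<close>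

definition bipow :: "('a, 'm) superring_scheme \<Rightarrow> 'a set \<Rightarrow> nat \<Rightarrow> nat \<Rightarrow> 'a set" where
  "bipow R I k l =
     ((\<lambda>J. ideal_prod R (I \<inter> even_part R) J) ^^ k)
       (((\<lambda>J. ideal_prod R (I \<inter> odd_part R) J) ^^ l) (carrier R))"

definition bipow_next :: "('a, 'm) superring_scheme \<Rightarrow> 'a set \<Rightarrow> nat \<Rightarrow> nat \<Rightarrow> 'a set" where
  "bipow_next R I k l = bipow R I (Suc k) l <+>\<^bsub>R\<^esub> bipow R I k (Suc l)"

text \<open>
  The additive group of the component of bidegree \<open>(k, l)\<close>, written multiplicatively as all
  groups of HOL-Algebra are.
\<close>

definition bgr_comp :: "('a, 'm) superring_scheme \<Rightarrow> 'a set \<Rightarrow> nat \<times> nat \<Rightarrow> 'a set monoid" where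
  "bgr_comp R I = (\<lambda>(k, l). add_monoid (R\<lparr>carrier := bipow R I k l\<rparr>) Mod bipow_next R I k l)"

definition bgr_add :: "('a, 'm) superring_scheme \<Rightarrow> 'a set \<Rightarrow> (nat \<times> nat \<Rightarrow> 'a set) monoid" where
  "bgr_add R I = sum_group UNIV (bgr_comp R I)"

text \<open>
  The component of bidegree \<open>(k, l)\<close> of a product is the sum of the products of the components of
  bidegrees \<open>(i, j)\<close> and \<open>(k - i, l - j)\<close>.  Here \<^const>\<open>rcoset_mult\<close> gives the class of the
  products in \<open>R\<close> of representatives; the sum is the \<^const>\<open>finprod\<close> of the multiplicatively written
  component group.
\<close>

definition bgr_mult ::
    "('a, 'm) superring_scheme \<Rightarrow> 'a set \<Rightarrow>
       (nat \<times> nat \<Rightarrow> 'a set) \<Rightarrow> (nat \<times> nat \<Rightarrow> 'a set) \<Rightarrow> (nat \<times> nat \<Rightarrow> 'a set)" where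
  "bgr_mult R I f g = (\<lambda>(k, l).
     finprod (bgr_comp R I (k, l))
       (\<lambda>(i, j). rcoset_mult R (bipow_next R I k l) (f (i, j)) (g (k - i, l - j)))
       ({..k} \<times> {..l}))"

text \<open>
  The parity of an element of \<open>bgr\<close> is the one inherited from \<open>R\<close>: each \<open>I\<^sub>0\<^sup>k I\<^sub>1\<^sup>l R\<close> is a superideal,
  so each component is \<open>\<int>\<^sub>2\<close>-graded by the classes of homogeneous elements.
\<close>

definition bgr_part ::
    "('a, 'm) superring_scheme \<Rightarrow> 'a set \<Rightarrow> 'a set \<Rightarrow> (nat \<times> nat \<Rightarrow> 'a set) set" where
  "bgr_part R I H = {f \<in> carrier (bgr_add R I).
     \<forall>k l. \<exists>a \<in> bipow R I k l \<inter> H. f (k, l) = bipow_next R I k l +>\<^bsub>R\<^esub> a}"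

definition bgr :: "('a, 'm) superring_scheme \<Rightarrow> 'a set \<Rightarrow> (nat \<times> nat \<Rightarrow> 'a set) superring" where
  "bgr R I = \<lparr>
     carrier = carrier (bgr_add R I),
     monoid.mult = bgr_mult R I,
     one = (\<lambda>(k, l). if (k, l) = (0, 0) then bipow_next R I 0 0 +>\<^bsub>R\<^esub> \<one>\<^bsub>R\<^esub>
                      else bipow_next R I k l),
     ring.zero = \<one>\<^bsub>bgr_add R I\<^esub>,
     ring.add = (\<otimes>\<^bsub>bgr_add R I\<^esub>),
     even_part = bgr_part R I (even_part R),
     odd_part = bgr_part R I (odd_part R)\<rparr>"

end

theory Submission
  imports Defs "HOL-Library.List_Lexorder"
begin

text \<open>
  Let \<open>d = Kdim R\<^sub>0\<close> and lift the system of parameters to \<open>x\<^sub>1, \<dots>, x\<^sub>d \<in> \<NN> \<inter> R\<^sub>0\<close>.  The ideal \<open>R\<^sub>1\<^sup>2\<close> is nil, so up to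
  nilpotents \<open>\<NN> \<inter> R\<^sub>0\<close> is generated by the \<open>x\<^sub>i\<close>.  Call an even element a unit form if its leading form
  in the \<open>x\<close>-adic filtration has a lexicographically least term with unit coefficient; unit
  forms are closed under multiplication.  By counting monomials against Hilbert functions, an ideal of
  \<open>R\<^sub>0\<close> is contained in the bottom of a chain of primes of length \<open>d\<close> if and only if it contains no unit
  form.  The even part of \<open>bgr\<close> is, modulo nilpotents, generated by the classes of the \<open>x\<^sub>i\<close> over a ring
  that is local modulo nilpotents, so its dimension is at most \<open>d\<close>, and the bottom of a chain of primes
  of length \<open>d\<close> contains no class of a unit form.

  Hence odd elements \<open>y\<^sub>1, \<dots>, y\<^sub>l\<close> of \<open>R\<close> are odd parameters if and only if no unit form kills
  \<open>y\<^sub>1 \<cdots> y\<^sub>l\<close>, and then some product of \<open>l\<close> of the finitely many generators of \<open>R\<^sub>1\<close> is not killed either.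
  If the class of every such product in \<open>bgr\<close> were annihilated by some singular element in the sense of Coquand
  and Lombardi, then unit forms would map all products of \<open>l\<close> generators into deeper steps of the
  filtration, and Gaussian elimination would yield a unit form killing all of them.  Conversely, a unit form killing
  all products of \<open>l\<close> generators has a class killing every product of \<open>l\<close> odd elements of \<open>bgr\<close>.
\<close>

section \<open>Spans and ideals\<close>

text \<open>Annihilators do not pass to leading forms: if a class in \<open>bgr\<close> kills the
  class of a product of odd elements, the product in \<open>R\<close> only moves one step deeper,
  where it becomes a combination of all words of the same length. So all words of length
  \<open>l\<close> are treated at once, as a linear system with unit forms on the diagonal. The odd
  direction of the bifiltration leads to no further relations: one extra odd factor has the wrong
  parity, and two form an element of \<open>R_1^2\<close>. This ideal is nil and is therefore put
  into every step; powers turn unit forms modulo \<open>R_1^2\<close> into honest ones.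

  The parameters need not be algebraically independent over the residue field in any usable sense,
  so a leading form has many representations. What is kept is one term with coefficient
  \<open>1\<close>, all others being lexicographically larger or having coefficients in the maximal
  ideal. Dimension enters by counting: elements of \<open>P (Suc i)\<close> outside
  \<open>P i\<close> give \<open>N^n\<close> monomials that are lexicographically independent over
  \<open>P 0\<close>, while a unit form in \<open>P 0\<close>, or a singular element in an ideal,
  lowers the growth of colengths to order \<open>d - 1\<close>.\<close>

definition is_ideal :: "'r::comm_ring_1 set \<Rightarrow> bool" where
  "is_ideal I \<longleftrightarrow> 0 \<in> I \<and> (\<forall>a\<in>I. \<forall>b\<in>I. a + b \<in> I) \<and> (\<forall>a\<in>I. \<forall>r. r * a \<in> I)"

definition is_prime :: "'r::comm_ring_1 set \<Rightarrow> bool" where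
  "is_prime P \<longleftrightarrow> is_ideal P \<and> 1 \<notin> P \<and> (\<forall>a b. a * b \<in> P \<longrightarrow> a \<in> P \<or> b \<in> P)"

definition is_subring :: "'r::comm_ring_1 set \<Rightarrow> bool" where
  "is_subring A \<longleftrightarrow> 0 \<in> A \<and> 1 \<in> A \<and> -1 \<in> A \<and> (\<forall>a\<in>A. \<forall>b\<in>A. a + b \<in> A \<and> a * b \<in> A)"

lemma is_idealD:
  assumes "is_ideal I"
  shows "0 \<in> I" "a \<in> I \<Longrightarrow> b \<in> I \<Longrightarrow> a + b \<in> I" "a \<in> I \<Longrightarrow> r * a \<in> I" "a \<in> I \<Longrightarrow> a * r \<in> I"
    "a \<in> I \<Longrightarrow> - a \<in> I" "a \<in> I \<Longrightarrow> b \<in> I \<Longrightarrow> a - b \<in> I"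
proof -
  show "0 \<in> I" "a \<in> I \<Longrightarrow> b \<in> I \<Longrightarrow> a + b \<in> I" and m: "\<And>a r. a \<in> I \<Longrightarrow> r * a \<in> I"
    using assms by (auto simp: is_ideal_def)
  show "a \<in> I \<Longrightarrow> a * r \<in> I" using m[of a r] by (simp add: mult.commute)
  show n: "- a \<in> I" if "a \<in> I" for a using m[OF that, of "-1"] by simp
  show "a \<in> I \<Longrightarrow> b \<in> I \<Longrightarrow> a - b \<in> I" using assms n[of b] unfolding is_ideal_def
    by (metis diff_conv_add_uminus)
qed

lemma is_primeD:
  assumes "is_prime P"
  shows "is_ideal P" "1 \<notin> P" "a * b \<in> P \<Longrightarrow> a \<notin> P \<Longrightarrow> b \<in> P"
  using assms by (auto simp: is_prime_def)

lemma is_prime_power: "is_prime P \<Longrightarrow> a ^ n \<in> P \<Longrightarrow> a \<in> P"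
  by (induction n) (auto simp: is_prime_def)

lemma is_subringD:
  assumes "is_subring A"
  shows "0 \<in> A" "1 \<in> A" "-1 \<in> A" "a \<in> A \<Longrightarrow> b \<in> A \<Longrightarrow> a + b \<in> A" "a \<in> A \<Longrightarrow> b \<in> A \<Longrightarrow> a * b \<in> A"
    "a \<in> A \<Longrightarrow> - a \<in> A" 
proof -
  show "0 \<in> A" "1 \<in> A" "-1 \<in> A" "a \<in> A \<Longrightarrow> b \<in> A \<Longrightarrow> a + b \<in> A"
    using assms by (auto simp: is_subring_def)
  have m: "a \<in> A \<Longrightarrow> b \<in> A \<Longrightarrow> a * b \<in> A" for a b
    using assms by (auto simp: is_subring_def)
  show "a \<in> A \<Longrightarrow> b \<in> A \<Longrightarrow> a * b \<in> A" by (rule m)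
  show "a \<in> A \<Longrightarrow> - a \<in> A"
    using m[of "-1" a] \<open>-1 \<in> A\<close> by auto
qed

lemma is_subring_UNIV [simp]: "is_subring UNIV"
  by (simp add: is_subring_def)

text \<open>The coefficient set is a parameter because the same counting is done twice: for ideals,
  with \<open>A = UNIV\<close>, and in \<open>bgr\<close>, where the monomials span only over the
  degree zero part.\<close>

inductive_set sp :: "'r::comm_ring_1 set \<Rightarrow> 'r set \<Rightarrow> 'r set" for A G where
  sp_zero: "0 \<in> sp A G"
| sp_step: "\<lbrakk>a \<in> A; x \<in> G; s \<in> sp A G\<rbrakk> \<Longrightarrow> a * x + s \<in> sp A G"

lemma sp_mono: "G \<subseteq> Y \<Longrightarrow> A \<subseteq> B \<Longrightarrow> sp A G \<subseteq> sp B Y"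
proof
  fix s assume "s \<in> sp A G" "G \<subseteq> Y" "A \<subseteq> B" then show "s \<in> sp B Y"
    by (induction) (auto intro: sp.intros)
qed

lemma sp_add: "s \<in> sp A G \<Longrightarrow> t \<in> sp A G \<Longrightarrow> s + t \<in> sp A G"
  by (induction rule: sp.induct) (auto simp: add.assoc intro: sp.intros)

lemma sp_mult:
  assumes "is_subring A" "s \<in> sp A G" "c \<in> A"
  shows "c * s \<in> sp A G"
  using assms(2,1,3)
proof (induction rule: sp.induct)
  case (sp_step a x s)
  then have "(c * a) * x + c * s \<in> sp A G" by (intro sp.sp_step) (auto dest: is_subringD)
  then show ?case by (simp add: algebra_simps)
qed (simp add: sp.intros)

lemma sp_base: "is_subring A \<Longrightarrow> x \<in> G \<Longrightarrow> x \<in> sp A G"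
  using sp.sp_step[of 1 A x G 0] by (auto dest: is_subringD intro: sp.intros)

lemma sp_base': "is_subring A \<Longrightarrow> x \<in> G \<Longrightarrow> a \<in> A \<Longrightarrow> a * x \<in> sp A G"
  by (simp add: sp_base sp_mult)

lemma sp_uminus: "is_subring A \<Longrightarrow> s \<in> sp A G \<Longrightarrow> - s \<in> sp A G"
  using sp_mult[of A s G "-1"] by (auto dest: is_subringD)

lemma sp_diff: "is_subring A \<Longrightarrow> s \<in> sp A G \<Longrightarrow> t \<in> sp A G \<Longrightarrow> s - t \<in> sp A G"
  using sp_add[of s A G "-t"] sp_uminus[of A t G] by simp

lemma sp_least: "is_subring A \<Longrightarrow> G \<subseteq> sp A Y \<Longrightarrow> sp A G \<subseteq> sp A Y"
proof
  fix s assume "s \<in> sp A G" "is_subring A" "G \<subseteq> sp A Y" then show "s \<in> sp A Y"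
    by (induction) (auto intro!: sp_add sp_mult sp_zero)
qed

lemma sp_leastD: "is_subring A \<Longrightarrow> s \<in> sp A G \<Longrightarrow> G \<subseteq> sp A Y \<Longrightarrow> s \<in> sp A Y"
  using sp_least by blast

lemma sp_ideal_subset: "is_ideal I \<Longrightarrow> G \<subseteq> I \<Longrightarrow> sp A G \<subseteq> I"
proof
  fix s assume "s \<in> sp A G" "is_ideal I" "G \<subseteq> I" then show "s \<in> I"
    by (induction) (auto dest: is_idealD)
qed

lemma is_ideal_sp: "is_ideal (sp UNIV G)"
  unfolding is_ideal_def by (auto intro: sp_zero sp_add sp_mult)

lemma sp_is_ideal: "is_ideal I \<Longrightarrow> sp UNIV I = I"
  using sp_ideal_subset[of I I] sp_base[of UNIV] by auto

lemma sp_insertD: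
  assumes "is_subring A" "s \<in> sp A (insert x G)"
  shows "\<exists>a\<in>A. s - a * x \<in> sp A G"
  using assms(2,1)
proof (induction s rule: sp.induct)
  case sp_zero
  then show ?case by (intro bexI[of _ 0]) (auto dest: is_subringD intro: sp.intros)
next
  case (sp_step a y s)
  then obtain b where b: "b \<in> A" "s - b * x \<in> sp A G" by blast
  show ?case
  proof (cases "y = x")
    case True
    then show ?thesis using b sp_step by (intro bexI[of _ "a + b"]) (auto simp: algebra_simps dest: is_subringD)
  next
    case False
    then have "a * y + (s - b * x) \<in> sp A G" using sp_step b by (auto intro: sp.sp_step)
    then show ?thesis using b by (intro bexI[of _ b]) (auto simp: algebra_simps)
  qed
qed

lemma sp_UnD: "s \<in> sp A (G \<union> Y) \<Longrightarrow> \<exists>u\<in>sp A G. s - u \<in> sp A Y"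
proof (induction s rule: sp.induct)
  case sp_zero
  then show ?case by (intro bexI[of _ 0]) (auto intro: sp.intros)
next
  case (sp_step a y s)
  then obtain u where u: "u \<in> sp A G" "s - u \<in> sp A Y" by blast
  show ?case
  proof (cases "y \<in> G")
    case True
    then have "a * y + u \<in> sp A G" using u sp_step by (auto intro: sp.sp_step)
    then show ?thesis using u by (intro bexI[of _ "a * y + u"]) auto
  next
    case False
    then have "a * y + (s - u) \<in> sp A Y" using sp_step u by (auto intro: sp.sp_step)
    then show ?thesis using u by (intro bexI[of _ u]) (auto simp: algebra_simps)
  qed
qed

lemma sp_UnI: "is_subring A \<Longrightarrow> u \<in> sp A G \<Longrightarrow> s - u \<in> sp A Y \<Longrightarrow> s \<in> sp A (G \<union> Y)"
  using sp_add[of u A "G \<union> Y" "s - u"] sp_mono[of G "G \<union> Y" A A] sp_mono[of Y "G \<union> Y" A A] by auto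

lemma sp_image: "s \<in> sp A G \<Longrightarrow> c * s \<in> sp A ((*) c ` G)"
proof (induction s rule: sp.induct)
  case (sp_step a x s)
  then have "a * (c * x) + c * s \<in> sp A ((*) c ` G)" by (intro sp.sp_step) auto
  then show ?case by (simp add: algebra_simps)
qed (simp add: sp.intros)

lemma sp_prod:
  assumes "is_subring A" "s \<in> sp A G" "t \<in> sp A Y" "\<And>x y. x \<in> G \<Longrightarrow> y \<in> Y \<Longrightarrow> x * y \<in> sp A Z"
  shows "s * t \<in> sp A Z"
  using assms(2)
proof (induction s rule: sp.induct)
  case (sp_step a x s)
  have "x * t \<in> sp A ((*) x ` Y)" using sp_image assms(3) by blast
  then have "x * t \<in> sp A Z" using sp_leastD[OF assms(1), of "x * t" "(*) x ` Y" Z] assms(4) sp_step by auto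
  then have "a * (x * t) + s * t \<in> sp A Z" using sp_step assms(1)
    by (intro sp_add sp_mult[of A "x * t" Z a]) auto
  then show ?case by (simp add: algebra_simps)
qed (simp add: sp.intros)

text \<open>
  A filtration of \<open>sp A (set gs \<union> I)\<close> over \<open>I\<close> whose successive quotients are killed by \<open>A \<inter> m\<close>; when
  \<open>A\<close> is local with maximal ideal \<open>A \<inter> m\<close> this bounds the length by \<open>length gs\<close>.
\<close>

fun simple :: "'r::comm_ring_1 set \<Rightarrow> 'r set \<Rightarrow> 'r set \<Rightarrow> 'r list \<Rightarrow> bool" where
  "simple A m I [] \<longleftrightarrow> True"
| "simple A m I (g # gs) \<longleftrightarrow> (\<forall>a\<in>A \<inter> m. a * g \<in> sp A (set gs \<union> I)) \<and> simple A m I gs"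

text \<open>Steinitz exchange along a composition series: each layer of the filtration given by
  \<open>gs\<close> has at most dimension one over the residue field and can absorb only one of the
  \<open>e i\<close>. Independence is asked relative to later indices only, which is the form that
  lexicographic arguments deliver.\<close>

lemma indep_bound:
  fixes E :: "'i::linorder set"
  assumes A: "is_subring A" and I: "is_ideal I"
    and u: "\<And>a. a \<in> A \<Longrightarrow> a \<notin> m \<Longrightarrow> \<exists>b\<in>A. a * b - 1 \<in> I"
    and "simple A m I gs" "finite E" "\<And>i. i \<in> E \<Longrightarrow> e i \<in> sp A (set gs \<union> I)"
    and "\<And>i. i \<in> E \<Longrightarrow> e i \<notin> sp A (e ` {j\<in>E. i < j} \<union> I)"
  shows "card E \<le> length gs"
  using assms(4-)
proof (induction gs arbitrary: e E)
  case Nil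
  have "E = {}"
  proof (rule ccontr)
    assume "E \<noteq> {}"
    then obtain i where i: "i \<in> E" by auto
    show False using Nil(3)[OF i] Nil(4)[OF i] sp_mono[of I "e ` {j\<in>E. i < j} \<union> I" A A] by auto
  qed
  then show ?case by simp
next
  case (Cons g gs)
  let ?S = "sp A (set gs \<union> I)"
  have "\<exists>c. \<forall>i\<in>E. c i \<in> A \<and> e i - c i * g \<in> ?S"
    using Cons.prems(3) sp_insertD[OF A, of _ g "set gs \<union> I"] by (intro bchoice) auto
  then obtain c where c: "\<And>i. i \<in> E \<Longrightarrow> c i \<in> A" "\<And>i. i \<in> E \<Longrightarrow> e i - c i * g \<in> ?S" by blast
  define B where "B = {i\<in>E. c i \<notin> m}"
  have inS: "e i \<in> ?S" if "i \<in> E" "i \<notin> B" for i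
  proof -
    have "c i * g \<in> ?S" using Cons.prems(1) that c B_def by auto
    from sp_add[OF this c(2)[OF that(1)]] show ?thesis by simp
  qed
  show ?case
  proof (cases "B = {}")
    case True
    then have "card E \<le> length gs" using Cons.prems inS by (intro Cons.IH[of E e]) auto
    then show ?thesis by simp
  next
    case False
    have fB: "finite B" using Cons.prems B_def by auto
    \<comment> \<open>The pivot is the last index whose coefficient at \<open>g\<close> is a unit:
      later elements already lie in \<open>?S\<close>, and earlier ones may be corrected by
      \<open>e k\<close> without losing their independence from later elements.\<close>
    define k where "k = Max B"
    have kB: "k \<in> B" using False fB k_def by auto
    then have kE: "k \<in> E" by (simp add: B_def)
    have kmax: "i \<notin> B" if "i > k" for i using fB k_def that Max_ge[of B i] by (meson leD)
    obtain b where b: "b \<in> A" "c k * b - 1 \<in> I" using u[of "c k"] c kB by (auto simp: B_def)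
    define e' where "e' i = (if i < k then e i - (c i * b) * e k else e i)" for i
    have "card (E - {k}) \<le> length gs"
    proof (intro Cons.IH[of "E - {k}" e'])
      show "simple A m I gs" "finite (E - {k})" using Cons.prems by auto
      show "e' i \<in> ?S" if i: "i \<in> E - {k}" for i
      proof (cases "i < k")
        case True
        have cb: "c i * b \<in> A" using c b i A by (auto dest: is_subringD)
        have "e' i = (e i - c i * g) - (c i * b) * (e k - c k * g) - (c i * g) * (c k * b - 1)"
          using True by (simp add: e'_def algebra_simps)
        moreover have "(c i * g) * (c k * b - 1) \<in> ?S"
          using b I A by (intro sp_base) (auto dest: is_idealD)
        moreover have "(c i * b) * (e k - c k * g) \<in> ?S" by (intro sp_mult c A kE cb)
        ultimately show ?thesis using c(2)[of i] i A by (auto intro!: sp_diff)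
      next
        case False
        then show ?thesis using i kmax[of i] inS[of i] by (auto simp: e'_def)
      qed
      show "e' i \<notin> sp A (e' ` {j\<in>E - {k}. i < j} \<union> I)" if i: "i \<in> E - {k}" for i
      proof
        assume h: "e' i \<in> sp A (e' ` {j\<in>E - {k}. i < j} \<union> I)"
        let ?T = "sp A (e ` {j\<in>E. i < j} \<union> I)"
        have ek: "x * e k \<in> ?T" if "x \<in> A" "i < k" for x using kE A that by (intro sp_base') auto
        have "e' j \<in> ?T" if j: "j \<in> E" "i < j" for j
        proof -
          have "e j \<in> ?T" using j A by (intro sp_base) auto
          moreover have "(c j * b) * e k \<in> ?T" if "j < k"
            using j that by (intro ek is_subringD(5)[OF A] c b) auto
          ultimately show ?thesis using sp_diff[OF A] by (auto simp: e'_def)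
        qed
        then have "e' ` {j\<in>E - {k}. i < j} \<union> I \<subseteq> ?T" using sp_base[OF A] by fastforce
        then have e'T: "e' i \<in> ?T" using sp_leastD[OF A h] by auto
        have "e i \<in> ?T"
        proof (cases "i < k")
          case True
          then have "(c i * b) * e k \<in> ?T" using ek i c b A by (auto dest: is_subringD)
          from sp_add[OF e'T this] True show ?thesis by (simp add: e'_def)
        qed (use e'T in \<open>simp add: e'_def\<close>)
        then show False using Cons.prems(4)[of i] i by auto
      qed
    qed
    then show ?thesis using Cons.prems kE by (simp add: card_Diff_singleton)
  qed
qed

section \<open>Monomials and leading forms\<close>

lemma sp_factor: "s \<in> sp A G \<Longrightarrow> G \<subseteq> (*) c ` Y \<Longrightarrow> \<exists>w\<in>sp A Y. s = c * w"
proof (induction s rule: sp.induct)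
  case sp_zero
  then show ?case by (intro bexI[of _ 0]) (auto intro: sp.intros)
next
  case (sp_step a x s)
  then obtain w y where "w \<in> sp A Y" "s = c * w" "y \<in> Y" "x = c * y" by blast
  moreover from this have "a * y + w \<in> sp A Y" using sp_step by (auto intro: sp.intros)
  ultimately show ?case by (intro bexI[of _ "a * y + w"]) (auto simp: algebra_simps)
qed

fun mon :: "'r::comm_ring_1 list \<Rightarrow> nat list \<Rightarrow> 'r" where
  "mon (x # xs) (a # as) = x ^ a * mon xs as"
| "mon _ _ = 1"

definition expo :: "nat \<Rightarrow> nat \<Rightarrow> nat list set" where
  "expo d k = {\<alpha>. length \<alpha> = d \<and> sum_list \<alpha> = k}"

abbreviation padd :: "nat list \<Rightarrow> nat list \<Rightarrow> nat list" where
  "padd \<equiv> map2 (+)"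

lemma expoI: "length \<alpha> = d \<Longrightarrow> sum_list \<alpha> = k \<Longrightarrow> \<alpha> \<in> expo d k"
  by (simp add: expo_def)

lemma finite_expo [simp]: "finite (expo d k)"
proof (rule finite_subset)
  show "expo d k \<subseteq> {\<alpha>. set \<alpha> \<subseteq> {..k} \<and> length \<alpha> = d}"
    by (auto simp: expo_def intro: member_le_sum_list)
qed (simp add: finite_lists_length_eq)

lemma sum_list_padd: "length \<alpha> = length \<beta> \<Longrightarrow> sum_list (padd \<alpha> \<beta>) = sum_list \<alpha> + sum_list \<beta>"
  by (induction \<alpha> \<beta> rule: list_induct2) auto

lemma padd_expo: "\<alpha> \<in> expo d k \<Longrightarrow> \<beta> \<in> expo d l \<Longrightarrow> padd \<alpha> \<beta> \<in> expo d (k + l)"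
  by (simp add: expo_def sum_list_padd)

lemma mon_padd:
  "length \<alpha> = length xs \<Longrightarrow> length \<beta> = length xs \<Longrightarrow> mon xs (padd \<alpha> \<beta>) = mon xs \<alpha> * mon xs \<beta>"
proof (induction xs arbitrary: \<alpha> \<beta>)
  case (Cons x xs)
  then show ?case by (cases \<alpha>; cases \<beta>) (auto simp: power_add algebra_simps)
qed simp

text \<open>Translation invariance of the lexicographic order on exponents of equal length; it makes
  lexicographically least terms multiplicative.\<close>

lemma padd_less: "length \<alpha> = length \<delta> \<Longrightarrow> length \<beta> = length \<delta> \<Longrightarrow> \<alpha> < \<beta> \<Longrightarrow> padd \<delta> \<alpha> < padd \<delta> \<beta>"
proof (induction \<delta> arbitrary: \<alpha> \<beta>)
  case (Cons x xs)
  then show ?case by (cases \<alpha>; cases \<beta>) auto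
qed simp

lemma padd_commute: "padd \<alpha> \<beta> = padd \<beta> \<alpha>" for \<alpha> :: "nat list"
  by (induction \<alpha> \<beta> rule: list_induct2') auto

lemma padd_less': "length \<alpha> = length \<delta> \<Longrightarrow> length \<beta> = length \<delta> \<Longrightarrow> \<alpha> < \<beta> \<Longrightarrow> padd \<alpha> \<delta> < padd \<beta> \<delta>"
  using padd_less padd_commute by metis

lemma mon_replicate_0 [simp]: "mon xs (replicate d 0) = 1"
proof (induction xs arbitrary: d)
  case (Cons x xs)
  then show ?case by (cases d) auto
qed simp

lemma expo_0: "expo d 0 = {replicate d 0}"
  by (auto simp: expo_def replicate_length_same[symmetric] intro!: replicate_eqI)

lemma expo_SucE:
  assumes "\<alpha> \<in> expo (length xs) (Suc k)"
  shows "\<exists>x\<in>set xs. \<exists>\<beta>\<in>expo (length xs) k. mon xs \<alpha> = x * mon xs \<beta>"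
  using assms
proof (induction xs arbitrary: \<alpha> k)
  case Nil
  then show ?case by (auto simp: expo_def)
next
  case (Cons x xs)
  then obtain a as where \<alpha>: "\<alpha> = a # as" "length as = length xs" by (cases \<alpha>) (auto simp: expo_def)
  show ?case
  proof (cases a)
    case 0
    then have "as \<in> expo (length xs) (Suc k)" using Cons.prems \<alpha> by (auto simp: expo_def)
    from Cons.IH[OF this] obtain y \<beta> where "y \<in> set xs" "\<beta> \<in> expo (length xs) k" "mon xs as = y * mon xs \<beta>" by blast
    then show ?thesis using 0 \<alpha> by (intro bexI[of _ y] bexI[of _ "0 # \<beta>"]) (auto simp: expo_def)
  next
    case (Suc b)
    then show ?thesis using \<alpha> Cons.prems
      by (intro bexI[of _ x] bexI[of _ "b # as"]) (auto simp: expo_def algebra_simps)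
  qed
qed

text \<open>This is the \<open>k\<close>-th power of the ideal generated by \<open>xs\<close>.
  Below, \<open>GT\<close> collects the competitors of \<open>x^\<mu>\<close> within its degree, and
  for an ideal \<open>m\<close> the set \<open>MQ\<close> generates the product of \<open>m\<close>
  with that power.\<close>

definition Qp :: "'r::comm_ring_1 list \<Rightarrow> nat \<Rightarrow> 'r set" where
  "Qp xs k = sp UNIV (mon xs ` expo (length xs) k)"

definition GT :: "'r::comm_ring_1 list \<Rightarrow> nat list \<Rightarrow> 'r set" where
  "GT xs \<mu> = mon xs ` {\<gamma> \<in> expo (length xs) (sum_list \<mu>). \<mu> < \<gamma>}"

definition MQ :: "'r::comm_ring_1 set \<Rightarrow> 'r list \<Rightarrow> nat \<Rightarrow> 'r set" where
  "MQ m xs k = {a * mon xs \<gamma> | a \<gamma>. a \<in> m \<and> \<gamma> \<in> expo (length xs) k}"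

text \<open>
  Elements of degree \<open>sum_list \<mu>\<close> in the \<open>xs\<close>-adic filtration whose leading form, over the residue
  field, has \<open>x\<^sup>\<mu>\<close> as its lexicographically least term, with coefficient \<open>1\<close>.
\<close>

definition FF :: "'r::comm_ring_1 set \<Rightarrow> 'r list \<Rightarrow> nat list \<Rightarrow> 'r set" where
  "FF m xs \<mu> = {f. f - mon xs \<mu> \<in> sp UNIV (GT xs \<mu> \<union> MQ m xs (sum_list \<mu>))}"

lemma is_ideal_Qp: "is_ideal (Qp xs k)"
  by (simp add: Qp_def is_ideal_sp)

lemma mon_Qp: "\<alpha> \<in> expo (length xs) k \<Longrightarrow> mon xs \<alpha> \<in> Qp xs k"
  by (simp add: Qp_def sp_base)

lemma Qp_0: "Qp xs 0 = UNIV"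
proof -
  have "1 \<in> Qp xs 0" using mon_Qp[of "replicate (length xs) 0" xs 0] by (simp add: expo_0)
  then show ?thesis using is_idealD(3)[OF is_ideal_Qp, of 1 xs 0] by (metis UNIV_eq_I mult.right_neutral)
qed

lemma Qp_mult:
  assumes "a \<in> Qp xs k" "b \<in> Qp xs l"
  shows "a * b \<in> Qp xs (k + l)"
  unfolding Qp_def
proof (rule sp_prod[OF is_subring_UNIV])
  show "a \<in> sp UNIV (mon xs ` expo (length xs) k)" "b \<in> sp UNIV (mon xs ` expo (length xs) l)"
    using assms by (auto simp: Qp_def)
  show "x * y \<in> sp UNIV (mon xs ` expo (length xs) (k + l))"
    if xy: "x \<in> mon xs ` expo (length xs) k" "y \<in> mon xs ` expo (length xs) l" for x y
  proof -
    obtain \<alpha> \<beta> where "\<alpha> \<in> expo (length xs) k" "\<beta> \<in> expo (length xs) l" "x = mon xs \<alpha>" "y = mon xs \<beta>"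
      using xy by blast
    then have "x * y = mon xs (padd \<alpha> \<beta>)" "padd \<alpha> \<beta> \<in> expo (length xs) (k + l)"
      by (auto simp: mon_padd padd_expo) (auto simp: expo_def mon_padd)
    then show ?thesis by (auto intro: sp_base)
  qed
qed

text \<open>One of the factors of a monomial is moved into the coefficient. Consequently terms of
  higher degree are invisible in a leading form: they are swallowed by the terms with coefficients
  in \<open>m\<close>.\<close>

lemma Qp_Suc_MQ: "set xs \<subseteq> m \<Longrightarrow> Qp xs (Suc k) \<subseteq> sp UNIV (MQ m xs k)"
  unfolding Qp_def
proof (rule sp_least)
  assume m: "set xs \<subseteq> m"
  show "mon xs ` expo (length xs) (Suc k) \<subseteq> sp UNIV (MQ m xs k)"
  proof clarify
    fix \<alpha> assume "\<alpha> \<in> expo (length xs) (Suc k)"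
    from expo_SucE[OF this] obtain x \<beta> where "x \<in> set xs" "\<beta> \<in> expo (length xs) k" "mon xs \<alpha> = x * mon xs \<beta>"
      by blast
    then show "mon xs \<alpha> \<in> sp UNIV (MQ m xs k)" using m by (intro sp_base) (auto simp: MQ_def)
  qed
qed simp

lemma MQ_Qp: "sp UNIV (MQ m xs k) \<subseteq> Qp xs k"
  by (rule sp_ideal_subset[OF is_ideal_Qp]) (auto simp: MQ_def intro: is_idealD(3)[OF is_ideal_Qp] mon_Qp)

lemma GT_Qp: "sp UNIV (GT xs \<mu>) \<subseteq> Qp xs (sum_list \<mu>)"
  by (rule sp_ideal_subset[OF is_ideal_Qp]) (auto simp: GT_def intro: mon_Qp)

lemma Qp_Suc: "Qp xs (Suc k) \<subseteq> Qp xs k"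
  using Qp_Suc_MQ[of xs "set xs" k] MQ_Qp by blast

lemma Qp_antimono: "k \<le> l \<Longrightarrow> Qp xs l \<subseteq> Qp xs k"
  by (rule lift_Suc_antimono_le[of "Qp xs"]) (auto simp: Qp_Suc[THEN subsetD])

lemma MQ_antimono: "set xs \<subseteq> m \<Longrightarrow> k < l \<Longrightarrow> Qp xs l \<subseteq> sp UNIV (MQ m xs k)"
  using Qp_antimono[of "Suc k" l xs] Qp_Suc_MQ[of xs m k] by auto

lemma FF_Qp: "length \<mu> = length xs \<Longrightarrow> FF m xs \<mu> \<subseteq> Qp xs (sum_list \<mu>)"
proof
  fix f assume l: "length \<mu> = length xs" and "f \<in> FF m xs \<mu>"
  then have "f - mon xs \<mu> \<in> sp UNIV (GT xs \<mu> \<union> MQ m xs (sum_list \<mu>))" by (simp add: FF_def)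
  moreover have "\<dots> \<subseteq> Qp xs (sum_list \<mu>)"
    using MQ_Qp[of m xs] GT_Qp[of xs \<mu>] sp_base[OF is_subring_UNIV] by (intro sp_ideal_subset[OF is_ideal_Qp]) blast
  ultimately have "(f - mon xs \<mu>) + mon xs \<mu> \<in> Qp xs (sum_list \<mu>)"
    using l by (intro is_idealD(2)[OF is_ideal_Qp] mon_Qp expoI) auto
  then show "f \<in> Qp xs (sum_list \<mu>)" by simp
qed

lemma FF_one: "1 \<in> FF m xs (replicate (length xs) 0)"
  by (simp add: FF_def sp_zero)

lemma FF_diff:
  assumes "set xs \<subseteq> m" "f \<in> FF m xs \<mu>" "q \<in> Qp xs (Suc (sum_list \<mu>))"
  shows "f - q \<in> FF m xs \<mu>"
proof -
  have "q \<in> sp UNIV (GT xs \<mu> \<union> MQ m xs (sum_list \<mu>))"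
    using assms Qp_Suc_MQ[of xs m] sp_mono[of "MQ m xs (sum_list \<mu>)" "GT xs \<mu> \<union> MQ m xs (sum_list \<mu>)" UNIV UNIV] by blast
  moreover have "f - mon xs \<mu> \<in> sp UNIV (GT xs \<mu> \<union> MQ m xs (sum_list \<mu>))" using assms by (simp add: FF_def)
  ultimately have "(f - mon xs \<mu>) - q \<in> sp UNIV (GT xs \<mu> \<union> MQ m xs (sum_list \<mu>))" by (simp add: sp_diff)
  then show ?thesis by (simp add: FF_def algebra_simps)
qed

text \<open>Write the factors as a leading monomial plus an error. In each of the three error
  products either a coefficient falls into \<open>m\<close>, or the exponent exceeds
  \<open>padd \<mu> \<nu>\<close> by translation invariance of the order.\<close>

lemma FF_mult:
  assumes m: "is_ideal m" and l: "length \<mu> = length xs" "length \<nu> = length xs"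
    and f: "f \<in> FF m xs \<mu>" and g: "g \<in> FF m xs \<nu>"
  shows "f * g \<in> FF m xs (padd \<mu> \<nu>)"
proof -
  let ?d = "length xs"
  let ?X = "\<lambda>\<mu>. GT xs \<mu> \<union> MQ m xs (sum_list \<mu>)"
  let ?S = "sp UNIV (?X (padd \<mu> \<nu>))"
  have sl: "sum_list (padd \<mu> \<nu>) = sum_list \<mu> + sum_list \<nu>" using l by (simp add: sum_list_padd)
  have mm: "a * mon xs \<gamma> \<in> ?S" if "a \<in> m" "\<gamma> \<in> expo ?d (sum_list \<mu> + sum_list \<nu>)" for a \<gamma>
    using that sl by (intro sp_base) (auto simp: MQ_def)
  have gg: "mon xs \<gamma> \<in> ?S" if "padd \<mu> \<nu> < \<gamma>" "\<gamma> \<in> expo ?d (sum_list \<mu> + sum_list \<nu>)" for \<gamma>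
    using that sl by (intro sp_base) (auto simp: GT_def)
  \<comment> \<open>One factor may be the leading monomial itself, hence the weak inequalities; the
    last assumption excludes only the product of the two leading monomials.\<close>
  have core: "(a * mon xs \<gamma>) * (b * mon xs \<delta>) \<in> ?S"
    if e: "\<gamma> \<in> expo ?d (sum_list \<mu>)" "\<delta> \<in> expo ?d (sum_list \<nu>)"
      and a: "a \<in> m \<or> a = 1 \<and> \<mu> \<le> \<gamma>" and b: "b \<in> m \<or> b = 1 \<and> \<nu> \<le> \<delta>"
      and n: "a \<in> m \<or> b \<in> m \<or> \<mu> < \<gamma> \<or> \<nu> < \<delta>" for a b \<gamma> \<delta>
  proof -
    have len: "length \<gamma> = ?d" "length \<delta> = ?d" using e by (auto simp: expo_def)
    have e': "padd \<gamma> \<delta> \<in> expo ?d (sum_list \<mu> + sum_list \<nu>)" using e by (intro padd_expo)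
    have xy: "(a * mon xs \<gamma>) * (b * mon xs \<delta>) = (a * b) * mon xs (padd \<gamma> \<delta>)"
      using len by (simp add: mon_padd algebra_simps)
    show ?thesis
    proof (cases "a \<in> m \<or> b \<in> m")
      case True
      then have "a * b \<in> m" using is_idealD[OF m] by auto
      then show ?thesis unfolding xy using mm e' by simp
    next
      case False
      then have ge: "\<mu> \<le> \<gamma>" "\<nu> \<le> \<delta>" "\<mu> < \<gamma> \<or> \<nu> < \<delta>" using a b n by auto
      have 1: "\<nu> < \<delta> \<Longrightarrow> padd \<mu> \<nu> < padd \<mu> \<delta>" using l len by (intro padd_less) auto
      have 2: "\<mu> < \<gamma> \<Longrightarrow> padd \<mu> \<delta> < padd \<gamma> \<delta>" using l len by (intro padd_less') auto
      have 3: "padd \<mu> \<nu> \<le> padd \<mu> \<delta>" using 1 ge(2) by (cases "\<nu> = \<delta>") (simp_all add: less_le)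
      have 4: "padd \<mu> \<delta> \<le> padd \<gamma> \<delta>" using 2 ge(1) by (cases "\<mu> = \<gamma>") (simp_all add: less_le)
      have "padd \<mu> \<nu> < padd \<gamma> \<delta>"
        using ge(3) le_less_trans[OF 3 2] less_le_trans[OF 1 4] by blast
      then show ?thesis unfolding xy using gg e' False a b by auto
    qed
  qed
  have rep: "\<exists>a \<gamma>. x = a * mon xs \<gamma> \<and> \<gamma> \<in> expo ?d (sum_list \<mu>) \<and> (a \<in> m \<or> a = 1 \<and> \<mu> < \<gamma>)"
    if "x \<in> ?X \<mu>" for x \<mu>
    using that
  proof
    assume "x \<in> GT xs \<mu>"
    then show ?thesis unfolding GT_def by (intro exI[of _ 1]) auto
  next
    assume "x \<in> MQ m xs (sum_list \<mu>)"
    then show ?thesis unfolding MQ_def by blast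
  qed
  let ?u = "f - mon xs \<mu>" and ?v = "g - mon xs \<nu>"
  have u: "?u \<in> sp UNIV (?X \<mu>)" and v: "?v \<in> sp UNIV (?X \<nu>)" using f g by (auto simp: FF_def)
  have e: "\<mu> \<in> expo ?d (sum_list \<mu>)" "\<nu> \<in> expo ?d (sum_list \<nu>)" using l by (auto simp: expo_def)
  have "?u * ?v \<in> ?S"
  proof (rule sp_prod[OF is_subring_UNIV u v])
    fix x y assume "x \<in> ?X \<mu>" "y \<in> ?X \<nu>"
    then obtain a b \<gamma> \<delta> where *: "x = a * mon xs \<gamma>" "\<gamma> \<in> expo ?d (sum_list \<mu>)" "a \<in> m \<or> a = 1 \<and> \<mu> < \<gamma>"
      "y = b * mon xs \<delta>" "\<delta> \<in> expo ?d (sum_list \<nu>)" "b \<in> m \<or> b = 1 \<and> \<nu> < \<delta>"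
      using rep[of x \<mu>] rep[of y \<nu>] by blast
    show "x * y \<in> ?S" unfolding *(1,4) using * by (intro core) (auto simp: less_imp_le)
  qed
  moreover have "mon xs \<mu> * ?v \<in> ?S"
  proof (rule sp_prod[OF is_subring_UNIV sp_base[OF is_subring_UNIV, of "mon xs \<mu>" "{mon xs \<mu>}"] v])
    fix x y assume "x \<in> {mon xs \<mu>}" "y \<in> ?X \<nu>"
    then obtain b \<delta> where *: "x = 1 * mon xs \<mu>"
      "y = b * mon xs \<delta>" "\<delta> \<in> expo ?d (sum_list \<nu>)" "b \<in> m \<or> b = 1 \<and> \<nu> < \<delta>"
      using rep[of y \<nu>] by auto
    show "x * y \<in> ?S" unfolding *(1,2) using * e by (intro core) (auto simp: less_imp_le)
  qed simp
  moreover have "?u * mon xs \<nu> \<in> ?S"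
  proof (rule sp_prod[OF is_subring_UNIV u sp_base[OF is_subring_UNIV, of "mon xs \<nu>" "{mon xs \<nu>}"]])
    fix x y assume "x \<in> ?X \<mu>" "y \<in> {mon xs \<nu>}"
    then obtain a \<gamma> where *: "x = a * mon xs \<gamma>" "\<gamma> \<in> expo ?d (sum_list \<mu>)" "a \<in> m \<or> a = 1 \<and> \<mu> < \<gamma>"
      "y = 1 * mon xs \<nu>" using rep[of x \<mu>] by auto
    show "x * y \<in> ?S" unfolding *(1,4) using * e by (intro core) (auto simp: less_imp_le)
  qed simp
  ultimately have "?u * ?v + (mon xs \<mu> * ?v + ?u * mon xs \<nu>) \<in> ?S" by (intro sp_add)
  moreover have "?u * ?v + (mon xs \<mu> * ?v + ?u * mon xs \<nu>) = f * g - mon xs (padd \<mu> \<nu>)"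
    using l by (simp add: mon_padd algebra_simps)
  ultimately show ?thesis by (simp add: FF_def)
qed

section \<open>Chains of primes\<close>

definition ple :: "nat list \<Rightarrow> nat list \<Rightarrow> bool" where
  "ple = list_all2 (\<le>)"

lemma ple_padd: "ple \<mu> \<alpha> \<Longrightarrow> \<exists>\<delta>. length \<delta> = length \<mu> \<and> \<alpha> = padd \<delta> \<mu>"
  unfolding ple_def
proof (induction rule: list_all2_induct)
  case (Cons x xs y ys)
  then obtain \<delta> where "length \<delta> = length xs" "ys = padd \<delta> xs" by blast
  then show ?case using Cons by (intro exI[of _ "(y - x) # \<delta>"]) auto
qed simp

text \<open>Division by a relation with leading monomial \<open>x^\<mu>\<close>: a multiple of it is
  replaced by lexicographically larger monomials of the same degree, up to multiples of
  \<open>B\<close> collected in \<open>B'\<close>. This terminates because each degree has finitely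
  many exponents.\<close>

lemma reduce_mon:
  assumes A: "is_subring A" and \<mu>: "length \<mu> = length xs" "mon xs \<mu> \<in> sp A (GT xs \<mu> \<union> B)"
    and B: "\<And>\<delta> b. length \<delta> = length xs \<Longrightarrow> b \<in> B \<Longrightarrow> sum_list \<delta> + sum_list \<mu> = j \<Longrightarrow> mon xs \<delta> * b \<in> sp A B'"
    and "\<alpha> \<in> expo (length xs) j"
  shows "mon xs \<alpha> \<in> sp A (mon xs ` {\<alpha>' \<in> expo (length xs) j. \<not> ple \<mu> \<alpha>'} \<union> B')" (is "_ \<in> ?S")
  using assms(5)
proof (induction "card {\<gamma> \<in> expo (length xs) j. \<alpha> < \<gamma>}" arbitrary: \<alpha> rule: less_induct)
  case less
  show ?case
  proof (cases "ple \<mu> \<alpha>")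
    case False
    then show ?thesis using less.prems by (intro sp_base[OF A]) auto
  next
    case True
    then obtain \<delta> where \<delta>: "length \<delta> = length \<mu>" "\<alpha> = padd \<delta> \<mu>" using ple_padd by blast
    then have sj: "sum_list \<delta> + sum_list \<mu> = j" using less.prems by (auto simp: expo_def sum_list_padd)
    have \<delta>e: "\<delta> \<in> expo (length xs) (sum_list \<delta>)" using \<delta> \<mu> by (simp add: expo_def)
    have "mon xs \<alpha> = mon xs \<delta> * mon xs \<mu>" using \<delta> \<mu> by (simp add: mon_padd)
    moreover have m: "mon xs \<delta> * mon xs \<mu> \<in> sp A ((*) (mon xs \<delta>) ` (GT xs \<mu> \<union> B))" by (intro sp_image \<mu>)
    moreover have g: "mon xs \<delta> * x \<in> ?S" if x: "x \<in> GT xs \<mu>" for x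
    proof -
      obtain \<gamma> where \<gamma>: "x = mon xs \<gamma>" "\<gamma> \<in> expo (length xs) (sum_list \<mu>)" "\<mu> < \<gamma>" using x by (auto simp: GT_def)
      have e: "padd \<delta> \<gamma> \<in> expo (length xs) j" using padd_expo[OF \<delta>e \<gamma>(2)] sj by simp
      have lt: "\<alpha> < padd \<delta> \<gamma>" using \<gamma> \<delta> \<mu> by (auto simp: expo_def intro: padd_less)
      have "card {\<gamma>' \<in> expo (length xs) j. padd \<delta> \<gamma> < \<gamma>'} < card {\<gamma> \<in> expo (length xs) j. \<alpha> < \<gamma>}"
        using e lt by (intro psubset_card_mono) (auto intro: less_trans)
      from less.hyps[OF this e] show ?thesis using \<gamma> \<delta> \<mu> by (simp add: mon_padd expo_def)
    qed
    moreover have b: "mon xs \<delta> * b \<in> ?S" if "b \<in> B" for b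
      using B[OF _ that sj] \<delta> \<mu> sp_mono[of B' "mon xs ` {\<alpha>' \<in> expo (length xs) j. \<not> ple \<mu> \<alpha>'} \<union> B'" A A] by auto
    moreover have "(*) (mon xs \<delta>) ` (GT xs \<mu> \<union> B) \<subseteq> ?S" using g b by blast
    ultimately show ?thesis using sp_leastD[OF A m] by simp
  qed
qed

definition box :: "nat \<Rightarrow> nat \<Rightarrow> nat list set" where
  "box d M = {\<alpha>. set \<alpha> \<subseteq> {..<M} \<and> length \<alpha> = d}"

lemma finite_box [simp]: "finite (box d M)" and card_box [simp]: "card (box d M) = M ^ d"
  by (auto simp: box_def finite_lists_length_eq card_lists_length_eq)

lemma box_Suc: "box (Suc d) M = (\<lambda>(a, \<alpha>). a # \<alpha>) ` ({..<M} \<times> box d M)"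
  by (auto simp: box_def length_Suc_conv image_iff)

text \<open>An exponent that is not above \<open>\<mu>\<close> has some coordinate \<open>i\<close>
  below \<open>\<mu>_i\<close>, which leaves \<open>\<mu>_i\<close> values there and
  \<open>M\<close> for every other coordinate. This is where the order of growth drops by
  one.\<close>

lemma card_not_ple: "card {\<alpha> \<in> box (length \<mu>) M. \<not> ple \<mu> \<alpha>} \<le> sum_list \<mu> * M ^ (length \<mu> - 1)"
proof (induction \<mu>)
  case Nil
  then show ?case by (auto simp: ple_def box_def)
next
  case (Cons a \<mu>)
  let ?N = "{\<alpha> \<in> box (length \<mu>) M. \<not> ple \<mu> \<alpha>}"
  have "{\<alpha> \<in> box (length (a # \<mu>)) M. \<not> ple (a # \<mu>) \<alpha>}
      \<subseteq> (\<lambda>(b, \<alpha>). b # \<alpha>) ` ({..<a} \<times> box (length \<mu>) M) \<union> (\<lambda>(b, \<alpha>). b # \<alpha>) ` ({..<M} \<times> ?N)"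
    by (auto simp: box_Suc ple_def)
  then have "card {\<alpha> \<in> box (length (a # \<mu>)) M. \<not> ple (a # \<mu>) \<alpha>}
      \<le> card ((\<lambda>(b, \<alpha>). b # \<alpha>) ` ({..<a} \<times> box (length \<mu>) M) \<union> (\<lambda>(b, \<alpha>). b # \<alpha>) ` ({..<M} \<times> ?N))"
    by (intro card_mono finite_UnI finite_imageI finite_cartesian_product finite_box finite_lessThan) auto
  also have "\<dots> \<le> card ((\<lambda>(b, \<alpha>). b # \<alpha>) ` ({..<a} \<times> box (length \<mu>) M)) + card ((\<lambda>(b, \<alpha>). b # \<alpha>) ` ({..<M} \<times> ?N))"
    by (rule card_Un_le)
  also have "\<dots> \<le> card ({..<a} \<times> box (length \<mu>) M) + card ({..<M} \<times> ?N)"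
    by (intro add_mono card_image_le finite_cartesian_product finite_box finite_lessThan) auto
  also have "\<dots> \<le> a * M ^ length \<mu> + M * (sum_list \<mu> * M ^ (length \<mu> - 1))"
    using Cons by (simp add: card_cartesian_product)
  also have "M * (sum_list \<mu> * M ^ (length \<mu> - 1)) = sum_list \<mu> * M ^ length \<mu>"
    by (cases \<mu>) auto
  finally show ?case by (simp add: algebra_simps)
qed

definition pchain :: "'r::comm_ring_1 set \<Rightarrow> (nat \<Rightarrow> 'r set) \<Rightarrow> nat \<Rightarrow> bool" where
  "pchain I P n \<longleftrightarrow> (\<forall>i\<le>n. is_prime (P i)) \<and> I \<subseteq> P 0 \<and> (\<forall>i<n. P i \<subset> P (Suc i))"

text \<open>
  The singular monoids of the elementary characterisation of Krull dimension due to Coquand and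
  Lombardi.
\<close>

fun sing :: "'r::comm_ring_1 list \<Rightarrow> 'r set" where
  "sing [] = {1}"
| "sing (x # xs) = {x ^ k * (s + a * x) | k s a. s \<in> sing xs}"

lemma one_sing: "1 \<in> sing xs"
proof (induction xs)
  case (Cons x xs)
  have "1 = x ^ 0 * (1 + 0 * x)" by simp
  then show ?case unfolding sing.simps using Cons by blast
qed simp

lemma sing_mult: "s \<in> sing xs \<Longrightarrow> t \<in> sing xs \<Longrightarrow> s * t \<in> sing xs"
proof (induction xs arbitrary: s t)
  case (Cons x xs)
  obtain k s' a where s: "s = x ^ k * (s' + a * x)" "s' \<in> sing xs" using Cons.prems by auto
  obtain l t' b where t: "t = x ^ l * (t' + b * x)" "t' \<in> sing xs" using Cons.prems by auto
  have "s * t = x ^ (k + l) * (s' * t' + (s' * b + a * t' + a * b * x) * x)"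
    using s t by (simp add: power_add algebra_simps)
  then show ?case using Cons.IH[OF s(2) t(2)] by auto
qed simp

text \<open>Krull: an ideal that is maximal among those disjoint from a multiplicative set is
  prime.\<close>

lemma prime_avoiding:
  fixes I S :: "'r::comm_ring_1 set"
  assumes I: "is_ideal I" and S: "1 \<in> S" "\<And>a b. a \<in> S \<Longrightarrow> b \<in> S \<Longrightarrow> a * b \<in> S" "S \<inter> I = {}"
  shows "\<exists>P. is_prime P \<and> I \<subseteq> P \<and> S \<inter> P = {}"
proof -
  let ?F = "{J. is_ideal J \<and> I \<subseteq> J \<and> S \<inter> J = {}}"
  have "\<exists>P\<in>?F. \<forall>J\<in>?F. P \<subseteq> J \<longrightarrow> J = P"
  proof (rule subset_Zorn_nonempty)
    show "?F \<noteq> {}" using I S by auto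
    fix C assume C: "C \<noteq> {}" "subset.chain ?F C"
    have ideal: "is_ideal (\<Union>C)"
      unfolding is_ideal_def
    proof (intro conjI ballI allI)
      obtain J where "J \<in> C" using C by blast
      moreover from this have "is_ideal J" using C by (auto simp: subset_chain_def)
      ultimately show "0 \<in> \<Union>C" using is_idealD(1)[of J] by blast
      fix a b assume "a \<in> \<Union>C" "b \<in> \<Union>C"
      then obtain J1 J2 where J: "J1 \<in> C" "J2 \<in> C" "a \<in> J1" "b \<in> J2" by blast
      then have "J1 \<subseteq> J2 \<or> J2 \<subseteq> J1" using C by (auto simp: subset_chain_def)
      then obtain J where "J \<in> C" "a \<in> J" "b \<in> J" using J by blast
      moreover from this have "is_ideal J" using C by (auto simp: subset_chain_def)
      ultimately show "a + b \<in> \<Union>C" using is_idealD(2)[of J a b] by blast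
    next
      fix a r assume "a \<in> \<Union>C"
      then obtain J where "J \<in> C" "a \<in> J" by blast
      moreover from this have "is_ideal J" using C by (auto simp: subset_chain_def)
      ultimately show "r * a \<in> \<Union>C" using is_idealD(3)[of J a r] by blast
    qed
    show "\<Union>C \<in> ?F" using ideal C by (auto simp: subset_chain_def) 
  qed
  then obtain P where PF: "P \<in> ?F" and maxF: "\<forall>J\<in>?F. P \<subseteq> J \<longrightarrow> J = P" ..
  from PF have P: "is_ideal P" "I \<subseteq> P" "S \<inter> P = {}" by simp_all
  have max: "J = P" if "is_ideal J" "P \<subseteq> J" "S \<inter> J = {}" for J
    using maxF that P(2) by simp
  have meet: "\<exists>s\<in>S. \<exists>r. s - r * a \<in> P" if "a \<notin> P" for a
  proof -
    let ?J = "sp UNIV (insert a P)"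
    have "a \<in> ?J" "P \<subseteq> ?J" by (auto intro: sp_base)
    then have "S \<inter> ?J \<noteq> {}" using max[of ?J] that by (auto simp: is_ideal_sp)
    then obtain s where "s \<in> S" "s \<in> ?J" by blast
    then show ?thesis using sp_insertD[OF is_subring_UNIV, of s a P] sp_is_ideal[OF P(1)] by auto
  qed
  have "a \<in> P \<or> b \<in> P" if "a * b \<in> P" for a b
  proof (rule ccontr)
    assume "\<not> ?thesis"
    then obtain s r t q where st: "s \<in> S" "s - r * a \<in> P" "t \<in> S" "t - q * b \<in> P" using meet by metis
    have "s * t = (s - r * a) * t + (r * a) * (t - q * b) + (r * q) * (a * b)" by (simp add: algebra_simps)
    also have "\<dots> \<in> P" using st that is_idealD[OF P(1)] by simp
    finally show False using S st P by blast
  qed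
  then have "is_prime P" using P S by (auto simp: is_prime_def)
  then show ?thesis using P by blast
qed

text \<open>A prime \<open>P\<close> above \<open>I\<close> avoiding \<open>sing (x # xs)\<close>
  does not contain \<open>x\<close>, and the ideal generated by \<open>P\<close> and
  \<open>x\<close> avoids \<open>sing xs\<close>: an element \<open>s\<close> there would give
  \<open>s - a * x\<close> in \<open>P\<close>. The rest of the chain is found above that larger
  ideal.\<close>

lemma chain_of_sing_disjoint:
  "is_ideal I \<Longrightarrow> sing xs \<inter> I = {} \<Longrightarrow> \<exists>P. pchain I P (length xs)"
proof (induction xs arbitrary: I)
  case Nil
  then obtain P where "is_prime P" "I \<subseteq> P" using prime_avoiding[of I "{1}"] by auto
  then show ?case by (intro exI[of _ "\<lambda>_. P"]) (auto simp: pchain_def)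
next
  case (Cons x xs)
  obtain P where P: "is_prime P" "I \<subseteq> P" "sing (x # xs) \<inter> P = {}"
    using prime_avoiding[of I "sing (x # xs)"] Cons.prems one_sing sing_mult by meson
  have Pi: "is_ideal P" using P is_primeD by blast
  let ?J = "sp UNIV (insert x P)"
  have "x ^ 1 * (1 + 0 * x) \<in> sing (x # xs)" unfolding sing.simps using one_sing by blast
  then have xP: "x \<notin> P" using P(3) by (simp del: sing.simps) blast
  have "sing xs \<inter> ?J = {}"
  proof (rule ccontr)
    assume "sing xs \<inter> ?J \<noteq> {}"
    then obtain s a where s: "s \<in> sing xs" "s - a * x \<in> P"
      using sp_insertD[OF is_subring_UNIV, of _ x P] sp_is_ideal[OF Pi] by blast
    have "x ^ 0 * (s + (- a) * x) \<in> sing (x # xs)" unfolding sing.simps using s by blast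
    then show False using s P(3) by (simp del: sing.simps) blast
  qed
  from Cons.IH[OF is_ideal_sp this] obtain Q where Q: "pchain ?J Q (length xs)" by blast
  have "x \<in> ?J" "P \<subseteq> ?J" by (auto intro: sp_base)
  then have "P \<subset> Q 0" using Q xP by (auto simp: pchain_def)
  then show ?case using Q P
    by (intro exI[of _ "\<lambda>i. case i of 0 \<Rightarrow> P | Suc j \<Rightarrow> Q j"]) (auto simp: pchain_def split: nat.split)
qed

text \<open>\<open>Qf\<close> is a descending filtration in which cancelling \<open>zs ! i\<close>
  modulo \<open>P i\<close> costs at most \<open>c\<close> steps. Cancelling the power of the first
  variable and passing from \<open>P 0\<close> to \<open>P 1\<close>, where that variable vanishes,
  reduces to the remaining variables; a monomial of degree \<open>sum_list \<beta>\<close> costs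
  \<open>c * sum_list \<beta>\<close> steps in all.\<close>

lemma lex_independent:
  fixes zs :: "'r::comm_ring_1 list"
  assumes "\<And>i. i \<le> length zs \<Longrightarrow> is_ideal (P i)" "\<And>i. i < length zs \<Longrightarrow> P i \<subseteq> P (Suc i)"
    and "\<And>i. i < length zs \<Longrightarrow> zs ! i \<in> P (Suc i)"
    and "\<And>i k a. i < length zs \<Longrightarrow> zs ! i * a \<in> sp UNIV (Qf (k + c) \<union> P i) \<Longrightarrow> a \<in> sp UNIV (Qf k \<union> P i)"
    and "\<And>k. k > 0 \<Longrightarrow> 1 \<notin> sp UNIV (Qf k \<union> P (length zs))"
    and "length \<beta> = length zs" "k > (0::nat)"
  shows "mon zs \<beta> \<notin> sp UNIV (mon zs ` {\<gamma>. length \<gamma> = length zs \<and> \<beta> < \<gamma>} \<union> (Qf (k + c * sum_list \<beta>) \<union> P 0))"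
  using assms
proof (induction zs arbitrary: P \<beta>)
  case (Cons z zs)
  note P = Cons.prems(1) and Psub = Cons.prems(2) and zP = Cons.prems(3) and colon = Cons.prems(4)
    and fin = Cons.prems(5) and k = Cons.prems(7)
  obtain b \<beta>' where \<beta>: "\<beta> = b # \<beta>'" "length \<beta>' = length zs" using Cons.prems(6) by (cases \<beta>) auto
  let ?M = "mon zs ` {\<gamma>. length \<gamma> = length zs \<and> \<beta>' < \<gamma>}"
  have z1: "z \<in> P 1" and P01: "P 0 \<subseteq> P 1" using zP[of 0] Psub[of 0] by auto
  show ?case
  proof
    assume "mon (z # zs) \<beta> \<in> sp UNIV (mon (z # zs) ` {\<gamma>. length \<gamma> = length (z # zs) \<and> \<beta> < \<gamma>} \<union> (Qf (k + c * sum_list \<beta>) \<union> P 0))"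
    from sp_UnD[OF this] obtain u where u: "u \<in> sp UNIV (mon (z # zs) ` {\<gamma>. length \<gamma> = length (z # zs) \<and> \<beta> < \<gamma>})"
      "mon (z # zs) \<beta> - u \<in> sp UNIV (Qf (k + c * sum_list \<beta>) \<union> P 0)" by blast
    \<comment> \<open>A lexicographically larger exponent either has the same first entry
      \<open>b\<close> and a larger tail, or a larger first entry. So every competitor is
      \<open>z ^ b\<close> times a larger monomial in \<open>zs\<close> or times a multiple of
      \<open>z\<close>.\<close>
    have "mon (z # zs) ` {\<gamma>. length \<gamma> = length (z # zs) \<and> \<beta> < \<gamma>} \<subseteq> (*) (z ^ b) ` sp UNIV (?M \<union> {z})"
    proof clarify
      fix \<gamma> assume \<gamma>: "length \<gamma> = length (z # zs)" "\<beta> < \<gamma>"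
      then obtain g \<gamma>' where g: "\<gamma> = g # \<gamma>'" "length \<gamma>' = length zs" by (cases \<gamma>) auto
      have "b < g \<or> (g = b \<and> \<beta>' < \<gamma>')" using \<gamma> g \<beta> by auto
      then show "mon (z # zs) \<gamma> \<in> (*) (z ^ b) ` sp UNIV (?M \<union> {z})"
      proof (elim disjE conjE)
        assume "b < g"
        then have "z ^ g = z ^ b * z ^ (g - b - 1) * z" by (simp flip: power_add power_Suc2)
        then have "mon (z # zs) \<gamma> = z ^ b * ((z ^ (g - b - 1) * mon zs \<gamma>') * z)" using g by (simp add: algebra_simps)
        moreover have "(z ^ (g - b - 1) * mon zs \<gamma>') * z \<in> sp UNIV (?M \<union> {z})" by (intro sp_base') auto
        ultimately show ?thesis by blast
      next
        assume "g = b" "\<beta>' < \<gamma>'"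
        moreover from this have "mon zs \<gamma>' \<in> sp UNIV (?M \<union> {z})" using g by (intro sp_base) auto
        ultimately show ?thesis using g by auto
      qed
    qed
    from sp_factor[OF u(1) this] obtain w where w0: "w \<in> sp UNIV (sp UNIV (?M \<union> {z}))" "u = z ^ b * w" by blast
    then have w: "w \<in> sp UNIV (?M \<union> {z})" using sp_is_ideal[OF is_ideal_sp] by blast
    \<comment> \<open>After the common factor \<open>z ^ b\<close> is taken out, the hypothesis on
      cancellation applies \<open>b\<close> times, each time giving up \<open>c\<close>
      steps.\<close>
    have "z ^ b * (mon zs \<beta>' - w) \<in> sp UNIV (Qf (k + c * sum_list \<beta>' + c * b) \<union> P 0)"
      using u w0 \<beta> by (simp add: algebra_simps)
    then have "mon zs \<beta>' - w \<in> sp UNIV (Qf (k + c * sum_list \<beta>') \<union> P 0)"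
    proof (induction b)
      case (Suc b)
      then have "z * (z ^ b * (mon zs \<beta>' - w)) \<in> sp UNIV (Qf (k + c * sum_list \<beta>' + c * b + c) \<union> P 0)"
        by (simp add: algebra_simps)
      then show ?case using colon[of 0] Suc.IH by simp
    qed simp
    moreover have "\<dots> \<subseteq> sp UNIV (Qf (k + c * sum_list \<beta>') \<union> P 1)" using P01 by (intro sp_mono) auto
    ultimately have 1: "mon zs \<beta>' - w \<in> sp UNIV (?M \<union> (Qf (k + c * sum_list \<beta>') \<union> P 1))"
      using sp_mono[of "Qf (k + c * sum_list \<beta>') \<union> P 1" "?M \<union> (Qf (k + c * sum_list \<beta>') \<union> P 1)" UNIV UNIV] by blast
    have "w \<in> sp UNIV (?M \<union> (Qf (k + c * sum_list \<beta>') \<union> P 1))"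
      using w sp_mono[of "?M \<union> {z}" "?M \<union> (Qf (k + c * sum_list \<beta>') \<union> P 1)" UNIV UNIV] z1 by blast
    from sp_add[OF 1 this] have "mon zs \<beta>' \<in> sp UNIV (?M \<union> (Qf (k + c * sum_list \<beta>') \<union> P (Suc 0)))" by simp
    moreover have "mon zs \<beta>' \<notin> sp UNIV (?M \<union> (Qf (k + c * sum_list \<beta>') \<union> P (Suc 0)))"
    proof (rule Cons.IH[of "\<lambda>i. P (Suc i)"])
      show "is_ideal (P (Suc i))" if "i \<le> length zs" for i using P that by simp
      show "P (Suc i) \<subseteq> P (Suc (Suc i))" if "i < length zs" for i using Psub that by simp
      show "zs ! i \<in> P (Suc (Suc i))" if "i < length zs" for i using zP[of "Suc i"] that by simp
      show "a \<in> sp UNIV (Qf k \<union> P (Suc i))" if "i < length zs" "zs ! i * a \<in> sp UNIV (Qf (k + c) \<union> P (Suc i))" for i k a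
        using colon[of "Suc i"] that by simp
      show "1 \<notin> sp UNIV (Qf k \<union> P (Suc (length zs)))" if "k > 0" for k using fin that by simp
    qed (use \<beta> k in auto)
    ultimately show False by blast
  qed
next
  case Nil
  have "mon ([] :: 'r list) ` {\<gamma>. length \<gamma> = length ([] :: 'r list) \<and> \<beta> < \<gamma>} \<union> (Qf (k + c * sum_list \<beta>) \<union> P 0)
      = Qf k \<union> P 0" using Nil.prems(6) by auto
  then show ?case using Nil.prems(5)[OF Nil.prems(7)] Nil.prems(6) by simp
qed

section \<open>Length and local Noetherian rings\<close>

text \<open>An upper bound for the length of the ideal generated by \<open>J\<close> and
  \<open>I\<close> modulo the one generated by \<open>I\<close>. Only upper bounds are ever needed,
  so it suffices that the filtered module contains \<open>J\<close>; the arguments are arbitrary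
  sets and stand for the ideals they generate.\<close>

definition clen :: "'r::comm_ring_1 set \<Rightarrow> 'r set \<Rightarrow> 'r set \<Rightarrow> nat \<Rightarrow> bool" where
  "clen m J I n \<longleftrightarrow> (\<exists>gs. length gs \<le> n \<and> J \<subseteq> sp UNIV (set gs \<union> I) \<and> simple UNIV m I gs)"

lemma sp_cover: "S \<subseteq> G \<Longrightarrow> I \<subseteq> sp UNIV H \<Longrightarrow> H \<subseteq> G \<Longrightarrow> sp UNIV (S \<union> I) \<subseteq> sp UNIV G"
  using sp_mono[of H G UNIV UNIV] sp_base[of UNIV _ G] by (intro sp_least is_subring_UNIV) auto

lemma simple_mono: "simple UNIV m I gs \<Longrightarrow> I \<subseteq> sp UNIV I' \<Longrightarrow> simple UNIV m I' gs"
proof (induction gs)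
  case (Cons g gs)
  have "sp UNIV (set gs \<union> I) \<subseteq> sp UNIV (set gs \<union> I')"
    using Cons.prems by (intro sp_cover[of _ _ _ I']) auto
  then show ?case using Cons by auto
qed simp

lemma simple_append:
  "simple UNIV m I gs \<Longrightarrow> simple UNIV m I' hs \<Longrightarrow> I \<subseteq> sp UNIV (set hs \<union> I') \<Longrightarrow> simple UNIV m I' (gs @ hs)"
proof (induction gs)
  case (Cons g gs)
  have "sp UNIV (set gs \<union> I) \<subseteq> sp UNIV (set (gs @ hs) \<union> I')"
    using Cons.prems by (intro sp_cover[of _ _ _ "set hs \<union> I'"]) auto
  then show ?case using Cons by auto
qed simp

lemma clen_trans:
  assumes "clen m J I a" "clen m I I' b"
  shows "clen m J I' (a + b)"
proof -
  obtain gs where gs: "length gs \<le> a" "J \<subseteq> sp UNIV (set gs \<union> I)" "simple UNIV m I gs" using assms by (auto simp: clen_def)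
  obtain hs where hs: "length hs \<le> b" "I \<subseteq> sp UNIV (set hs \<union> I')" "simple UNIV m I' hs" using assms by (auto simp: clen_def)
  have "sp UNIV (set gs \<union> I) \<subseteq> sp UNIV (set (gs @ hs) \<union> I')"
    using hs by (intro sp_cover[of _ _ _ "set hs \<union> I'"]) auto
  then show ?thesis unfolding clen_def using gs hs simple_append[of m I gs I' hs]
    by (intro exI[of _ "gs @ hs"]) auto
qed

lemma clen_mono:
  assumes "clen m J I a" "J' \<subseteq> sp UNIV (J \<union> I')" "I \<subseteq> sp UNIV I'" "a \<le> b"
  shows "clen m J' I' b"
proof -
  obtain gs where gs: "length gs \<le> a" "J \<subseteq> sp UNIV (set gs \<union> I)" "simple UNIV m I gs" using assms by (auto simp: clen_def)
  have "sp UNIV (set gs \<union> I) \<subseteq> sp UNIV (set gs \<union> I')"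
    using assms by (intro sp_cover[of _ _ _ I']) auto
  then have "J \<subseteq> sp UNIV (set gs \<union> I')" using gs by blast
  then have "sp UNIV (J \<union> I') \<subseteq> sp UNIV (set gs \<union> I')" using sp_base[of UNIV _ "set gs \<union> I'"] by (intro sp_least) auto
  then show ?thesis unfolding clen_def using gs assms simple_mono[of m I gs I'] by (intro exI[of _ gs]) auto
qed

lemma clen_0: "J \<subseteq> sp UNIV I \<Longrightarrow> clen m J I 0"
  by (auto simp: clen_def)

lemma simple_map: "simple UNIV m I gs \<Longrightarrow> simple UNIV m ((*) c ` I) (map ((*) c) gs)"
proof (induction gs)
  case (Cons g gs)
  have "a * (c * g) \<in> sp UNIV (set (map ((*) c) gs) \<union> (*) c ` I)" if "a \<in> m" for a
    using sp_image[of "a * g" UNIV "set gs \<union> I" c] that Cons.prems by (simp add: image_Un algebra_simps)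
  then show ?case using Cons by auto
qed simp

lemma clen_image:
  assumes "clen m J I a"
  shows "clen m ((*) c ` J) ((*) c ` I) a"
proof -
  obtain gs where gs: "length gs \<le> a" "J \<subseteq> sp UNIV (set gs \<union> I)" "simple UNIV m I gs" using assms by (auto simp: clen_def)
  have "(*) c ` J \<subseteq> sp UNIV (set (map ((*) c) gs) \<union> (*) c ` I)"
    using gs(2) sp_image[of _ UNIV "set gs \<union> I" c] by (auto simp: image_Un)
  then show ?thesis unfolding clen_def using gs simple_map by (intro exI[of _ "map ((*) c) gs"]) auto
qed

lemma clen_finite:
  assumes "finite S" "\<And>s. s \<in> S \<Longrightarrow> clen m {s} I a"
  shows "clen m (S \<union> I) I (a * card S)"
  using assms
proof (induction S)
  case empty
  then show ?case using sp_base[of UNIV] by (auto intro: clen_0)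
next
  case (insert s S)
  have "clen m (insert s S \<union> I) (S \<union> I) a"
    using insert.prems(1)[of s] by (rule clen_mono) (auto intro: sp_base)
  moreover have "clen m (S \<union> I) I (a * card S)" using insert by blast
  ultimately show ?case using clen_trans insert by fastforce
qed

text \<open>Multiplication by \<open>y ^ k\<close> maps the quotient by \<open>y\<close> and
  \<open>J\<close> onto the layer between \<open>y ^ k\<close> and \<open>y ^ Suc k\<close>; there
  are \<open>k\<close> layers, each of length at most \<open>a\<close>.\<close>

lemma clen_power:
  assumes "clen m UNIV (insert y J) a"
  shows "clen m UNIV (insert (y ^ k) J) (k * a)"
proof (induction k)
  case 0
  have "x \<in> sp UNIV (insert (y ^ 0) J)" for x using sp_base'[of UNIV 1 "insert (y ^ 0) J" x] by simp
  then show ?case by (auto intro: clen_0)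
next
  case (Suc k)
  have "clen m (insert (y ^ k) J) (insert (y ^ Suc k) J) a"
  proof (rule clen_mono[OF clen_image[OF assms, of "y ^ k"]])
    show "insert (y ^ k) J \<subseteq> sp UNIV ((*) (y ^ k) ` UNIV \<union> insert (y ^ Suc k) J)"
      using image_eqI[of "y ^ k" "(*) (y ^ k)" 1 UNIV] by (auto intro!: sp_base)
    show "(*) (y ^ k) ` insert y J \<subseteq> sp UNIV (insert (y ^ Suc k) J)"
      by (auto intro!: sp_base'[of UNIV _ _ "y ^ k"] intro: sp_base simp: mult.commute[of "y ^ k" y])
  qed simp
  from clen_trans[OF Suc this] show ?case by (simp add: add.commute)
qed

lemma clen_powers:
  assumes "clen m UNIV (set ys \<union> I) a"
  shows "clen m UNIV ((\<lambda>y. y ^ k) ` set ys \<union> I) (a * k ^ length ys)"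
  using assms
proof (induction ys arbitrary: I)
  case (Cons y ys)
  have "clen m UNIV ((\<lambda>y. y ^ k) ` set ys \<union> insert y I) (a * k ^ length ys)"
    using Cons.prems by (intro Cons.IH) (simp add: Un_commute)
  then have "clen m UNIV (insert y ((\<lambda>y. y ^ k) ` set ys \<union> I)) (a * k ^ length ys)" by simp
  from clen_power[OF this, of k] show ?case by (simp add: algebra_simps)
qed simp

text \<open>Without a singular element \<open>clen_powers\<close> gives order
  \<open>k ^ length ys\<close>; a singular element in \<open>I\<close> saves one factor
  \<open>k\<close>. The bound is stated for \<open>n * k\<close> so that an empty \<open>ys\<close>,
  where \<open>I\<close> is everything and \<open>n = 0\<close>, fits in without subtraction in the
  exponent.\<close>

lemma clen_sing:
  assumes "s \<in> sing ys" "s \<in> I" "is_ideal I" "clen m UNIV (set ys \<union> I) l"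
  shows "\<exists>C. \<forall>k\<ge>1. \<exists>n. clen m UNIV ((\<lambda>y. y ^ k) ` set ys \<union> I) n \<and> n * k \<le> C * k ^ length ys"
  using assms
proof (induction ys arbitrary: s I)
  case Nil
  then have "1 \<in> I" by simp
  then have "x \<in> I" for x using is_idealD(3)[OF Nil(3), of 1 x] by simp
  then have "clen m UNIV I 0" using sp_base[of UNIV] by (intro clen_0) auto
  then show ?case by (intro exI[of _ 0]) auto
next
  case (Cons y ys)
  obtain j s' a where s: "s = y ^ j * (s' + a * y)" "s' \<in> sing ys" using Cons.prems by auto
  define t where "t = s' + a * y"
  define I' where "I' = sp UNIV (insert y (insert t I))"
  have I': "is_ideal I'" "y \<in> I'" "t \<in> I'" "I \<subseteq> I'" by (auto simp: I'_def is_ideal_sp intro: sp_base)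
  have "s' \<in> I'" using is_idealD(6)[OF I'(1) I'(3), of "a * y"] is_idealD(3)[OF I'(1,2)] by (simp add: t_def)
  moreover have "clen m UNIV (set ys \<union> I') l"
    by (rule clen_mono[OF Cons.prems(4)]) (use I' in \<open>auto intro: sp_base\<close>)
  ultimately obtain C where C: "\<And>k. k \<ge> 1 \<Longrightarrow> \<exists>n. clen m UNIV ((\<lambda>y. y ^ k) ` set ys \<union> I') n \<and> n * k \<le> C * k ^ length ys"
    using Cons.IH[OF s(2) _ I'(1)] by blast
  show ?case
  proof (rule exI[of _ "j * l + C"], intro allI impI)
    fix k :: nat assume k: "k \<ge> 1"
    let ?p = "(\<lambda>y. y ^ k) ` set ys"
    obtain n where n: "clen m UNIV (?p \<union> I') n" "n * k \<le> C * k ^ length ys" using C[OF k] by blast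
    have "clen m UNIV (insert y (insert t (?p \<union> I))) n"
    proof (rule clen_mono[OF n(1)])
      have "I' \<subseteq> sp UNIV (insert y (insert t (?p \<union> I)))" unfolding I'_def by (intro sp_mono) auto
      then show "?p \<union> I' \<subseteq> sp UNIV (insert y (insert t (?p \<union> I)))" by (auto intro: sp_base)
    qed (auto intro: sp_base)
    from clen_power[OF this, of k] have t: "clen m UNIV (insert (y ^ k) (insert t (?p \<union> I))) (k * n)" .
    \<comment> \<open>Because \<open>y ^ j * t\<close> lies in \<open>I\<close>, multiplication by
      \<open>y ^ j\<close> maps the quotient by \<open>y ^ k\<close> and \<open>t\<close> onto the
      layer between \<open>y ^ j\<close> and \<open>y ^ k\<close>. The induction hypothesis controls
      that quotient, as \<open>s'\<close> lies in the ideal of \<open>y\<close> and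
      \<open>t\<close>.\<close>
    have 2: "clen m (insert (y ^ j) (?p \<union> I)) (insert (y ^ k) (?p \<union> I)) (k * n)"
    proof (rule clen_mono[OF clen_image[OF t, of "y ^ j"]])
      show "insert (y ^ j) (?p \<union> I) \<subseteq> sp UNIV (range ((*) (y ^ j)) \<union> insert (y ^ k) (?p \<union> I))"
        using image_eqI[of "y ^ j" "(*) (y ^ j)" 1 UNIV] by (auto intro!: sp_base)
      have "y ^ j * t \<in> I" using s Cons.prems by (simp add: t_def)
      then show "(*) (y ^ j) ` insert (y ^ k) (insert t (?p \<union> I)) \<subseteq> sp UNIV (insert (y ^ k) (?p \<union> I))"
        by (intro image_subsetI) (elim insertE UnE; force intro: sp_base sp_base')
    qed simp
    \<comment> \<open>The layer above \<open>y ^ j\<close> involves the fixed number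
      \<open>j\<close> of powers of \<open>y\<close>, so it grows only like the powers of the
      remaining variables and contributes \<open>j * l\<close> to the constant.\<close>
    have "clen m UNIV (set ys \<union> insert y I) l" using Cons.prems by (simp add: Un_commute)
    from clen_powers[OF this, of k] have "clen m UNIV (insert y (?p \<union> I)) (l * k ^ length ys)" by simp
    from clen_trans[OF clen_power[OF this, of j] 2]
    have "clen m UNIV (insert (y ^ k) (?p \<union> I)) (j * (l * k ^ length ys) + k * n)" .
    moreover have "(j * (l * k ^ length ys) + k * n) * k \<le> (j * l + C) * k ^ length (y # ys)"
    proof -
      have "(j * (l * k ^ length ys) + k * n) * k = j * l * k ^ length ys * k + (n * k) * k"
        by (simp add: algebra_simps)
      also have "\<dots> \<le> j * l * k ^ length ys * k + (C * k ^ length ys) * k"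
        by (intro add_left_mono mult_right_mono n) simp
      also have "\<dots> = (j * l + C) * k ^ length (y # ys)" by (simp add: algebra_simps)
      finally show ?thesis .
    qed
    ultimately show "\<exists>n. clen m UNIV ((\<lambda>y. y ^ k) ` set (y # ys) \<union> I) n \<and> n * k \<le> (j * l + C) * k ^ length (y # ys)"
      by auto
  qed
qed

section \<open>Dickson's lemma and the ascending chain condition\<close>

lemma nat_increasing_subseq:
  fixes f :: "nat \<Rightarrow> nat"
  shows "\<exists>r :: nat \<Rightarrow> nat. strict_mono r \<and> (\<forall>i j. i \<le> j \<longrightarrow> f (r i) \<le> f (r j))"
proof -
  have least: "\<exists>x>x0. \<forall>y\<ge>x. f x \<le> f y" for x0
  proof -
    obtain x where "x > x0" "\<forall>y. y > x0 \<longrightarrow> f x \<le> f y"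
      using ex_has_least_nat[of "\<lambda>x. x > x0" "Suc x0" f] by auto
    then show ?thesis by (intro exI[of _ x]) auto
  qed
  have "\<exists>r. \<forall>n. (\<forall>y\<ge>r n. f (r n) \<le> f y) \<and> r n < r (Suc n)"
    by (rule dependent_nat_choice) (use least[of 0] least in blast)+
  then obtain r where r: "\<And>n. \<forall>y\<ge>r n. f (r n) \<le> f y" "\<And>n. r n < r (Suc n)" by blast
  then have sm: "strict_mono r" by (simp add: strict_mono_Suc_iff)
  have "f (r i) \<le> f (r j)" if "i \<le> j" for i j
    using r(1)[of i] sm that by (simp add: strict_mono_less_eq)
  then show ?thesis using sm by blast
qed

text \<open>Dickson's lemma for sequences, one coordinate at a time: a subsequence with weakly
  increasing heads is thinned out further by the induction hypothesis for the tails.\<close>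

lemma dickson:
  fixes a :: "nat \<Rightarrow> nat list"
  assumes "\<And>i. length (a i) = d"
  shows "\<exists>r :: nat \<Rightarrow> nat. strict_mono r \<and> (\<forall>i j. i \<le> j \<longrightarrow> ple (a (r i)) (a (r j)))"
  using assms
proof (induction d arbitrary: a)
  case 0
  then have "ple (a i) (a j)" for i j by (simp add: ple_def)
  then have "strict_mono (id :: nat \<Rightarrow> nat) \<and> (\<forall>i j. i \<le> j \<longrightarrow> ple (a (id i)) (a (id j)))"
    using strict_mono_id by simp
  then show ?case by (rule exI[of _ id])
next
  case (Suc d)
  have "\<exists>r :: nat \<Rightarrow> nat. strict_mono r \<and> (\<forall>i j. i \<le> j \<longrightarrow> hd (a (r i)) \<le> hd (a (r j)))" by (rule nat_increasing_subseq)
  then obtain r :: "nat \<Rightarrow> nat" where r: "strict_mono r \<and> (\<forall>i j. i \<le> j \<longrightarrow> hd (a (r i)) \<le> hd (a (r j)))" ..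
  have "\<exists>s :: nat \<Rightarrow> nat. strict_mono s \<and> (\<forall>i j. i \<le> j \<longrightarrow> ple (tl (a (r (s i)))) (tl (a (r (s j)))))"
    using Suc.IH[of "\<lambda>i. tl (a (r i))"] Suc.prems by simp
  then obtain s :: "nat \<Rightarrow> nat" where s: "strict_mono s \<and> (\<forall>i j. i \<le> j \<longrightarrow> ple (tl (a (r (s i)))) (tl (a (r (s j)))))" ..
  have "ple (a (r (s i))) (a (r (s j)))" if "i \<le> j" for i j
  proof -
    have "s i \<le> s j" using s that by (simp add: strict_mono_less_eq)
    then have "hd (a (r (s i))) \<le> hd (a (r (s j)))" using r by simp
    moreover have "ple (tl (a (r (s i)))) (tl (a (r (s j))))" using s that by simp
    ultimately show ?thesis using Suc.prems[of "r (s i)"] Suc.prems[of "r (s j)"]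
      by (cases "a (r (s i))"; cases "a (r (s j))") (auto simp: ple_def)
  qed
  moreover have "strict_mono (r \<circ> s)" using r s by (simp add: strict_mono_o)
  ultimately have "strict_mono (r \<circ> s) \<and> (\<forall>i j. i \<le> j \<longrightarrow> ple (a ((r \<circ> s) i)) (a ((r \<circ> s) j)))"
    unfolding o_apply by blast
  then show ?case by (rule exI[of _ "r \<circ> s"])
qed

definition acc_above :: "'r::comm_ring_1 set \<Rightarrow> bool" where
  "acc_above K \<longleftrightarrow> (\<forall>I :: nat \<Rightarrow> 'r set. (\<forall>n. is_ideal (I n) \<and> K \<subseteq> I n \<and> I n \<subseteq> I (Suc n)) \<longrightarrow> (\<exists>N. \<forall>n\<ge>N. I n = I N))"

lemma acc_maximal:
  assumes "acc_above K" "F \<noteq> {}" "\<And>J. J \<in> F \<Longrightarrow> is_ideal J \<and> K \<subseteq> J"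
  shows "\<exists>M\<in>F. \<forall>J\<in>F. M \<subseteq> J \<longrightarrow> J = M"
proof (rule ccontr)
  assume "\<not> ?thesis"
  then have ex: "\<exists>J. J \<in> F \<and> M \<subset> J" if "M \<in> F" for M using that by blast
  obtain M0 where "M0 \<in> F" using assms(2) by blast
  define I where "I = rec_nat M0 (\<lambda>n M. SOME J. J \<in> F \<and> M \<subset> J)"
  have I_Suc: "I (Suc n) = (SOME J. J \<in> F \<and> I n \<subset> J)" for n by (simp add: I_def)
  have IF: "I n \<in> F" for n
  proof (induction n)
    case 0
    then show ?case using \<open>M0 \<in> F\<close> by (simp add: I_def)
  next
    case (Suc n)
    then show ?case unfolding I_Suc using someI_ex[OF ex[OF Suc]] by simp
  qed
  have I: "I n \<in> F" "I n \<subset> I (Suc n)" for n using IF someI_ex[OF ex[OF IF[of n]]] by (simp_all add: I_Suc)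
  have "\<forall>n. is_ideal (I n) \<and> K \<subseteq> I n \<and> I n \<subseteq> I (Suc n)"
    using assms(3)[OF I(1)] I(2) by (simp add: psubset_imp_subset)
  then have "\<exists>N. \<forall>n\<ge>N. I n = I N" by (rule assms(1)[unfolded acc_above_def, THEN spec, THEN mp])
  then obtain N where N: "\<forall>n\<ge>N. I n = I N" ..
  have "I (Suc N) = I N" by (rule N[rule_format]) simp
  with I(2)[of N] show False by blast
qed

lemma acc_maximalE:
  assumes "acc_above K" "Pr J0" "\<And>J. Pr J \<Longrightarrow> is_ideal J \<and> K \<subseteq> J"
  obtains M where "Pr M" "\<And>J. Pr J \<Longrightarrow> M \<subseteq> J \<Longrightarrow> J = M"
proof -
  have "\<exists>M\<in>Collect Pr. \<forall>J\<in>Collect Pr. M \<subseteq> J \<longrightarrow> J = M"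
    using assms by (intro acc_maximal[of K]) auto
  then show ?thesis using that by auto
qed

text \<open>A monotone family of ideals indexed by exponents takes all its values in bounded degree,
  below the given exponent. Otherwise Dickson's lemma extracts from the counterexamples an
  increasing sequence of exponents whose ideals never become stationary.\<close>

lemma acc_dickson:
  assumes acc: "acc_above K" and L: "\<And>\<alpha>. length \<alpha> = d \<Longrightarrow> is_ideal (L \<alpha>) \<and> K \<subseteq> L \<alpha>"
    and mono: "\<And>\<alpha> \<beta>. length \<alpha> = d \<Longrightarrow> ple \<alpha> \<beta> \<Longrightarrow> L \<alpha> \<subseteq> L \<beta>"
  shows "\<exists>c. \<forall>\<alpha>. length \<alpha> = d \<longrightarrow> (\<exists>\<tau>. length \<tau> = d \<and> ple \<tau> \<alpha> \<and> sum_list \<tau> \<le> c \<and> L \<tau> = L \<alpha>)"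
proof (rule ccontr)
  assume "\<not> ?thesis"
  then obtain f where f: "\<And>c. length (f c) = d" 
    "\<And>c \<tau>. length \<tau> = d \<Longrightarrow> ple \<tau> (f c) \<Longrightarrow> sum_list \<tau> \<le> c \<Longrightarrow> L \<tau> \<noteq> L (f c)" by metis
  \<comment> \<open>The bounds are running maxima of degrees, so every earlier counterexample has
    degree at most the present bound and is an admissible \<open>\<tau>\<close> for the later
    ones.\<close>
  define c where "c = rec_nat 0 (\<lambda>n x. max x (sum_list (f x)))"
  have c: "c (Suc n) = max (c n) (sum_list (f (c n)))" for n by (simp add: c_def)
  have cm: "mono c" by (rule incseq_SucI) (simp add: c)
  define a where "a n = f (c n)" for n
  have la: "length (a i) = d" for i by (simp add: a_def f)
  have ne: "\<not> (ple (a i) (a j) \<and> L (a i) = L (a j))" if "i < j" for i j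
  proof -
    have "sum_list (a i) \<le> c (Suc i)" by (simp add: c a_def)
    also have "\<dots> \<le> c j" using cm that by (auto simp: mono_def)
    finally show ?thesis using f(2)[of "a i" "c j"] la by (auto simp: a_def)
  qed
  from dickson[of a, OF la] obtain r :: "nat \<Rightarrow> nat"
    where r: "strict_mono r \<and> (\<forall>i j. i \<le> j \<longrightarrow> ple (a (r i)) (a (r j)))" ..
  have "\<forall>n. is_ideal (L (a (r n))) \<and> K \<subseteq> L (a (r n)) \<and> L (a (r n)) \<subseteq> L (a (r (Suc n)))"
    using L[OF la] mono[OF la] r by simp
  then have "\<exists>N. \<forall>n\<ge>N. L (a (r n)) = L (a (r N))"
    by (rule acc[unfolded acc_above_def, THEN spec, THEN mp])
  then obtain N where N: "\<forall>n\<ge>N. L (a (r n)) = L (a (r N))" ..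
  have "L (a (r (Suc N))) = L (a (r N))" by (rule N[rule_format]) simp
  then show False using ne[of "r N" "r (Suc N)"] r by (auto simp: strict_mono_def)
qed

text \<open>The Noetherian local ring is the quotient by \<open>K\<close>; the ambient type need not be Noetherian.\<close>

locale noeth_local =
  fixes K m :: "'r::comm_ring_1 set" and xs :: "'r list"
  assumes idK: "is_ideal K" and idm: "is_ideal m" and Km: "K \<subseteq> m" and one_m: "1 \<notin> m"
    and unit: "a \<notin> m \<Longrightarrow> \<exists>b. a * b - 1 \<in> K"
    and acc: "acc_above K"
    and xs_m: "set xs \<subseteq> m"
    and rad: "a \<in> m \<Longrightarrow> \<exists>n. a ^ n \<in> sp UNIV (set xs \<union> K)"
begin

lemma ideal_sub_m:
  assumes "is_ideal I" "K \<subseteq> I" "1 \<notin> I"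
  shows "I \<subseteq> m"
proof
  fix a assume a: "a \<in> I"
  show "a \<in> m"
  proof (rule ccontr)
    assume "a \<notin> m"
    then obtain b where "a * b - 1 \<in> K" using unit by blast
    then have "a * b - 1 \<in> I" "a * b \<in> I" using assms(2) is_idealD(4)[OF assms(1) a] by auto
    from is_idealD(6)[OF assms(1) this(2,1)] show False using assms by simp
  qed
qed

text \<open>A colon ideal of \<open>J\<close> by an element outside \<open>J\<close>, chosen
  maximal, is prime. It contains \<open>K\<close> and \<open>xs\<close>, hence all of
  \<open>m\<close> by \<open>rad\<close>.\<close>

lemma socle:
  assumes J: "is_ideal J" "K \<subseteq> J" "set xs \<subseteq> J" "1 \<notin> J"
  shows "\<exists>a. a \<notin> J \<and> (\<forall>b\<in>m. b * a \<in> J)"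
proof -
  let ?c = "\<lambda>a. {c. c * a \<in> J}"
  have id: "is_ideal (?c a)" for a unfolding is_ideal_def
    using is_idealD[OF J(1)] by (auto simp: distrib_right mult.assoc)
  have Jc: "J \<subseteq> ?c a" for a using is_idealD[OF J(1)] by auto
  define Q where "Q L \<longleftrightarrow> (\<exists>a. a \<notin> J \<and> L = ?c a)" for L
  have "Q (?c 1)" unfolding Q_def using J(4) by (intro exI[of _ 1] conjI refl)
  moreover have "is_ideal L \<and> K \<subseteq> L" if "Q L" for L
    using that id Jc J(2) unfolding Q_def by (elim exE conjE) (simp only:, blast)
  ultimately obtain M where M: "Q M" and M_max: "\<And>L. Q L \<Longrightarrow> M \<subseteq> L \<Longrightarrow> L = M"
    using acc_maximalE[OF acc, of Q "?c 1"] by blast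
  obtain a where a: "a \<notin> J" "M = ?c a" using M unfolding Q_def by (elim exE conjE)
  have max: "?c b = ?c a" if "b \<notin> J" "?c a \<subseteq> ?c b" for b
  proof -
    have "Q (?c b)" unfolding Q_def using that(1) by blast
    then show ?thesis using M_max[of "?c b"] that(2) a(2) by simp
  qed
  have prime: "b \<in> ?c a" if "b * c \<in> ?c a" "c \<notin> ?c a" for b c
  proof -
    have "?c a \<subseteq> ?c (c * a)" using is_idealD(3)[OF J(1), of _ c] by (auto simp: mult.left_commute[of _ c a])
    then have "?c (c * a) = ?c a" using that by (intro max) auto
    moreover have "b \<in> ?c (c * a)" using that by (simp add: mult.assoc)
    ultimately show ?thesis by blast
  qed
  have "b * a \<in> J" if bm: "b \<in> m" for b
  proof -
    obtain n where "b ^ n \<in> sp UNIV (set xs \<union> K)" using rad[OF bm] ..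
    then have "b ^ n \<in> ?c a" using sp_ideal_subset[OF J(1), of "set xs \<union> K" UNIV] J Jc[of a] by auto
    then show ?thesis
    proof (induction n)
      case 0
      then show ?case using a by simp
    next
      case (Suc n)
      then show ?case using prime[of b "b ^ n"] by auto
    qed
  qed
  then show ?thesis using a by blast
qed

text \<open>Among the ideals of finite length over \<open>I\<close> take a maximal one. If it were
  proper, a socle element would enlarge it by one more simple layer.\<close>

lemma finite_colength:
  assumes I: "is_ideal I" "K \<subseteq> I" "set xs \<subseteq> I"
  shows "\<exists>n. clen m UNIV I n"
proof -
  let ?P = "\<lambda>J. is_ideal J \<and> K \<subseteq> J \<and> I \<subseteq> J \<and> (\<exists>n. clen m J I n)"
  have "clen m I I 0" using sp_base[of UNIV _ I] by (intro clen_0) auto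
  then have "?P I" using I by blast
  from acc_maximalE[OF acc, of ?P, OF this] obtain J where J': "?P J" and J_max: "\<And>L. ?P L \<Longrightarrow> J \<subseteq> L \<Longrightarrow> L = J" by blast
  then obtain n where J: "is_ideal J" "K \<subseteq> J" "I \<subseteq> J" "clen m J I n" by blast
  have max: "L = J" if "is_ideal L" "J \<subseteq> L" "clen m L I n'" for L n'
    by (rule J_max) (use that J in auto)
  have "1 \<in> J"
  proof (rule ccontr)
    assume "1 \<notin> J"
    then obtain a where a: "a \<notin> J" "\<And>b. b \<in> m \<Longrightarrow> b * a \<in> J" using socle[of J] J I by blast
    let ?J = "sp UNIV (insert a J)"
    have "clen m ?J J 1" unfolding clen_def
      using a sp_base[of UNIV _ J] by (intro exI[of _ "[a]"]) auto
    from clen_trans[OF this J(4)] have "?J = J" by (intro max) (auto simp: is_ideal_sp intro: sp_base)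
    then show False using a sp_base[of UNIV a "insert a J"] by auto
  qed
  then have "J = UNIV" using is_idealD(3)[OF J(1), of 1] by auto
  then show ?thesis using J by blast
qed

text \<open>The place of finite generation is taken by the assumption that \<open>xs\<close>
  multiply \<open>W\<close> into \<open>V\<close>. If the colon ideal of \<open>V\<close> by
  \<open>W\<close> were proper, it would have a socle element \<open>a\<close>; multiplying the
  inclusion of \<open>W\<close> in \<open>V + m W\<close> by \<open>a\<close> then puts
  \<open>a W\<close> into \<open>V\<close>, which contradicts the choice of
  \<open>a\<close>.\<close>

lemma nakayama:
  assumes V: "is_ideal V" "K \<subseteq> V" and q: "\<And>x w. x \<in> set xs \<Longrightarrow> w \<in> W \<Longrightarrow> x * w \<in> V"
    and W: "W \<subseteq> sp UNIV (V \<union> {a * w | a w. a \<in> m \<and> w \<in> W})"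
  shows "W \<subseteq> V"
proof -
  let ?C = "{c. \<forall>w\<in>W. c * w \<in> V}"
  have C: "is_ideal ?C" unfolding is_ideal_def
    using is_idealD[OF V(1)] by (auto simp: distrib_right mult.assoc)
  have "K \<subseteq> ?C" using V is_idealD[OF V(1)] by auto
  moreover have "set xs \<subseteq> ?C" using q by auto
  ultimately have "1 \<in> ?C"
  proof (rule_tac ccontr)
    assume KC: "K \<subseteq> ?C" "set xs \<subseteq> ?C" and "1 \<notin> ?C"
    then obtain a where a: "a \<notin> ?C" "\<And>b. b \<in> m \<Longrightarrow> b * a \<in> ?C" using socle[OF C] by blast
    have "a * w \<in> V" if "w \<in> W" for w
    proof -
      have "a * w \<in> sp UNIV ((*) a ` (V \<union> {a * w | a w. a \<in> m \<and> w \<in> W}))"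
        using W that by (intro sp_image) auto
      moreover have "(*) a ` (V \<union> {a * w | a w. a \<in> m \<and> w \<in> W}) \<subseteq> V"
      proof (intro image_subsetI)
        fix v assume "v \<in> V \<union> {a * w | a w. a \<in> m \<and> w \<in> W}"
        then show "a * v \<in> V"
        proof
          assume "v \<in> {a * w | a w. a \<in> m \<and> w \<in> W}"
          then obtain b w where v: "v = b * w" "b \<in> m" "w \<in> W" by blast
          have "b * a * w \<in> V" using a(2)[OF v(2)] v(3) by blast
          then show ?thesis using v by (simp add: mult.assoc mult.left_commute)
        qed (use is_idealD[OF V(1)] in auto)
      qed
      ultimately show ?thesis using sp_ideal_subset[OF V(1)] by blast
    qed
    then show False using a by blast
  qed
  then show ?thesis by auto
qed

lemma Qp_xs: "x \<in> set xs \<Longrightarrow> w \<in> Qp xs j \<Longrightarrow> x * w \<in> Qp xs (Suc j)"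
proof -
  assume x: "x \<in> set xs" and w: "w \<in> Qp xs j"
  obtain ys zs where xs: "xs = ys @ x # zs" using split_list[OF x] by blast
  have "mon xs (replicate (length ys) 0 @ 1 # replicate (length zs) 0) = x"
    unfolding xs by (induction ys) auto
  then have "x \<in> Qp xs 1" using mon_Qp[of "replicate (length ys) 0 @ 1 # replicate (length zs) 0" xs 1]
    by (simp add: expo_def xs sum_list_replicate)
  from Qp_mult[OF this w] show ?thesis by simp
qed

text \<open>A unit form in \<open>I\<close> is a relation with leading monomial
  \<open>x^\<mu>\<close>, so each graded layer is spanned by monomials not divisible by it. Each of
  these generates a quotient of the ring modulo \<open>xs\<close> and \<open>K\<close>, of length at
  most \<open>l\<close>.\<close>

lemma FF_growth:
  assumes I: "is_ideal I" "K \<subseteq> I" and f: "f \<in> FF m xs \<mu>" "f \<in> I" "length \<mu> = length xs"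
    and l: "clen m UNIV (set xs \<union> K) l"
  shows "clen m UNIV (Qp xs k \<union> I) (l * card {\<alpha> \<in> box (length xs) k. \<not> ple \<mu> \<alpha>})"
proof -
  let ?d = "length xs"
  define S where "S j = {\<alpha> \<in> expo ?d j. \<not> ple \<mu> \<alpha>}" for j
  have \<mu>: "mon xs \<mu> \<in> sp UNIV (GT xs \<mu> \<union> (MQ m xs (sum_list \<mu>) \<union> I))"
  proof -
    have "f - mon xs \<mu> \<in> sp UNIV (GT xs \<mu> \<union> MQ m xs (sum_list \<mu>))" using f by (simp add: FF_def)
    then have "f - mon xs \<mu> \<in> sp UNIV (GT xs \<mu> \<union> (MQ m xs (sum_list \<mu>) \<union> I))"
      using sp_mono[of "GT xs \<mu> \<union> MQ m xs (sum_list \<mu>)" "GT xs \<mu> \<union> (MQ m xs (sum_list \<mu>) \<union> I)" UNIV UNIV] by blast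
    moreover have "f \<in> sp UNIV (GT xs \<mu> \<union> (MQ m xs (sum_list \<mu>) \<union> I))" using f by (auto intro: sp_base)
    ultimately show ?thesis using sp_diff[OF is_subring_UNIV, of f _ "f - mon xs \<mu>"] by simp
  qed
  \<comment> \<open>Division by the unit form works only modulo \<open>m\<close> times the layer,
    since the coefficients of its other terms in \<open>MQ\<close> are merely in \<open>m\<close>;
    \<open>nakayama\<close> removes this error.\<close>
  have step: "Qp xs j \<subseteq> sp UNIV (mon xs ` S j \<union> (Qp xs (Suc j) \<union> I))" for j
  proof (rule nakayama)
    let ?V = "sp UNIV (mon xs ` S j \<union> (Qp xs (Suc j) \<union> I))"
    show "is_ideal ?V" by (rule is_ideal_sp)
    show "K \<subseteq> ?V" using I by (auto intro: sp_base)
    show "x * w \<in> ?V" if "x \<in> set xs" "w \<in> Qp xs j" for x w using Qp_xs[OF that] by (auto intro: sp_base)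
    show "Qp xs j \<subseteq> sp UNIV (?V \<union> {a * w | a w. a \<in> m \<and> w \<in> Qp xs j})" (is "_ \<subseteq> ?T")
      unfolding Qp_def[of xs j]
    proof (rule sp_least[OF is_subring_UNIV], clarify)
      fix \<alpha> assume \<alpha>: "\<alpha> \<in> expo ?d j"
      have "mon xs \<alpha> \<in> sp UNIV (mon xs ` {\<alpha>' \<in> expo ?d j. \<not> ple \<mu> \<alpha>'} \<union> (MQ m xs j \<union> I))"
      proof (rule reduce_mon[OF is_subring_UNIV f(3) \<mu> _ \<alpha>])
        fix \<delta> b assume \<delta>: "length \<delta> = ?d" "b \<in> MQ m xs (sum_list \<mu>) \<union> I" "sum_list \<delta> + sum_list \<mu> = j"
        show "mon xs \<delta> * b \<in> sp UNIV (MQ m xs j \<union> I)"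
          using \<delta>(2)
        proof
          assume "b \<in> MQ m xs (sum_list \<mu>)"
          then obtain a \<gamma> where "b = a * mon xs \<gamma>" "a \<in> m" "\<gamma> \<in> expo ?d (sum_list \<mu>)" by (auto simp: MQ_def)
          then have "mon xs \<delta> * b = a * mon xs (padd \<delta> \<gamma>)" "padd \<delta> \<gamma> \<in> expo ?d j"
            using \<delta> by (auto simp: expo_def mon_padd sum_list_padd algebra_simps)
          then have "mon xs \<delta> * b \<in> MQ m xs j" using \<open>a \<in> m\<close> by (auto simp: MQ_def)
          then show ?thesis by (auto intro: sp_base)
        next
          assume "b \<in> I"
          then show ?thesis by (auto intro: sp_base')
        qed
      qed
      moreover have "mon xs ` {\<alpha>' \<in> expo ?d j. \<not> ple \<mu> \<alpha>'} \<union> (MQ m xs j \<union> I) \<subseteq> ?T"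
      proof -
        have "mon xs ` {\<alpha>' \<in> expo ?d j. \<not> ple \<mu> \<alpha>'} \<union> I \<subseteq> ?V" by (auto simp: S_def intro: sp_base)
        moreover have "?V \<subseteq> ?T" by (auto intro: sp_base)
        moreover have "MQ m xs j \<subseteq> {a * w | a w. a \<in> m \<and> w \<in> Qp xs j}" unfolding MQ_def using mon_Qp by blast
        moreover have "{a * w | a w. a \<in> m \<and> w \<in> Qp xs j} \<subseteq> ?T"
          by (intro subsetI sp_base[OF is_subring_UNIV] UnI2)
        ultimately show ?thesis by blast
      qed
      ultimately show "mon xs \<alpha> \<in> sp UNIV (?V \<union> {a * w | a w. a \<in> m \<and> w \<in> sp UNIV (mon xs ` expo ?d j)})"
        unfolding Qp_def[of xs j, symmetric] using sp_leastD[OF is_subring_UNIV] by blast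
    qed
  qed
  have cj: "clen m (Qp xs j \<union> I) (Qp xs (Suc j) \<union> I) (l * card (S j))" for j
  proof -
    have "clen m (mon xs ` S j \<union> (Qp xs (Suc j) \<union> I)) (Qp xs (Suc j) \<union> I) (l * card (mon xs ` S j))"
    proof (rule clen_finite)
      show "finite (mon xs ` S j)" by (simp add: S_def)
      fix s assume "s \<in> mon xs ` S j"
      then have s: "s \<in> Qp xs j" using mon_Qp by (auto simp: S_def)
      show "clen m {s} (Qp xs (Suc j) \<union> I) l"
      proof (rule clen_mono[OF clen_image[OF l, of s]])
        show "{s} \<subseteq> sp UNIV (range ((*) s) \<union> (Qp xs (Suc j) \<union> I))"
          using image_eqI[of s "(*) s" 1 UNIV] by (auto intro!: sp_base)
        show "(*) s ` (set xs \<union> K) \<subseteq> sp UNIV (Qp xs (Suc j) \<union> I)"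
          using Qp_xs[OF _ s] subsetD[OF I(2)] is_idealD(4)[OF I(1)] by (auto intro!: sp_base simp: mult.commute[of s])
      qed simp
    qed
    then show ?thesis
    proof (rule clen_mono)
      show "Qp xs j \<union> I \<subseteq> sp UNIV (mon xs ` S j \<union> (Qp xs (Suc j) \<union> I) \<union> (Qp xs (Suc j) \<union> I))"
        using step[of j] by (auto simp: Un_assoc intro: sp_base)
      show "l * card (mon xs ` S j) \<le> l * card (S j)" by (intro mult_left_mono card_image_le) (auto simp: S_def)
    qed (auto intro: sp_base)
  qed
  have total: "clen m UNIV (Qp xs k \<union> I) (\<Sum>j<k. l * card (S j))" for k
  proof (induction k)
    case 0
    then show ?case by (auto intro!: clen_0 sp_base simp: Qp_0)
  next
    case (Suc k)
    from clen_trans[OF this cj[of k]] show ?case by simp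
  qed
  have "(\<Sum>j<k. l * card (S j)) = l * card (\<Union>j<k. S j)"
  proof -
    have "card (\<Union>j<k. S j) = (\<Sum>j<k. card (S j))"
      by (intro card_UN_disjoint) (auto simp: S_def, auto simp: expo_def)
    then show ?thesis by (simp add: sum_distrib_left)
  qed
  also have "\<dots> \<le> l * card {\<alpha> \<in> box ?d k. \<not> ple \<mu> \<alpha>}"
  proof (intro mult_left_mono card_mono)
    show "(\<Union>j<k. S j) \<subseteq> {\<alpha> \<in> box ?d k. \<not> ple \<mu> \<alpha>}"
      by (auto simp: S_def expo_def box_def dest: member_le_sum_list)
  qed auto
  finally show ?thesis using total[of k] unfolding clen_def by (meson le_trans)
qed

end

lemma box_sum_le: "\<beta> \<in> box d N \<Longrightarrow> sum_list \<beta> \<le> d * N"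
proof (induction \<beta> arbitrary: d)
  case (Cons b \<beta>)
  then have "\<beta> \<in> box (length \<beta>) N" "b \<le> N" "d = Suc (length \<beta>)" by (auto simp: box_def)
  then show ?case using Cons.IH[of "length \<beta>"] by simp
qed simp

text \<open>The condition for \<open>d = 0\<close> is due to truncated subtraction: there
  \<open>d - 1\<close> is \<open>0\<close> too, and only \<open>C = 0\<close> makes the right-hand
  side smaller.\<close>

lemma poly_growth:
  fixes C b d :: nat
  assumes "\<And>N. N \<ge> 1 \<Longrightarrow> N ^ d \<le> C * (b * N + 1) ^ (d - 1)" "d = 0 \<Longrightarrow> C = 0"
  shows False
proof (cases d)
  case 0
  then show False using assms(1)[of 1] assms(2) by simp
next
  case (Suc e)
  \<comment> \<open>Chosen to exceed the bound on \<open>N\<close> that remains after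
    \<open>N ^ e\<close> is cancelled.\<close>
  define N where "N = C * (b + 1) ^ e + 1"
  have "N * N ^ e \<le> C * (b * N + 1) ^ e" using assms(1)[of N] Suc by (simp add: N_def)
  also have "\<dots> \<le> C * ((b + 1) * N) ^ e" by (intro mult_left_mono power_mono) (auto simp: N_def)
  also have "\<dots> = (C * (b + 1) ^ e) * N ^ e" by (simp only: power_mult_distrib mult.assoc)
  finally have "N \<le> C * (b + 1) ^ e" by (simp only: mult_le_cancel2) (simp add: N_def)
  then show False by (simp add: N_def)
qed

section \<open>Unit forms and chains of primes in the local ring\<close>

context noeth_local
begin

lemma unit_sp:
  assumes "a \<notin> m" "K \<subseteq> G"
  shows "\<exists>b\<in>UNIV. a * b - 1 \<in> sp UNIV G"
proof -
  obtain b where "a * b - 1 \<in> K" using unit[OF assms(1)] ..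
  then have "a * b - 1 \<in> sp UNIV G" using assms(2) by (intro sp_base) auto
  then show ?thesis by blast
qed

lemma finite_colength_gen:
  assumes "K \<subseteq> I"
  shows "\<exists>l. clen m UNIV (set xs \<union> I) l"
proof -
  have "K \<subseteq> sp UNIV (set xs \<union> I)" "set xs \<subseteq> sp UNIV (set xs \<union> I)" using assms by (auto intro: sp_base)
  from finite_colength[OF is_ideal_sp this] obtain l where "clen m UNIV (sp UNIV (set xs \<union> I)) l" ..
  then have "clen m UNIV (set xs \<union> I) l" by (rule clen_mono) (auto intro: sp_base)
  then show ?thesis ..
qed

text \<open>An Artin-Rees statement: cancelling \<open>z\<close> modulo a prime costs a bounded
  number \<open>c\<close> of steps, uniformly in \<open>k\<close>. It is obtained from leading
  coefficient ideals and Dickson's lemma, in the manner of the Hilbert basis theorem.\<close>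

lemma colon_bound:
  assumes P: "is_prime P" "K \<subseteq> P" "z \<notin> P"
  shows "\<exists>c. \<forall>k a. z * a \<in> sp UNIV (Qp xs (k + c) \<union> P) \<longrightarrow> a \<in> sp UNIV (Qp xs k \<union> P)"
proof -
  let ?d = "length xs"
  have Pi: "is_ideal P" using P is_primeD by blast
  \<comment> \<open>Leading coefficients, at the monomial \<open>x^\<alpha>\<close>, of relations
    modulo \<open>z\<close> and \<open>P\<close> within one degree. Multiplication by a monomial
    makes them grow with \<open>\<alpha>\<close>, so \<open>acc_dickson\<close> finds each of them
    already in degree at most \<open>c\<close>.\<close>
  define L where "L \<alpha> = {c. c * mon xs \<alpha> \<in> sp UNIV (GT xs \<alpha> \<union> insert z P)}" for \<alpha>
  have L: "is_ideal (L \<alpha>) \<and> K \<subseteq> L \<alpha>" for \<alpha>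
  proof
    show "is_ideal (L \<alpha>)" unfolding is_ideal_def L_def
      by (auto simp: distrib_right mult.assoc intro: sp_zero sp_add sp_mult)
    show "K \<subseteq> L \<alpha>" using P(2) is_idealD(4)[OF Pi] by (auto simp: L_def intro!: sp_base)
  qed
  have L_mono: "L \<alpha> \<subseteq> L \<beta>" if \<alpha>: "length \<alpha> = ?d" and le: "ple \<alpha> \<beta>" for \<alpha> \<beta>
  proof
    fix c assume c: "c \<in> L \<alpha>"
    obtain \<delta> where \<delta>: "length \<delta> = ?d" "\<beta> = padd \<delta> \<alpha>" using ple_padd[OF le] \<alpha> by auto
    have "mon xs \<delta> * (c * mon xs \<alpha>) \<in> sp UNIV ((*) (mon xs \<delta>) ` (GT xs \<alpha> \<union> insert z P))"
      using c by (intro sp_image) (simp add: L_def)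
    moreover have "(*) (mon xs \<delta>) ` (GT xs \<alpha> \<union> insert z P) \<subseteq> sp UNIV (GT xs \<beta> \<union> insert z P)"
    proof (intro image_subsetI)
      fix x assume "x \<in> GT xs \<alpha> \<union> insert z P"
      then show "mon xs \<delta> * x \<in> sp UNIV (GT xs \<beta> \<union> insert z P)"
      proof
        assume "x \<in> GT xs \<alpha>"
        then obtain \<gamma> where \<gamma>: "x = mon xs \<gamma>" "\<gamma> \<in> expo ?d (sum_list \<alpha>)" "\<alpha> < \<gamma>" by (auto simp: GT_def)
        then have "mon xs \<delta> * x = mon xs (padd \<delta> \<gamma>)" "padd \<delta> \<gamma> \<in> expo ?d (sum_list \<beta>)" "\<beta> < padd \<delta> \<gamma>"
          using \<alpha> \<delta> by (auto simp: expo_def mon_padd sum_list_padd intro: padd_less)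
        then show ?thesis by (auto simp: GT_def intro!: sp_base)
      next
        assume "x \<in> insert z P"
        then show ?thesis by (intro sp_base') auto
      qed
    qed
    ultimately have "mon xs \<delta> * (c * mon xs \<alpha>) \<in> sp UNIV (GT xs \<beta> \<union> insert z P)"
      using sp_leastD[OF is_subring_UNIV] by blast
    then show "c \<in> L \<beta>" using \<alpha> \<delta> by (simp add: L_def mon_padd algebra_simps)
  qed
  have "\<exists>c. \<forall>\<alpha>. length \<alpha> = ?d \<longrightarrow> (\<exists>\<tau>. length \<tau> = ?d \<and> ple \<tau> \<alpha> \<and> sum_list \<tau> \<le> c \<and> L \<tau> = L \<alpha>)"
    by (rule acc_dickson[OF acc L L_mono])
  then obtain c where c: "\<forall>\<alpha>. length \<alpha> = ?d \<longrightarrow> (\<exists>\<tau>. length \<tau> = ?d \<and> ple \<tau> \<alpha> \<and> sum_list \<tau> \<le> c \<and> L \<tau> = L \<alpha>)" ..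
  show ?thesis
  proof (intro exI[of _ c] allI impI)
    fix k a assume za: "z * a \<in> sp UNIV (Qp xs (k + c) \<union> P)"
    let ?T = "sp UNIV ((*) z ` Qp xs k \<union> P)"
    let ?E = "expo ?d (k + c)"
    \<comment> \<open>A form of degree \<open>k + c\<close> lying in the ideal of \<open>z\<close>
      and \<open>P\<close> is shown to lie in \<open>z\<close> times the \<open>k\<close>-th power
      plus \<open>P\<close>, by removing its least monomial. Upward closure of \<open>B\<close>
      guarantees that the corrections use only monomials that are still available.\<close>
    have main: "\<forall>v. v \<in> sp UNIV (mon xs ` B) \<longrightarrow> v \<in> sp UNIV (insert z P) \<longrightarrow> v \<in> ?T"
      if "finite B" "B \<subseteq> ?E" "\<forall>b\<in>B. \<forall>\<gamma>\<in>?E. b < \<gamma> \<longrightarrow> \<gamma> \<in> B" for B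
      using that
    proof (induction B rule: finite_linorder_min_induct)
      case empty
      have "v \<in> sp UNIV {} \<Longrightarrow> v = 0" for v :: 'r by (auto elim: sp.cases)
      then show ?case by (auto intro: sp_zero)
    next
      case (insert b B)
      have up: "\<forall>b\<in>B. \<forall>\<gamma>\<in>?E. b < \<gamma> \<longrightarrow> \<gamma> \<in> B"
      proof (intro ballI impI)
        fix a \<gamma> assume "a \<in> B" "\<gamma> \<in> ?E" "a < \<gamma>"
        moreover from this have "b < \<gamma>" using insert.hyps(2) by (auto intro: less_trans)
        ultimately show "\<gamma> \<in> B" using insert.prems(2) by auto
      qed
      have BE: "B \<subseteq> ?E" using insert.prems by auto
      note IH = insert.IH[OF BE up]
      have bE: "b \<in> ?E" using insert.prems by auto
      then have lb: "length b = ?d" "sum_list b = k + c" by (auto simp: expo_def)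
      have B_GT: "mon xs ` B \<subseteq> GT xs b" using insert.prems insert.hyps lb by (auto simp: GT_def)
      have GT_B: "mon xs \<gamma> \<in> mon xs ` B" if "\<gamma> \<in> ?E" "b < \<gamma>" for \<gamma> using insert.prems(2) that by auto
      show ?case
      proof (intro allI impI)
        fix v assume v: "v \<in> sp UNIV (mon xs ` insert b B)" "v \<in> sp UNIV (insert z P)"
        obtain e where e: "v - e * mon xs b \<in> sp UNIV (mon xs ` B)"
          using sp_insertD[OF is_subring_UNIV, of v "mon xs b" "mon xs ` B"] v by auto
        have "v - e * mon xs b \<in> sp UNIV (GT xs b \<union> insert z P)"
          using e sp_mono[of "mon xs ` B" "GT xs b \<union> insert z P" UNIV UNIV] B_GT by blast
        moreover have "v \<in> sp UNIV (GT xs b \<union> insert z P)"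
          using v sp_mono[of "insert z P" "GT xs b \<union> insert z P" UNIV UNIV] by blast
        ultimately have "e \<in> L b" unfolding L_def using sp_diff[OF is_subring_UNIV, of v _ "v - e * mon xs b"] by simp
        \<comment> \<open>As \<open>b\<close> has degree \<open>k + c\<close> and
          \<open>\<tau>\<close> at most \<open>c\<close>, the cofactor \<open>\<delta>\<close> has
          degree at least \<open>k\<close>. The relation for \<open>\<tau>\<close> times
          \<open>x^\<delta>\<close> therefore involves \<open>z\<close> only with a factor from the
          \<open>k\<close>-th power.\<close>
        obtain \<tau> where \<tau>: "length \<tau> = ?d" "ple \<tau> b" "sum_list \<tau> \<le> c" "L \<tau> = L b" using c lb(1) by blast
        then obtain \<delta> where \<delta>: "length \<delta> = ?d" "b = padd \<delta> \<tau>" using ple_padd[OF \<tau>(2)] by auto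
        have "sum_list b = sum_list \<delta> + sum_list \<tau>" using \<delta> \<tau> by (simp add: sum_list_padd)
        then have s\<delta>: "k \<le> sum_list \<delta>" using lb \<tau> by simp
        have "e * mon xs \<tau> \<in> sp UNIV (GT xs \<tau> \<union> insert z P)" using \<open>e \<in> L b\<close> \<tau>(4) by (auto simp: L_def)
        from sp_UnD[OF this] obtain u where u: "u \<in> sp UNIV (GT xs \<tau>)" "e * mon xs \<tau> - u \<in> sp UNIV (insert z P)" by blast
        from sp_insertD[OF is_subring_UNIV u(2)] obtain r where r: "e * mon xs \<tau> - u - r * z \<in> P"
          using sp_is_ideal[OF Pi] by auto
        define p where "p = e * mon xs \<tau> - u - r * z"
        have eb: "e * mon xs b = mon xs \<delta> * u + mon xs \<delta> * (r * z + p)"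
          using \<delta> \<tau> by (simp add: p_def mon_padd algebra_simps)
        have "mon xs \<delta> * u \<in> sp UNIV ((*) (mon xs \<delta>) ` GT xs \<tau>)" by (intro sp_image u)
        moreover have "(*) (mon xs \<delta>) ` GT xs \<tau> \<subseteq> mon xs ` B"
        proof (intro image_subsetI)
          fix x assume "x \<in> GT xs \<tau>"
          then obtain \<gamma> where \<gamma>: "x = mon xs \<gamma>" "\<gamma> \<in> expo ?d (sum_list \<tau>)" "\<tau> < \<gamma>" by (auto simp: GT_def)
          then have "mon xs \<delta> * x = mon xs (padd \<delta> \<gamma>)" "padd \<delta> \<gamma> \<in> ?E" "b < padd \<delta> \<gamma>"
            using \<tau> \<delta> lb by (auto simp: expo_def mon_padd sum_list_padd intro: padd_less)
          then show "mon xs \<delta> * x \<in> mon xs ` B" using GT_B by simp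
        qed
        ultimately have "mon xs \<delta> * u \<in> sp UNIV (mon xs ` B)" using sp_mono[of _ "mon xs ` B" UNIV UNIV] by blast
        from sp_add[OF e this] have v': "v - mon xs \<delta> * (r * z + p) \<in> sp UNIV (mon xs ` B)" using eb by (simp add: algebra_simps)
        have p: "p \<in> P" using r by (simp add: p_def)
        have "(mon xs \<delta> * r) * z + mon xs \<delta> * p \<in> sp UNIV (insert z P)"
          using p by (intro sp_add sp_base') auto
        then have "v - mon xs \<delta> * (r * z + p) \<in> sp UNIV (insert z P)"
          using sp_diff[OF is_subring_UNIV v(2)] by (simp add: algebra_simps)
        then have 1: "v - mon xs \<delta> * (r * z + p) \<in> ?T" using IH v' by blast
        have "mon xs \<delta> \<in> Qp xs k" using mon_Qp[of \<delta> xs "sum_list \<delta>"] Qp_antimono[OF s\<delta>, of xs] \<delta> by (auto simp: expo_def)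
        then have "z * (mon xs \<delta> * r) \<in> (*) z ` Qp xs k" using is_idealD(4)[OF is_ideal_Qp] by blast
        then have "z * (mon xs \<delta> * r) \<in> ?T" by (intro sp_base) auto
        moreover have "mon xs \<delta> * p \<in> ?T" using p by (intro sp_base') auto
        ultimately have "z * (mon xs \<delta> * r) + mon xs \<delta> * p \<in> ?T" by (rule sp_add)
        from sp_add[OF 1 this] show "v \<in> ?T" by (simp add: algebra_simps)
      qed
    qed
    from sp_UnD[OF za] obtain v where v: "v \<in> Qp xs (k + c)" "z * a - v \<in> P"
      using sp_is_ideal[OF is_ideal_Qp] sp_is_ideal[OF Pi] by auto
    have "z * a - (z * a - v) \<in> sp UNIV (insert z P)"
    proof (rule sp_diff[OF is_subring_UNIV])
      show "z * a \<in> sp UNIV (insert z P)" using sp_base'[OF is_subring_UNIV, of z "insert z P" a] by (simp add: mult.commute)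
    qed (use v in \<open>auto intro: sp_base\<close>)
    then have "v \<in> sp UNIV (insert z P)" by simp
    moreover have "v \<in> sp UNIV (mon xs ` ?E)" using v by (simp add: Qp_def)
    ultimately have "v \<in> ?T" using main[of ?E] by auto
    from sp_UnD[OF this] obtain u where u: "u \<in> sp UNIV ((*) z ` Qp xs k)" "v - u \<in> P" using sp_is_ideal[OF Pi] by auto
    obtain q where q: "q \<in> Qp xs k" "u = z * q" using sp_factor[OF u(1), of z "Qp xs k"] sp_is_ideal[OF is_ideal_Qp] by auto
    have "(z * a - v) + (v - u) \<in> P" using u v is_idealD[OF Pi] by blast
    then have "z * (a - q) \<in> P" using q by (simp add: algebra_simps)
    then have "a - q \<in> P" using P is_primeD(3) by blast
    then show "a \<in> sp UNIV (Qp xs k \<union> P)" using q by (intro sp_UnI[of _ q]) (auto intro: sp_base)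
  qed
qed

text \<open>Two counts modulo \<open>Qp xs k\<close> and \<open>P 0\<close>, with \<open>k\<close>
  linear in \<open>N\<close>: elements chosen between consecutive primes give \<open>N ^ d\<close>
  independent monomials, whereas a unit form in \<open>P 0\<close> bounds the colength by a multiple
  of \<open>k ^ (d - 1)\<close>.\<close>

theorem FF_disjoint_chain:
  assumes P: "pchain K P (length xs)" and \<mu>: "length \<mu> = length xs"
  shows "FF m xs \<mu> \<inter> P 0 = {}"
proof (rule ccontr)
  let ?d = "length xs"
  assume "FF m xs \<mu> \<inter> P 0 \<noteq> {}"
  then obtain f where f: "f \<in> FF m xs \<mu>" "f \<in> P 0" by blast
  have prime: "is_prime (P i)" if "i \<le> ?d" for i using P that by (simp add: pchain_def)
  then have ideal: "is_ideal (P i)" if "i \<le> ?d" for i using that is_primeD by blast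
  have sub: "P i \<subset> P (Suc i)" if "i < ?d" for i using P that by (simp add: pchain_def)
  have KP0: "K \<subseteq> P 0" using P by (simp add: pchain_def)
  have KP: "K \<subseteq> P i" if "i \<le> ?d" for i using that
  proof (induction i)
    case (Suc i)
    then show ?case using sub[of i] by auto
  qed (use KP0 in auto)
  obtain l where l: "clen m UNIV (set xs \<union> K) l" using finite_colength_gen[of K] by auto
  define zf where "zf i = (SOME z. z \<in> P (Suc i) \<and> z \<notin> P i)" for i
  have zf: "zf i \<in> P (Suc i) \<and> zf i \<notin> P i" if "i < ?d" for i
  proof -
    have "\<exists>z. z \<in> P (Suc i) \<and> z \<notin> P i" using sub[OF that] by blast
    then show ?thesis unfolding zf_def by (rule someI_ex)
  qed
  define zs where "zs = map zf [0..<?d]"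
  have lz: "length zs = ?d" and zs: "zs ! i = zf i" if "i < ?d" for i using that by (auto simp: zs_def)
  have lz: "length zs = ?d" by (simp add: zs_def)
  define cf where "cf i = (SOME c. \<forall>k a. zf i * a \<in> sp UNIV (Qp xs (k + c) \<union> P i) \<longrightarrow> a \<in> sp UNIV (Qp xs k \<union> P i))" for i
  have cf: "a \<in> sp UNIV (Qp xs k \<union> P i)" if "i < ?d" "zf i * a \<in> sp UNIV (Qp xs (k + cf i) \<union> P i)" for i k a
  proof -
    have "\<exists>c. \<forall>k a. zf i * a \<in> sp UNIV (Qp xs (k + c) \<union> P i) \<longrightarrow> a \<in> sp UNIV (Qp xs k \<union> P i)"
      using colon_bound[OF prime KP, of i "zf i"] zf that by simp
    from someI_ex[OF this] show ?thesis using that(2) unfolding cf_def[symmetric] by blast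
  qed
  \<comment> \<open>A single constant that dominates the losses for all members of the chain, as
    \<open>lex_independent\<close> requires.\<close>
  define c where "c = (\<Sum>i<?d. cf i)"
  have colon: "a \<in> sp UNIV (Qp xs k \<union> P i)" if "i < ?d" "zf i * a \<in> sp UNIV (Qp xs (k + c) \<union> P i)" for i k a
  proof -
    have "cf i \<le> c" unfolding c_def using that by (intro member_le_sum) auto
    then have "Qp xs (k + c) \<subseteq> Qp xs (k + cf i)" by (intro Qp_antimono) simp
    then have "sp UNIV (Qp xs (k + c) \<union> P i) \<subseteq> sp UNIV (Qp xs (k + cf i) \<union> P i)" by (intro sp_mono) auto
    then show ?thesis using cf that by blast
  qed
  have fin: "1 \<notin> sp UNIV (Qp xs k \<union> P ?d)" if "k > 0" for k
  proof -
    have "P ?d \<subseteq> m" using ideal_sub_m[OF ideal KP] prime is_primeD(2) by blast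
    moreover have "Qp xs k \<subseteq> m"
    proof -
      have "Qp xs k \<subseteq> sp UNIV (MQ m xs 0)" using MQ_antimono[OF xs_m, of 0 k] that by simp
      also have "\<dots> \<subseteq> m" by (rule sp_ideal_subset[OF idm]) (auto simp: MQ_def intro: is_idealD(4)[OF idm])
      finally show ?thesis .
    qed
    ultimately show ?thesis using sp_ideal_subset[OF idm, of "Qp xs k \<union> P ?d" UNIV] one_m by auto
  qed
  show False
  proof (rule poly_growth[of ?d "l * sum_list \<mu>" "c * ?d"])
    show "l * sum_list \<mu> = 0" if "?d = 0" using \<mu> that by simp
    fix N :: nat assume "N \<ge> 1"
    \<comment> \<open>Exponents in the box have degree at most \<open>d N\<close>, and every factor
      costs \<open>c\<close> steps; the additional \<open>1\<close> leaves a positive step at the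
      end, where \<open>fin\<close> applies.\<close>
    define k where "k = c * ?d * N + 1"
    let ?I = "sp UNIV (Qp xs k \<union> P 0)"
    obtain gs where gs: "length gs \<le> l * card {\<alpha> \<in> box ?d k. \<not> ple \<mu> \<alpha>}"
      "UNIV \<subseteq> sp UNIV (set gs \<union> (Qp xs k \<union> P 0))" "simple UNIV m (Qp xs k \<union> P 0) gs"
      using FF_growth[OF ideal KP0 f \<mu> l, of k] by (auto simp: clen_def)
    have "card (box ?d N) \<le> length gs"
    proof (rule indep_bound[OF is_subring_UNIV is_ideal_sp])
      show "\<exists>b\<in>UNIV. a * b - 1 \<in> ?I" if "a \<notin> m" for a
        using KP0 by (intro unit_sp[OF that]) auto
      show "simple UNIV m ?I gs" using gs(3) by (rule simple_mono) (auto intro!: sp_base)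
      show "mon zs i \<in> sp UNIV (set gs \<union> ?I)" for i
      proof -
        have "sp UNIV (set gs \<union> (Qp xs k \<union> P 0)) \<subseteq> sp UNIV (set gs \<union> ?I)"
          by (rule sp_mono) (auto intro: sp_base)
        then show ?thesis using gs(2) by blast
      qed
      show "mon zs \<beta> \<notin> sp UNIV (mon zs ` {j \<in> box ?d N. \<beta> < j} \<union> ?I)" if \<beta>: "\<beta> \<in> box ?d N" for \<beta>
      proof -
        have "c * sum_list \<beta> \<le> c * (?d * N)" using box_sum_le[OF \<beta>] by (rule mult_left_mono) simp
        then have "c * sum_list \<beta> < k" unfolding k_def mult.assoc by linarith
        then have k: "(k - c * sum_list \<beta>) + c * sum_list \<beta> = k" "k - c * sum_list \<beta> > 0" by linarith+
        have "mon zs \<beta> \<notin> sp UNIV (mon zs ` {\<gamma>. length \<gamma> = length zs \<and> \<beta> < \<gamma>} \<union> (Qp xs ((k - c * sum_list \<beta>) + c * sum_list \<beta>) \<union> P 0))"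
        proof (rule lex_independent)
          show "P i \<subseteq> P (Suc i)" if "i < length zs" for i using sub[of i] that lz by auto
          show "a \<in> sp UNIV (Qp xs k \<union> P i)" if "i < length zs" "zs ! i * a \<in> sp UNIV (Qp xs (k + c) \<union> P i)" for i k a
            using colon that zs lz by simp
          show "1 \<notin> sp UNIV (Qp xs k \<union> P (length zs))" if "0 < k" for k using fin[OF that] lz by simp
        qed (use ideal lz zs zf k \<beta> in \<open>auto simp: box_def\<close>)
        moreover have "sp UNIV (mon zs ` {j \<in> box ?d N. \<beta> < j} \<union> ?I)
            \<subseteq> sp UNIV (mon zs ` {\<gamma>. length \<gamma> = length zs \<and> \<beta> < \<gamma>} \<union> (Qp xs k \<union> P 0))"
          by (rule sp_cover[where H = "Qp xs k \<union> P 0"]) (auto simp: lz box_def intro: sp_base)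
        ultimately show ?thesis unfolding k(1) by blast
      qed
    qed simp
    also note gs(1)
    also have "l * card {\<alpha> \<in> box ?d k. \<not> ple \<mu> \<alpha>} \<le> l * (sum_list \<mu> * k ^ (?d - 1))"
      using mult_le_mono2[OF card_not_ple[of \<mu> k], of l] unfolding \<mu> .
    finally show "N ^ ?d \<le> l * sum_list \<mu> * (c * ?d * N + 1) ^ (?d - 1)" by (simp add: k_def mult.assoc)
  qed
qed

text \<open>If \<open>I\<close> contains no unit form, the box monomials are independent modulo
  \<open>I\<close> and the powers \<open>x^k\<close>, since a dependence would be a unit form in
  \<open>I\<close>. Their number \<open>N ^ d\<close> contradicts the bound of
  \<open>clen_sing\<close> for a singular element in \<open>I\<close>.\<close>

theorem sing_disjoint:
  assumes I: "is_ideal I" "K \<subseteq> I" and FF: "\<And>\<mu>. length \<mu> = length xs \<Longrightarrow> FF m xs \<mu> \<inter> I = {}"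
  shows "sing xs \<inter> I = {}"
proof (rule ccontr)
  let ?d = "length xs"
  assume "sing xs \<inter> I \<noteq> {}"
  then obtain s where s: "s \<in> sing xs" "s \<in> I" by blast
  obtain l where l: "clen m UNIV (set xs \<union> I) l" using finite_colength_gen[OF I(2)] ..
  obtain C where C: "\<And>k. k \<ge> 1 \<Longrightarrow> \<exists>n. clen m UNIV ((\<lambda>y. y ^ k) ` set xs \<union> I) n \<and> n * k \<le> C * k ^ ?d"
    using clen_sing[OF s I(1) l] by blast
  \<comment> \<open>The two counts reduce to \<open>k \<le> C * (d + 1) ^ d\<close>, which this
    \<open>N\<close> violates. The factor \<open>d + 1\<close> in \<open>k\<close> puts the powers
    \<open>x^k\<close> beyond the degree, at most \<open>d N\<close>, of every exponent in the
    box.\<close>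
  define N where "N = C * (?d + 1) ^ ?d + 1"
  define k where "k = (?d + 1) * N"
  have k1: "k \<ge> 1" by (simp add: k_def N_def)
  let ?G = "(\<lambda>y. y ^ k) ` set xs \<union> I"
  let ?I = "sp UNIV ?G"
  obtain n where n: "clen m UNIV ?G n" "n * k \<le> C * k ^ ?d" using C[OF k1] by blast
  then obtain gs where gs: "length gs \<le> n" "UNIV \<subseteq> sp UNIV (set gs \<union> ?G)" "simple UNIV m ?G gs" by (auto simp: clen_def)
  have xk: "x ^ j \<in> Qp xs j" if "x \<in> set xs" for x j
    by (induction j) (auto simp: Qp_0 intro: Qp_xs that)
  \<comment> \<open>Prefixing the degree makes the order of lists compare degrees first, so that all
    later monomials are of higher degree or larger in the same degree.\<close>
  let ?E = "(\<lambda>\<alpha>. sum_list \<alpha> # \<alpha>) ` box ?d N"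
  have "card ?E \<le> length gs"
  proof (rule indep_bound[OF is_subring_UNIV is_ideal_sp])
    show "\<exists>b\<in>UNIV. a * b - 1 \<in> ?I" if "a \<notin> m" for a
      using I(2) by (intro unit_sp[OF that]) auto
    show "simple UNIV m ?I gs" using gs(3) by (rule simple_mono) (auto intro!: sp_base)
    show "mon xs (tl i) \<in> sp UNIV (set gs \<union> ?I)" for i
    proof -
      have "sp UNIV (set gs \<union> ?G) \<subseteq> sp UNIV (set gs \<union> ?I)"
        by (rule sp_mono) (auto intro: sp_base)
      then show ?thesis using gs(2) by blast
    qed
    show "mon xs (tl i) \<notin> sp UNIV ((\<lambda>i. mon xs (tl i)) ` {j \<in> ?E. i < j} \<union> ?I)" if i: "i \<in> ?E" for i
    proof
      assume h: "mon xs (tl i) \<in> sp UNIV ((\<lambda>i. mon xs (tl i)) ` {j \<in> ?E. i < j} \<union> ?I)"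
      obtain \<alpha> where \<alpha>: "i = sum_list \<alpha> # \<alpha>" "\<alpha> \<in> box ?d N" using i by blast
      have la: "length \<alpha> = ?d" using \<alpha> by (simp add: box_def)
      have sk: "sum_list \<alpha> < k" using box_sum_le[OF \<alpha>(2)] by (simp add: k_def N_def)
      let ?X = "GT xs \<alpha> \<union> MQ m xs (sum_list \<alpha>)"
      let ?T = "sp UNIV (?X \<union> I)"
      have MQT: "sp UNIV (MQ m xs (sum_list \<alpha>)) \<subseteq> ?T" by (rule sp_mono) auto
      have "(\<lambda>i. mon xs (tl i)) ` {j \<in> ?E. i < j} \<subseteq> ?T"
      proof clarify
        fix \<gamma> assume \<gamma>: "\<gamma> \<in> box ?d N" "i < sum_list \<gamma> # \<gamma>"
        have lg: "length \<gamma> = ?d" using \<gamma> by (simp add: box_def)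
        have "sum_list \<alpha> < sum_list \<gamma> \<or> (sum_list \<alpha> = sum_list \<gamma> \<and> \<alpha> < \<gamma>)" using \<gamma> \<alpha> by auto
        then show "mon xs (tl (sum_list \<gamma> # \<gamma>)) \<in> ?T"
        proof (elim disjE conjE)
          assume "sum_list \<alpha> < sum_list \<gamma>"
          then have "Qp xs (sum_list \<gamma>) \<subseteq> ?T" using MQ_antimono[OF xs_m] MQT by blast
          then show ?thesis using mon_Qp[of \<gamma> xs "sum_list \<gamma>"] lg by (auto simp: expo_def)
        next
          assume "sum_list \<alpha> = sum_list \<gamma>" "\<alpha> < \<gamma>"
          then show ?thesis using lg by (auto intro!: sp_base simp: GT_def expo_def)
        qed
      qed
      moreover have "?I \<subseteq> ?T"
      proof (rule sp_least[OF is_subring_UNIV])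
        have "x ^ k \<in> ?T" if "x \<in> set xs" for x
          using xk[OF that] MQ_antimono[OF xs_m sk] MQT by blast
        then show "?G \<subseteq> ?T" by (auto intro: sp_base)
      qed
      ultimately have "mon xs \<alpha> \<in> ?T" using sp_leastD[OF is_subring_UNIV h, of "?X \<union> I"] \<alpha> by auto
      from sp_UnD[OF this] obtain u where u: "u \<in> sp UNIV ?X" "mon xs \<alpha> - u \<in> I" using sp_is_ideal[OF I(1)] by auto
      \<comment> \<open>All terms other than \<open>mon xs \<alpha>\<close> are admissible errors in
        the definition of \<open>FF\<close>, so the part of the dependence lying in \<open>I\<close>
        is itself a unit form.\<close>
      have "(mon xs \<alpha> - u) - mon xs \<alpha> \<in> sp UNIV ?X" using sp_uminus[OF is_subring_UNIV u(1)] by simp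
      then have "mon xs \<alpha> - u \<in> FF m xs \<alpha>" by (simp add: FF_def)
      then show False using FF[OF la] u(2) by blast
    qed
  qed simp
  then have "N ^ ?d \<le> n" using gs(1) by (simp add: card_image inj_on_def)
  then have "N ^ ?d * k \<le> C * k ^ ?d" using n(2) by (meson le_trans mult_le_mono1)
  also have "\<dots> = N ^ ?d * (C * (?d + 1) ^ ?d)" by (simp only: k_def power_mult_distrib) (simp only: mult.commute mult.left_commute)
  finally have "k \<le> C * (?d + 1) ^ ?d" by (simp only: mult_le_cancel1) (simp add: N_def)
  then show False by (simp add: k_def N_def)
qed

corollary chain_of_FF_disjoint:
  assumes "is_ideal I" "K \<subseteq> I" "\<And>\<mu>. length \<mu> = length xs \<Longrightarrow> FF m xs \<mu> \<inter> I = {}"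
  shows "\<exists>P. pchain I P (length xs)"
  using chain_of_sing_disjoint[OF assms(1) sing_disjoint[OF assms]] .

end

section \<open>Graded rings generated in degree one\<close>

text \<open>The filtration by degree at most \<open>M\<close>. Exact degrees would not do: the prime
  in the place of \<open>I\<close> and the elements chosen between consecutive primes need not be
  homogeneous.\<close>

definition Vp :: "'r::comm_ring_1 set \<Rightarrow> 'r list \<Rightarrow> 'r set \<Rightarrow> nat \<Rightarrow> 'r set" where
  "Vp A ts I M = sp A (mon ts ` {\<alpha>. length \<alpha> = length ts \<and> sum_list \<alpha> \<le> M} \<union> I)"

lemma Vp_mono: "M \<le> N \<Longrightarrow> Vp A ts I M \<subseteq> Vp A ts I N"
  unfolding Vp_def by (intro sp_mono) auto

lemma Vp_mult:
  assumes A: "is_subring A" and I: "is_ideal I" and a: "a \<in> Vp A ts I M" and b: "b \<in> Vp A ts I N"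
  shows "a * b \<in> Vp A ts I (M + N)"
  unfolding Vp_def
proof (rule sp_prod[OF A a[unfolded Vp_def] b[unfolded Vp_def]])
  fix x y assume x: "x \<in> mon ts ` {\<alpha>. length \<alpha> = length ts \<and> sum_list \<alpha> \<le> M} \<union> I"
    and y: "y \<in> mon ts ` {\<alpha>. length \<alpha> = length ts \<and> sum_list \<alpha> \<le> N} \<union> I"
  show "x * y \<in> sp A (mon ts ` {\<alpha>. length \<alpha> = length ts \<and> sum_list \<alpha> \<le> M + N} \<union> I)"
  proof (cases "x \<in> I \<or> y \<in> I")
    case True
    then have "x * y \<in> I" using is_idealD[OF I] by auto
    then show ?thesis by (intro sp_base[OF A]) auto
  next
    case False
    then obtain \<alpha> \<beta> where ab: "x = mon ts \<alpha>" "length \<alpha> = length ts" "sum_list \<alpha> \<le> M"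
      "y = mon ts \<beta>" "length \<beta> = length ts" "sum_list \<beta> \<le> N" using x y by auto
    have "x * y = mon ts (padd \<alpha> \<beta>)" "length (padd \<alpha> \<beta>) = length ts" "sum_list (padd \<alpha> \<beta>) \<le> M + N"
      using ab by (auto simp: mon_padd sum_list_padd)
    then show ?thesis by (intro sp_base[OF A]) auto
  qed
qed

lemma Vp_one: "is_subring A \<Longrightarrow> 1 \<in> Vp A ts I 0"
  unfolding Vp_def by (intro sp_base UnI1 image_eqI[of _ _ "replicate (length ts) 0"]) auto

lemma Vp_mon:
  assumes A: "is_subring A" and I: "is_ideal I" and zs: "\<And>z. z \<in> set zs \<Longrightarrow> z \<in> Vp A ts I D"
  shows "length \<beta> = length zs \<Longrightarrow> mon zs \<beta> \<in> Vp A ts I (D * sum_list \<beta>)"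
  using zs
proof (induction zs arbitrary: \<beta>)
  case Nil
  then show ?case using Vp_one[OF A] by auto
next
  case (Cons z zs)
  then obtain b \<beta>' where \<beta>: "\<beta> = b # \<beta>'" "length \<beta>' = length zs" by (cases \<beta>) auto
  have "z ^ b \<in> Vp A ts I (D * b)"
  proof (induction b)
    case (Suc b)
    from Vp_mult[OF A I _ this, of z D] show ?case using Cons.prems(2)[of z] by simp
  qed (use Vp_one[OF A] in auto)
  from Vp_mult[OF A I this Cons.IH[OF \<beta>(2)]] show ?case using \<beta> Cons.prems by (simp add: algebra_simps)
qed

text \<open>
  Here \<open>A\<close> is the degree zero part of a graded ring, local modulo the prime \<open>P 0\<close>; a chain of
  primes starting at \<open>P 0\<close> cannot be longer than the growth of the number of monomials spanning
  the ring modulo \<open>P 0\<close>.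
\<close>

lemma chain_length_bound:
  fixes P :: "nat \<Rightarrow> 'r::comm_ring_1 set"
  assumes A: "is_subring A" and P: "pchain {} P n" and m: "A \<inter> m \<subseteq> P 0"
    and u: "\<And>a. a \<in> A \<Longrightarrow> a \<notin> m \<Longrightarrow> \<exists>b\<in>A. a * b - 1 \<in> P 0"
    and gen: "\<And>z. \<exists>M. z \<in> Vp A ts (P 0) M"
    and S: "\<And>M. finite (S M)" "\<And>M. Vp A ts (P 0) M \<subseteq> sp A (mon ts ` S M \<union> P 0)"
  shows "\<exists>D. \<forall>N\<ge>1. N ^ n \<le> card (S (D * N))"
proof -
  have prime: "is_prime (P i)" if "i \<le> n" for i using P that by (simp add: pchain_def)
  then have ideal: "is_ideal (P i)" if "i \<le> n" for i using that is_primeD by blast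
  have sub: "P i \<subset> P (Suc i)" if "i < n" for i using P that by (simp add: pchain_def)
  define zf where "zf i = (SOME z. z \<in> P (Suc i) \<and> z \<notin> P i)" for i
  have zf: "zf i \<in> P (Suc i) \<and> zf i \<notin> P i" if "i < n" for i
  proof -
    have "\<exists>z. z \<in> P (Suc i) \<and> z \<notin> P i" using sub[OF that] by blast
    then show ?thesis unfolding zf_def by (rule someI_ex)
  qed
  define zs where "zs = map zf [0..<n]"
  have lz: "length zs = n" and zs: "zs ! i = zf i" if "i < n" for i using that by (auto simp: zs_def)
  have lz: "length zs = n" by (simp add: zs_def)
  define Mf where "Mf z = (SOME M. z \<in> Vp A ts (P 0) M)" for z
  have Mf: "z \<in> Vp A ts (P 0) (Mf z)" for z unfolding Mf_def using gen[of z] by (rule someI_ex)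
  define D where "D = (\<Sum>z\<in>set zs. Mf z)"
  have zD: "z \<in> Vp A ts (P 0) D" if "z \<in> set zs" for z
  proof -
    have "Mf z \<le> D" unfolding D_def using that by (intro member_le_sum) auto
    then show ?thesis using Mf Vp_mono by blast
  qed
  have "N ^ n \<le> card (S (D * n * N))" if "N \<ge> 1" for N
  proof -
    let ?M = "D * n * N"
    obtain gs where gs: "set gs = mon ts ` S ?M" "length gs \<le> card (S ?M)"
    proof -
      obtain ss where ss: "set ss = S ?M" "distinct ss" using finite_distinct_list[OF S(1)] by blast
      show ?thesis using that[of "map (mon ts) ss"] ss distinct_card[of ss] by auto
    qed
    \<comment> \<open>Modulo \<open>P 0\<close> the coefficients form a field, because
      \<open>A \<inter> m\<close> lies in \<open>P 0\<close>; so every list is a filtration of the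
      required kind.\<close>
    have simple: "simple A m (P 0) hs" for hs
    proof (induction hs)
      case (Cons h hs)
      have "a * h \<in> sp A (set hs \<union> P 0)" if "a \<in> A \<inter> m" for a
        using that m is_idealD(4)[OF ideal[of 0]] by (intro sp_base[OF A]) auto
      then show ?case using Cons by auto
    qed simp
    have "card (box n N) \<le> length gs"
    proof (rule indep_bound[OF A ideal[of 0] u simple])
      show "mon zs i \<in> sp A (set gs \<union> P 0)" if i: "i \<in> box n N" for i
      proof -
        have "mon zs i \<in> Vp A ts (P 0) (D * sum_list i)"
          using Vp_mon[OF A ideal[of 0] zD] i lz by (simp add: box_def)
        moreover have "D * sum_list i \<le> ?M" using box_sum_le[OF i] by (simp add: mult.assoc)
        ultimately have "mon zs i \<in> Vp A ts (P 0) ?M" using subsetD[OF Vp_mono] by blast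
        then show ?thesis using subsetD[OF S(2)] unfolding gs(1) by simp
      qed
      show "mon zs \<beta> \<notin> sp A (mon zs ` {j \<in> box n N. \<beta> < j} \<union> P 0)" if \<beta>: "\<beta> \<in> box n N" for \<beta>
      proof -
        \<comment> \<open>Cancellation modulo a prime is exact, so the filtration is taken to be
          empty and the loss \<open>c\<close> to be zero.\<close>
        have "mon zs \<beta> \<notin> sp UNIV (mon zs ` {\<gamma>. length \<gamma> = length zs \<and> \<beta> < \<gamma>} \<union> ((\<lambda>_. {}) (1 + 0 * sum_list \<beta>) \<union> P 0))"
        proof (rule lex_independent[where c = 0 and Qf = "\<lambda>_. {}"])
          show "P i \<subseteq> P (Suc i)" if "i < length zs" for i using sub[of i] that lz by auto
          show "a \<in> sp UNIV ({} \<union> P i)" if "i < length zs" "zs ! i * a \<in> sp UNIV ({} \<union> P i)" for i k a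
            using that zf[of i] lz zs[of i] is_primeD(3)[OF prime, of i "zf i" a] sp_is_ideal[OF ideal, of i] by simp
          show "1 \<notin> sp UNIV ({} \<union> P (length zs))" for k
            using is_primeD(2)[OF prime, of n] sp_is_ideal[OF ideal, of n] lz by simp
        qed (use ideal lz zs zf \<beta> in \<open>auto simp: box_def\<close>)
        moreover have "sp A (mon zs ` {j \<in> box n N. \<beta> < j} \<union> P 0) \<subseteq> sp UNIV (mon zs ` {\<gamma>. length \<gamma> = length zs \<and> \<beta> < \<gamma>} \<union> P 0)"
          by (rule sp_mono) (auto simp: lz box_def)
        ultimately show ?thesis by auto
      qed
    qed auto
    then show ?thesis using gs(2) by simp
  qed
  then show ?thesis by (intro exI[of _ "D * n"]) auto
qed

locale graded_like =
  fixes A m :: "'r::comm_ring_1 set" and ts :: "'r list" and P :: "nat \<Rightarrow> 'r set" and n :: nat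
  assumes A: "is_subring A" and P: "pchain {} P n" and m: "A \<inter> m \<subseteq> P 0"
    and u: "\<And>a. a \<in> A \<Longrightarrow> a \<notin> m \<Longrightarrow> \<exists>b\<in>A. a * b - 1 \<in> P 0"
    and gen: "\<And>z. \<exists>M. z \<in> Vp A ts (P 0) M"
begin

lemma finite_sum_le: "finite {\<alpha> :: nat list. length \<alpha> = d \<and> sum_list \<alpha> \<le> M \<and> Q \<alpha>}"
  by (rule finite_subset[OF _ finite_box[of d "Suc M"]])
    (auto simp: box_def le_imp_less_Suc dest: member_le_sum_list)

text \<open>With \<open>d\<close> variables there are only \<open>O(N^d)\<close> monomials of degree
  at most \<open>D N\<close>, against the \<open>N^n\<close> forced by a chain of length
  \<open>n\<close>.\<close>

lemma chain_le: "n \<le> length ts"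
proof (rule ccontr)
  assume "\<not> ?thesis"
  then have n: "n \<ge> Suc (length ts)" by simp
  let ?S = "\<lambda>M. {\<alpha>. length \<alpha> = length ts \<and> sum_list \<alpha> \<le> M \<and> True}"
  have "\<exists>D. \<forall>N\<ge>1. N ^ n \<le> card (?S (D * N))"
  proof (rule chain_length_bound[OF A P m u gen finite_sum_le])
    show "Vp A ts (P 0) M \<subseteq> sp A (mon ts ` ?S M \<union> P 0)" for M by (simp add: Vp_def)
  qed
  then obtain D where D: "\<forall>N\<ge>1. N ^ n \<le> card (?S (D * N))" ..
  show False
  proof (rule poly_growth[of "Suc (length ts)" 1 D])
    fix N :: nat assume N: "N \<ge> 1"
    have "N ^ Suc (length ts) \<le> N ^ n" using N n by (intro power_increasing) auto
    also have "\<dots> \<le> card (?S (D * N))" using D N by blast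
    also have "\<dots> \<le> card (box (length ts) (Suc (D * N)))"
      by (rule card_mono[OF finite_box]) (auto simp: box_def le_imp_less_Suc dest: member_le_sum_list)
    finally show "N ^ Suc (length ts) \<le> 1 * (D * N + 1) ^ (Suc (length ts) - 1)" by simp
  qed simp
qed

lemma leading_form_disjoint:
  assumes \<mu>: "length \<mu> = length ts" and n: "n = length ts"
  shows "mon ts \<mu> \<notin> sp A (GT ts \<mu> \<union> P 0)"
proof
  assume h: "mon ts \<mu> \<in> sp A (GT ts \<mu> \<union> P 0)"
  have P0: "is_ideal (P 0)" using P by (auto simp: pchain_def is_prime_def)
  let ?S = "\<lambda>M. {\<alpha>. length \<alpha> = length ts \<and> sum_list \<alpha> \<le> M \<and> \<not> ple \<mu> \<alpha>}"
  have red: "Vp A ts (P 0) M \<subseteq> sp A (mon ts ` ?S M \<union> P 0)" for M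
    unfolding Vp_def
  proof (rule sp_least[OF A], rule Un_least)
    show "P 0 \<subseteq> sp A (mon ts ` ?S M \<union> P 0)" by (auto intro: sp_base[OF A])
    show "mon ts ` {\<alpha>. length \<alpha> = length ts \<and> sum_list \<alpha> \<le> M} \<subseteq> sp A (mon ts ` ?S M \<union> P 0)"
    proof clarify
      fix \<alpha> :: "nat list" assume \<alpha>: "length \<alpha> = length ts" "sum_list \<alpha> \<le> M"
      have "mon ts \<alpha> \<in> sp A (mon ts ` {\<alpha>' \<in> expo (length ts) (sum_list \<alpha>). \<not> ple \<mu> \<alpha>'} \<union> P 0)"
        using is_idealD(3)[OF P0] \<alpha>(1)
        by (intro reduce_mon[OF A \<mu> h]) (auto intro: sp_base[OF A] simp: expo_def)
      also have "\<dots> \<subseteq> sp A (mon ts ` ?S M \<union> P 0)" using \<alpha> by (intro sp_mono) (auto simp: expo_def)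
      finally show "mon ts \<alpha> \<in> sp A (mon ts ` ?S M \<union> P 0)" .
    qed
  qed
  have "\<exists>D. \<forall>N\<ge>1. N ^ n \<le> card (?S (D * N))"
    by (rule chain_length_bound[OF A P m u gen finite_sum_le red])
  then obtain D where D: "\<forall>N\<ge>1. N ^ n \<le> card (?S (D * N))" ..
  show False
  proof (rule poly_growth[of "length ts" "sum_list \<mu>" D])
    show "length ts = 0 \<Longrightarrow> sum_list \<mu> = 0" using \<mu> by simp
    fix N :: nat assume N: "N \<ge> 1"
    have "N ^ length ts \<le> card (?S (D * N))" using D N n by blast
    also have "\<dots> \<le> card {\<alpha> \<in> box (length \<mu>) (Suc (D * N)). \<not> ple \<mu> \<alpha>}"
    proof (rule card_mono)
      show "finite {\<alpha> \<in> box (length \<mu>) (Suc (D * N)). \<not> ple \<mu> \<alpha>}" by simp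
    qed (use \<mu> in \<open>auto simp: box_def le_imp_less_Suc dest: member_le_sum_list\<close>)
    also have "\<dots> \<le> sum_list \<mu> * Suc (D * N) ^ (length \<mu> - 1)" by (rule card_not_ple)
    finally show "N ^ length ts \<le> sum_list \<mu> * (D * N + 1) ^ (length ts - 1)" using \<mu> by simp
  qed
qed

end

section \<open>Transfer to rings with explicit carriers\<close>

text \<open>
  Ideals of a commutative ring with explicit carrier are studied through their preimages in the
  free commutative ring \<open>'a fcr\<close>, a type of class \<^class>\<open>comm_ring_1\<close>.
\<close>

datatype 'a rexp = Rgen 'a | Rzero | Rone | Rplus "'a rexp" "'a rexp" | Rtimes "'a rexp" "'a rexp" | Rneg "'a rexp"

inductive req :: "'a rexp \<Rightarrow> 'a rexp \<Rightarrow> bool" where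
  "req x x"
| "req x y \<Longrightarrow> req y x"
| "req x y \<Longrightarrow> req y z \<Longrightarrow> req x z"
| "req x x' \<Longrightarrow> req y y' \<Longrightarrow> req (Rplus x y) (Rplus x' y')"
| "req x x' \<Longrightarrow> req y y' \<Longrightarrow> req (Rtimes x y) (Rtimes x' y')"
| "req x x' \<Longrightarrow> req (Rneg x) (Rneg x')"
| "req (Rplus (Rplus x y) z) (Rplus x (Rplus y z))"
| "req (Rplus x y) (Rplus y x)"
| "req (Rplus Rzero x) x"
| "req (Rplus (Rneg x) x) Rzero"
| "req (Rtimes (Rtimes x y) z) (Rtimes x (Rtimes y z))"
| "req (Rtimes x y) (Rtimes y x)"
| "req (Rtimes Rone x) x"
| "req (Rtimes (Rplus x y) z) (Rplus (Rtimes x z) (Rtimes y z))"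

quotient_type 'a fcr = "'a rexp" / req
proof (rule equivpI)
  show "reflp req" by (auto simp: reflp_def intro: req.intros)
  show "symp req" by (auto simp: symp_def intro: req.intros)
  show "transp req" by (auto simp: transp_def intro: req.intros(3))
qed

text \<open>Generators outside the carrier are sent to zero, so evaluation is total and always lands
  in the carrier.\<close>

primrec rexp_ev :: "('a, 'm) ring_scheme \<Rightarrow> 'a rexp \<Rightarrow> 'a" where
  "rexp_ev A (Rgen a) = (if a \<in> carrier A then a else \<zero>\<^bsub>A\<^esub>)"
| "rexp_ev A Rzero = \<zero>\<^bsub>A\<^esub>"
| "rexp_ev A Rone = \<one>\<^bsub>A\<^esub>"
| "rexp_ev A (Rplus x y) = rexp_ev A x \<oplus>\<^bsub>A\<^esub> rexp_ev A y"
| "rexp_ev A (Rtimes x y) = rexp_ev A x \<otimes>\<^bsub>A\<^esub> rexp_ev A y"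
| "rexp_ev A (Rneg x) = \<ominus>\<^bsub>A\<^esub> rexp_ev A x"

lemma rexp_ev_closed: "cring A \<Longrightarrow> rexp_ev A x \<in> carrier A"
proof (induction x)
qed (simp_all add: cring_def ring.ring_simprules)

lemma rexp_ev_cong: "req x y \<Longrightarrow> cring A \<Longrightarrow> rexp_ev A x = rexp_ev A y"
  by (induction rule: req.induct) (simp_all add: rexp_ev_closed cring.cring_simprules)

text \<open>Evaluation in the integers separates \<open>0\<close> from \<open>1\<close> in the quotient.\<close>

primrec rexp_int :: "'a rexp \<Rightarrow> int" where
  "rexp_int (Rgen a) = 0"
| "rexp_int Rzero = 0"
| "rexp_int Rone = 1"
| "rexp_int (Rplus x y) = rexp_int x + rexp_int y"
| "rexp_int (Rtimes x y) = rexp_int x * rexp_int y"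
| "rexp_int (Rneg x) = - rexp_int x"

lemma rexp_int_cong: "req x y \<Longrightarrow> rexp_int x = rexp_int y"
  by (induction rule: req.induct) (simp_all add: algebra_simps)

instantiation fcr :: (type) comm_ring_1
begin

lift_definition zero_fcr :: "'a fcr" is Rzero .
lift_definition one_fcr :: "'a fcr" is Rone .
lift_definition plus_fcr :: "'a fcr \<Rightarrow> 'a fcr \<Rightarrow> 'a fcr" is Rplus by (rule req.intros)
lift_definition times_fcr :: "'a fcr \<Rightarrow> 'a fcr \<Rightarrow> 'a fcr" is Rtimes by (rule req.intros)
lift_definition uminus_fcr :: "'a fcr \<Rightarrow> 'a fcr" is Rneg by (rule req.intros)
definition minus_fcr :: "'a fcr \<Rightarrow> 'a fcr \<Rightarrow> 'a fcr" where "minus_fcr x y = x + - y"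

instance
proof
  fix a b c :: "'a fcr"
  show "a + b + c = a + (b + c)" by transfer (rule req.intros)
  show "a + b = b + a" by transfer (rule req.intros)
  show "0 + a = a" by transfer (rule req.intros)
  show "- a + a = 0" by transfer (rule req.intros)
  show "a - b = a + - b" by (rule minus_fcr_def)
  show "a * b * c = a * (b * c)" by transfer (rule req.intros)
  show "a * b = b * a" by transfer (rule req.intros)
  show "1 * a = a" by transfer (rule req.intros)
  show "(a + b) * c = a * c + b * c" by transfer (rule req.intros)
  show "(0 :: 'a fcr) \<noteq> 1" by transfer (auto dest: rexp_int_cong)
qed

end

definition fcr_ev :: "('a, 'm) ring_scheme \<Rightarrow> 'a fcr \<Rightarrow> 'a" where
  "fcr_ev A p = rexp_ev A (rep_fcr p)"

lemma fcr_ev_abs: "cring A \<Longrightarrow> fcr_ev A (abs_fcr x) = rexp_ev A x"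
  unfolding fcr_ev_def using rexp_ev_cong Quotient3_fcr rep_abs_rsp_left[OF Quotient3_fcr req.intros(1)] by metis

definition surj_hom :: "('r::comm_ring_1 \<Rightarrow> 'b) \<Rightarrow> ('b, 'm) ring_scheme \<Rightarrow> bool" where
  "surj_hom h B \<longleftrightarrow> cring B \<and> range h = carrier B \<and> h 1 = \<one>\<^bsub>B\<^esub> \<and>
     (\<forall>x y. h (x + y) = h x \<oplus>\<^bsub>B\<^esub> h y) \<and> (\<forall>x y. h (x * y) = h x \<otimes>\<^bsub>B\<^esub> h y)"

lemma surj_hom_fcr_ev:
  assumes A: "cring A"
  shows "surj_hom (fcr_ev A) A"
  unfolding surj_hom_def
proof (intro conjI allI)
  show "range (fcr_ev A) = carrier A"
  proof
    show "range (fcr_ev A) \<subseteq> carrier A" using rexp_ev_closed[OF A] by (auto simp: fcr_ev_def)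
    have "a = fcr_ev A (abs_fcr (Rgen a))" if "a \<in> carrier A" for a using that by (simp add: fcr_ev_abs[OF A])
    then show "carrier A \<subseteq> range (fcr_ev A)" by blast
  qed
  show "fcr_ev A 1 = \<one>\<^bsub>A\<^esub>" by (simp add: one_fcr_def fcr_ev_abs[OF A])
  fix x y
  show "fcr_ev A (x + y) = fcr_ev A x \<oplus>\<^bsub>A\<^esub> fcr_ev A y"
    by (induction x; induction y) (simp add: plus_fcr.abs_eq fcr_ev_abs[OF A])
  show "fcr_ev A (x * y) = fcr_ev A x \<otimes>\<^bsub>A\<^esub> fcr_ev A y"
    by (induction x; induction y) (simp add: times_fcr.abs_eq fcr_ev_abs[OF A])
qed (rule A)

definition prime_chain :: "('a, 'm) ring_scheme \<Rightarrow> nat \<Rightarrow> bool" where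
  "prime_chain C n \<longleftrightarrow> (\<exists>P :: nat \<Rightarrow> 'a set. (\<forall>i\<le>n. primeideal (P i) C) \<and> (\<forall>i<n. P i \<subset> P (Suc i)))"

section \<open>Ideals, primes and chains along a surjective homomorphism\<close>

context
  fixes h :: "'r::comm_ring_1 \<Rightarrow> 'b" and B :: "('b, 'm) ring_scheme"
  assumes h: "surj_hom h B"
begin

interpretation B: cring B using h by (simp add: surj_hom_def)

lemma hom_closed [simp]: "h x \<in> carrier B" using h by (auto simp: surj_hom_def)
lemma hom_surj: "b \<in> carrier B \<Longrightarrow> \<exists>x. h x = b" using h unfolding surj_hom_def by (metis imageE)
lemma hom_add: "h (x + y) = h x \<oplus>\<^bsub>B\<^esub> h y" using h by (simp add: surj_hom_def)
lemma hom_mult: "h (x * y) = h x \<otimes>\<^bsub>B\<^esub> h y" using h by (simp add: surj_hom_def)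
lemma hom_one: "h 1 = \<one>\<^bsub>B\<^esub>" using h by (simp add: surj_hom_def)

lemma hom_zero: "h 0 = \<zero>\<^bsub>B\<^esub>"
  using hom_add[of 0 0] by (simp add: B.add.r_cancel_one)

lemma hom_uminus: "h (- x) = \<ominus>\<^bsub>B\<^esub> h x"
  using hom_add[of "- x" x] by (simp add: hom_zero B.minus_equality)

lemma hom_diff: "h (x - y) = h x \<ominus>\<^bsub>B\<^esub> h y"
  using hom_add[of x "- y"] by (simp add: hom_uminus a_minus_def)

lemma hom_power: "h (x ^ n) = h x [^]\<^bsub>B\<^esub> n"
  by (induction n) (simp_all add: hom_one hom_mult B.m_comm)

lemma is_ideal_vimage:
  assumes "ideal I B"
  shows "is_ideal {x. h x \<in> I}"
proof -
  interpret I: ideal I B by fact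
  show ?thesis unfolding is_ideal_def
    by (auto simp: hom_zero hom_add hom_mult I.zero_closed I.a_closed I.I_l_closed)
qed

text \<open>Ideals above the kernel are saturated, which gives the correspondence with ideals of the
  target and preserves strict inclusions.\<close>

lemma vimage_image:
  assumes "is_ideal Q" "{x. h x = \<zero>\<^bsub>B\<^esub>} \<subseteq> Q"
  shows "h x \<in> h ` Q \<longleftrightarrow> x \<in> Q"
proof
  assume "h x \<in> h ` Q"
  then obtain y where y: "y \<in> Q" "h x = h y" by blast
  then have "h (x - y) = \<zero>\<^bsub>B\<^esub>" by (simp add: hom_diff B.r_right_minus_eq)
  then have "x - y \<in> Q" using assms by blast
  from is_idealD(2)[OF assms(1) this y(1)] show "x \<in> Q" by simp
qed simp

lemma ideal_image:
  assumes Q: "is_ideal Q"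
  shows "ideal (h ` Q) B"
proof (rule idealI)
  show "ring B" by (rule B.ring_axioms)
  show "subgroup (h ` Q) (add_monoid B)"
  proof (rule B.add.subgroupI)
    show "h ` Q \<noteq> {}" using is_idealD(1)[OF Q] by blast
    show "\<ominus>\<^bsub>B\<^esub> a \<in> h ` Q" if "a \<in> h ` Q" for a
      using that is_idealD(5)[OF Q] by (auto simp: hom_uminus[symmetric])
    show "a \<oplus>\<^bsub>B\<^esub> b \<in> h ` Q" if "a \<in> h ` Q" "b \<in> h ` Q" for a b
      using that is_idealD(2)[OF Q] by (auto simp: hom_add[symmetric])
  qed auto
  fix a x assume a: "a \<in> h ` Q" and x: "x \<in> carrier B"
  obtain y where y: "h y = x" using hom_surj[OF x] ..
  show "x \<otimes>\<^bsub>B\<^esub> a \<in> h ` Q" "a \<otimes>\<^bsub>B\<^esub> x \<in> h ` Q"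
    using a is_idealD(3,4)[OF Q] by (auto simp: hom_mult[symmetric] y[symmetric])
qed

lemma is_prime_vimage:
  assumes "primeideal P B"
  shows "is_prime {x. h x \<in> P}"
proof -
  interpret P: primeideal P B by fact
  have "1 \<notin> {x. h x \<in> P}"
    using P.I_notcarr P.one_imp_carrier by (auto simp: hom_one)
  then show ?thesis unfolding is_prime_def using is_ideal_vimage[OF P.is_ideal]
    by (auto simp: hom_mult dest: P.I_prime[rotated 2])
qed

lemma primeideal_image:
  assumes Q: "is_prime Q" "{x. h x = \<zero>\<^bsub>B\<^esub>} \<subseteq> Q"
  shows "primeideal (h ` Q) B"
proof (rule primeidealI)
  have Qi: "is_ideal Q" using Q is_primeD by blast
  note vi = vimage_image[OF Qi Q(2)]
  show "ideal (h ` Q) B" by (rule ideal_image[OF Qi])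
  show "cring B" by (rule B.cring_axioms)
  show "carrier B \<noteq> h ` Q" using vi[of 1] is_primeD(2)[OF Q(1)] hom_closed[of 1] by metis
  fix a b assume "a \<in> carrier B" "b \<in> carrier B" "a \<otimes>\<^bsub>B\<^esub> b \<in> h ` Q"
  then obtain x y where xy: "h x = a" "h y = b" "h (x * y) \<in> h ` Q" using hom_surj by (metis hom_mult)
  then show "a \<in> h ` Q \<or> b \<in> h ` Q" using vi Q(1) unfolding is_prime_def by blast
qed

lemma prime_chain_iff: "prime_chain B n \<longleftrightarrow> (\<exists>P. pchain {x. h x = \<zero>\<^bsub>B\<^esub>} P n)"
proof
  assume "prime_chain B n"
  then obtain P where P: "\<And>i. i \<le> n \<Longrightarrow> primeideal (P i) B" "\<And>i. i < n \<Longrightarrow> P i \<subset> P (Suc i)"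
    unfolding prime_chain_def by blast
  let ?Q = "\<lambda>i. {x. h x \<in> P i}"
  have sub: "?Q i \<subset> ?Q (Suc i)" if i: "i < n" for i
  proof -
    obtain b where b: "b \<in> P (Suc i)" "b \<notin> P i" using P(2)[OF i] by blast
    then have "b \<in> carrier B" using P(1)[of "Suc i"] i
      by (meson Suc_leI additive_subgroup.a_Hcarr ideal.axioms(1) primeideal.axioms(1))
    then obtain x where "h x = b" using hom_surj by blast
    then show ?thesis using b P(2)[OF i] by blast
  qed
  have "\<zero>\<^bsub>B\<^esub> \<in> P 0" using P(1)[of 0] by (simp add: additive_subgroup.zero_closed ideal.axioms(1) primeideal.axioms(1))
  then have "pchain {x. h x = \<zero>\<^bsub>B\<^esub>} ?Q n" unfolding pchain_def using sub is_prime_vimage P(1) by auto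
  then show "\<exists>P. pchain {x. h x = \<zero>\<^bsub>B\<^esub>} P n" by (rule exI[of _ ?Q])
next
  assume "\<exists>P. pchain {x. h x = \<zero>\<^bsub>B\<^esub>} P n"
  then obtain Q where Q: "pchain {x. h x = \<zero>\<^bsub>B\<^esub>} Q n" ..
  have ker: "{x. h x = \<zero>\<^bsub>B\<^esub>} \<subseteq> Q i" if "i \<le> n" for i
    using that
  proof (induction i)
    case (Suc i)
    have "Q i \<subset> Q (Suc i)" using Q Suc.prems by (simp add: pchain_def)
    then show ?case using Suc by auto
  qed (use Q in \<open>simp add: pchain_def\<close>)
  have prime: "is_prime (Q i)" if "i \<le> n" for i using Q that by (simp add: pchain_def)
  have "h ` Q i \<subset> h ` Q (Suc i)" if i: "i < n" for i
  proof -
    have "Q i \<subset> Q (Suc i)" using Q i by (simp add: pchain_def)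
    then obtain x where "x \<in> Q (Suc i)" "x \<notin> Q i" "Q i \<subseteq> Q (Suc i)" by blast
    moreover from this have "h x \<notin> h ` Q i"
      using vimage_image[OF is_primeD(1)[OF prime] ker, of i x] i by simp
    ultimately show ?thesis by blast
  qed
  then show "prime_chain B n" unfolding prime_chain_def
    using primeideal_image[OF prime ker] by (intro exI[of _ "\<lambda>i. h ` Q i"]) auto
qed

lemma surj_hom_Quot:
  assumes "ideal I B"
  shows "surj_hom (\<lambda>x. I +>\<^bsub>B\<^esub> h x) (B Quot I)"
proof -
  interpret I: ideal I B by fact
  have hom: "(+>\<^bsub>B\<^esub>) I \<in> ring_hom B (B Quot I)" by (rule I.rcos_ring_hom)
  show ?thesis unfolding surj_hom_def
  proof (intro conjI allI)
    show "cring (B Quot I)" by (rule I.quotient_is_cring[OF B.cring_axioms])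
    have "carrier (B Quot I) = (\<lambda>x. I +>\<^bsub>B\<^esub> x) ` carrier B"
      by (auto simp: FactRing_def A_RCOSETS_def' image_iff)
    also have "carrier B = range h" using h by (simp add: surj_hom_def)
    finally show "range (\<lambda>x. I +>\<^bsub>B\<^esub> h x) = carrier (B Quot I)" by (simp add: image_image)
    show "I +>\<^bsub>B\<^esub> h 1 = \<one>\<^bsub>B Quot I\<^esub>" unfolding hom_one by (rule ring_hom_one[OF hom])
    fix x y
    show "I +>\<^bsub>B\<^esub> h (x + y) = (I +>\<^bsub>B\<^esub> h x) \<oplus>\<^bsub>B Quot I\<^esub> (I +>\<^bsub>B\<^esub> h y)"
      unfolding hom_add by (rule ring_hom_add[OF hom]) simp_all
    show "I +>\<^bsub>B\<^esub> h (x * y) = (I +>\<^bsub>B\<^esub> h x) \<otimes>\<^bsub>B Quot I\<^esub> (I +>\<^bsub>B\<^esub> h y)"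
      unfolding hom_mult by (rule ring_hom_mult[OF hom]) simp_all
  qed
qed

lemma Quot_kernel:
  assumes "ideal I B"
  shows "{x. I +>\<^bsub>B\<^esub> h x = \<zero>\<^bsub>B Quot I\<^esub>} = {x. h x \<in> I}"
proof -
  interpret I: ideal I B by fact
  have "I +>\<^bsub>B\<^esub> h x = I \<longleftrightarrow> h x \<in> I" for x
    using I.rcos_const_imp_mem[of "h x"] I.a_rcos_const[of "h x"] hom_closed[of x] by blast
  then show ?thesis by (simp add: FactRing_def)
qed

end

lemma prime_chain_Quot_iff:
  assumes h: "surj_hom h B" and I: "ideal I B"
  shows "prime_chain (B Quot I) n \<longleftrightarrow> (\<exists>P. pchain {x. h x \<in> I} P n)"
  unfolding prime_chain_iff[OF surj_hom_Quot[OF h I]] Quot_kernel[OF h I] ..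

lemma prime_chain_mono: "prime_chain C n \<Longrightarrow> k \<le> n \<Longrightarrow> prime_chain C k"
  unfolding prime_chain_def by (meson less_le_trans order_trans)

lemma Kdim_ge_iff: "ereal (real n) \<le> Kdim C \<longleftrightarrow> prime_chain C n"
proof
  assume n: "ereal (real n) \<le> Kdim C"
  show "prime_chain C n"
  proof (rule ccontr)
    assume "\<not> prime_chain C n"
    then have lt: "k < n" if "prime_chain C k" for k using that prime_chain_mono by (metis not_le)
    have Kd: "Kdim C = Sup {ereal (real k) | k. prime_chain C k}" by (simp add: Kdim_def prime_chain_def)
    show False
    proof (cases n)
      \<comment> \<open>Without any chain the supremum is that of the empty set, negative infinity,
        which is strictly below \<open>0\<close>.\<close>
      case 0
      then have "{ereal (real k) | k. prime_chain C k} = {}" using lt by auto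
      then have "Kdim C = - \<infinity>" unfolding Kd by (simp only:) (simp add: bot_ereal_def)
      then show False using n by simp
    next
      case (Suc n')
      have "Kdim C \<le> ereal (real n')" unfolding Kd
        using lt Suc by (intro Sup_least) (auto simp: less_Suc_eq_le)
      then have "ereal (real n) \<le> ereal (real n')" using n by (rule order_trans[rotated])
      then show False using Suc by simp
    qed
  qed
next
  assume "prime_chain C n"
  then show "ereal (real n) \<le> Kdim C" unfolding Kdim_def prime_chain_def by (intro Sup_upper) auto
qed

lemma Kdim_eq_iff: "Kdim C = ereal (real d) \<longleftrightarrow> prime_chain C d \<and> \<not> prime_chain C (Suc d)"
proof
  assume *: "Kdim C = ereal (real d)"
  have "\<not> ereal (real (Suc d)) \<le> Kdim C" unfolding * by simp
  moreover have "ereal (real d) \<le> Kdim C" unfolding * by simp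
  ultimately show "prime_chain C d \<and> \<not> prime_chain C (Suc d)"
    using Kdim_ge_iff[of d C] Kdim_ge_iff[of "Suc d" C] by blast
next
  assume *: "prime_chain C d \<and> \<not> prime_chain C (Suc d)"
  have "k \<le> d" if "prime_chain C k" for k using that * prime_chain_mono by (metis not_less_eq_eq)
  then have "Kdim C \<le> ereal (real d)"
    unfolding Kdim_def prime_chain_def[symmetric] by (intro Sup_least) auto
  moreover have "ereal (real d) \<le> Kdim C" using * Kdim_ge_iff by blast
  ultimately show "Kdim C = ereal (real d)" by (rule antisym)
qed

section \<open>Super-rings\<close>

context super_ring
begin

abbreviation "E0 \<equiv> even_part R"
abbreviation "E1 \<equiv> odd_part R"

lemma even_carrier: "a \<in> E0 \<Longrightarrow> a \<in> carrier R"
  using additive_subgroup.a_subset[OF even_subgroup] by blast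

lemma odd_carrier: "a \<in> E1 \<Longrightarrow> a \<in> carrier R"
  using additive_subgroup.a_subset[OF odd_subgroup] by blast

lemma even_add: "a \<in> E0 \<Longrightarrow> b \<in> E0 \<Longrightarrow> a \<oplus> b \<in> E0"
  by (rule additive_subgroup.a_closed[OF even_subgroup])

lemma odd_add: "a \<in> E1 \<Longrightarrow> b \<in> E1 \<Longrightarrow> a \<oplus> b \<in> E1"
  by (rule additive_subgroup.a_closed[OF odd_subgroup])

lemma even_zero: "\<zero> \<in> E0" by (rule additive_subgroup.zero_closed[OF even_subgroup])
lemma odd_zero: "\<zero> \<in> E1" by (rule additive_subgroup.zero_closed[OF odd_subgroup])

lemma subgroup_uminus: "additive_subgroup H R \<Longrightarrow> a \<in> H \<Longrightarrow> \<ominus> a \<in> H"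
  using subgroup.m_inv_closed[OF additive_subgroup.a_subgroup] by (fastforce simp: a_inv_def)

lemma even_uminus: "a \<in> E0 \<Longrightarrow> \<ominus> a \<in> E0" by (rule subgroup_uminus[OF even_subgroup])
lemma odd_uminus: "a \<in> E1 \<Longrightarrow> \<ominus> a \<in> E1" by (rule subgroup_uminus[OF odd_subgroup])

lemma parts_decomp:
  assumes "r \<in> carrier R"
  obtains a b where "a \<in> E0" "b \<in> E1" "r = a \<oplus> b"
  using assms unfolding parts_sum[symmetric] set_add_def' by blast

lemma parts_zero: "a \<in> E0 \<Longrightarrow> a \<in> E1 \<Longrightarrow> a = \<zero>"
  using parts_disjoint by blast

lemma parts_unique:
  assumes "a \<in> E0" "a' \<in> E0" "b \<in> E1" "b' \<in> E1" "a \<oplus> b = a' \<oplus> b'"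
  shows "a = a'" "b = b'"
proof -
  have c: "a \<in> carrier R" "a' \<in> carrier R" "b \<in> carrier R" "b' \<in> carrier R"
    using assms even_carrier odd_carrier by auto
  have "a \<ominus> a' = (a \<oplus> b) \<oplus> (\<ominus> a' \<oplus> \<ominus> b)" using c by algebra
  also have "\<dots> = (a' \<oplus> b') \<oplus> (\<ominus> a' \<oplus> \<ominus> b)" using assms by simp
  also have "\<dots> = b' \<ominus> b" using c by algebra
  finally have e: "a \<ominus> a' = b' \<ominus> b" .
  have "a \<ominus> a' \<in> E0" unfolding a_minus_def using assms even_add even_uminus by auto
  moreover have "b' \<ominus> b \<in> E1" unfolding a_minus_def using assms odd_add odd_uminus by auto
  ultimately have "a \<ominus> a' = \<zero>" using parts_zero e by simp
  then show a: "a = a'" using c r_right_minus_eq by blast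
  show "b = b'" using assms(5) c unfolding a by (simp only: add.l_cancel)
qed

lemma even_central: "a \<in> E0 \<Longrightarrow> r \<in> carrier R \<Longrightarrow> a \<otimes> r = r \<otimes> a"
proof -
  assume a: "a \<in> E0" and "r \<in> carrier R"
  then obtain b c where r: "b \<in> E0" "c \<in> E1" "r = b \<oplus> c" using parts_decomp by blast
  then have "a \<otimes> b = b \<otimes> a" "a \<otimes> c = c \<otimes> a" using even_comm a by auto
  then show ?thesis using r a even_carrier odd_carrier by (simp add: r_distr l_distr)
qed

abbreviation "A0 \<equiv> even_ring R"

lemma even_ring_simps [simp]:
  "carrier A0 = E0" "monoid.mult A0 = monoid.mult R" "monoid.one A0 = monoid.one R" "ring.zero A0 = ring.zero R" "ring.add A0 = ring.add R"
  by (simp_all add: even_ring_def)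

lemma cring_even: "cring A0"
proof (rule cringI)
  show "abelian_group A0"
  proof (rule abelian_groupI)
    show "\<exists>y\<in>carrier A0. y \<oplus>\<^bsub>A0\<^esub> x = \<zero>\<^bsub>A0\<^esub>" if "x \<in> carrier A0" for x
      using that even_uminus even_carrier by (intro bexI[of _ "\<ominus> x"]) (auto simp: l_neg)
  qed (auto simp: even_add even_zero even_carrier a_ac)
  show "comm_monoid A0"
    by (rule comm_monoidI) (auto simp: even_even one_even even_carrier m_assoc intro: even_comm)
qed (auto simp: even_carrier l_distr)

lemma even_ring_uminus: "a \<in> E0 \<Longrightarrow> \<ominus>\<^bsub>A0\<^esub> a = \<ominus> a"
proof -
  assume a: "a \<in> E0"
  interpret A: cring A0 by (rule cring_even)
  have "\<ominus> a \<oplus>\<^bsub>A0\<^esub> a = \<zero>\<^bsub>A0\<^esub>" using a even_carrier by (simp add: l_neg)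
  from A.minus_equality[OF this] show ?thesis using a even_uminus by simp
qed

lemma even_ring_pow: "a [^]\<^bsub>A0\<^esub> (n::nat) = a [^] n"
  by (induction n) (simp_all add: nat_pow_def even_ring_def)

lemma ideal_even_iff:
  "ideal J A0 \<longleftrightarrow> J \<subseteq> E0 \<and> \<zero> \<in> J \<and> (\<forall>a\<in>J. \<forall>b\<in>J. a \<oplus> b \<in> J) \<and> (\<forall>a\<in>J. \<forall>r\<in>E0. r \<otimes> a \<in> J)"
proof
  assume "ideal J A0"
  then interpret J: ideal J A0 .
  show "J \<subseteq> E0 \<and> \<zero> \<in> J \<and> (\<forall>a\<in>J. \<forall>b\<in>J. a \<oplus> b \<in> J) \<and> (\<forall>a\<in>J. \<forall>r\<in>E0. r \<otimes> a \<in> J)"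
    using J.a_subset additive_subgroup.zero_closed[OF J.is_additive_subgroup]
      additive_subgroup.a_closed[OF J.is_additive_subgroup] J.I_l_closed by auto
next
  assume J: "J \<subseteq> E0 \<and> \<zero> \<in> J \<and> (\<forall>a\<in>J. \<forall>b\<in>J. a \<oplus> b \<in> J) \<and> (\<forall>a\<in>J. \<forall>r\<in>E0. r \<otimes> a \<in> J)"
  interpret A: cring A0 by (rule cring_even)
  show "ideal J A0"
  proof (rule idealI)
    show "subgroup J (add_monoid A0)"
    proof (rule A.add.subgroupI)
      fix a assume a: "a \<in> J"
      then have "\<ominus> \<one> \<otimes> a \<in> J" using J even_uminus[OF one_even] by blast
      moreover have "\<ominus> \<one> \<otimes> a = \<ominus> a" using a J even_carrier by (auto simp: l_minus)
      ultimately show "\<ominus>\<^bsub>A0\<^esub> a \<in> J" using a J even_ring_uminus by auto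
    qed (use J in auto)
    show "a \<otimes>\<^bsub>A0\<^esub> x \<in> J" if "a \<in> J" "x \<in> carrier A0" for a x
      using J that A.m_comm[of a x] by auto
  qed (use J A.ring_axioms in auto)
qed

lemma odd_sq_ideal: "ideal (odd_sq R) A0"
  unfolding ideal_even_iff
proof (intro conjI ballI)
  show sub: "odd_sq R \<subseteq> E0"
  proof
    fix x assume "x \<in> odd_sq R"
    then show "x \<in> E0" unfolding odd_sq_def
      by (induction rule: ideal_prod.induct) (auto intro: odd_odd even_add)
  qed
  have "\<zero> \<otimes> \<zero> \<in> odd_sq R" unfolding odd_sq_def by (intro ideal_prod.prod odd_zero)
  then show "\<zero> \<in> odd_sq R" by simp
  show "a \<oplus> b \<in> odd_sq R" if "a \<in> odd_sq R" "b \<in> odd_sq R" for a b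
    using that unfolding odd_sq_def by (rule ideal_prod.sum)
  fix a r assume "a \<in> odd_sq R" and r: "r \<in> E0"
  then have "r \<otimes> a \<in> odd_sq R \<and> a \<in> carrier R" unfolding odd_sq_def
  proof (induction rule: ideal_prod.induct)
    case (prod i j)
    then have "(r \<otimes> i) \<otimes> j \<in> ideal_prod R E1 E1" by (intro ideal_prod.prod even_odd)
    then show ?case using prod r even_carrier odd_carrier by (simp add: m_assoc)
  next
    case (sum s t)
    then show ?case using r even_carrier by (simp add: r_distr ideal_prod.sum)
  qed
  then show "r \<otimes> a \<in> odd_sq R" ..
qed

abbreviation "ev \<equiv> fcr_ev A0"

lemma ev_hom: "surj_hom ev A0" by (rule surj_hom_fcr_ev[OF cring_even])

lemma ev_even [simp]: "ev p \<in> E0" using hom_closed[OF ev_hom] by simp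
lemma ev_carrier [simp]: "ev p \<in> carrier R" using even_carrier by simp
lemma ev_surj: "a \<in> E0 \<Longrightarrow> \<exists>p. ev p = a" using hom_surj[OF ev_hom] by simp
lemma ev_add: "ev (p + q) = ev p \<oplus> ev q" using hom_add[OF ev_hom] by simp
lemma ev_mult: "ev (p * q) = ev p \<otimes> ev q" using hom_mult[OF ev_hom] by simp
lemma ev_one: "ev 1 = \<one>" using hom_one[OF ev_hom] by simp
lemma ev_zero: "ev 0 = \<zero>" using hom_zero[OF ev_hom] by simp
lemma ev_uminus: "ev (- p) = \<ominus> ev p" using hom_uminus[OF ev_hom] even_ring_uminus by simp
lemma ev_diff: "ev (p - q) = ev p \<ominus> ev q"
  using ev_add[of p "- q"] by (simp add: ev_uminus a_minus_def)
definition Ker :: "'a fcr set" where "Ker = {p. ev p = \<zero>}"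
definition Osq :: "'a fcr set" where "Osq = {p. ev p \<in> odd_sq R}"

lemma is_ideal_Ker: "is_ideal Ker"
  unfolding is_ideal_def Ker_def by (auto simp: ev_zero ev_add ev_mult)

lemma is_ideal_Osq: "is_ideal Osq"
  unfolding Osq_def by (rule is_ideal_vimage[OF ev_hom odd_sq_ideal])

lemma Ker_Osq: "Ker \<subseteq> Osq"
  using is_idealD(1)[OF is_ideal_Osq] by (auto simp: Ker_def Osq_def ev_zero)

text \<open>By anticommutativity a product of two odd elements has square zero. For a sum, a prime
  avoiding all powers of \<open>p\<close> would contain both nilpotent summands and hence
  \<open>p\<close>; this replaces a binomial expansion.\<close>

lemma Osq_nilpotent:
  assumes "p \<in> Osq"
  shows "\<exists>n. p ^ n \<in> Ker"
proof -
  have "\<exists>n. p ^ n \<in> Ker" if "ev p = r" "r \<in> ideal_prod R E1 E1" for p r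
    using that(2,1)
  proof (induction arbitrary: p rule: ideal_prod.induct)
    case (prod i j)
    have c: "i \<in> carrier R" "j \<in> carrier R" using prod odd_carrier by auto
    have "(i \<otimes> j) \<otimes> (i \<otimes> j) = i \<otimes> (j \<otimes> i) \<otimes> j" using c by (simp add: m_assoc)
    also have "\<dots> = \<ominus> ((i \<otimes> i) \<otimes> (j \<otimes> j))" using c odd_anticomm[OF prod(2,1)] by (simp add: m_assoc r_minus l_minus)
    also have "\<dots> = \<zero>" using odd_square prod by simp
    finally have "p ^ 2 \<in> Ker" using prod by (simp add: Ker_def power2_eq_square ev_mult)
    then show ?case ..
  next
    case (sum s t)
    obtain q where q: "ev q = s" using sum ev_surj odd_sq_ideal unfolding ideal_even_iff odd_sq_def by blast
    have ts: "t \<in> carrier R" "s \<in> carrier R" using sum odd_sq_ideal even_carrier unfolding ideal_even_iff odd_sq_def by blast+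
    have "ev (p - q) = (s \<oplus> t) \<ominus> s" using sum.prems q by (simp add: ev_diff)
    also have "\<dots> = t" using ts by algebra
    finally have "ev (p - q) = t" .
    then obtain k where k: "(p - q) ^ k \<in> Ker" using sum.IH by blast
    obtain n where n: "q ^ n \<in> Ker" using sum.IH q by blast
    have "\<exists>n. p ^ n \<in> Ker"
    proof (rule ccontr)
      assume nn: "\<not> ?thesis"
      obtain P where P: "is_prime P" "Ker \<subseteq> P" "range (\<lambda>n. p ^ n) \<inter> P = {}"
      proof -
        have "1 \<in> range (\<lambda>n. p ^ n)" by (rule range_eqI[of _ _ 0]) simp
        moreover have "a * b \<in> range (\<lambda>n. p ^ n)" if "a \<in> range (\<lambda>n. p ^ n)" "b \<in> range (\<lambda>n. p ^ n)" for a b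
          using that by (auto simp flip: power_add)
        moreover have "range (\<lambda>n. p ^ n) \<inter> Ker = {}" using nn by blast
        ultimately show ?thesis using prime_avoiding[OF is_ideal_Ker, of "range (\<lambda>n. p ^ n)"] that by blast
      qed
      have "q \<in> P" "p - q \<in> P" using is_prime_power[OF P(1)] n k P(2) by blast+
      then have "p - q + q \<in> P" by (intro is_idealD(2)[OF is_primeD(1)[OF P(1)]])
      then have "p ^ 1 \<in> P" by simp
      then show False using P(3) by blast
    qed
    then show ?case .
  qed
  then show ?thesis using assms by (simp add: Osq_def odd_sq_def)
qed

lemma Osq_sub_prime: "is_prime P \<Longrightarrow> Ker \<subseteq> P \<Longrightarrow> Osq \<subseteq> P"
  using Osq_nilpotent is_prime_power by blast

end

text \<open>The counterpart of \<open>sp\<close> inside a ring with explicit carrier: the vectors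
  lie in a noncommutative ring, while the coefficients will be ideals of the even part or steps of
  its filtration.\<close>

inductive_set lsp :: "('a, 'm) ring_scheme \<Rightarrow> 'a set \<Rightarrow> 'a set \<Rightarrow> 'a set" for R C W where
  lsp_zero: "\<zero>\<^bsub>R\<^esub> \<in> lsp R C W"
| lsp_step: "\<lbrakk>a \<in> C; w \<in> W; s \<in> lsp R C W\<rbrakk> \<Longrightarrow> (a \<otimes>\<^bsub>R\<^esub> w) \<oplus>\<^bsub>R\<^esub> s \<in> lsp R C W"

lemma lsp_mono: "C \<subseteq> D \<Longrightarrow> V \<subseteq> W \<Longrightarrow> lsp R C V \<subseteq> lsp R D W"
proof
  fix s assume "s \<in> lsp R C V" "C \<subseteq> D" "V \<subseteq> W" then show "s \<in> lsp R D W"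
    by induction (auto intro: lsp.intros)
qed

context ring
begin

lemma lsp_closed: "C \<subseteq> carrier R \<Longrightarrow> W \<subseteq> carrier R \<Longrightarrow> lsp R C W \<subseteq> carrier R"
proof
  fix s assume "s \<in> lsp R C W" "C \<subseteq> carrier R" "W \<subseteq> carrier R" then show "s \<in> carrier R"
    by induction auto
qed

lemma lsp_add:
  assumes "C \<subseteq> carrier R" "W \<subseteq> carrier R" "s \<in> lsp R C W" "t \<in> lsp R C W"
  shows "s \<oplus> t \<in> lsp R C W"
  using assms(3)
proof (induction s rule: lsp.induct)
  case lsp_zero
  then show ?case using assms lsp_closed[of C W] by auto
next
  case (lsp_step a w s)
  have "a \<in> carrier R" "w \<in> carrier R" "s \<in> carrier R" "t \<in> carrier R"
    using lsp_step assms lsp_closed[of C W] by auto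
  then have "a \<otimes> w \<oplus> s \<oplus> t = a \<otimes> w \<oplus> (s \<oplus> t)" by (simp add: a_assoc)
  then show ?case using lsp_step by (simp add: lsp.lsp_step)
qed

lemma lsp_base:
  assumes "a \<in> C" "w \<in> W" "C \<subseteq> carrier R" "W \<subseteq> carrier R"
  shows "a \<otimes> w \<in> lsp R C W"
proof -
  have "a \<in> carrier R" "w \<in> carrier R" using assms by auto
  then show ?thesis using lsp.lsp_step[OF assms(1,2) lsp.lsp_zero, of R] by simp
qed

lemma lsp_smult:
  assumes "s \<in> lsp R C W" "c \<in> carrier R" "\<And>a. a \<in> C \<Longrightarrow> c \<otimes> a \<in> D" "C \<subseteq> carrier R" "W \<subseteq> carrier R"
  shows "c \<otimes> s \<in> lsp R D W"
  using assms(1)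
proof (induction s rule: lsp.induct)
  case lsp_zero
  then show ?case using assms by (simp add: lsp.lsp_zero)
next
  case (lsp_step a w s)
  have "a \<in> carrier R" "w \<in> carrier R" "s \<in> carrier R"
    using lsp_step assms lsp_closed[of C W] by auto
  then have "c \<otimes> (a \<otimes> w \<oplus> s) = (c \<otimes> a) \<otimes> w \<oplus> c \<otimes> s" using assms by (simp add: r_distr m_assoc)
  then show ?case using lsp_step assms(3) by (simp add: lsp.lsp_step)
qed

lemma lsp_insertD:
  assumes "t \<in> lsp R C (insert g W)" "C \<subseteq> carrier R" "insert g W \<subseteq> carrier R"
    "\<zero> \<in> C" "\<And>a b. a \<in> C \<Longrightarrow> b \<in> C \<Longrightarrow> a \<oplus> b \<in> C"
  shows "\<exists>a\<in>C. \<exists>s\<in>lsp R C W. t = a \<otimes> g \<oplus> s"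
  using assms(1)
proof (induction t rule: lsp.induct)
  case lsp_zero
  then show ?case using assms by (intro bexI[of _ \<zero>] bexI[of _ \<zero>]) (auto intro: lsp.intros)
next
  case (lsp_step a w t)
  then obtain b s where b: "b \<in> C" "s \<in> lsp R C W" "t = b \<otimes> g \<oplus> s" by blast
  have c: "a \<in> carrier R" "w \<in> carrier R" "b \<in> carrier R" "s \<in> carrier R" "g \<in> carrier R"
    using lsp_step b assms lsp_closed[of C W] by auto
  show ?case
  proof (cases "w = g")
    case True
    then have "a \<otimes> w \<oplus> t = (a \<oplus> b) \<otimes> g \<oplus> s" using b c by (simp add: l_distr a_assoc)
    then show ?thesis using b lsp_step assms(5) by blast
  next
    case False
    then have "a \<otimes> w \<oplus> s \<in> lsp R C W" using lsp_step b by (auto intro: lsp.lsp_step)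
    moreover have "a \<otimes> w \<oplus> t = b \<otimes> g \<oplus> (a \<otimes> w \<oplus> s)" using b c by (simp add: a_lcomm)
    ultimately show ?thesis using b by blast
  qed
qed

lemma ideal_criterion:
  assumes "I \<subseteq> carrier R" "\<zero> \<in> I" "\<And>a b. a \<in> I \<Longrightarrow> b \<in> I \<Longrightarrow> a \<oplus> b \<in> I"
    "\<And>a r. a \<in> I \<Longrightarrow> r \<in> carrier R \<Longrightarrow> r \<otimes> a \<in> I" "\<And>a r. a \<in> I \<Longrightarrow> r \<in> carrier R \<Longrightarrow> a \<otimes> r \<in> I"
  shows "ideal I R"
proof (rule idealI)
  show "subgroup I (add_monoid R)"
  proof (rule add.subgroupI)
    show "\<ominus> a \<in> I" if "a \<in> I" for a
      using assms(4)[OF that, of "\<ominus> \<one>"] that assms(1) by (auto simp: l_minus)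
  qed (use assms in auto)
qed (use assms ring_axioms in auto)

text \<open>
  Gaussian elimination in place of the determinant trick: diagonal entries lie in \<open>U\<close>, entries
  right of the pivot in deeper filtration steps.
\<close>

lemma elimination:
  fixes e :: "'r::comm_ring_1 \<Rightarrow> 'a" and U C :: "nat \<Rightarrow> 'r set"
  assumes e: "\<And>p. e p \<in> carrier R" "\<And>p q. e (p + q) = e p \<oplus> e q" "\<And>p q. e (p * q) = e p \<otimes> e q" "e 0 = \<zero>"
      "\<And>p q. e (p - q) = e p \<ominus> e q"
    and UC: "\<And>k. U k \<subseteq> C k" and U_mult: "\<And>k l a b. a \<in> U k \<Longrightarrow> b \<in> U l \<Longrightarrow> a * b \<in> U (k + l)"
    and C_mult: "\<And>k l a b. a \<in> C k \<Longrightarrow> b \<in> C l \<Longrightarrow> a * b \<in> C (k + l)"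
    and C_add: "\<And>k a b. a \<in> C k \<Longrightarrow> b \<in> C k \<Longrightarrow> a + b \<in> C k" and C_zero: "\<And>k. 0 \<in> C k"
    and C_anti: "\<And>k l. k \<le> l \<Longrightarrow> C l \<subseteq> C k"
    and U_diff: "\<And>k u a. u \<in> U k \<Longrightarrow> a \<in> C (Suc k) \<Longrightarrow> u - a \<in> U k" and U_one: "1 \<in> U 0"
    and W: "finite W" "W \<subseteq> carrier R" "\<And>g. g \<in> W \<Longrightarrow> \<exists>u\<in>U k. e u \<otimes> g \<in> lsp R (e ` C (Suc k)) W"
  shows "\<exists>l. \<exists>u\<in>U l. \<forall>g\<in>W. e u \<otimes> g = \<zero>"
  using W
proof (induction W arbitrary: k)
  case empty
  then show ?case using U_one by blast
next
  case (insert g W)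
  have Cc: "e ` C k \<subseteq> carrier R" for k using e by auto
  have Wc: "W \<subseteq> carrier R" "g \<in> carrier R" using insert by auto
  have split: "\<exists>a\<in>C k. \<exists>s\<in>lsp R (e ` C k) W. t = e a \<otimes> g \<oplus> s" if "t \<in> lsp R (e ` C k) (insert g W)" for t k
  proof -
    have "\<exists>a\<in>e ` C k. \<exists>s\<in>lsp R (e ` C k) W. t = a \<otimes> g \<oplus> s"
    proof (rule lsp_insertD[OF that Cc insert.prems(1)])
      show "\<zero> \<in> e ` C k" using C_zero[of k] e(4) by (metis image_eqI)
      show "a \<oplus> b \<in> e ` C k" if "a \<in> e ` C k" "b \<in> e ` C k" for a b
        using that C_add by (auto simp flip: e(2))
    qed
    then show ?thesis by blast
  qed
  have sm: "e c \<otimes> s \<in> lsp R (e ` C (k + l)) W" if "c \<in> C k" "s \<in> lsp R (e ` C l) W" for c s k l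
    using that by (intro lsp_smult[OF _ _ _ Cc[of l] Wc(1)]) (auto simp flip: e(3) intro: C_mult e(1))
  obtain u where u: "u \<in> U k" "e u \<otimes> g \<in> lsp R (e ` C (Suc k)) (insert g W)" using insert.prems(2)[of g] by blast
  from split[OF u(2)] obtain a v where v: "a \<in> C (Suc k)" "v \<in> lsp R (e ` C (Suc k)) W" "e u \<otimes> g = e a \<otimes> g \<oplus> v" by blast
  have vc: "v \<in> carrier R" using v lsp_closed[OF Cc Wc(1)] by blast
  \<comment> \<open>The coefficient of \<open>g\<close> in its own relation comes from a deeper
    step, so moving it to the other side keeps the pivot in \<open>U k\<close> and expresses
    \<open>u' g\<close> by the remaining generators.\<close>
  define u' where "u' = u - a"
  have u': "u' \<in> U k" using u v U_diff by (simp add: u'_def)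
  have ug: "e u' \<otimes> g = v"
  proof -
    have "e u' \<otimes> g = e u \<otimes> g \<ominus> e a \<otimes> g" unfolding u'_def e(5)
      using e(1)[of u] e(1)[of a] Wc(2) by (simp add: a_minus_def l_distr l_minus)
    also have "\<dots> = (e a \<otimes> g \<oplus> v) \<ominus> e a \<otimes> g" using v by simp
    also have "\<dots> = v" using e(1)[of a] Wc(2) vc by algebra
    finally show ?thesis .
  qed
  \<comment> \<open>Multiplying another relation by the pivot allows \<open>g\<close> to be replaced
    by \<open>v\<close>. The two resulting terms lie in steps \<open>2 k + 2\<close> and
    \<open>2 k + 1\<close>, so the hypothesis recurs with \<open>2 k\<close> in place of
    \<open>k\<close>.\<close>
  have "\<exists>w\<in>U (k + k). e w \<otimes> g' \<in> lsp R (e ` C (Suc (k + k))) W" if g': "g' \<in> W" for g'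
  proof -
    obtain w where w: "w \<in> U k" "e w \<otimes> g' \<in> lsp R (e ` C (Suc k)) (insert g W)" using insert.prems(2)[of g'] g' by blast
    from split[OF w(2)] obtain b v' where v': "b \<in> C (Suc k)" "v' \<in> lsp R (e ` C (Suc k)) W" "e w \<otimes> g' = e b \<otimes> g \<oplus> v'" by blast
    have c: "v' \<in> carrier R" "g' \<in> carrier R" using v' lsp_closed[OF Cc Wc(1)] g' Wc by blast+
    have "e (u' * w) \<otimes> g' = e u' \<otimes> (e w \<otimes> g')" using e c by (simp add: m_assoc)
    also have "\<dots> = e u' \<otimes> (e b \<otimes> g) \<oplus> e u' \<otimes> v'" unfolding v'(3) using e c Wc by (simp add: r_distr)
    also have "e u' \<otimes> (e b \<otimes> g) = e b \<otimes> (e u' \<otimes> g)"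
      using e(1) Wc(2) by (simp add: m_assoc[symmetric] e(3)[symmetric] mult.commute)
    also have "\<dots> = e b \<otimes> v" by (simp add: ug)
    finally have eq: "e (u' * w) \<otimes> g' = e b \<otimes> v \<oplus> e u' \<otimes> v'" .
    have "C (Suc k + Suc k) \<subseteq> C (Suc (k + k))" by (rule C_anti) simp
    then have "lsp R (e ` C (Suc k + Suc k)) W \<subseteq> lsp R (e ` C (Suc (k + k))) W" by (intro lsp_mono) auto
    then have "e b \<otimes> v \<in> lsp R (e ` C (Suc (k + k))) W" using sm[OF v'(1) v(2)] by blast
    moreover have "u' \<in> C k" using u' UC by blast
    then have "e u' \<otimes> v' \<in> lsp R (e ` C (Suc (k + k))) W" using sm[of u' k v' "Suc k"] v'(2) by simp
    ultimately have "e (u' * w) \<otimes> g' \<in> lsp R (e ` C (Suc (k + k))) W"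
      unfolding eq by (intro lsp_add Cc Wc(1))
    then show ?thesis using U_mult[OF u' w(1)] by blast
  qed
  from insert.IH[OF Wc(1) this] obtain l w where w: "w \<in> U l" "\<forall>g\<in>W. e w \<otimes> g = \<zero>" by blast
  have wv: "e w \<otimes> s = \<zero>" if "s \<in> lsp R (e ` C (Suc k)) W" for s
    using that
  proof (induction s rule: lsp.induct)
    case (lsp_step a x s)
    obtain a' where a: "a = e a'" using lsp_step by blast
    have c: "x \<in> carrier R" "s \<in> carrier R" using lsp_step Wc lsp_closed[OF Cc Wc(1)] by auto
    have "e w \<otimes> (a \<otimes> x \<oplus> s) = (e w \<otimes> e a') \<otimes> x \<oplus> e w \<otimes> s" using c e(1) by (simp add: a r_distr m_assoc)
    also have "(e w \<otimes> e a') \<otimes> x = e a' \<otimes> (e w \<otimes> x)" using c e(1) by (simp add: m_assoc[symmetric] e(3)[symmetric] mult.commute)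
    finally show ?case using lsp_step w e(1) by simp
  qed (use e in simp)
  have "e (w * u') \<otimes> g' = \<zero>" if "g' \<in> insert g W" for g'
  proof (cases "g' = g")
    case True
    have "e (w * u') \<otimes> g = e w \<otimes> (e u' \<otimes> g)" using e Wc by (simp add: m_assoc)
    also have "\<dots> = \<zero>" unfolding ug by (rule wv[OF v(2)])
    finally show ?thesis using True by simp
  next
    case False
    then have g': "g' \<in> W" "g' \<in> carrier R" using that Wc by auto
    have "e (w * u') \<otimes> g' = e u' \<otimes> (e w \<otimes> g')"
      using e(1) g' by (simp add: m_assoc[symmetric] e(3)[symmetric] mult.commute)
    then show ?thesis using w g' e(1) by simp
  qed
  then show ?case using U_mult[OF w(1) u'] by blast
qed

end

text \<open>\<open>elimination\<close> wants one degree for all generators. Multiplying a relation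
  by an element of \<open>U l\<close> raises its degree by \<open>l\<close>, so the different
  degrees can be added up over the finite set.\<close>

lemma uniform_degree:
  fixes U :: "nat \<Rightarrow> 'r::comm_ring_1 set"
  assumes U_mult: "\<And>k l a b. a \<in> U k \<Longrightarrow> b \<in> U l \<Longrightarrow> a * b \<in> U (k + l)" and U_one: "1 \<in> U 0"
    and stable: "\<And>g k l u v. Pr g k u \<Longrightarrow> u \<in> U k \<Longrightarrow> v \<in> U l \<Longrightarrow> g \<in> W \<Longrightarrow> Pr g (k + l) (u * v)"
    and W: "finite W" "\<And>g. g \<in> W \<Longrightarrow> \<exists>k. \<exists>u\<in>U k. Pr g k u"
  shows "\<exists>k. (\<exists>v. v \<in> U k) \<and> (\<forall>g\<in>W. \<exists>u\<in>U k. Pr g k u)"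
  using W stable
proof (induction W)
  case empty
  then show ?case using U_one by blast
next
  case (insert g W)
  have "\<exists>k. (\<exists>v. v \<in> U k) \<and> (\<forall>g\<in>W. \<exists>u\<in>U k. Pr g k u)"
  proof (rule insert.IH)
    show "\<exists>k. \<exists>u\<in>U k. Pr g k u" if "g \<in> W" for g using insert.prems(1)[of g] that by simp
    show "Pr g (k + l) (u * v)" if "Pr g k u" "u \<in> U k" "v \<in> U l" "g \<in> W" for g k l u v
      using insert.prems(2)[OF that(1-3)] that(4) by simp
  qed
  then obtain k v where k: "v \<in> U k" "\<forall>g\<in>W. \<exists>u\<in>U k. Pr g k u" by (elim exE conjE)
  have "\<exists>l. \<exists>w\<in>U l. Pr g l w" by (rule insert.prems(1)) simp
  then obtain l w where l: "w \<in> U l" "Pr g l w" by (elim exE bexE)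
  have "\<exists>u\<in>U (k + l). Pr g' (k + l) u" if "g' \<in> insert g W" for g'
  proof (cases "g' = g")
    case True
    have "Pr g (l + k) (w * v)" "w * v \<in> U (l + k)" using insert.prems(2)[OF l(2,1) k(1)] U_mult[OF l(1) k(1)] by auto
    then show ?thesis using True by (auto simp: add.commute)
  next
    case False
    then have "\<exists>u\<in>U k. Pr g' k u" using that k(2) by simp
    then obtain u where u: "u \<in> U k" "Pr g' k u" by (elim bexE)
    have "Pr g' (k + l) (u * w)" "u * w \<in> U (k + l)" using insert.prems(2)[OF u(2,1) l(1)] U_mult[OF u(1) l(1)] that by auto
    then show ?thesis by (intro bexI)
  qed
  moreover have "v * w \<in> U (k + l)" by (rule U_mult[OF k(1) l(1)])
  ultimately show ?case by (intro exI[of _ "k + l"] conjI ballI exI[of _ "v * w"])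
qed

primrec words :: "('a, 'm) ring_scheme \<Rightarrow> 'a set \<Rightarrow> nat \<Rightarrow> 'a set" where
  "words R Y 0 = {\<one>\<^bsub>R\<^esub>}"
| "words R Y (Suc l) = (\<lambda>(y, w). y \<otimes>\<^bsub>R\<^esub> w) ` (Y \<times> words R Y l)"

lemma finite_words: "finite Y \<Longrightarrow> finite (words R Y l)"
  by (induction l) auto

section \<open>The Noetherian condition on superideals, seen on the even and the odd part\<close>

context super_ring
begin

text \<open>The assumptions \<open>JM\<close> and \<open>MJ\<close> are closure under odd
  multiplication in both directions. They allow chains of even ideals or of odd submodules to be
  completed to chains of superideals, to which the Noetherian condition applies.\<close>

lemma superideal_sum:
  assumes J: "ideal J A0" and M: "M \<subseteq> E1" "\<zero> \<in> M" "\<And>a b. a \<in> M \<Longrightarrow> b \<in> M \<Longrightarrow> a \<oplus> b \<in> M"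
      "\<And>a r. a \<in> M \<Longrightarrow> r \<in> E0 \<Longrightarrow> r \<otimes> a \<in> M"
    and JM: "\<And>a y. a \<in> J \<Longrightarrow> y \<in> E1 \<Longrightarrow> a \<otimes> y \<in> M" and MJ: "\<And>b y. b \<in> M \<Longrightarrow> y \<in> E1 \<Longrightarrow> b \<otimes> y \<in> J"
  shows "superideal (J <+>\<^bsub>R\<^esub> M) R" "(J <+>\<^bsub>R\<^esub> M) \<inter> E0 = J" "(J <+>\<^bsub>R\<^esub> M) \<inter> E1 = M"
proof -
  have J': "J \<subseteq> E0" "\<zero> \<in> J" "\<And>a b. a \<in> J \<Longrightarrow> b \<in> J \<Longrightarrow> a \<oplus> b \<in> J" "\<And>a r. a \<in> J \<Longrightarrow> r \<in> E0 \<Longrightarrow> r \<otimes> a \<in> J"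
    using J unfolding ideal_even_iff by auto
  let ?I = "J <+>\<^bsub>R\<^esub> M"
  have I: "x \<in> ?I \<longleftrightarrow> (\<exists>a\<in>J. \<exists>b\<in>M. x = a \<oplus> b)" for x by (auto simp: set_add_def')
  have Jc: "a \<in> J \<Longrightarrow> a \<in> carrier R" and Mc: "b \<in> M \<Longrightarrow> b \<in> carrier R" for a b
    using J' M even_carrier odd_carrier by auto
  have lmult: "r \<otimes> x \<in> ?I \<and> x \<otimes> r \<in> ?I" if x: "x \<in> ?I" and r: "r \<in> carrier R" for r x
  proof -
    obtain a b where ab: "a \<in> J" "b \<in> M" "x = a \<oplus> b" using x I by blast
    obtain s t where st: "s \<in> E0" "t \<in> E1" "r = s \<oplus> t" using parts_decomp[OF r] .
    have c: "a \<in> carrier R" "b \<in> carrier R" "s \<in> carrier R" "t \<in> carrier R" using ab st Jc Mc even_carrier odd_carrier by auto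
    have sa: "s \<otimes> a \<in> J" "s \<otimes> b \<in> M" "a \<otimes> t \<in> M" "b \<otimes> t \<in> J" using ab st J' M JM MJ by auto
    have tb: "t \<otimes> b = \<ominus> (b \<otimes> t)" using odd_anticomm ab st M by blast
    have ideal_neg: "\<ominus> y \<in> J" if "y \<in> J" for y
      using J'(4)[OF that even_uminus[OF one_even]] Jc[OF that] by (simp add: l_minus)
    have ta: "t \<otimes> a = a \<otimes> t" "s \<otimes> a = a \<otimes> s" "s \<otimes> b = b \<otimes> s"
      using even_central[of a t] even_central[of s a] even_central[of s b] ab st J' c by auto
    have "r \<otimes> x = (s \<otimes> a \<oplus> t \<otimes> b) \<oplus> (s \<otimes> b \<oplus> t \<otimes> a)" unfolding ab(3) st(3) using c by algebra
    moreover have "s \<otimes> a \<oplus> t \<otimes> b \<in> J" using sa J'(3) ideal_neg unfolding tb by blast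
    moreover have "s \<otimes> b \<oplus> t \<otimes> a \<in> M" using sa M(3) unfolding ta by auto
    ultimately have 1: "r \<otimes> x \<in> ?I" using I by blast
    have "x \<otimes> r = (a \<otimes> s \<oplus> b \<otimes> t) \<oplus> (b \<otimes> s \<oplus> a \<otimes> t)" unfolding ab(3) st(3) using c by algebra
    moreover have "a \<otimes> s \<oplus> b \<otimes> t \<in> J" using sa J'(3) unfolding ta by auto
    moreover have "b \<otimes> s \<oplus> a \<otimes> t \<in> M" using sa M(3) unfolding ta by auto
    ultimately have "x \<otimes> r \<in> ?I" using I by blast
    then show ?thesis using 1 by blast
  qed
  have ideal: "ideal ?I R"
  proof (rule ideal_criterion)
    show "?I \<subseteq> carrier R" using I Jc Mc by auto
    show "\<zero> \<in> ?I" unfolding I using J'(2) M(2) by (intro bexI[of _ \<zero>]) auto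
    fix x y assume "x \<in> ?I" "y \<in> ?I"
    then obtain a b a' b' where ab: "a \<in> J" "b \<in> M" "x = a \<oplus> b" "a' \<in> J" "b' \<in> M" "y = a' \<oplus> b'" unfolding I by blast
    then have "x \<oplus> y = (a \<oplus> a') \<oplus> (b \<oplus> b')" using Jc Mc by (simp add: a_ac)
    then show "x \<oplus> y \<in> ?I" unfolding I using ab J'(3) M(3) by blast
  qed (use lmult in auto)
  have par: "a \<in> J \<and> b = \<zero>" if "a \<in> J" "b \<in> M" "a \<oplus> b \<in> E0" for a b
  proof -
    have "a \<oplus> b = (a \<oplus> b) \<oplus> \<zero>" using that Jc Mc by simp
    then have "b = \<zero>" using parts_unique(2)[of a "a \<oplus> b" b \<zero>] that odd_zero subsetD[OF J'(1)] subsetD[OF M(1)] by blast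
    then show ?thesis using that by simp
  qed
  have par': "b \<in> M \<and> a = \<zero>" if "a \<in> J" "b \<in> M" "a \<oplus> b \<in> E1" for a b
  proof -
    have "a \<oplus> b = \<zero> \<oplus> (a \<oplus> b)" using that Jc Mc by simp
    then have "a = \<zero>" using parts_unique(1)[of a \<zero> b "a \<oplus> b"] that even_zero subsetD[OF J'(1)] subsetD[OF M(1)] by blast
    then show ?thesis using that by simp
  qed
  show e: "?I \<inter> E0 = J"
  proof
    show "?I \<inter> E0 \<subseteq> J" using par Jc unfolding I by (force simp: I)
    have "a \<in> ?I" if "a \<in> J" for a unfolding I using Jc[OF that] that M(2) by (intro bexI[of _ a] bexI[of _ \<zero>]) auto
    then show "J \<subseteq> ?I \<inter> E0" using J'(1) by blast
  qed
  show o: "?I \<inter> E1 = M"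
  proof
    show "?I \<inter> E1 \<subseteq> M" using par' Mc by (force simp: I)
    have "b \<in> ?I" if "b \<in> M" for b unfolding I using Mc[OF that] that J'(2) by (intro bexI[of _ \<zero>] bexI[of _ b]) auto
    then show "M \<subseteq> ?I \<inter> E1" using M(1) by blast
  qed
  show "superideal ?I R" unfolding superideal_def e o using ideal by simp
qed

text \<open>Every ideal of \<open>R_0\<close> is the even part of a superideal: adjoin the odd
  elements that \<open>R_1\<close> multiplies into it. Products of the ideal with \<open>R_1\<close>
  qualify because a product of two odd elements is an even scalar.\<close>

lemma acc_even:
  assumes noeth: "super_noetherian R"
  shows "acc_above Ker"
  unfolding acc_above_def
proof (intro allI impI)
  fix I :: "nat \<Rightarrow> 'a fcr set" assume I: "\<forall>n. is_ideal (I n) \<and> Ker \<subseteq> I n \<and> I n \<subseteq> I (Suc n)"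
  define J where "J n = ev ` I n" for n
  define M where "M n = {b \<in> E1. \<forall>y\<in>E1. b \<otimes> y \<in> J n}" for n
  have J: "ideal (J n) A0" for n unfolding J_def using I by (intro ideal_image[OF ev_hom]) auto
  have J': "J n \<subseteq> E0" "\<zero> \<in> J n" "a \<in> J n \<Longrightarrow> b \<in> J n \<Longrightarrow> a \<oplus> b \<in> J n" "a \<in> J n \<Longrightarrow> r \<in> E0 \<Longrightarrow> r \<otimes> a \<in> J n" for n a b r
    using J[of n] unfolding ideal_even_iff by auto
  have s: "superideal (J n <+>\<^bsub>R\<^esub> M n) R" "(J n <+>\<^bsub>R\<^esub> M n) \<inter> E0 = J n" for n
  proof -
    have *: "superideal (J n <+>\<^bsub>R\<^esub> M n) R \<and> (J n <+>\<^bsub>R\<^esub> M n) \<inter> E0 = J n"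
    proof (intro conjI superideal_sum(1,2)[OF J])
      show "a \<otimes> y \<in> M n" if "a \<in> J n" "y \<in> E1" for a y
      proof -
        have "a \<in> E0" using that J' by auto
        then have "(a \<otimes> y) \<otimes> z \<in> J n" if "z \<in> E1" for z
          using \<open>y \<in> E1\<close> \<open>a \<in> J n\<close> that J'(4)[of a n "y \<otimes> z"] odd_odd even_central[of a "y \<otimes> z"] even_carrier odd_carrier
          by (simp add: m_assoc)
        then show ?thesis using that \<open>a \<in> E0\<close> even_odd by (simp add: M_def)
      qed
      then show "a \<otimes> y \<in> M n" if "a \<in> J n" "y \<in> E1" for a y using that .
      show "r \<otimes> a \<in> M n" if "a \<in> M n" "r \<in> E0" for a r
        using that J'(4) even_odd even_carrier odd_carrier by (simp add: M_def m_assoc)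
      then show "r \<otimes> a \<in> M n" if "a \<in> M n" "r \<in> E0" for a r using that .
      show "a \<oplus> b \<in> M n" if "a \<in> M n" "b \<in> M n" for a b
        using that J'(3) odd_add odd_carrier by (simp add: M_def l_distr)
      then show "a \<oplus> b \<in> M n" if "a \<in> M n" "b \<in> M n" for a b using that .
    qed (auto simp: M_def odd_zero J' odd_carrier)
    then show "superideal (J n <+>\<^bsub>R\<^esub> M n) R" "(J n <+>\<^bsub>R\<^esub> M n) \<inter> E0 = J n" by auto
  qed
  have "J n \<subseteq> J (Suc n)" for n unfolding J_def using I by blast
  then have "J n <+>\<^bsub>R\<^esub> M n \<subseteq> J (Suc n) <+>\<^bsub>R\<^esub> M (Suc n)" for n unfolding set_add_def' M_def by blast
  then obtain N where N: "\<forall>n\<ge>N. J n <+>\<^bsub>R\<^esub> M n = J N <+>\<^bsub>R\<^esub> M N" using noeth s(1) unfolding super_noetherian_def by meson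
  have "I n = I N" if "n \<ge> N" for n
  proof -
    have "J n = J N" using s(2)[of n] s(2)[of N] N that by (metis (no_types))
    then have "p \<in> I n \<longleftrightarrow> p \<in> I N" for p
      using vimage_image[OF ev_hom, of "I n" p] vimage_image[OF ev_hom, of "I N" p] I by (simp add: J_def Ker_def)
    then show ?thesis by blast
  qed
  then show "\<exists>N. \<forall>n\<ge>N. I n = I N" by blast
qed

lemma E0_carrier: "E0 \<subseteq> carrier R" and E1_carrier: "E1 \<subseteq> carrier R"
  using even_carrier odd_carrier by auto

text \<open>Dually to \<open>acc_even\<close>, an \<open>R_0\<close>-submodule of \<open>R_1\<close>
  is completed by the even elements that multiply \<open>R_1\<close> into it; for \<open>b\<close>
  in the submodule, \<open>b y z = (y z) b\<close> stays there. Adding generators forever would thus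
  give a strictly increasing chain of superideals.\<close>

lemma odd_finitely_generated:
  assumes noeth: "super_noetherian R"
  shows "\<exists>Y. finite Y \<and> Y \<subseteq> E1 \<and> E1 \<subseteq> lsp R E0 Y"
proof (rule ccontr)
  assume no: "\<not> ?thesis"
  then have ex: "\<exists>y. y \<in> E1 \<and> y \<notin> lsp R E0 Y" if "finite Y" "Y \<subseteq> E1" for Y using that by blast
  define nxt where "nxt Y = insert (SOME y. y \<in> E1 \<and> y \<notin> lsp R E0 Y) Y" for Y
  define Y where "Y n = (nxt ^^ n) {}" for n
  have Y: "finite (Y n) \<and> Y n \<subseteq> E1" for n
  proof (induction n)
    case (Suc n)
    from someI_ex[OF ex, of "Y n"] Suc show ?case by (simp add: Y_def nxt_def)
  qed (simp add: Y_def)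
  have new: "\<exists>y\<in>Y (Suc n). y \<notin> lsp R E0 (Y n)" for n
    using someI_ex[OF ex, of "Y n"] Y[of n] by (auto simp: Y_def nxt_def)
  have Yc: "Y n \<subseteq> carrier R" for n using Y[of n] E1_carrier by blast
  define M where "M n = lsp R E0 (Y n)" for n
  define J where "J n = {a \<in> E0. \<forall>y\<in>E1. a \<otimes> y \<in> M n}" for n
  have M_odd: "M n \<subseteq> E1" for n
  proof
    fix t assume "t \<in> M n" then show "t \<in> E1" unfolding M_def
      by (induction rule: lsp.induct) (use Y[of n] in \<open>auto intro: odd_zero odd_add even_odd\<close>)
  qed
  have M_mult: "r \<otimes> a \<in> M n" if "a \<in> M n" "r \<in> E0" for a r n
    using that Yc unfolding M_def by (intro lsp_smult[of a E0]) (auto intro: even_even even_carrier)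
  have M_add: "a \<oplus> b \<in> M n" if "a \<in> M n" "b \<in> M n" for a b n
    using that Yc unfolding M_def by (intro lsp_add E0_carrier)
  have J: "ideal (J n) A0" for n
    unfolding ideal_even_iff J_def
    by (auto simp: even_zero even_add even_even l_distr m_assoc even_carrier odd_carrier M_add M_mult M_def lsp.lsp_zero)
       (use M_add M_mult in \<open>auto simp: M_def\<close>)
  have s: "superideal (J n <+>\<^bsub>R\<^esub> M n) R \<and> (J n <+>\<^bsub>R\<^esub> M n) \<inter> E1 = M n" for n
  proof (intro conjI superideal_sum(1,3)[OF J])
    show bJ: "b \<otimes> y \<in> J n" if b: "b \<in> M n" and y: "y \<in> E1" for b y
    proof -
      have bo: "b \<in> E1" using b M_odd by blast
      have "(b \<otimes> y) \<otimes> z \<in> M n" if z: "z \<in> E1" for z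
      proof -
        have "(b \<otimes> y) \<otimes> z = (y \<otimes> z) \<otimes> b"
          using even_central[of "y \<otimes> z" b] odd_odd[OF y z] bo y z odd_carrier by (simp add: m_assoc)
        then show ?thesis using M_mult[OF b odd_odd[OF y z]] by simp
      qed
      then show ?thesis using odd_odd[OF bo y] by (simp add: J_def)
    qed
    then show "b \<otimes> y \<in> J n" if "b \<in> M n" "y \<in> E1" for b y using that .
    show "\<zero> \<in> M n" by (simp add: M_def lsp.lsp_zero)
    then show "\<zero> \<in> M n" .
  qed (use M_odd M_mult M_add in \<open>auto simp: J_def\<close>)
  have "Y n \<subseteq> Y (Suc n)" for n by (auto simp: Y_def nxt_def)
  then have Msub: "M n \<subseteq> M (Suc n)" for n unfolding M_def by (intro lsp_mono) auto
  then have "J n <+>\<^bsub>R\<^esub> M n \<subseteq> J (Suc n) <+>\<^bsub>R\<^esub> M (Suc n)" for n unfolding set_add_def' J_def by blast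
  then obtain N where N: "\<forall>n\<ge>N. J n <+>\<^bsub>R\<^esub> M n = J N <+>\<^bsub>R\<^esub> M N" using noeth s unfolding super_noetherian_def by meson
  have "J (Suc N) <+>\<^bsub>R\<^esub> M (Suc N) = J N <+>\<^bsub>R\<^esub> M N" by (rule N[rule_format]) simp
  then have "M (Suc N) = M N" using s by metis
  moreover have "y \<in> M (Suc N)" if "y \<in> Y (Suc N)" for y
    using lsp_base[OF one_even that E0_carrier Yc] subsetD[OF Yc that] by (simp add: M_def)
  ultimately show False using new[of N] by (auto simp: M_def)
qed

section \<open>Words in the odd generators and unit forms modulo the square of the odd part\<close>

definition wpar :: "nat \<Rightarrow> 'a set" where "wpar l = (if even l then E0 else E1)"

lemma wpar_carrier: "wpar l \<subseteq> carrier R" using E0_carrier E1_carrier by (simp add: wpar_def)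

lemma wpar_add: "a \<in> wpar l \<Longrightarrow> b \<in> wpar l \<Longrightarrow> a \<oplus> b \<in> wpar l"
  by (simp add: wpar_def even_add odd_add split: if_splits)

lemma wpar_zero: "\<zero> \<in> wpar l" by (simp add: wpar_def even_zero odd_zero)

lemma wpar_even: "a \<in> E0 \<Longrightarrow> b \<in> wpar l \<Longrightarrow> a \<otimes> b \<in> wpar l"
  by (simp add: wpar_def even_even even_odd split: if_splits)

lemma wpar_odd: "a \<in> E1 \<Longrightarrow> b \<in> wpar l \<Longrightarrow> a \<otimes> b \<in> wpar (Suc l)"
  by (simp add: wpar_def odd_even odd_odd split: if_splits)

lemma words_wpar: "Y \<subseteq> E1 \<Longrightarrow> words R Y l \<subseteq> wpar l"
proof (induction l)
  case (Suc l)
  then show ?case using wpar_odd by fastforce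
qed (simp add: wpar_def one_even)

lemma words_carrier: "Y \<subseteq> E1 \<Longrightarrow> words R Y l \<subseteq> carrier R"
  using words_wpar wpar_carrier by blast

lemma lsp_wpar: "C \<subseteq> E0 \<Longrightarrow> W \<subseteq> wpar l \<Longrightarrow> lsp R C W \<subseteq> wpar l"
proof
  fix s assume "s \<in> lsp R C W" "C \<subseteq> E0" "W \<subseteq> wpar l" then show "s \<in> wpar l"
    by induction (auto intro!: wpar_zero wpar_add intro: wpar_even)
qed

text \<open>Expanding \<open>b\<close> in the generators prepends a letter, and even coefficients
  move to the front since they are central. The set \<open>C\<close> is all of \<open>R_0\<close> in
  one use and a step of the filtration in the other.\<close>

lemma odd_mult_lsp:
  assumes Y: "Y \<subseteq> E1" "E1 \<subseteq> lsp R E0 Y" and C: "C \<subseteq> E0" "\<And>a r. a \<in> C \<Longrightarrow> r \<in> E0 \<Longrightarrow> r \<otimes> a \<in> C"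
    and b: "b \<in> E1" and t: "t \<in> lsp R C (words R Y l)"
  shows "b \<otimes> t \<in> lsp R C (words R Y (Suc l))"
proof -
  have Cc: "C \<subseteq> carrier R" using C E0_carrier by blast
  note wc = words_carrier[OF Y(1)]
  have tc: "t \<in> carrier R" using t lsp_closed[OF Cc wc] by blast
  have y: "y \<otimes> t \<in> lsp R C (words R Y (Suc l))" if y: "y \<in> Y" for y
    using t
  proof (induction t rule: lsp.induct)
    case lsp_zero
    have "y \<in> carrier R" using y Y odd_carrier by blast
    then show ?case by (simp add: lsp.lsp_zero)
  next
    case (lsp_step a w s)
    have c: "y \<in> carrier R" "a \<in> carrier R" "w \<in> carrier R" "s \<in> carrier R"
      using y Y odd_carrier lsp_step Cc wc[of l] lsp_closed[OF Cc wc[of l]] by auto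
    have "y \<otimes> (a \<otimes> w \<oplus> s) = (y \<otimes> a) \<otimes> w \<oplus> y \<otimes> s" using c by (simp add: r_distr m_assoc)
    also have "y \<otimes> a = a \<otimes> y" using even_central[of a y] lsp_step C c by auto
    also have "a \<otimes> y \<otimes> w \<oplus> y \<otimes> s = a \<otimes> (y \<otimes> w) \<oplus> y \<otimes> s" using c by (simp add: m_assoc)
    finally show ?case using lsp_step y by (auto intro!: lsp.lsp_step)
  qed
  have "b \<in> lsp R E0 Y" using b Y by blast
  then show ?thesis
  proof (induction b rule: lsp.induct)
    case lsp_zero
    then show ?case using tc by (simp add: lsp.lsp_zero)
  next
    case (lsp_step a y s)
    have c: "y \<in> carrier R" "a \<in> carrier R" "s \<in> carrier R"
      using Y odd_carrier even_carrier lsp_step lsp_closed[OF E0_carrier, of Y] by auto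
    have "(a \<otimes> y \<oplus> s) \<otimes> t = a \<otimes> (y \<otimes> t) \<oplus> s \<otimes> t" using c tc by (simp add: l_distr m_assoc)
    moreover have "a \<otimes> (y \<otimes> t) \<in> lsp R C (words R Y (Suc l))"
      by (rule lsp_smult[OF y[OF lsp_step(2)]]) (use c C lsp_step wc[of "Suc l"] Cc in auto)
    ultimately show ?case using lsp_step.IH by (simp add: lsp_add[OF Cc wc] del: words.simps)
  qed
qed

text \<open>The first two letters are read as a coefficient in \<open>R_1^2\<close>; this is why two
  additional odd factors can be absorbed by the even filtration.\<close>

lemma lsp_words_shift:
  assumes Y: "Y \<subseteq> E1"
  shows "lsp R E0 (words R Y (Suc (Suc l))) \<subseteq> lsp R (odd_sq R) (words R Y l)"
proof
  have O: "odd_sq R \<subseteq> E0" "\<And>a r. a \<in> odd_sq R \<Longrightarrow> r \<in> E0 \<Longrightarrow> r \<otimes> a \<in> odd_sq R"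
    using odd_sq_ideal unfolding ideal_even_iff by auto
  note wc = words_carrier[OF Y]
  fix t assume "t \<in> lsp R E0 (words R Y (Suc (Suc l)))"
  then show "t \<in> lsp R (odd_sq R) (words R Y l)"
  proof (induction rule: lsp.induct)
    case (lsp_step a w s)
    obtain y z v where w: "w = y \<otimes> (z \<otimes> v)" "y \<in> Y" "z \<in> Y" "v \<in> words R Y l" using lsp_step(2) by auto
    have c: "a \<in> carrier R" "y \<in> carrier R" "z \<in> carrier R" "v \<in> carrier R"
      using lsp_step w Y odd_carrier even_carrier wc[of l] by auto
    have "a \<otimes> w = (a \<otimes> (y \<otimes> z)) \<otimes> v" unfolding w(1) using c by (simp add: m_assoc)
    moreover have "y \<otimes> z \<in> odd_sq R" unfolding odd_sq_def using w Y by (intro ideal_prod.prod) auto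
    then have "a \<otimes> (y \<otimes> z) \<in> odd_sq R" using O(2) lsp_step(1) by blast
    ultimately show ?case using lsp_step w by (auto intro: lsp.lsp_step)
  qed (rule lsp.lsp_zero)
qed

text \<open>Modulo \<open>R_1^2\<close> the even part of the superideal is generated by
  \<open>Xs\<close>, so its powers are compared with those of \<open>Xs\<close> only after
  \<open>R_1^2\<close> is added to each step. Correspondingly \<open>Uf\<close> consists of the unit
  forms of degree \<open>k\<close> up to \<open>R_1^2\<close>.\<close>

definition Cf :: "'a fcr list \<Rightarrow> nat \<Rightarrow> 'a fcr set" where
  "Cf Xs k = {f. \<exists>q\<in>Qp Xs k. f - q \<in> Osq}"

definition Uf :: "'a fcr set \<Rightarrow> 'a fcr list \<Rightarrow> nat \<Rightarrow> 'a fcr set" where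
  "Uf mm Xs k = {f. \<exists>\<mu>. length \<mu> = length Xs \<and> sum_list \<mu> = k \<and> (\<exists>g\<in>FF mm Xs \<mu>. f - g \<in> Osq)}"

lemma is_ideal_Cf: "is_ideal (Cf Xs k)"
  unfolding is_ideal_def
proof (intro conjI ballI allI)
  note Q = is_idealD[OF is_ideal_Qp[of Xs k]] and O = is_idealD[OF is_ideal_Osq]
  show "0 \<in> Cf Xs k" unfolding Cf_def using Q(1) O(1) by (auto intro!: bexI[of _ 0])
  show "f + g \<in> Cf Xs k" if f: "f \<in> Cf Xs k" and g: "g \<in> Cf Xs k" for f g
  proof -
    obtain p q where p: "p \<in> Qp Xs k" "f - p \<in> Osq" and q: "q \<in> Qp Xs k" "g - q \<in> Osq" using f g by (auto simp: Cf_def)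
    have "(f + g) - (p + q) \<in> Osq" using O(2)[OF p(2) q(2)] by (simp add: algebra_simps)
    then show ?thesis using Q(2)[OF p(1) q(1)] by (auto simp: Cf_def)
  qed
  show "r * f \<in> Cf Xs k" if f: "f \<in> Cf Xs k" for f r
  proof -
    obtain p where p: "p \<in> Qp Xs k" "f - p \<in> Osq" using f by (auto simp: Cf_def)
    have "r * f - r * p \<in> Osq" using O(3)[OF p(2), of r] by (simp add: algebra_simps)
    then show ?thesis using Q(3)[OF p(1)] by (auto simp: Cf_def)
  qed
qed

lemma Cf_mult: "a \<in> Cf Xs k \<Longrightarrow> b \<in> Cf Xs l \<Longrightarrow> a * b \<in> Cf Xs (k + l)"
proof -
  note O = is_idealD[OF is_ideal_Osq]
  assume "a \<in> Cf Xs k" "b \<in> Cf Xs l"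
  then obtain p q where p: "p \<in> Qp Xs k" "a - p \<in> Osq" and q: "q \<in> Qp Xs l" "b - q \<in> Osq" by (auto simp: Cf_def)
  have "a * b - p * q = a * (b - q) + (a - p) * q" by (simp add: algebra_simps)
  also have "\<dots> \<in> Osq" using O(2)[OF O(3)[OF q(2)] O(4)[OF p(2)]] .
  finally show ?thesis using Qp_mult[OF p(1) q(1)] by (auto simp: Cf_def)
qed

lemma Cf_antimono: "k \<le> l \<Longrightarrow> Cf Xs l \<subseteq> Cf Xs k"
  using Qp_antimono by (fastforce simp: Cf_def)

lemma Uf_Cf: "Uf mm Xs k \<subseteq> Cf Xs k"
  using FF_Qp by (fastforce simp: Uf_def Cf_def)

lemma Uf_one: "1 \<in> Uf mm Xs 0"
proof -
  have "length (replicate (length Xs) (0::nat)) = length Xs" "sum_list (replicate (length Xs) (0::nat)) = 0"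
    by (simp_all add: sum_list_replicate)
  moreover have "(1 :: 'a fcr) - 1 \<in> Osq" using is_idealD(1)[OF is_ideal_Osq] by simp
  ultimately show ?thesis unfolding Uf_def using FF_one by blast
qed

lemma Uf_mult:
  assumes m: "is_ideal mm" and a: "a \<in> Uf mm Xs k" and b: "b \<in> Uf mm Xs l"
  shows "a * b \<in> Uf mm Xs (k + l)"
proof -
  note O = is_idealD[OF is_ideal_Osq]
  obtain \<mu> p where p: "length \<mu> = length Xs" "sum_list \<mu> = k" "p \<in> FF mm Xs \<mu>" "a - p \<in> Osq" using a unfolding Uf_def by blast
  obtain \<nu> q where q: "length \<nu> = length Xs" "sum_list \<nu> = l" "q \<in> FF mm Xs \<nu>" "b - q \<in> Osq" using b unfolding Uf_def by blast
  have "a * b - p * q = a * (b - q) + (a - p) * q" by (simp add: algebra_simps)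
  also have "\<dots> \<in> Osq" using O(2)[OF O(3)[OF q(4)] O(4)[OF p(4)]] .
  finally have "a * b - p * q \<in> Osq" .
  moreover have "p * q \<in> FF mm Xs (padd \<mu> \<nu>)" by (rule FF_mult[OF m p(1) q(1) p(3) q(3)])
  moreover have "length (padd \<mu> \<nu>) = length Xs" "sum_list (padd \<mu> \<nu>) = k + l" using p q by (simp_all add: sum_list_padd)
  ultimately show ?thesis unfolding Uf_def by blast
qed

lemma Uf_diff:
  assumes m: "set Xs \<subseteq> mm" and u: "u \<in> Uf mm Xs k" and a: "a \<in> Cf Xs (Suc k)"
  shows "u - a \<in> Uf mm Xs k"
proof -
  note O = is_idealD[OF is_ideal_Osq]
  obtain \<mu> p where p: "length \<mu> = length Xs" "sum_list \<mu> = k" "p \<in> FF mm Xs \<mu>" "u - p \<in> Osq" using u unfolding Uf_def by blast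
  obtain q where q: "q \<in> Qp Xs (Suc k)" "a - q \<in> Osq" using a by (auto simp: Cf_def)
  have "(u - a) - (p - q) \<in> Osq" using O(6)[OF p(4) q(2)] by (simp add: algebra_simps)
  moreover have "p - q \<in> FF mm Xs \<mu>" using FF_diff[OF m p(3)] q(1) p(2) by simp
  ultimately show ?thesis unfolding Uf_def using p by blast
qed

text \<open>If \<open>u\<close> and \<open>p\<close> differ by a nilpotent, then
  \<open>(p - u) ^ n\<close> vanishes in \<open>R_0\<close> for some \<open>n\<close>, and expanding
  it shows \<open>p ^ n\<close> to be a multiple of \<open>u\<close> there. As a power of a unit
  form, \<open>p ^ n\<close> is one without any error from \<open>R_1^2\<close>.\<close>

lemma Uf_power_FF:
  assumes m: "is_ideal mm" and u: "u \<in> Uf mm Xs k"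
  shows "\<exists>\<mu> f c. length \<mu> = length Xs \<and> f \<in> FF mm Xs \<mu> \<and> f - c * u \<in> Ker"
proof -
  obtain \<mu> p where p: "length \<mu> = length Xs" "p \<in> FF mm Xs \<mu>" "u - p \<in> Osq" using u unfolding Uf_def by blast
  obtain n where n: "(u - p) ^ n \<in> Ker" using Osq_nilpotent[OF p(3)] by blast
  have pow: "\<exists>\<nu>. length \<nu> = length Xs \<and> p ^ n \<in> FF mm Xs \<nu>" for n
  proof (induction n)
    case 0
    show ?case using FF_one by (intro exI[of _ "replicate (length Xs) 0"]) simp
  next
    case (Suc n)
    then obtain \<nu> where "length \<nu> = length Xs" "p ^ n \<in> FF mm Xs \<nu>" by blast
    then show ?case using FF_mult[OF m p(1) _ p(2)] p(1) by (intro exI[of _ "padd \<mu> \<nu>"]) simp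
  qed
  have "\<exists>c. (p - u) ^ n - p ^ n = c * u" for n
  proof (induction n)
    case (Suc n)
    then obtain c where c: "(p - u) ^ n = p ^ n + c * u" by (metis add.commute diff_eq_eq)
    have "(p - u) ^ Suc n - p ^ Suc n = (p * c - p ^ n - c * u) * u" unfolding power_Suc c by (simp add: algebra_simps)
    then show ?case by blast
  qed (auto intro: exI[of _ 0])
  then obtain c where c: "(p - u) ^ n - p ^ n = c * u" by blast
  have "(p - u) ^ n = (- 1) ^ n * (u - p) ^ n" by (simp flip: power_mult_distrib)
  then have "(p - u) ^ n \<in> Ker" using is_idealD(3)[OF is_ideal_Ker n] by simp
  moreover have "p ^ n - (- c) * u = (p - u) ^ n" using c by (simp add: algebra_simps)
  ultimately show ?thesis using pow[of n] by metis
qed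

end

section \<open>The bigraded super-ring\<close>

context ring
begin

lemma finsum_Sigma:
  assumes "finite A" "\<And>a. a \<in> A \<Longrightarrow> finite (B a)" "\<And>a b. a \<in> A \<Longrightarrow> b \<in> B a \<Longrightarrow> f a b \<in> carrier R"
  shows "(\<Oplus>a\<in>A. \<Oplus>b\<in>B a. f a b) = (\<Oplus>p\<in>Sigma A B. f (fst p) (snd p))"
  using assms
proof (induction A)
  case (insert a A)
  have S: "Sigma (insert a A) B = Pair a ` B a \<union> Sigma A B" by auto
  have "(\<Oplus>p\<in>Pair a ` B a. f (fst p) (snd p)) = (\<Oplus>b\<in>B a. f (fst (a, b)) (snd (a, b)))"
    using insert by (intro finsum_reindex) (auto simp: inj_on_def)
  then have 1: "(\<Oplus>p\<in>Pair a ` B a. f (fst p) (snd p)) = (\<Oplus>b\<in>B a. f a b)" by simp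
  have "(\<Oplus>p\<in>Sigma (insert a A) B. f (fst p) (snd p)) =
      (\<Oplus>p\<in>Pair a ` B a. f (fst p) (snd p)) \<oplus> (\<Oplus>p\<in>Sigma A B. f (fst p) (snd p))"
    unfolding S using insert by (intro finsum_Un_disjoint) auto
  also have "\<dots> = (\<Oplus>b\<in>B a. f a b) \<oplus> (\<Oplus>a\<in>A. \<Oplus>b\<in>B a. f a b)" unfolding 1 using insert by simp
  also have "\<dots> = (\<Oplus>a\<in>insert a A. \<Oplus>b\<in>B a. f a b)"
    using insert by (intro finsum_insert[symmetric]) (auto intro!: finsum_closed)
  finally show ?case ..
qed simp

end

abbreviation below :: "nat \<times> nat \<Rightarrow> (nat \<times> nat) set" where
  "below u \<equiv> {..fst u} \<times> {..snd u}"

abbreviation pminus :: "nat \<times> nat \<Rightarrow> nat \<times> nat \<Rightarrow> nat \<times> nat" where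
  "pminus u v \<equiv> (fst u - fst v, snd u - snd v)"

text \<open>The product of \<open>bgr\<close> on the level of representatives: the ring laws are
  proved for families in \<open>R\<close> and then passed on to their classes.\<close>

definition conv :: "('a, 'm) ring_scheme \<Rightarrow> (nat \<times> nat \<Rightarrow> 'a) \<Rightarrow> (nat \<times> nat \<Rightarrow> 'a) \<Rightarrow> nat \<times> nat \<Rightarrow> 'a" where
  "conv R p q u = finsum R (\<lambda>v. p v \<otimes>\<^bsub>R\<^esub> q (pminus u v)) (below u)"

context ring
begin

lemma conv_closed: "range p \<subseteq> carrier R \<Longrightarrow> range q \<subseteq> carrier R \<Longrightarrow> conv R p q u \<in> carrier R"
proof -
  assume "range p \<subseteq> carrier R" "range q \<subseteq> carrier R"
  then have [simp]: "p v \<in> carrier R" "q v \<in> carrier R" for v by auto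
  show ?thesis unfolding conv_def by (intro finsum_closed) auto
qed

lemma conv_assoc:
  assumes p: "range p \<subseteq> carrier R" and q: "range q \<subseteq> carrier R" and r: "range r \<subseteq> carrier R"
  shows "conv R (conv R p q) r u = conv R p (conv R q r) u"
proof -
  have c [simp]: "p v \<in> carrier R" "q v \<in> carrier R" "r v \<in> carrier R" for v using assms by auto
  let ?S = "Sigma (below u) below" and ?T = "Sigma (below u) (\<lambda>v. below (pminus u v))"
  let ?f = "\<lambda>v w. p w \<otimes> q (pminus v w) \<otimes> r (pminus u v)" and ?g = "\<lambda>v w. p v \<otimes> (q w \<otimes> r (pminus (pminus u v) w))"
  have "conv R (conv R p q) r u = (\<Oplus>v\<in>below u. \<Oplus>w\<in>below v. ?f v w)"
    unfolding conv_def by (intro finsum_cong' refl finsum_ldistr Pi_I finsum_closed) auto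
  also have "\<dots> = (\<Oplus>z\<in>?S. ?f (fst z) (snd z))" by (intro finsum_Sigma) auto
  also have "\<dots> = (\<Oplus>z\<in>?T. ?g (fst z) (snd z))"
  proof -
    \<comment> \<open>The pair of summation indices \<open>(v, w)\<close> is traded for
      \<open>(v + w, v)\<close>, which matches the two ways of bracketing three factors.\<close>
    let ?h = "\<lambda>z. ((fst (fst z) + fst (snd z), snd (fst z) + snd (snd z)), fst z)"
    have im: "?h ` ?T = ?S"
    proof (intro equalityI subsetI)
      fix z assume "z \<in> ?S"
      then obtain a b c d where "z = ((a, b), (c, d))" "a \<le> fst u" "b \<le> snd u" "c \<le> a" "d \<le> b" by auto
      then show "z \<in> ?h ` ?T" by (intro image_eqI[of _ _ "((c, d), (a - c, b - d))"]) auto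
    qed auto
    have "(\<Oplus>z\<in>?h ` ?T. ?f (fst z) (snd z)) = (\<Oplus>z\<in>?T. ?f (fst (?h z)) (snd (?h z)))"
      by (intro finsum_reindex) (auto simp: inj_on_def)
    also have "\<dots> = (\<Oplus>z\<in>?T. ?g (fst z) (snd z))"
      by (intro finsum_cong' refl Pi_I) (auto simp: m_assoc)
    finally show ?thesis unfolding im .
  qed
  also have "\<dots> = (\<Oplus>v\<in>below u. \<Oplus>w\<in>below (pminus u v). ?g v w)" by (intro finsum_Sigma[symmetric]) auto
  also have "\<dots> = conv R p (conv R q r) u"
    unfolding conv_def by (intro finsum_cong' refl finsum_rdistr[symmetric] Pi_I) (auto intro!: finsum_closed)
  finally show ?thesis .
qed

lemma conv_add_left:
  assumes "range p \<subseteq> carrier R" "range q \<subseteq> carrier R" "range r \<subseteq> carrier R"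
  shows "conv R (\<lambda>v. p v \<oplus> q v) r u = conv R p r u \<oplus> conv R q r u"
proof -
  have c [simp]: "p v \<in> carrier R" "q v \<in> carrier R" "r v \<in> carrier R" for v using assms by auto
  have "conv R (\<lambda>v. p v \<oplus> q v) r u = (\<Oplus>v\<in>below u. p v \<otimes> r (pminus u v) \<oplus> q v \<otimes> r (pminus u v))"
    unfolding conv_def by (intro finsum_cong' refl Pi_I) (auto simp: l_distr)
  also have "\<dots> = conv R p r u \<oplus> conv R q r u" unfolding conv_def by (intro finsum_addf) auto
  finally show ?thesis .
qed

lemma conv_add_right:
  assumes "range p \<subseteq> carrier R" "range q \<subseteq> carrier R" "range r \<subseteq> carrier R"
  shows "conv R r (\<lambda>v. p v \<oplus> q v) u = conv R r p u \<oplus> conv R r q u"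
proof -
  have c [simp]: "p v \<in> carrier R" "q v \<in> carrier R" "r v \<in> carrier R" for v using assms by auto
  have "conv R r (\<lambda>v. p v \<oplus> q v) u = (\<Oplus>v\<in>below u. r v \<otimes> p (pminus u v) \<oplus> r v \<otimes> q (pminus u v))"
    unfolding conv_def by (intro finsum_cong' refl Pi_I) (auto simp: r_distr)
  also have "\<dots> = conv R r p u \<oplus> conv R r q u" unfolding conv_def by (intro finsum_addf) auto
  finally show ?thesis .
qed

definition hom_elt :: "nat \<times> nat \<Rightarrow> 'a \<Rightarrow> nat \<times> nat \<Rightarrow> 'a" where
  "hom_elt v a = (\<lambda>u. if u = v then a else \<zero>)"

lemma range_hom_elt: "a \<in> carrier R \<Longrightarrow> range (hom_elt v a) \<subseteq> carrier R"
  by (auto simp: hom_elt_def)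

lemma conv_hom_left:
  assumes a: "a \<in> carrier R" and q: "range q \<subseteq> carrier R"
  shows "conv R (hom_elt v a) q u = (if v \<in> below u then a \<otimes> q (pminus u v) else \<zero>)"
proof -
  have c [simp]: "q v \<in> carrier R" for v using assms by auto
  have "conv R (hom_elt v a) q u = (\<Oplus>w\<in>below u. if w = v then a \<otimes> q (pminus u w) else \<zero>)"
    unfolding conv_def hom_elt_def using a by (intro finsum_cong' refl Pi_I) auto
  also have "\<dots> = (if v \<in> below u then a \<otimes> q (pminus u v) else \<zero>)"
  proof (cases "v \<in> below u")
    case True
    have "(\<Oplus>w\<in>below u. if w = v then a \<otimes> q (pminus u w) else \<zero>) = a \<otimes> q (pminus u v)"
      using add.finprod_singleton_swap[of v "below u" "\<lambda>w. a \<otimes> q (pminus u w)"] True a by auto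
    then show ?thesis using True by simp
  next
    case False
    have "(\<Oplus>w\<in>below u. if w = v then a \<otimes> q (pminus u w) else \<zero>) = (\<Oplus>w\<in>below u. \<zero>)"
      using False a by (intro finsum_cong' refl Pi_I) auto
    also have "\<dots> = \<zero>" by (rule finsum_zero)
    finally show ?thesis using False by simp
  qed
  finally show ?thesis .
qed

lemma conv_one_right:
  assumes q: "range q \<subseteq> carrier R"
  shows "conv R q (hom_elt (0, 0) \<one>) u = q u"
proof -
  have c [simp]: "q v \<in> carrier R" for v using assms by auto
  have "conv R q (hom_elt (0, 0) \<one>) u = (\<Oplus>w\<in>below u. if w = u then q w else \<zero>)"
    unfolding conv_def hom_elt_def by (intro finsum_cong' refl Pi_I) (auto simp: prod_eq_iff)
  also have "\<dots> = q u" by (intro add.finprod_singleton_swap) (auto simp: mem_Times_iff)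
  finally show ?thesis .
qed

end

context super_ring
begin

lemma conv_commute:
  assumes p: "range p \<subseteq> E0" and q: "range q \<subseteq> carrier R"
  shows "conv R p q u = conv R q p u"
proof -
  have c [simp]: "p v \<in> carrier R" "q v \<in> carrier R" for v using assms even_carrier by auto
  have "p v \<in> E0" for v using p by blast
  then have ec: "q w \<otimes> p v = p v \<otimes> q w" for v w by (rule even_central[symmetric]) simp
  let ?h = "\<lambda>v. pminus u v"
  have im: "?h ` below u = below u"
  proof (intro equalityI subsetI)
    fix z assume "z \<in> below u"
    then show "z \<in> ?h ` below u" by (intro image_eqI[of _ _ "pminus u z"]) auto
  qed auto
  have "conv R q p u = (\<Oplus>v\<in>?h ` below u. q v \<otimes> p (pminus u v))" unfolding im conv_def ..
  also have "\<dots> = (\<Oplus>v\<in>below u. q (?h v) \<otimes> p (pminus u (?h v)))"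
    by (intro finsum_reindex) (auto simp: inj_on_def)
  also have "\<dots> = conv R p q u" unfolding conv_def
    by (intro finsum_cong' refl Pi_I) (auto simp: ec)
  finally show ?thesis ..
qed

end

section \<open>The bifiltration and its multiplicativity\<close>

locale bigraded = super_ring +
  fixes I assumes I_ideal: "ideal I R"
begin

abbreviation "F0 \<equiv> \<lambda>J. ideal_prod R (I \<inter> E0) J"
abbreviation "F1 \<equiv> \<lambda>J. ideal_prod R (I \<inter> E1) J"

lemma I_carrier: "I \<inter> E0 \<subseteq> carrier R" "I \<inter> E1 \<subseteq> carrier R"
  using E0_carrier E1_carrier by auto

lemma I_zero: "\<zero> \<in> I" using additive_subgroup.zero_closed[OF ideal.axioms(1)[OF I_ideal]] .

lemma ideal_props:
  assumes "ideal J R"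
  shows "J \<subseteq> carrier R" "\<zero> \<in> J" "a \<in> J \<Longrightarrow> b \<in> J \<Longrightarrow> a \<oplus> b \<in> J" "a \<in> J \<Longrightarrow> r \<in> carrier R \<Longrightarrow> r \<otimes> a \<in> J"
    "a \<in> J \<Longrightarrow> r \<in> carrier R \<Longrightarrow> a \<otimes> r \<in> J" "a \<in> J \<Longrightarrow> \<ominus> a \<in> J"
proof -
  interpret J: ideal J R by fact
  show "J \<subseteq> carrier R" "\<zero> \<in> J" "a \<in> J \<Longrightarrow> b \<in> J \<Longrightarrow> a \<oplus> b \<in> J" "a \<in> J \<Longrightarrow> r \<in> carrier R \<Longrightarrow> r \<otimes> a \<in> J"
    "a \<in> J \<Longrightarrow> r \<in> carrier R \<Longrightarrow> a \<otimes> r \<in> J" "a \<in> J \<Longrightarrow> \<ominus> a \<in> J"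
    by (fact J.a_subset additive_subgroup.zero_closed[OF J.is_additive_subgroup]
      additive_subgroup.a_closed[OF J.is_additive_subgroup] J.I_l_closed J.I_r_closed subgroup_uminus[OF J.is_additive_subgroup])+
qed

text \<open>The set \<open>G\<close> is only the even or the odd part of an ideal. That the products
  absorb scalars from \<open>R\<close> rests on \<open>l\<close>: a scalar moves past
  \<open>x\<close>, up to a sign on its odd part, and is absorbed by \<open>J\<close>.\<close>

lemma ip_ideal:
  assumes G: "G \<subseteq> carrier R" "\<zero> \<in> G" and J: "ideal J R"
    and l: "\<And>r x j. r \<in> carrier R \<Longrightarrow> x \<in> G \<Longrightarrow> j \<in> J \<Longrightarrow> r \<otimes> (x \<otimes> j) \<in> ideal_prod R G J"
  shows "ideal (ideal_prod R G J) R" "ideal_prod R G J \<subseteq> J"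
proof -
  note Jp = ideal_props[OF J]
  have Jc: "j \<in> J \<Longrightarrow> j \<in> carrier R" for j using Jp(1) by blast
  show sub: "ideal_prod R G J \<subseteq> J"
  proof
    fix s assume "s \<in> ideal_prod R G J" then show "s \<in> J"
      by (induction rule: ideal_prod.induct) (use Jp G in auto)
  qed
  show "ideal (ideal_prod R G J) R"
  proof (rule ideal_criterion)
    show "ideal_prod R G J \<subseteq> carrier R" using sub Jp(1) by blast
    show "\<zero> \<in> ideal_prod R G J" using ideal_prod.prod[OF G(2) Jp(2), of R] by simp
    show "s \<oplus> t \<in> ideal_prod R G J" if "s \<in> ideal_prod R G J" "t \<in> ideal_prod R G J" for s t
      using that by (rule ideal_prod.sum)
    fix s r assume s: "s \<in> ideal_prod R G J" and r: "r \<in> carrier R"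
    show "r \<otimes> s \<in> ideal_prod R G J" using s
    proof (induction rule: ideal_prod.induct)
      case (sum s t)
      then have "s \<in> carrier R" "t \<in> carrier R" using sub Jp(1) by auto
      then show ?case using sum r by (simp add: r_distr ideal_prod.sum)
    qed (use l r in blast)
    show "s \<otimes> r \<in> ideal_prod R G J" using s
    proof (induction rule: ideal_prod.induct)
      case (sum s t)
      then have "s \<in> carrier R" "t \<in> carrier R" using sub Jp(1) by auto
      then show ?case using sum r by (simp add: l_distr ideal_prod.sum)
    next
      case (prod x j)
      have "x \<otimes> (j \<otimes> r) \<in> ideal_prod R G J" using prod Jp(5) r by (intro ideal_prod.prod) auto
      moreover have "x \<in> carrier R" "j \<in> carrier R" using prod G Jc by auto
      ultimately show ?case using r by (simp add: m_assoc)
    qed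
  qed
qed

lemma F0_ideal: assumes J: "ideal J R" shows "ideal (F0 J) R" "F0 J \<subseteq> J"
proof -
  have l: "r \<otimes> (x \<otimes> j) \<in> F0 J" if "r \<in> carrier R" "x \<in> I \<inter> E0" "j \<in> J" for r x j
  proof -
    have c: "x \<in> carrier R" "j \<in> carrier R" using that E0_carrier ideal_props(1)[OF J] by auto
    have "r \<otimes> (x \<otimes> j) = (r \<otimes> x) \<otimes> j" using c that by (simp add: m_assoc)
    also have "r \<otimes> x = x \<otimes> r" using even_central[of x r] that by auto
    also have "x \<otimes> r \<otimes> j = x \<otimes> (r \<otimes> j)" using c that by (simp add: m_assoc)
    also have "\<dots> \<in> F0 J" using that ideal_props(4)[OF J] by (intro ideal_prod.prod) auto
    finally show ?thesis .
  qed
  have z: "\<zero> \<in> I \<inter> E0" using I_zero even_zero by blast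
  show "ideal (F0 J) R" "F0 J \<subseteq> J" using ip_ideal[OF I_carrier(1) z J l] by auto
qed

lemma F1_ideal: assumes J: "ideal J R" shows "ideal (F1 J) R" "F1 J \<subseteq> J"
proof -
  have l: "r \<otimes> (x \<otimes> j) \<in> F1 J" if rc: "r \<in> carrier R" and xI: "x \<in> I \<inter> E1" and jJ: "j \<in> J" for r x j
  proof -
    obtain a b where r: "a \<in> E0" "b \<in> E1" "r = a \<oplus> b" using parts_decomp[OF rc] .
    have c: "x \<in> carrier R" "j \<in> carrier R" "a \<in> carrier R" "b \<in> carrier R"
      using that r E0_carrier E1_carrier ideal_props(1)[OF J] by auto
    have 1: "a \<otimes> x = x \<otimes> a" using even_central[OF r(1) c(1)] .
    have "x \<in> E1" using xI by blast
    then have 2: "b \<otimes> x = \<ominus> (x \<otimes> b)" by (rule odd_anticomm[OF r(2)])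
    have "r \<otimes> (x \<otimes> j) = (a \<otimes> x) \<otimes> j \<oplus> (b \<otimes> x) \<otimes> j" unfolding r(3) using c by (simp add: l_distr m_assoc)
    also have "\<dots> = x \<otimes> (a \<otimes> j \<oplus> \<ominus> (b \<otimes> j))" unfolding 1 2 using c by (simp add: m_assoc r_distr r_minus l_minus)
    also have "\<dots> \<in> F1 J"
      using xI ideal_props(4)[OF J jJ c(3)] ideal_props(6)[OF J ideal_props(4)[OF J jJ c(4)]]
      by (intro ideal_prod.prod ideal_props(3)[OF J])
    finally show ?thesis .
  qed
  have z: "\<zero> \<in> I \<inter> E1" using I_zero odd_zero by blast
  show "ideal (F1 J) R" "F1 J \<subseteq> J" using ip_ideal[OF I_carrier(2) z J l] by auto
qed

lemma F0_pow_ideal: "ideal J R \<Longrightarrow> ideal ((F0 ^^ k) J) R"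
  by (induction k) (auto intro: F0_ideal)

lemma F1_pow_ideal: "ideal J R \<Longrightarrow> ideal ((F1 ^^ k) J) R"
  by (induction k) (auto intro: F1_ideal)

lemma ip_mono: "J \<subseteq> J' \<Longrightarrow> ideal_prod R G J \<subseteq> ideal_prod R G J'"
proof
  fix s assume "s \<in> ideal_prod R G J" "J \<subseteq> J'" then show "s \<in> ideal_prod R G J'"
    by (induction rule: ideal_prod.induct) (auto intro: ideal_prod.intros)
qed

lemma F0_pow_mono: "J \<subseteq> J' \<Longrightarrow> (F0 ^^ k) J \<subseteq> (F0 ^^ k) J'"
  by (induction k) (auto dest: ip_mono)

text \<open>Even elements are central, so odd factors can be moved behind even ones. This makes the
  bifiltration multiplicative although its definition puts all even factors in front.\<close>

lemma F1_F0: assumes J: "ideal J R" shows "F1 (F0 J) \<subseteq> F0 (F1 J)"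
proof
  fix s assume "s \<in> F1 (F0 J)" then show "s \<in> F0 (F1 J)"
  proof (induction rule: ideal_prod.induct)
    case (prod y t)
    have y: "y \<in> carrier R" "y \<in> I \<inter> E1" using prod E1_carrier by auto
    have "t \<in> carrier R \<and> y \<otimes> t \<in> F0 (F1 J)" using prod(2)
    proof (induction rule: ideal_prod.induct)
      case (prod x j)
      have c: "x \<in> carrier R" "j \<in> carrier R" using prod E0_carrier ideal_props(1)[OF J] by auto
      have "y \<otimes> (x \<otimes> j) = (y \<otimes> x) \<otimes> j" using c y by (simp add: m_assoc)
      also have "y \<otimes> x = x \<otimes> y" using even_central[of x y] prod y by auto
      also have "x \<otimes> y \<otimes> j = x \<otimes> (y \<otimes> j)" using c y by (simp add: m_assoc)
      also have "\<dots> \<in> F0 (F1 J)" using prod y by (intro ideal_prod.prod) auto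
      finally show ?case using c by simp
    next
      case (sum s t)
      then show ?case using y by (simp add: r_distr ideal_prod.sum)
    qed
    then show ?case ..
  qed (rule ideal_prod.sum)
qed

lemma F1_F0_pow: "ideal J R \<Longrightarrow> F1 ((F0 ^^ k) J) \<subseteq> (F0 ^^ k) (F1 J)"
proof (induction k)
  case (Suc k)
  have "F1 (F0 ((F0 ^^ k) J)) \<subseteq> F0 (F1 ((F0 ^^ k) J))" using F1_F0 F0_pow_ideal Suc.prems by blast
  also have "\<dots> \<subseteq> F0 ((F0 ^^ k) (F1 J))" using Suc by (intro ip_mono) auto
  finally show ?case by simp
qed simp

lemma F1_pow_F0_pow: "ideal J R \<Longrightarrow> (F1 ^^ l) ((F0 ^^ k) J) \<subseteq> (F0 ^^ k) ((F1 ^^ l) J)"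
proof (induction l)
  case (Suc l)
  have "F1 ((F1 ^^ l) ((F0 ^^ k) J)) \<subseteq> F1 ((F0 ^^ k) ((F1 ^^ l) J))" using Suc by (intro ip_mono) auto
  also have "\<dots> \<subseteq> (F0 ^^ k) (F1 ((F1 ^^ l) J))" using F1_F0_pow F1_pow_ideal Suc.prems by blast
  finally show ?case by simp
qed simp

lemma ip_right:
  assumes "s \<in> ideal_prod R G J" "G \<subseteq> carrier R" "J \<subseteq> carrier R" "b \<in> carrier R"
    and "\<And>j. j \<in> J \<Longrightarrow> j \<otimes> b \<in> J'"
  shows "s \<otimes> b \<in> ideal_prod R G J'"
proof -
  have "s \<in> carrier R \<and> s \<otimes> b \<in> ideal_prod R G J'" using assms(1)
  proof (induction rule: ideal_prod.induct)
    case (prod x j)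
    then have "x \<in> carrier R" "j \<in> carrier R" using assms by auto
    then show ?case using prod assms by (auto simp: m_assoc intro: ideal_prod.prod)
  next
    case (sum s t)
    then show ?case using assms(4) by (simp add: l_distr ideal_prod.sum)
  qed
  then show ?thesis ..
qed

abbreviation "BB \<equiv> bipow R I"
abbreviation "NN \<equiv> bipow_next R I"

lemma BB_ideal: "ideal (BB k l) R"
  unfolding bipow_def by (intro F0_pow_ideal F1_pow_ideal oneideal)

lemma BB_mult: "a \<in> BB k l \<Longrightarrow> b \<in> BB k' l' \<Longrightarrow> a \<otimes> b \<in> BB (k + k') (l + l')"
proof -
  assume a: "a \<in> BB k l" and b: "b \<in> BB k' l'"
  have bc: "b \<in> carrier R" using b ideal_props(1)[OF BB_ideal] by blast
  let ?J = "BB k' l'"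
  have 1: "s \<otimes> b \<in> (F1 ^^ l) ?J" if "s \<in> (F1 ^^ l) (carrier R)" for s l
    using that
  proof (induction l arbitrary: s)
    case 0
    then show ?case using b ideal_props(4)[OF BB_ideal] by auto
  next
    case (Suc l)
    have "(F1 ^^ l) (carrier R) \<subseteq> carrier R" using ideal_props(1)[OF F1_pow_ideal[OF oneideal]] .
    then show ?case using Suc I_carrier bc by (auto intro!: ip_right[where J = "(F1 ^^ l) (carrier R)"])
  qed
  have 2: "s \<otimes> b \<in> (F0 ^^ k) ((F1 ^^ l) ?J)" if "s \<in> (F0 ^^ k) ((F1 ^^ l) (carrier R))" for s k
    using that
  proof (induction k arbitrary: s)
    case 0
    then show ?case using 1 by auto
  next
    case (Suc k)
    have "(F0 ^^ k) ((F1 ^^ l) (carrier R)) \<subseteq> carrier R" using ideal_props(1)[OF F0_pow_ideal[OF F1_pow_ideal[OF oneideal]]] .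
    then show ?case using Suc I_carrier bc by (auto intro!: ip_right[where J = "(F0 ^^ k) ((F1 ^^ l) (carrier R))"])
  qed
  have "a \<otimes> b \<in> (F0 ^^ k) ((F1 ^^ l) ?J)" using a unfolding bipow_def[of R I k l] by (rule 2)
  also have "\<dots> \<subseteq> (F0 ^^ k) ((F0 ^^ k') ((F1 ^^ l) ((F1 ^^ l') (carrier R))))"
    unfolding bipow_def by (intro F0_pow_mono F1_pow_F0_pow F1_pow_ideal oneideal)
  also have "\<dots> = BB (k + k') (l + l')" unfolding bipow_def by (simp add: funpow_add)
  finally show ?thesis .
qed

lemma BB_Suc_left: "BB (Suc k) l \<subseteq> BB k l"
  unfolding bipow_def by (simp add: F0_ideal(2)[OF F0_pow_ideal[OF F1_pow_ideal[OF oneideal]]])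

lemma BB_Suc_right: "BB k (Suc l) \<subseteq> BB k l"
  unfolding bipow_def using F0_pow_mono[OF F1_ideal(2)[OF F1_pow_ideal[OF oneideal]]] by simp

lemma BB_0_0: "BB 0 0 = carrier R" by (simp add: bipow_def)

lemma BB_1_0: "x \<in> I \<inter> E0 \<Longrightarrow> x \<in> BB 1 0"
  using ideal_prod.prod[of x "I \<inter> E0" \<one> "carrier R" R] E0_carrier by (auto simp: bipow_def)

lemma BB_0_1: "y \<in> I \<inter> E1 \<Longrightarrow> y \<in> BB 0 1"
  using ideal_prod.prod[of y "I \<inter> E1" \<one> "carrier R" R] E1_carrier by (auto simp: bipow_def)

lemma NN_ideal: "ideal (NN k l) R"
  unfolding bipow_next_def by (intro add_ideals BB_ideal)

lemma NN_iff: "x \<in> NN k l \<longleftrightarrow> (\<exists>a\<in>BB (Suc k) l. \<exists>b\<in>BB k (Suc l). x = a \<oplus> b)"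
  by (auto simp: bipow_next_def set_add_def')

lemma NN_BB: "NN k l \<subseteq> BB k l"
  using BB_Suc_left BB_Suc_right ideal_props(3)[OF BB_ideal] by (fastforce simp: NN_iff)

lemma NN_mult_left: "a \<in> NN k l \<Longrightarrow> b \<in> BB k' l' \<Longrightarrow> a \<otimes> b \<in> NN (k + k') (l + l')"
proof -
  assume "a \<in> NN k l" and b: "b \<in> BB k' l'"
  then obtain s t where st: "s \<in> BB (Suc k) l" "t \<in> BB k (Suc l)" "a = s \<oplus> t" unfolding NN_iff by blast
  have "s \<in> carrier R" "t \<in> carrier R" "b \<in> carrier R" using st b ideal_props(1)[OF BB_ideal] by auto
  then have "a \<otimes> b = s \<otimes> b \<oplus> t \<otimes> b" using st by (simp add: l_distr)
  then show ?thesis unfolding NN_iff using BB_mult[OF st(1) b] BB_mult[OF st(2) b] by auto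
qed

lemma NN_mult_right: "a \<in> BB k l \<Longrightarrow> b \<in> NN k' l' \<Longrightarrow> a \<otimes> b \<in> NN (k + k') (l + l')"
proof -
  assume a: "a \<in> BB k l" and "b \<in> NN k' l'"
  then obtain s t where st: "s \<in> BB (Suc k') l'" "t \<in> BB k' (Suc l')" "b = s \<oplus> t" unfolding NN_iff by blast
  have "s \<in> carrier R" "t \<in> carrier R" "a \<in> carrier R" using st a ideal_props(1)[OF BB_ideal] by auto
  then have "a \<otimes> b = a \<otimes> s \<oplus> a \<otimes> t" using st by (simp add: r_distr)
  then show ?thesis unfolding NN_iff using BB_mult[OF a st(1)] BB_mult[OF a st(2)] by auto
qed

end

section \<open>Representing families and the ring structure of \<open>bgr\<close>\<close>

context bigraded
begin

abbreviation "S \<equiv> bgr R I"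
abbreviation "BP \<equiv> \<lambda>u. BB (fst u) (snd u)"
abbreviation "NP \<equiv> \<lambda>u. NN (fst u) (snd u)"

definition cl :: "nat \<times> nat \<Rightarrow> 'a \<Rightarrow> 'a set" where "cl u a = NP u +> a"
definition cls :: "(nat \<times> nat \<Rightarrow> 'a) \<Rightarrow> nat \<times> nat \<Rightarrow> 'a set" where "cls p = (\<lambda>u. cl u (p u))"

lemma BP_carrier: "BP u \<subseteq> carrier R" using ideal_props(1)[OF BB_ideal] .

lemma cl_eq_iff: "a \<in> carrier R \<Longrightarrow> b \<in> carrier R \<Longrightarrow> cl u a = cl u b \<longleftrightarrow> a \<ominus> b \<in> NP u"
  unfolding cl_def using quotient_eq_iff_same_a_r_cos[OF NN_ideal] by simp

lemma cl_zero: "cl u \<zero> = NP u"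
  unfolding cl_def using ideal_props(1)[OF NN_ideal] by (simp add: a_coset_add_zero)

lemma cl_eq_zero_iff: "a \<in> carrier R \<Longrightarrow> cl u a = NP u \<longleftrightarrow> a \<in> NP u"
  using cl_eq_iff[of a \<zero> u] by (simp add: cl_zero a_minus_def)

lemma comp_group: "comm_group (bgr_comp R I u)"
  and comp_carrier: "carrier (bgr_comp R I u) = cl u ` BP u"
  and comp_mult: "a \<in> carrier R \<Longrightarrow> b \<in> carrier R \<Longrightarrow> cl u a \<otimes>\<^bsub>bgr_comp R I u\<^esub> cl u b = cl u (a \<oplus> b)"
  and comp_one: "\<one>\<^bsub>bgr_comp R I u\<^esub> = NP u"
proof -
  let ?G = "add_monoid (R\<lparr>carrier := BP u\<rparr>)"
  have c: "bgr_comp R I u = ?G Mod NP u" by (cases u) (simp add: bgr_comp_def)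
  note Bp = ideal_props[OF BB_ideal[of "fst u" "snd u"]] and Np = ideal_props[OF NN_ideal[of "fst u" "snd u"]]
  have Gg: "comm_group ?G"
  proof (rule comm_groupI)
    show "\<exists>y\<in>carrier ?G. y \<otimes>\<^bsub>?G\<^esub> x = \<one>\<^bsub>?G\<^esub>" if "x \<in> carrier ?G" for x
      using that Bp(6)[of x] subsetD[OF Bp(1), of x] by (intro bexI[of _ "\<ominus> x"]) (auto simp: l_neg)
  qed (use Bp(2,3) subsetD[OF Bp(1)] in \<open>auto simp: a_ac\<close>)
  then interpret G: comm_group ?G .
  have sub: "subgroup (NP u) ?G"
  proof (rule G.subgroupI)
    show "inv\<^bsub>?G\<^esub> a \<in> NP u" if "a \<in> NP u" for a
    proof -
      have "a \<in> BP u" "\<ominus> a \<in> BP u" using that NN_BB Bp(6) by auto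
      then have "inv\<^bsub>?G\<^esub> a = \<ominus> a" using subsetD[OF Bp(1)] by (intro G.inv_equality) (auto simp: l_neg)
      then show ?thesis using Np(6)[OF that] by simp
    qed
  qed (use NN_BB[of "fst u" "snd u"] Np(2,3) in auto)
  show "comm_group (bgr_comp R I u)" unfolding c by (rule G.abelian_FactGroup[OF sub])
  show "carrier (bgr_comp R I u) = cl u ` BP u" unfolding c
    by (auto simp: FactGroup_def RCOSETS_def r_coset_def cl_def a_r_coset_def)
  show "\<one>\<^bsub>bgr_comp R I u\<^esub> = NP u" unfolding c by (simp add: FactGroup_def)
  assume ab: "a \<in> carrier R" "b \<in> carrier R"
  interpret N: ideal "NP u" R by (rule NN_ideal)
  have "cl u a \<otimes>\<^bsub>bgr_comp R I u\<^esub> cl u b = cl u a <+>\<^bsub>R\<^esub> cl u b" unfolding c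
    by (simp add: FactGroup_def set_add_def set_mult_def)
  also have "\<dots> = cl u (a \<oplus> b)" unfolding cl_def using N.a_rcos_sum ab by simp
  finally show "cl u a \<otimes>\<^bsub>bgr_comp R I u\<^esub> cl u b = cl u (a \<oplus> b)" .
qed

text \<open>Families of representatives, through which elements of \<open>bgr\<close> are handled;
  finite support reflects the direct sum.\<close>

definition good :: "(nat \<times> nat \<Rightarrow> 'a) \<Rightarrow> bool" where
  "good p \<longleftrightarrow> (\<forall>u. p u \<in> BP u) \<and> finite {u. p u \<noteq> \<zero>}"

lemma good_carrier: "good p \<Longrightarrow> range p \<subseteq> carrier R"
  using BP_carrier by (fastforce simp: good_def)

lemma good_BP: "good p \<Longrightarrow> p u \<in> BP u"
  unfolding good_def by blast

lemma good_closed: "good p \<Longrightarrow> p u \<in> carrier R" using good_carrier by blast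

lemma S_simps: "monoid.mult S = bgr_mult R I" "ring.zero S = \<one>\<^bsub>bgr_add R I\<^esub>" "ring.add S = (\<otimes>\<^bsub>bgr_add R I\<^esub>)"
  "carrier S = carrier (bgr_add R I)" "even_part S = bgr_part R I E0" "odd_part S = bgr_part R I E1"
  by (simp_all add: bgr_def)

lemma bgr_add_carrier: "carrier (bgr_add R I) = {f. (\<forall>u. f u \<in> cl u ` BP u) \<and> finite {u. f u \<noteq> NP u}}"
proof -
  have "carrier (bgr_add R I) = {x \<in> \<Pi>\<^sub>E i\<in>UNIV. carrier (bgr_comp R I i). finite {i \<in> UNIV. x i \<noteq> \<one>\<^bsub>bgr_comp R I i\<^esub>}}"
    unfolding bgr_add_def by (rule carrier_sum_group) (rule comm_group.axioms(2)[OF comp_group])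
  then show ?thesis by (auto simp: comp_carrier comp_one PiE_def Pi_def)
qed

lemma cls_closed: "good p \<Longrightarrow> cls p \<in> carrier S"
proof -
  assume p: "good p"
  have "{u. cls p u \<noteq> NP u} \<subseteq> {u. p u \<noteq> \<zero>}" using cl_zero by (auto simp: cls_def)
  then show ?thesis using p by (auto simp: S_simps bgr_add_carrier good_def cls_def dest: finite_subset)
qed

lemma carrier_rep:
  assumes f: "f \<in> carrier S" and H: "\<zero> \<in> H" "\<And>u. \<exists>a\<in>BP u \<inter> H. f u = cl u a"
  shows "\<exists>p. good p \<and> range p \<subseteq> H \<and> f = cls p"
proof -
  \<comment> \<open>Trivial classes are represented by zero; an arbitrary choice could destroy
    finiteness of the support.\<close>
  define p where "p u = (if f u = NP u then \<zero> else SOME a. a \<in> BP u \<inter> H \<and> f u = cl u a)" for u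
  have p: "p u \<in> BP u \<inter> H \<and> f u = cl u (p u)" for u
  proof (cases "f u = NP u")
    case True
    then show ?thesis using H(1) ideal_props(2)[OF BB_ideal] by (simp add: p_def cl_zero)
  next
    case False
    have "\<exists>a. a \<in> BP u \<inter> H \<and> f u = cl u a" using H(2) by blast
    from someI_ex[OF this] show ?thesis using False by (simp add: p_def)
  qed
  have "{u. p u \<noteq> \<zero>} \<subseteq> {u. f u \<noteq> NP u}" by (auto simp: p_def)
  then have "finite {u. p u \<noteq> \<zero>}" using f by (auto simp: S_simps bgr_add_carrier dest: finite_subset)
  then have "good p" using p by (simp add: good_def)
  moreover have "f = cls p" using p by (auto simp: cls_def)
  ultimately show ?thesis using p by blast
qed

lemma carrier_repE:
  assumes f: "f \<in> carrier S"
  obtains p where "good p" "f = cls p"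
proof -
  have "\<exists>a\<in>BP u \<inter> carrier R. f u = cl u a" for u
    using f BP_carrier by (fastforce simp: S_simps bgr_add_carrier)
  from carrier_rep[OF f zero_closed this] show ?thesis using that by blast
qed

lemma part_iff: "f \<in> bgr_part R I H \<longleftrightarrow> f \<in> carrier S \<and> (\<forall>u. \<exists>a\<in>BP u \<inter> H. f u = cl u a)"
  by (auto simp: bgr_part_def S_simps cl_def)

lemma cls_add: "good p \<Longrightarrow> good q \<Longrightarrow> cls p \<oplus>\<^bsub>S\<^esub> cls q = cls (\<lambda>u. p u \<oplus> q u)"
  by (auto simp: S_simps bgr_add_def cls_def comp_mult good_closed)

lemma cls_zero: "\<zero>\<^bsub>S\<^esub> = cls (\<lambda>u. \<zero>)"
  by (auto simp: S_simps bgr_add_def cls_def cl_zero comp_one)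

lemma cls_one: "\<one>\<^bsub>S\<^esub> = cls (hom_elt (0, 0) \<one>)"
proof -
  have "\<one>\<^bsub>S\<^esub> = (\<lambda>(k, l). if (k, l) = (0, 0) then NN 0 0 +> \<one> else NN k l)" by (simp add: bgr_def)
  then show ?thesis by (auto simp: fun_eq_iff cls_def hom_elt_def cl_zero) (simp_all add: cl_def)
qed

lemma finprod_comp:
  assumes "finite T" "\<And>v. v \<in> T \<Longrightarrow> c v \<in> BP u"
  shows "finprod (bgr_comp R I u) (\<lambda>v. cl u (c v)) T = cl u (finsum R c T)"
  using assms
proof (induction T)
  case empty
  interpret C: comm_group "bgr_comp R I u" by (rule comp_group)
  show ?case by (simp add: comp_one cl_zero)
next
  case (insert v T)
  interpret C: comm_group "bgr_comp R I u" by (rule comp_group)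
  have car: "c w \<in> carrier R" if "w \<in> insert v T" for w using insert.prems[OF that] BP_carrier by blast
  have "finprod (bgr_comp R I u) (\<lambda>v. cl u (c v)) (insert v T) = cl u (c v) \<otimes>\<^bsub>bgr_comp R I u\<^esub> cl u (finsum R c T)"
    using insert by (subst C.finprod_insert) (auto simp: comp_carrier)
  also have "\<dots> = cl u (c v \<oplus> finsum R c T)" using car by (intro comp_mult finsum_closed) auto
  also have "c v \<oplus> finsum R c T = finsum R c (insert v T)" using insert car by (intro finsum_insert[symmetric]) auto
  finally show ?case .
qed

text \<open>\<open>rcoset_mult\<close> is a union over all pairs of representatives. All cosets in
  it agree, since changing a factor by the next step of its bidegree changes the product by the next
  step of the total bidegree.\<close>

lemma rcoset_mult_cl:
  assumes a: "a \<in> BP v" and b: "b \<in> BP w" and u: "u = (fst v + fst w, snd v + snd w)"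
  shows "rcoset_mult R (NP u) (cl v a) (cl w b) = cl u (a \<otimes> b)"
proof -
  have c: "a \<in> carrier R" "b \<in> carrier R" using subsetD[OF BP_carrier a] subsetD[OF BP_carrier b] .
  have eq: "NP u +> (x \<otimes> y) = cl u (a \<otimes> b)" if x: "x \<in> cl v a" and y: "y \<in> cl w b" for x y
  proof -
    obtain s where s: "s \<in> NP v" "x = s \<oplus> a" using x by (auto simp: cl_def a_r_coset_def r_coset_def)
    obtain t where t: "t \<in> NP w" "y = t \<oplus> b" using y by (auto simp: cl_def a_r_coset_def r_coset_def)
    have st: "s \<in> carrier R" "t \<in> carrier R" using s t ideal_props(1)[OF NN_ideal] by auto
    have e: "x \<otimes> y \<ominus> a \<otimes> b = s \<otimes> y \<oplus> a \<otimes> t" unfolding s t using st c by algebra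
    have "y \<in> BP w" using t NN_BB b ideal_props(3)[OF BB_ideal] by blast
    then have "s \<otimes> y \<in> NP u" using NN_mult_left[OF s(1)] u by simp
    moreover have "a \<otimes> t \<in> NP u" using NN_mult_right[OF a t(1)] u by simp
    ultimately have "x \<otimes> y \<ominus> a \<otimes> b \<in> NP u" unfolding e by (rule ideal_props(3)[OF NN_ideal])
    then show ?thesis using cl_eq_iff[of "x \<otimes> y" "a \<otimes> b" u] st c s t by (simp add: cl_def)
  qed
  have "a \<in> cl v a" "b \<in> cl w b"
    unfolding cl_def using c ideal_props(2)[OF NN_ideal] by (force simp: a_r_coset_def r_coset_def)+
  then show ?thesis unfolding rcoset_mult_def using eq by blast
qed

lemma cls_mult:
  assumes p: "good p" and q: "good q"
  shows "cls p \<otimes>\<^bsub>S\<^esub> cls q = cls (conv R p q)"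
proof
  fix u
  interpret C: comm_group "bgr_comp R I u" by (rule comp_group)
  have BP: "p v \<otimes> q (pminus u v) \<in> BP u" if "v \<in> below u" for v
    using BB_mult[of "p v" "fst v" "snd v" "q (pminus u v)" "fst (pminus u v)" "snd (pminus u v)"] p q that by (auto simp: good_def)
  have "(cls p \<otimes>\<^bsub>S\<^esub> cls q) u = finprod (bgr_comp R I u)
       (\<lambda>v. rcoset_mult R (NP u) (cls p v) (cls q (pminus u v))) (below u)"
    by (cases u) (simp add: S_simps bgr_mult_def split_def)
  also have "\<dots> = finprod (bgr_comp R I u) (\<lambda>v. cl u (p v \<otimes> q (pminus u v))) (below u)"
  proof (rule C.finprod_cong')
    show "rcoset_mult R (NP u) (cls p v) (cls q (pminus u v)) = cl u (p v \<otimes> q (pminus u v))" if "v \<in> below u" for v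
      unfolding cls_def using p q that by (intro rcoset_mult_cl) (auto simp: good_def)
  qed (use BP in \<open>auto simp: comp_carrier\<close>)
  also have "\<dots> = cl u (conv R p q u)" unfolding conv_def by (rule finprod_comp) (use BP in auto)
  finally show "(cls p \<otimes>\<^bsub>S\<^esub> cls q) u = cls (conv R p q) u" by (simp add: cls_def)
qed

lemma finsum_in:
  assumes "finite T" "\<And>v. v \<in> T \<Longrightarrow> c v \<in> H" "H \<subseteq> carrier R" "\<zero> \<in> H" "\<And>a b. a \<in> H \<Longrightarrow> b \<in> H \<Longrightarrow> a \<oplus> b \<in> H"
  shows "finsum R c T \<in> H"
  using assms(1,2)
proof (induction T)
  case (insert v T)
  have "finsum R c (insert v T) = c v \<oplus> finsum R c T" using insert assms(3) by (intro finsum_insert) auto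
  then show ?case using insert assms(5) by simp
qed (simp add: assms(4))

lemma good_conv:
  assumes p: "good p" and q: "good q"
  shows "good (conv R p q)"
  unfolding good_def
proof (intro conjI allI)
  fix u
  have BP: "p v \<otimes> q (pminus u v) \<in> BP u" if "v \<in> below u" for v
    using BB_mult[of "p v" "fst v" "snd v" "q (pminus u v)" "fst (pminus u v)" "snd (pminus u v)"] p q that by (auto simp: good_def)
  show "conv R p q u \<in> BP u" unfolding conv_def
    by (rule finsum_in[OF _ BP BP_carrier]) (auto intro: ideal_props(2,3)[OF BB_ideal])
next
  let ?A = "{u. p u \<noteq> \<zero>}" and ?B = "{u. q u \<noteq> \<zero>}"
  have "{u. conv R p q u \<noteq> \<zero>} \<subseteq> (\<lambda>(v, w). (fst v + fst w, snd v + snd w)) ` (?A \<times> ?B)"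
  proof
    fix u assume "u \<in> {u. conv R p q u \<noteq> \<zero>}"
    then have nz: "conv R p q u \<noteq> \<zero>" by simp
    have "\<exists>v\<in>below u. p v \<otimes> q (pminus u v) \<noteq> \<zero>"
    proof (rule ccontr)
      assume "\<not> ?thesis"
      then have "conv R p q u = (\<Oplus>v\<in>below u. \<zero>)" unfolding conv_def by (intro finsum_cong' refl) auto
      then show False using nz by simp
    qed
    then obtain v where v: "v \<in> below u" "p v \<otimes> q (pminus u v) \<noteq> \<zero>" by blast
    then have "p v \<noteq> \<zero>" "q (pminus u v) \<noteq> \<zero>" using good_closed[OF p] good_closed[OF q] by auto
    then show "u \<in> (\<lambda>(v, w). (fst v + fst w, snd v + snd w)) ` (?A \<times> ?B)"
      using v by (intro image_eqI[of _ _ "(v, pminus u v)"]) (auto simp: prod_eq_iff mem_Times_iff)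
  qed
  then show "finite {u. conv R p q u \<noteq> \<zero>}"
    using p q by (auto simp: good_def intro: finite_subset)
qed

lemma good_hom_elt: "a \<in> BP v \<Longrightarrow> good (hom_elt v a)"
  using ideal_props(2)[OF BB_ideal] by (auto simp: good_def hom_elt_def)

lemma good_add: "good p \<Longrightarrow> good q \<Longrightarrow> good (\<lambda>u. p u \<oplus> q u)"
proof -
  assume p: "good p" and q: "good q"
  have "{u. p u \<oplus> q u \<noteq> \<zero>} \<subseteq> {u. p u \<noteq> \<zero>} \<union> {u. q u \<noteq> \<zero>}" by auto
  then show ?thesis using p q ideal_props(3)[OF BB_ideal] by (auto simp: good_def intro: finite_subset)
qed

lemma good_uminus: "good p \<Longrightarrow> good (\<lambda>u. \<ominus> p u)"
proof -
  assume p: "good p"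
  have "{u. \<ominus> p u \<noteq> \<zero>} \<subseteq> {u. p u \<noteq> \<zero>}" by auto
  then show ?thesis using p ideal_props(6)[OF BB_ideal] by (auto simp: good_def intro: finite_subset)
qed

lemma good_zero: "good (\<lambda>u. \<zero>)"
  using ideal_props(2)[OF BB_ideal] by (simp add: good_def)

lemma good_one: "good (hom_elt (0, 0) \<one>)"
  by (rule good_hom_elt) (simp add: BB_0_0)

lemma ring_S: "ring S"
proof (rule ringI)
  show "abelian_group S"
  proof (rule abelian_groupI)
    fix x y z assume xyz: "x \<in> carrier S" "y \<in> carrier S" "z \<in> carrier S"
    obtain p q r where p: "good p" "x = cls p" and q: "good q" "y = cls q" and r: "good r" "z = cls r"
      using xyz by (meson carrier_repE)
    note g = good_closed[OF p(1)] good_closed[OF q(1)] good_closed[OF r(1)]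
    show "x \<oplus>\<^bsub>S\<^esub> y \<in> carrier S" using p q by (simp add: cls_add good_add cls_closed)
    show "x \<oplus>\<^bsub>S\<^esub> y \<oplus>\<^bsub>S\<^esub> z = x \<oplus>\<^bsub>S\<^esub> (y \<oplus>\<^bsub>S\<^esub> z)" using p q r g by (simp add: cls_add good_add a_assoc)
    show "x \<oplus>\<^bsub>S\<^esub> y = y \<oplus>\<^bsub>S\<^esub> x" using p q g by (simp add: cls_add a_comm)
    show "\<zero>\<^bsub>S\<^esub> \<oplus>\<^bsub>S\<^esub> x = x" using p g by (simp add: cls_zero cls_add good_zero)
    show "\<exists>y\<in>carrier S. y \<oplus>\<^bsub>S\<^esub> x = \<zero>\<^bsub>S\<^esub>"
      using p g by (intro bexI[of _ "cls (\<lambda>u. \<ominus> p u)"]) (auto simp: cls_zero cls_add good_uminus l_neg cls_closed)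
  qed (simp add: cls_zero cls_closed good_zero)
  show "Group.monoid S"
  proof (rule monoidI)
    fix x y z assume xyz: "x \<in> carrier S" "y \<in> carrier S" "z \<in> carrier S"
    obtain p q r where p: "good p" "x = cls p" and q: "good q" "y = cls q" and r: "good r" "z = cls r"
      using xyz by (meson carrier_repE)
    show "x \<otimes>\<^bsub>S\<^esub> y \<in> carrier S" using p q by (simp add: cls_mult good_conv cls_closed)
    have "conv R (conv R p q) r = conv R p (conv R q r)"
      using conv_assoc[OF good_carrier[OF p(1)] good_carrier[OF q(1)] good_carrier[OF r(1)]] by (rule ext)
    then show "x \<otimes>\<^bsub>S\<^esub> y \<otimes>\<^bsub>S\<^esub> z = x \<otimes>\<^bsub>S\<^esub> (y \<otimes>\<^bsub>S\<^esub> z)" using p q r by (simp add: cls_mult good_conv)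
    have "conv R (hom_elt (0, 0) \<one>) p = p"
      using conv_hom_left[OF one_closed good_carrier[OF p(1)], of "(0, 0)"] good_closed[OF p(1)] by (auto simp: fun_eq_iff)
    then show "\<one>\<^bsub>S\<^esub> \<otimes>\<^bsub>S\<^esub> x = x" using p by (simp add: cls_one cls_mult good_one)
    have "conv R p (hom_elt (0, 0) \<one>) = p" using conv_one_right[OF good_carrier[OF p(1)]] by (rule ext)
    then show "x \<otimes>\<^bsub>S\<^esub> \<one>\<^bsub>S\<^esub> = x" using p by (simp add: cls_one cls_mult good_one)
  qed (simp add: cls_one cls_closed good_one)
  fix x y z assume xyz: "x \<in> carrier S" "y \<in> carrier S" "z \<in> carrier S"
  obtain p q r where p: "good p" "x = cls p" and q: "good q" "y = cls q" and r: "good r" "z = cls r"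
    using xyz by (meson carrier_repE)
  note gc = good_carrier[OF p(1)] good_carrier[OF q(1)] good_carrier[OF r(1)]
  have "conv R (\<lambda>v. p v \<oplus> q v) r = (\<lambda>u. conv R p r u \<oplus> conv R q r u)"
    using conv_add_left[OF gc] by (rule ext)
  then show "(x \<oplus>\<^bsub>S\<^esub> y) \<otimes>\<^bsub>S\<^esub> z = x \<otimes>\<^bsub>S\<^esub> z \<oplus>\<^bsub>S\<^esub> y \<otimes>\<^bsub>S\<^esub> z" using p q r by (simp add: cls_mult cls_add good_add good_conv)
  have "conv R r (\<lambda>v. p v \<oplus> q v) = (\<lambda>u. conv R r p u \<oplus> conv R r q u)"
    using conv_add_right[OF gc] by (rule ext)
  then show "z \<otimes>\<^bsub>S\<^esub> (x \<oplus>\<^bsub>S\<^esub> y) = z \<otimes>\<^bsub>S\<^esub> x \<oplus>\<^bsub>S\<^esub> z \<otimes>\<^bsub>S\<^esub> y" using p q r by (simp add: cls_mult cls_add good_add good_conv)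
qed

lemma conv_in:
  assumes "\<And>v w. p v \<otimes> q w \<in> H" "H \<subseteq> carrier R" "\<zero> \<in> H" "\<And>a b. a \<in> H \<Longrightarrow> b \<in> H \<Longrightarrow> a \<oplus> b \<in> H"
  shows "range (conv R p q) \<subseteq> H"
proof (intro image_subsetI)
  fix u
  show "conv R p q u \<in> H" unfolding conv_def by (rule finsum_in[OF _ assms(1-4)]) simp
qed

lemma even_S: "even_part S = bgr_part R I E0" and odd_S: "odd_part S = bgr_part R I E1"
  by (simp_all add: bgr_def)

lemma part_carrier: "bgr_part R I H \<subseteq> carrier S"
  by (auto simp: part_iff)

lemma even_S_iff: "f \<in> even_part S \<longleftrightarrow> (\<exists>p. good p \<and> range p \<subseteq> E0 \<and> f = cls p)"
proof
  assume "f \<in> even_part S"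
  then show "\<exists>p. good p \<and> range p \<subseteq> E0 \<and> f = cls p"
    unfolding even_S part_iff using carrier_rep[OF _ even_zero, of f] by blast
next
  assume "\<exists>p. good p \<and> range p \<subseteq> E0 \<and> f = cls p"
  then obtain p where p: "good p" "range p \<subseteq> E0" "f = cls p" by blast
  have "\<exists>a\<in>BP u \<inter> E0. f u = cl u a" for u
    using p good_BP[OF p(1), of u] by (intro bexI[of _ "p u"]) (auto simp: cls_def)
  then show "f \<in> even_part S" unfolding even_S part_iff using cls_closed p by simp
qed

lemma odd_S_rep: "f \<in> odd_part S \<Longrightarrow> \<exists>p. good p \<and> range p \<subseteq> E1 \<and> f = cls p"
  unfolding odd_S part_iff using carrier_rep[OF _ odd_zero, of f] by blast

lemma odd_S_I:
  assumes p: "good p" "range p \<subseteq> E1"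
  shows "cls p \<in> odd_part S"
proof -
  have "\<exists>a\<in>BP u \<inter> E1. cls p u = cl u a" for u
    using p good_BP[OF p(1), of u] by (intro bexI[of _ "p u"]) (auto simp: cls_def)
  then show ?thesis unfolding odd_S part_iff using cls_closed p by simp
qed

lemma cring_even_S: "cring (even_ring S)"
proof -
  interpret S: ring S by (rule ring_S)
  have sub: "even_part S \<subseteq> carrier S" unfolding even_S by (rule part_carrier)
  have ring: "ring (even_ring S)" unfolding even_ring_def
  proof (rule S.subring_is_ring)
    show "subring (even_part S) S"
    proof (rule S.subringI[OF sub])
      show "\<one>\<^bsub>S\<^esub> \<in> even_part S" unfolding even_S_iff
      proof (intro exI[of _ "hom_elt (0, 0) \<one>"] conjI good_one cls_one)
        show "range (hom_elt (0, 0) \<one>) \<subseteq> E0" using one_even even_zero by (auto simp: hom_elt_def)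
      qed
      fix f g assume "f \<in> even_part S" "g \<in> even_part S"
      then obtain p q where p: "good p" "range p \<subseteq> E0" "f = cls p" and q: "good q" "range q \<subseteq> E0" "g = cls q"
        unfolding even_S_iff by blast
      have pe: "p v \<in> E0" "q v \<in> E0" for v using p q by auto
      show "f \<otimes>\<^bsub>S\<^esub> g \<in> even_part S" unfolding even_S_iff
        using p q pe conv_in[of p q E0] even_even E0_carrier even_zero even_add
        by (intro exI[of _ "conv R p q"]) (auto simp: cls_mult good_conv)
      show "f \<oplus>\<^bsub>S\<^esub> g \<in> even_part S" unfolding even_S_iff
        using p q pe even_add by (intro exI[of _ "\<lambda>u. p u \<oplus> q u"]) (auto simp: cls_add good_add)
      have "cls (\<lambda>u. \<ominus> p u) \<oplus>\<^bsub>S\<^esub> f = \<zero>\<^bsub>S\<^esub>"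
        using p good_closed[OF p(1)] by (simp add: cls_zero cls_add good_uminus l_neg)
      then have "\<ominus>\<^bsub>S\<^esub> f = cls (\<lambda>u. \<ominus> p u)" using p by (intro S.minus_equality) (auto simp: cls_closed good_uminus)
      then show "\<ominus>\<^bsub>S\<^esub> f \<in> even_part S" unfolding even_S_iff
        using p pe even_uminus good_uminus by (intro exI[of _ "\<lambda>u. \<ominus> p u"]) auto
    qed
  qed
  have comm: "f \<otimes>\<^bsub>S\<^esub> g = g \<otimes>\<^bsub>S\<^esub> f" if fg: "f \<in> even_part S" "g \<in> even_part S" for f g
  proof -
    obtain p q where p: "good p" "range p \<subseteq> E0" "f = cls p" and q: "good q" "range q \<subseteq> E0" "g = cls q"
      using fg unfolding even_S_iff by blast
    have "conv R p q = conv R q p" using conv_commute[OF p(2) good_carrier[OF q(1)]] by (rule ext)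
    then show "f \<otimes>\<^bsub>S\<^esub> g = g \<otimes>\<^bsub>S\<^esub> f" using p q by (simp add: cls_mult)
  qed
  show ?thesis
    by (rule cring.intro[OF ring monoid.monoid_comm_monoidI[OF ring.is_monoid[OF ring]]])
      (simp add: even_ring_def comm)
qed

lemma even_ann_ideal:
  assumes f: "f \<in> carrier S"
  shows "ideal (even_ann S f) (even_ring S)"
proof -
  interpret S: ring S by (rule ring_S)
  interpret T: cring "even_ring S" by (rule cring_even_S)
  have simps: "carrier (even_ring S) = even_part S" "monoid.mult (even_ring S) = monoid.mult S"
    "ring.add (even_ring S) = ring.add S" "ring.zero (even_ring S) = ring.zero S" by (simp_all add: even_ring_def)
  have sub: "even_part S \<subseteq> carrier S" unfolding even_S by (rule part_carrier)
  show ?thesis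
  proof (rule T.ideal_criterion)
    show "even_ann S f \<subseteq> carrier (even_ring S)" by (auto simp: even_ann_def simps)
    show "\<zero>\<^bsub>even_ring S\<^esub> \<in> even_ann S f" using T.zero_closed f by (simp add: even_ann_def simps)
    show "a \<oplus>\<^bsub>even_ring S\<^esub> b \<in> even_ann S f" if "a \<in> even_ann S f" "b \<in> even_ann S f" for a b
      using that T.a_closed[of a b] f subsetD[OF sub] by (auto simp: even_ann_def simps S.l_distr)
    show r: "r \<otimes>\<^bsub>even_ring S\<^esub> a \<in> even_ann S f" if "a \<in> even_ann S f" "r \<in> carrier (even_ring S)" for a r
      using that T.m_closed[of r a] f subsetD[OF sub] by (auto simp: even_ann_def simps S.m_assoc)
    show "a \<otimes>\<^bsub>even_ring S\<^esub> r \<in> even_ann S f" if "a \<in> even_ann S f" "r \<in> carrier (even_ring S)" for a r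
      using r[OF that] T.m_comm[of a r] that by (simp add: even_ann_def simps)
  qed
qed

end

section \<open>Special superideals\<close>

text \<open>What is retained of a special superideal: \<open>Xs\<close> are lifts of the parameters,
  and \<open>I_Cf\<close> says that they generate its even part modulo \<open>R_1^2\<close>.\<close>

locale special_bgr = bigraded R I for R :: "('a, 'm) superring_scheme" (structure) and I :: "'a set" +
  fixes m :: "'a set" and Xs :: "'a fcr list" and Y :: "'a set"
  assumes loc: "noeth_local Ker {p. ev p \<in> m} Xs"
    and odd_I: "E1 \<subseteq> I"
    and Xs_I: "p \<in> set Xs \<Longrightarrow> ev p \<in> I"
    and I_Cf: "ev p \<in> I \<Longrightarrow> p \<in> Cf Xs 1"
    and Y: "finite Y" "Y \<subseteq> E1" "E1 \<subseteq> lsp R E0 Y"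
begin

abbreviation "mm \<equiv> {p. ev p \<in> m}"
abbreviation "W \<equiv> words R Y"
abbreviation "Lk k l \<equiv> lsp R (ev ` Cf Xs k) (W l)"

lemma ev_Cf: "ev ` Cf Xs k \<subseteq> E0" "ev ` Cf Xs k \<subseteq> carrier R" by auto

lemma ev_Cf_mult:
  assumes "a \<in> ev ` Cf Xs k" "r \<in> E0"
  shows "r \<otimes> a \<in> ev ` Cf Xs k"
proof -
  obtain p where p: "p \<in> Cf Xs k" "a = ev p" using assms(1) by blast
  obtain q where q: "ev q = r" using ev_surj[OF assms(2)] ..
  have "q * p \<in> Cf Xs k" by (rule is_idealD(3)[OF is_ideal_Cf p(1)])
  then show ?thesis using p(2) q by (auto simp flip: ev_mult)
qed

lemma Cf_0: "ev ` Cf Xs 0 = E0"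
proof -
  have "p - p \<in> Osq" for p :: "'a fcr" using is_idealD(1)[OF is_ideal_Osq] by simp
  then have "Cf Xs 0 = UNIV" unfolding Cf_def Qp_0 by blast
  then show ?thesis using ev_surj by fastforce
qed

lemma odd_sq_Cf: "odd_sq R \<subseteq> ev ` Cf Xs k"
proof
  fix a assume a: "a \<in> odd_sq R"
  then have "a \<in> E0" using odd_sq_ideal unfolding ideal_even_iff by blast
  then obtain p where p: "ev p = a" using ev_surj by blast
  then have "p - 0 \<in> Osq" using a by (simp add: Osq_def)
  then have "p \<in> Cf Xs k" unfolding Cf_def using is_idealD(1)[OF is_ideal_Qp] by blast
  then show "a \<in> ev ` Cf Xs k" using p by blast
qed

lemma W_carrier: "W l \<subseteq> carrier R" by (rule words_carrier[OF Y(2)])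
lemma W_wpar: "W l \<subseteq> wpar l" by (rule words_wpar[OF Y(2)])
lemma Lk_wpar: "Lk k l \<subseteq> wpar l" by (rule lsp_wpar[OF ev_Cf(1) W_wpar])
lemma Lk_carrier: "Lk k l \<subseteq> carrier R" by (rule lsp_closed[OF ev_Cf(2) W_carrier])
lemma Lk_add: "a \<in> Lk k l \<Longrightarrow> b \<in> Lk k l \<Longrightarrow> a \<oplus> b \<in> Lk k l" by (rule lsp_add[OF ev_Cf(2) W_carrier])

text \<open>The trailing factor \<open>R\<close>, split as \<open>R_0 + R_1\<close>, contributes at
  most one further odd letter. Hence only words of length \<open>l\<close> and \<open>Suc l\<close>
  occur, and these have different parity.\<close>

lemma BB_sub: "r \<in> BB k l \<Longrightarrow> \<exists>s\<in>Lk k l. \<exists>t\<in>Lk k (Suc l). r = s \<oplus> t"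
proof -
  let ?P = "\<lambda>k l r. \<exists>s\<in>Lk k l. \<exists>t\<in>Lk k (Suc l). r = s \<oplus> t"
  have P_add: "?P k l (r \<oplus> r')" if r: "?P k l r" and r': "?P k l r'" for k l r r'
  proof -
    obtain s t s' t' where *: "s \<in> Lk k l" "t \<in> Lk k (Suc l)" "r = s \<oplus> t" "s' \<in> Lk k l" "t' \<in> Lk k (Suc l)" "r' = s' \<oplus> t'"
      using r r' by blast
    have "s \<in> carrier R" "t \<in> carrier R" "s' \<in> carrier R" "t' \<in> carrier R"
      using subsetD[OF Lk_carrier *(1)] subsetD[OF Lk_carrier *(2)] subsetD[OF Lk_carrier *(4)] subsetD[OF Lk_carrier *(5)] .
    then have "r \<oplus> r' = (s \<oplus> s') \<oplus> (t \<oplus> t')" unfolding *(3,6) by (simp add: a_ac)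
    then show ?thesis using Lk_add[OF *(1,4)] Lk_add[OF *(2,5)] by blast
  qed
  have P0: "?P 0 l r" if "r \<in> (F1 ^^ l) (carrier R)" for l r
    using that
  proof (induction l arbitrary: r)
    case 0
    then obtain a b where r: "a \<in> E0" "b \<in> E1" "r = a \<oplus> b" using parts_decomp[of r] by auto
    have "a \<otimes> \<one> \<in> Lk 0 0" unfolding Cf_0 using r E0_carrier by (intro lsp_base) auto
    then have a: "a \<in> Lk 0 0" using r even_carrier by simp
    have "Y \<subseteq> W 1"
    proof
      fix y assume y: "y \<in> Y"
      then have "y \<otimes> \<one> = y" using Y odd_carrier by (intro r_one) blast
      moreover have "y \<otimes> \<one> \<in> W (Suc 0)" using y unfolding words.simps by (auto intro!: imageI)
      ultimately show "y \<in> W 1" by simp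
    qed
    then have "lsp R E0 Y \<subseteq> lsp R E0 (W 1)" by (intro lsp_mono) auto
    then have "b \<in> Lk 0 (Suc 0)" unfolding Cf_0 using r Y by auto
    then show ?case using a r by blast
  next
    case (Suc l)
    then have "r \<in> ideal_prod R (I \<inter> E1) ((F1 ^^ l) (carrier R))" by simp
    then show ?case
    proof (induction rule: ideal_prod.induct)
      case (prod y j)
      obtain s t where st: "s \<in> Lk 0 l" "t \<in> Lk 0 (Suc l)" "j = s \<oplus> t" using Suc.IH[OF prod(2)] by blast
      have y: "y \<in> E1" "y \<in> carrier R" using prod odd_carrier by auto
      have "y \<otimes> j = y \<otimes> s \<oplus> y \<otimes> t" unfolding st(3) by (rule r_distr[OF subsetD[OF Lk_carrier st(1)] subsetD[OF Lk_carrier st(2)] y(2)])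
      moreover have "y \<otimes> s \<in> Lk 0 (Suc l)" "y \<otimes> t \<in> Lk 0 (Suc (Suc l))"
        using odd_mult_lsp[OF Y(2,3) ev_Cf(1) ev_Cf_mult y(1) st(1)] odd_mult_lsp[OF Y(2,3) ev_Cf(1) ev_Cf_mult y(1) st(2)] by auto
      ultimately show ?case by blast
    qed (rule P_add)
  qed
  have "?P k l r" if "r \<in> (F0 ^^ k) ((F1 ^^ l) (carrier R))" for k r
    using that
  proof (induction k arbitrary: r)
    case 0
    then show ?case using P0 by auto
  next
    case (Suc k)
    then have "r \<in> ideal_prod R (I \<inter> E0) ((F0 ^^ k) ((F1 ^^ l) (carrier R)))" by simp
    then show ?case
    proof (induction rule: ideal_prod.induct)
      case (prod x j)
      obtain s t where st: "s \<in> Lk k l" "t \<in> Lk k (Suc l)" "j = s \<oplus> t" using Suc.IH[OF prod(2)] by blast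
      obtain p where p: "ev p = x" using prod ev_surj by blast
      then have pC: "p \<in> Cf Xs 1" using I_Cf prod by blast
      have x: "x \<in> carrier R" using prod even_carrier by auto
      have m: "x \<otimes> a \<in> ev ` Cf Xs (Suc k)" if "a \<in> ev ` Cf Xs k" for a
        using that Cf_mult[OF pC] p by (auto simp flip: ev_mult)
      have "x \<otimes> j = x \<otimes> s \<oplus> x \<otimes> t" unfolding st(3) by (rule r_distr[OF subsetD[OF Lk_carrier st(1)] subsetD[OF Lk_carrier st(2)] x])
      moreover have "x \<otimes> s \<in> Lk (Suc k) l" using lsp_smult[OF st(1) x m ev_Cf(2) W_carrier] .
      moreover have "x \<otimes> t \<in> Lk (Suc k) (Suc l)" using lsp_smult[OF st(2) x m ev_Cf(2) W_carrier] .
      ultimately show ?case by blast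
    qed (rule P_add)
  qed
  then show "r \<in> BB k l \<Longrightarrow> ?P k l r" unfolding bipow_def by blast
qed

lemma wpar_split:
  assumes "r \<in> wpar l" "s \<in> wpar l" "t \<in> wpar (Suc l)" "r = s \<oplus> t"
  shows "r = s"
proof -
  have c: "r \<in> carrier R" "s \<in> carrier R" "t \<in> carrier R"
    using subsetD[OF wpar_carrier assms(1)] subsetD[OF wpar_carrier assms(2)] subsetD[OF wpar_carrier assms(3)] .
  show ?thesis
  proof (cases "even l")
    case True
    then show ?thesis using assms c parts_unique(1)[of r s \<zero> t] odd_zero by (simp add: wpar_def)
  next
    case False
    then show ?thesis using assms c parts_unique(2)[of \<zero> t r s] even_zero by (simp add: wpar_def a_comm)
  qed
qed

lemma BB_wpar:
  assumes "r \<in> BB k l" "r \<in> wpar l"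
  shows "r \<in> Lk k l"
proof -
  obtain s t where st: "s \<in> Lk k l" "t \<in> Lk k (Suc l)" "r = s \<oplus> t" using BB_sub[OF assms(1)] by (elim bexE)
  have "r = s" by (rule wpar_split[OF assms(2) subsetD[OF Lk_wpar st(1)] subsetD[OF Lk_wpar st(2)] st(3)])
  then show ?thesis using st(1) by simp
qed

text \<open>The two parts of the next step give four summands. Two consist of words of length
  \<open>l + 1\<close> and drop out by parity; the words of length \<open>l + 2\<close> acquire
  coefficients in \<open>R_1^2\<close>, which lies in every step; what remains are words of length
  \<open>l\<close> in step \<open>Suc k\<close>. So only the even direction of the bifiltration is
  felt.\<close>

lemma NN_wpar:
  assumes r: "r \<in> NN k l" "r \<in> wpar l"
  shows "r \<in> Lk (Suc k) l"
proof -
  obtain a b where ab: "a \<in> BB (Suc k) l" "b \<in> BB k (Suc l)" "r = a \<oplus> b" using r(1) unfolding NN_iff by blast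
  obtain s1 t1 where 1: "s1 \<in> Lk (Suc k) l" "t1 \<in> Lk (Suc k) (Suc l)" "a = s1 \<oplus> t1" using BB_sub[OF ab(1)] by blast
  obtain s2 t2 where 2: "s2 \<in> Lk k (Suc l)" "t2 \<in> Lk k (Suc (Suc l))" "b = s2 \<oplus> t2" using BB_sub[OF ab(2)] by blast
  have c: "s1 \<in> carrier R" "t1 \<in> carrier R" "s2 \<in> carrier R" "t2 \<in> carrier R"
    using subsetD[OF Lk_carrier 1(1)] subsetD[OF Lk_carrier 1(2)] subsetD[OF Lk_carrier 2(1)] subsetD[OF Lk_carrier 2(2)] .
  have "Lk k (Suc (Suc l)) \<subseteq> lsp R E0 (W (Suc (Suc l)))" by (rule lsp_mono[OF ev_Cf(1) subset_refl])
  also have "\<dots> \<subseteq> lsp R (odd_sq R) (W l)" by (rule lsp_words_shift[OF Y(2)])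
  also have "\<dots> \<subseteq> Lk (Suc k) l" by (rule lsp_mono[OF odd_sq_Cf subset_refl])
  finally have t2: "t2 \<in> Lk (Suc k) l" using 2 by blast
  have "r = (s1 \<oplus> t2) \<oplus> (t1 \<oplus> s2)" unfolding ab 1 2 using c by (simp add: a_ac)
  moreover have s: "s1 \<oplus> t2 \<in> Lk (Suc k) l" by (rule Lk_add[OF 1(1) t2])
  moreover have "t1 \<oplus> s2 \<in> wpar (Suc l)"
    by (rule wpar_add[OF subsetD[OF Lk_wpar 1(2)] subsetD[OF Lk_wpar 2(1)]])
  ultimately have "r = s1 \<oplus> t2" using wpar_split[OF r(2) subsetD[OF Lk_wpar s]] by simp
  then show ?thesis using s by simp
qed

lemma even_BB_0: "a \<in> BB k 0 \<Longrightarrow> a \<in> E0 \<Longrightarrow> \<exists>b\<in>Cf Xs k. ev b = a"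
proof -
  assume "a \<in> BB k 0" "a \<in> E0"
  then have "a \<in> Lk k 0" using BB_wpar[of a k 0] by (simp add: wpar_def)
  then have "a \<in> ev ` Cf Xs k"
  proof (induction rule: lsp.induct)
    case lsp_zero
    then show ?case using is_idealD(1)[OF is_ideal_Cf] ev_zero by (metis image_eqI)
  next
    case (lsp_step a w s)
    then obtain p q where pq: "p \<in> Cf Xs k" "a = ev p" "q \<in> Cf Xs k" "s = ev q" by blast
    then have "a \<otimes> w \<oplus> s = ev (p + q)" using lsp_step by (simp add: ev_add)
    then show ?case using is_idealD(2)[OF is_ideal_Cf] pq by blast
  qed
  then show ?thesis by blast
qed

text \<open>There is at least one odd factor, so parity forces a second one. Hence even elements of
  positive odd degree are nilpotent, and modulo nilpotents the even part of \<open>bgr\<close> lives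
  in the bidegrees \<open>(k, 0)\<close>.\<close>

lemma even_BB_Suc: "a \<in> BB k (Suc l) \<Longrightarrow> a \<in> E0 \<Longrightarrow> a \<in> odd_sq R"
proof -
  have O: "odd_sq R \<subseteq> E0" "\<zero> \<in> odd_sq R" "\<And>a b. a \<in> odd_sq R \<Longrightarrow> b \<in> odd_sq R \<Longrightarrow> a \<oplus> b \<in> odd_sq R"
    using odd_sq_ideal unfolding ideal_even_iff by auto
  assume a: "a \<in> BB k (Suc l)" "a \<in> E0"
  have "BB k l \<subseteq> BB 0 l" for k l by (induction k) (use BB_Suc_left in blast)+
  moreover have "BB 0 (Suc l) \<subseteq> BB 0 1" by (induction l) (use BB_Suc_right in fastforce)+
  ultimately have "a \<in> BB 0 1" using a by blast
  then have "a \<in> ideal_prod R (I \<inter> E1) (carrier R)" by (simp add: bipow_def)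
  then have "\<exists>s\<in>odd_sq R. \<exists>t\<in>E1. a = s \<oplus> t"
  proof (induction rule: ideal_prod.induct)
    case (prod y j)
    obtain b c where bc: "b \<in> E0" "c \<in> E1" "j = b \<oplus> c" using parts_decomp[OF prod(2)] .
    have car: "y \<in> carrier R" "b \<in> carrier R" "c \<in> carrier R" using prod bc even_carrier odd_carrier by auto
    have "y \<otimes> j = y \<otimes> c \<oplus> y \<otimes> b" unfolding bc using car by (simp add: r_distr a_comm)
    moreover have "y \<otimes> c \<in> odd_sq R" unfolding odd_sq_def using prod bc by (intro ideal_prod.prod) auto
    moreover have "y \<otimes> b \<in> E1" using prod bc odd_even by auto
    ultimately show ?case by blast
  next
    case (sum a b)
    then obtain s t s' t' where *: "s \<in> odd_sq R" "t \<in> E1" "a = s \<oplus> t" "s' \<in> odd_sq R" "t' \<in> E1" "b = s' \<oplus> t'" by blast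
    then have car: "s \<in> carrier R" "t \<in> carrier R" "s' \<in> carrier R" "t' \<in> carrier R"
      using O(1) even_carrier odd_carrier by auto
    have "a \<oplus> b = (s \<oplus> s') \<oplus> (t \<oplus> t')" unfolding * using car by (simp add: a_ac)
    then show ?case using O(3)[OF *(1,4)] odd_add[OF *(2,5)] by blast
  qed
  then obtain s t where st: "s \<in> odd_sq R" "t \<in> E1" "a = s \<oplus> t" by blast
  then have "a = s" using wpar_split[of a 0 s t] a O(1) by (auto simp: wpar_def)
  then show ?thesis using st by simp
qed

lemma ev_mon_BB: "length \<alpha> = length Zs \<Longrightarrow> set Zs \<subseteq> set Xs \<Longrightarrow> ev (mon Zs \<alpha>) \<in> BB (sum_list \<alpha>) 0"
proof (induction Zs arbitrary: \<alpha>)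
  case (Cons Z Zs)
  then obtain a \<alpha>' where \<alpha>: "\<alpha> = a # \<alpha>'" "length \<alpha>' = length Zs" by (cases \<alpha>) auto
  have Z: "ev Z \<in> BB 1 0" using Xs_I Cons.prems BB_1_0 by simp
  have "ev (Z ^ a) \<in> BB a 0"
  proof (induction a)
    case (Suc a)
    from BB_mult[OF Z Suc] show ?case by (simp add: ev_mult)
  qed (simp add: ev_one BB_0_0)
  from BB_mult[OF this Cons.IH[OF \<alpha>(2)]] show ?case using \<alpha> Cons.prems by (simp add: ev_mult)
qed (simp add: ev_one BB_0_0)

lemma ev_Qp_BB: "f \<in> Qp Xs k \<Longrightarrow> ev f \<in> BB k 0"
  unfolding Qp_def
proof (induction rule: sp.induct)
  case sp_zero
  then show ?case using ideal_props(2)[OF BB_ideal] by (simp add: ev_zero)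
next
  case (sp_step a x s)
  obtain \<alpha> where "x = mon Xs \<alpha>" "\<alpha> \<in> expo (length Xs) k" using sp_step by blast
  then have "ev x \<in> BB k 0" using ev_mon_BB[of \<alpha> Xs] by (auto simp: expo_def)
  then show ?case using sp_step ideal_props(3,4)[OF BB_ideal] by (simp add: ev_add ev_mult)
qed

lemma W_BB: "W l \<subseteq> BB 0 l"
proof (induction l)
  case (Suc l)
  show ?case
  proof
    fix w assume "w \<in> W (Suc l)"
    then obtain y v where w: "y \<in> Y" "v \<in> W l" "w = y \<otimes> v" by auto
    have "y \<in> BB 0 1" using w Y odd_I by (intro BB_0_1) auto
    then show "w \<in> BB 0 (Suc l)" using BB_mult[of y 0 1 v 0 l] w Suc by auto
  qed
qed (simp add: BB_0_0)

definition hc :: "nat \<times> nat \<Rightarrow> 'a \<Rightarrow> nat \<times> nat \<Rightarrow> 'a set" where "hc v a = cls (hom_elt v a)"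

lemma hc_closed: "a \<in> BP v \<Longrightarrow> hc v a \<in> carrier S"
  unfolding hc_def by (intro cls_closed good_hom_elt)

lemma hc_even: "a \<in> BP v \<Longrightarrow> a \<in> E0 \<Longrightarrow> hc v a \<in> even_part S"
  unfolding hc_def even_S_iff using good_hom_elt even_zero by (intro exI[of _ "hom_elt v a"]) (auto simp: hom_elt_def)

lemma hc_add: "a \<in> BP v \<Longrightarrow> b \<in> BP v \<Longrightarrow> hc v a \<oplus>\<^bsub>S\<^esub> hc v b = hc v (a \<oplus> b)"
proof -
  assume "a \<in> BP v" "b \<in> BP v"
  moreover have "(\<lambda>u. hom_elt v a u \<oplus> hom_elt v b u) = hom_elt v (a \<oplus> b)" by (auto simp: hom_elt_def)
  ultimately show ?thesis unfolding hc_def by (simp add: cls_add good_hom_elt)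
qed

lemma conv_hom_hom:
  assumes "a \<in> carrier R" "b \<in> carrier R"
  shows "conv R (hom_elt v a) (hom_elt w b) = hom_elt (fst v + fst w, snd v + snd w) (a \<otimes> b)"
proof
  fix u
  show "conv R (hom_elt v a) (hom_elt w b) u = hom_elt (fst v + fst w, snd v + snd w) (a \<otimes> b) u"
    unfolding conv_hom_left[OF assms(1) range_hom_elt[OF assms(2)]]
    using assms by (cases u; cases v; cases w) (auto simp: hom_elt_def)
qed

lemma hc_mult: "a \<in> BP v \<Longrightarrow> b \<in> BP w \<Longrightarrow> hc v a \<otimes>\<^bsub>S\<^esub> hc w b = hc (fst v + fst w, snd v + snd w) (a \<otimes> b)"
proof -
  assume a: "a \<in> BP v" and b: "b \<in> BP w"
  show ?thesis unfolding hc_def cls_mult[OF good_hom_elt[OF a] good_hom_elt[OF b]]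
    using conv_hom_hom[OF subsetD[OF BP_carrier a] subsetD[OF BP_carrier b]] by simp
qed

lemma hc_zero: "a \<in> NP v \<Longrightarrow> hc v a = \<zero>\<^bsub>S\<^esub>"
proof -
  assume a: "a \<in> NP v"
  then have c: "a \<in> carrier R" by (rule subsetD[OF ideal_props(1)[OF NN_ideal]])
  have "cl v a = NP v" using cl_eq_zero_iff[OF c] a by simp
  then have "cls (hom_elt v a) u = cls (\<lambda>u. \<zero>) u" for u
    by (cases "u = v") (simp_all add: cls_def hom_elt_def cl_zero)
  then show ?thesis unfolding hc_def cls_zero by (rule ext)
qed

lemma hc_one: "hc (0, 0) \<one> = \<one>\<^bsub>S\<^esub>" by (simp add: hc_def cls_one)

end

lemma mon_single: "mon Xs (replicate i 0 @ k # replicate r 0) = (Xs ! i) ^ k" if "length Xs = i + Suc r"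
  using that
proof (induction i arbitrary: Xs)
  case 0
  then show ?case by (cases Xs) auto
next
  case (Suc i)
  then show ?case by (cases Xs) auto
qed

lemma padd_zeros: "padd (replicate i 0 @ k # replicate r 0) (replicate i 0 @ 0 # \<beta>) = replicate i 0 @ k # \<beta>" if "length \<beta> = r"
proof -
  have "padd (replicate r 0) \<beta> = \<beta>" using that by (induction r arbitrary: \<beta>) (auto simp: length_Suc_conv)
  then show ?thesis by (induction i) auto
qed

text \<open>Raising the exponent at position \<open>i\<close> outweighs all later positions,
  whatever \<open>\<gamma>\<close> adds.\<close>

lemma less_shift: "length \<gamma> = i + Suc r \<Longrightarrow> replicate i 0 @ k # \<beta> < padd (replicate i 0 @ Suc k # replicate r 0) \<gamma>"
proof (induction i arbitrary: \<gamma>)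
  case 0
  then show ?case by (cases \<gamma>) auto
next
  case (Suc i)
  then obtain c \<gamma>' where g: "\<gamma> = c # \<gamma>'" "length \<gamma>' = i + Suc r" by (cases \<gamma>) auto
  then show ?case using Suc.IH[of \<gamma>'] by (cases "c = 0") auto
qed

section \<open>Singular elements of \<open>bgr\<close> and their leading components\<close>

context special_bgr
begin

interpretation L: noeth_local Ker mm Xs by (rule loc)

abbreviation "evS \<equiv> fcr_ev (even_ring S)"

lemma evS_hom: "surj_hom evS (even_ring S)" by (rule surj_hom_fcr_ev[OF cring_even_S])

lemma S_even_simps: "carrier (even_ring S) = even_part S" "monoid.mult (even_ring S) = monoid.mult S"
    "ring.add (even_ring S) = ring.add S" "ring.zero (even_ring S) = ring.zero S" "monoid.one (even_ring S) = monoid.one S"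
  by (simp_all add: even_ring_def)

lemma evS_closed: "evS p \<in> even_part S" using hom_closed[OF evS_hom] by (simp add: S_even_simps)
lemma evS_surj: "f \<in> even_part S \<Longrightarrow> \<exists>p. evS p = f" using hom_surj[OF evS_hom] by (simp add: S_even_simps)
lemma evS_add: "evS (p + q) = evS p \<oplus>\<^bsub>S\<^esub> evS q" using hom_add[OF evS_hom] by (simp add: S_even_simps)
lemma evS_mult: "evS (p * q) = evS p \<otimes>\<^bsub>S\<^esub> evS q" using hom_mult[OF evS_hom] by (simp add: S_even_simps)
lemma evS_one: "evS 1 = \<one>\<^bsub>S\<^esub>" using hom_one[OF evS_hom] by (simp add: S_even_simps)
lemma evS_zero: "evS 0 = \<zero>\<^bsub>S\<^esub>" using hom_zero[OF evS_hom] by (simp add: S_even_simps)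

lemma evS_repE:
  obtains p where "good p" "range p \<subseteq> E0" "evS z = cls p"
  using evS_closed[of z] unfolding even_S_iff by blast

definition KerS :: "(nat \<times> nat \<Rightarrow> 'a set) fcr set" where "KerS = {z. evS z = \<zero>\<^bsub>S\<^esub>}"
definition AnnS :: "(nat \<times> nat \<Rightarrow> 'a set) \<Rightarrow> (nat \<times> nat \<Rightarrow> 'a set) fcr set" where "AnnS f = {z. evS z \<otimes>\<^bsub>S\<^esub> f = \<zero>\<^bsub>S\<^esub>}"

lemma AnnS_alt: "AnnS f = {z. evS z \<in> even_ann S f}"
  using evS_closed by (auto simp: AnnS_def even_ann_def)

lemma is_ideal_AnnS: "f \<in> carrier S \<Longrightarrow> is_ideal (AnnS f)"
  unfolding AnnS_alt by (rule is_ideal_vimage[OF evS_hom even_ann_ideal])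

definition xlift :: "'a fcr \<Rightarrow> (nat \<times> nat \<Rightarrow> 'a set) fcr" where
  "xlift p = (SOME z. evS z = hc (1, 0) (ev p))"

lemma evS_xlift: "p \<in> set Xs \<Longrightarrow> evS (xlift p) = hc (1, 0) (ev p)"
proof -
  assume "p \<in> set Xs"
  then have "hc (1, 0) (ev p) \<in> even_part S" using Xs_I BB_1_0[of "ev p"] by (intro hc_even) auto
  then show ?thesis unfolding xlift_def by (rule someI_ex[OF evS_surj])
qed

abbreviation "Ts \<equiv> map xlift Xs"

definition Gf :: "nat list \<Rightarrow> 'a fcr set" where
  "Gf \<mu> = {f. \<exists>g\<in>FF mm Xs \<mu>. f - g \<in> Osq}"

lemma Gf_Uf: "length \<mu> = length Xs \<Longrightarrow> Gf \<mu> \<subseteq> Uf mm Xs (sum_list \<mu>)"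
  unfolding Gf_def Uf_def by blast

text \<open>In \<open>x ^ Suc k * b\<close> the exponent exceeds \<open>k\<close> at position
  \<open>i\<close> or is already positive before it, so this term is lexicographically larger than
  the leading one of \<open>x ^ k * u\<close>. The degree of \<open>b\<close> is one below that of
  \<open>u\<close>, to make both terms equally deep; in degree zero this leaves only
  \<open>b = 0\<close>.\<close>

lemma Gf_step:
  assumes i: "length Xs = i + Suc r" and \<beta>: "length \<beta> = r" and u: "u \<in> Gf (replicate i 0 @ 0 # \<beta>)"
    and b: "(sum_list \<beta> = 0 \<and> b = 0) \<or> (\<exists>j. sum_list \<beta> = Suc j \<and> b \<in> Cf Xs j)"
  shows "(Xs ! i) ^ k * (u + Xs ! i * b) \<in> Gf (replicate i 0 @ k # \<beta>)"
proof -
  note O = is_idealD[OF is_ideal_Osq]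
  let ?x = "Xs ! i" and ?\<mu> = "replicate i 0 @ k # \<beta>" and ?e = "replicate i 0 @ k # replicate r 0"
  obtain g where g: "g \<in> FF mm Xs (replicate i 0 @ 0 # \<beta>)" "u - g \<in> Osq" using u by (auto simp: Gf_def)
  have "mon Xs ?e \<in> FF mm Xs ?e" by (simp add: FF_def sp_zero)
  then have "?x ^ k \<in> FF mm Xs ?e" by (simp add: mon_single[OF i])
  from FF_mult[OF L.idm _ _ this g(1)] have xg: "?x ^ k * g \<in> FF mm Xs ?\<mu>" using padd_zeros[OF \<beta>] i \<beta> by simp
  have sm: "sum_list ?\<mu> = k + sum_list \<beta>" by (simp add: sum_list_replicate)
  obtain q where q: "?x ^ Suc k * q \<in> sp UNIV (GT Xs ?\<mu>)" "b - q \<in> Osq"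
    using b
  proof (elim disjE exE conjE)
    assume "b = 0"
    then show ?thesis using that[of 0] O(1) by (simp add: sp_zero)
  next
    fix j assume j: "sum_list \<beta> = Suc j" "b \<in> Cf Xs j"
    then obtain q where q: "q \<in> Qp Xs j" "b - q \<in> Osq" by (auto simp: Cf_def)
    have "?x ^ Suc k * q \<in> sp UNIV ((*) (?x ^ Suc k) ` mon Xs ` expo (length Xs) j)"
      using q(1) unfolding Qp_def by (rule sp_image)
    moreover have "(*) (?x ^ Suc k) ` mon Xs ` expo (length Xs) j \<subseteq> GT Xs ?\<mu>"
    proof clarify
      fix \<gamma> assume \<gamma>: "\<gamma> \<in> expo (length Xs) j"
      let ?e' = "replicate i 0 @ Suc k # replicate r 0"
      have le: "length ?e' = length Xs" "length \<gamma> = length Xs" "sum_list \<gamma> = j" using i \<gamma> by (auto simp: expo_def)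
      have "?x ^ Suc k * mon Xs \<gamma> = mon Xs (padd ?e' \<gamma>)"
        using mon_padd[OF le(1,2)] mon_single[OF i, of "Suc k"] by simp
      moreover have "padd ?e' \<gamma> \<in> expo (length Xs) (sum_list ?\<mu>)"
        using le j(1) sum_list_padd[of ?e' \<gamma>] unfolding sm by (auto simp: expo_def sum_list_replicate)
      moreover have "?\<mu> < padd ?e' \<gamma>" using less_shift[of \<gamma> i r k \<beta>] le i by simp
      ultimately show "?x ^ Suc k * mon Xs \<gamma> \<in> GT Xs ?\<mu>" unfolding GT_def by auto
    qed
    ultimately have "?x ^ Suc k * q \<in> sp UNIV (GT Xs ?\<mu>)" using sp_mono[of _ "GT Xs ?\<mu>" UNIV UNIV] by blast
    then show ?thesis using that q(2) by blast
  qed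
  have "?x ^ Suc k * q \<in> sp UNIV (GT Xs ?\<mu> \<union> MQ mm Xs (sum_list ?\<mu>))"
    using q(1) sp_mono[of "GT Xs ?\<mu>" "GT Xs ?\<mu> \<union> MQ mm Xs (sum_list ?\<mu>)" UNIV UNIV] by blast
  moreover have "?x ^ k * g - mon Xs ?\<mu> \<in> sp UNIV (GT Xs ?\<mu> \<union> MQ mm Xs (sum_list ?\<mu>))" using xg by (simp add: FF_def)
  ultimately have "(?x ^ k * g - mon Xs ?\<mu>) + ?x ^ Suc k * q \<in> sp UNIV (GT Xs ?\<mu> \<union> MQ mm Xs (sum_list ?\<mu>))" by (intro sp_add)
  then have F: "?x ^ k * g + ?x ^ Suc k * q \<in> FF mm Xs ?\<mu>" unfolding FF_def by (simp add: algebra_simps)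
  have "?x ^ k * (u + ?x * b) - (?x ^ k * g + ?x ^ Suc k * q) = ?x ^ k * (u - g) + ?x ^ Suc k * (b - q)"
    by (simp add: algebra_simps)
  also have "\<dots> \<in> Osq" by (intro O(2) O(3) g q)
  finally show ?thesis using F unfolding Gf_def by blast
qed

text \<open>A singular element of \<open>bgr\<close> is not homogeneous, but following its
  construction from the last variable to the first, one component of bidegree \<open>(k, 0)\<close>
  is seen to be the class of a unit form. One component suffices, because killing a homogeneous
  class is tested bidegree by bidegree.\<close>

lemma sing_component:
  assumes "Xs = As @ Bs" "s \<in> sing (map xlift Bs)"
  shows "\<exists>\<beta> u p. length \<beta> = length Bs \<and> u \<in> Gf (replicate (length As) 0 @ \<beta>) \<and> good p \<and> range p \<subseteq> E0 \<and>
    evS s = cls p \<and> p (sum_list \<beta>, 0) = ev u"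
  using assms
proof (induction Bs arbitrary: As s)
  case Nil
  have "1 - 1 \<in> Osq" using is_idealD(1)[OF is_ideal_Osq] by simp
  then have "1 \<in> Gf (replicate (length As) 0)" unfolding Gf_def using FF_one[of mm Xs] Nil by (intro CollectI bexI[of _ 1]) auto
  moreover have "evS s = cls (hom_elt (0, 0) \<one>)" using Nil by (simp add: evS_one cls_one)
  moreover have "range (hom_elt (0, 0) \<one>) \<subseteq> E0" using one_even even_zero by (auto simp: hom_elt_def)
  ultimately show ?case using good_one
    by (intro exI[of _ "[]"] exI[of _ 1] exI[of _ "hom_elt (0, 0) \<one>"]) (auto simp: ev_one hom_elt_def)
next
  case (Cons B Bs)
  obtain k s' a where s: "s = xlift B ^ k * (s' + a * xlift B)" "s' \<in> sing (map xlift Bs)" using Cons.prems by auto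
  have "Xs = (As @ [B]) @ Bs" using Cons.prems by simp
  from Cons.IH[OF this s(2)] obtain \<beta> u p where IH: "length \<beta> = length Bs" "u \<in> Gf (replicate (Suc (length As)) 0 @ \<beta>)"
    "good p" "range p \<subseteq> E0" "evS s' = cls p" "p (sum_list \<beta>, 0) = ev u" by auto
  obtain pa where pa: "good pa" "range pa \<subseteq> E0" "evS a = cls pa" by (rule evS_repE)
  have B: "B \<in> set Xs" "Xs ! length As = B" "length Xs = length As + Suc (length Bs)" using Cons.prems by auto
  have xB: "ev B \<in> BP (1, 0)" using Xs_I[OF B(1)] BB_1_0[of "ev B"] by simp
  let ?h = "hom_elt (1, 0) (ev B)"
  have gh: "good ?h" by (rule good_hom_elt[OF xB])
  have eh: "evS (xlift B) = cls ?h" using evS_xlift[OF B(1)] by (simp add: hc_def)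
  have he: "range ?h \<subseteq> E0" using even_zero by (auto simp: hom_elt_def)
  have step: "\<exists>p'. good p' \<and> range p' \<subseteq> E0 \<and> evS (xlift B * z) = cls p' \<and> p' (0, 0) = \<zero> \<and> (\<forall>j. p' (Suc j, 0) = ev B \<otimes> q (j, 0))"
    if z: "good q" "range q \<subseteq> E0" "evS z = cls q" for z q
  proof (intro exI[of _ "conv R ?h q"] conjI allI)
    show "good (conv R ?h q)" by (rule good_conv[OF gh z(1)])
    show "range (conv R ?h q) \<subseteq> E0"
      using he z(2) by (intro conv_in E0_carrier even_zero even_add even_even) auto
    show "evS (xlift B * z) = cls (conv R ?h q)" unfolding evS_mult eh z(3) by (rule cls_mult[OF gh z(1)])
    show "conv R ?h q (0, 0) = \<zero>" "conv R ?h q (Suc j, 0) = ev B \<otimes> q (j, 0)" for j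
      using conv_hom_left[OF ev_carrier good_carrier[OF z(1)], of "(1, 0)" B] by auto
  qed
  obtain pb where pb: "good pb" "range pb \<subseteq> E0" "evS (xlift B * a) = cls pb" "pb (0, 0) = \<zero>" "\<And>j. pb (Suc j, 0) = ev B \<otimes> pa (j, 0)"
    using step[OF pa] by blast
  \<comment> \<open>\<open>B * b\<close> represents the component of \<open>xlift B * a\<close> in
    the degree of \<open>u\<close>. It comes from the component of \<open>a\<close> one degree
    lower, and is zero in degree zero.\<close>
  obtain b where b: "(sum_list \<beta> = 0 \<and> b = 0) \<or> (\<exists>j. sum_list \<beta> = Suc j \<and> b \<in> Cf Xs j)" "pb (sum_list \<beta>, 0) = ev (B * b)"
  proof (cases "sum_list \<beta>")
    case 0
    show ?thesis
    proof (rule that)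
      show "(sum_list \<beta> = 0 \<and> (0 :: 'a fcr) = 0) \<or> (\<exists>j. sum_list \<beta> = Suc j \<and> 0 \<in> Cf Xs j)" using 0 by simp
      show "pb (sum_list \<beta>, 0) = ev (B * 0)" unfolding 0 using pb(4) by (simp add: ev_zero)
    qed
  next
    case (Suc j)
    have "pa (j, 0) \<in> BB j 0" "pa (j, 0) \<in> E0" using good_BP[OF pa(1), of "(j, 0)"] pa(2) by auto
    then obtain b where b: "b \<in> Cf Xs j" "ev b = pa (j, 0)" using even_BB_0 by blast
    show ?thesis
    proof (rule that)
      show "(sum_list \<beta> = 0 \<and> b = 0) \<or> (\<exists>j. sum_list \<beta> = Suc j \<and> b \<in> Cf Xs j)" using b Suc by blast
      show "pb (sum_list \<beta>, 0) = ev (B * b)" unfolding Suc using pb(5) b by (simp add: ev_mult)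
    qed
  qed
  define p1 where "p1 v = p v \<oplus> pb v" for v
  have p1: "good p1" "range p1 \<subseteq> E0" "evS (s' + a * xlift B) = cls p1" "p1 (sum_list \<beta>, 0) = ev (u + B * b)"
  proof -
    show "good p1" unfolding p1_def by (rule good_add[OF IH(3) pb(1)])
    show "range p1 \<subseteq> E0" using IH(4) pb(2) even_add by (auto simp: p1_def)
    have "evS (s' + a * xlift B) = evS s' \<oplus>\<^bsub>S\<^esub> evS (xlift B * a)" by (simp add: evS_add mult.commute)
    then show "evS (s' + a * xlift B) = cls p1" by (simp add: IH(5) pb(3) cls_add[OF IH(3) pb(1)] p1_def[abs_def])
    show "p1 (sum_list \<beta>, 0) = ev (u + B * b)" by (simp add: p1_def IH(6) b(2) ev_add)
  qed
  have pow: "\<exists>p'. good p' \<and> range p' \<subseteq> E0 \<and> evS (xlift B ^ k * (s' + a * xlift B)) = cls p' \<and> p' (k + sum_list \<beta>, 0) = ev (B ^ k * (u + B * b))" for k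
  proof (induction k)
    case 0
    then show ?case using p1 by auto
  next
    case (Suc k)
    then obtain p' where p': "good p'" "range p' \<subseteq> E0" "evS (xlift B ^ k * (s' + a * xlift B)) = cls p'"
      "p' (k + sum_list \<beta>, 0) = ev (B ^ k * (u + B * b))" by blast
    from step[OF p'(1-3)] obtain p'' where p'': "good p''" "range p'' \<subseteq> E0"
      "evS (xlift B * (xlift B ^ k * (s' + a * xlift B))) = cls p''" "\<And>j. p'' (Suc j, 0) = ev B \<otimes> p' (j, 0)" by blast
    have "p'' (Suc k + sum_list \<beta>, 0) = ev (B ^ Suc k * (u + B * b))"
      using p''(4)[of "k + sum_list \<beta>"] p'(4) by (simp add: ev_mult m_assoc)
    then show ?case using p'' by (intro exI[of _ p'']) (auto simp: mult.assoc)
  qed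
  obtain p' where p': "good p'" "range p' \<subseteq> E0" "evS s = cls p'" "p' (k + sum_list \<beta>, 0) = ev (B ^ k * (u + B * b))"
    using pow[of k] s(1) by blast
  have "u \<in> Gf (replicate (length As) 0 @ 0 # \<beta>)" using IH(2) by (simp add: replicate_app_Cons_same)
  from Gf_step[OF B(3) IH(1) this b(1), of k]
  have "B ^ k * (u + B * b) \<in> Gf (replicate (length As) 0 @ k # \<beta>)" unfolding B(2) .
  then show ?case using p' IH(1) by (intro exI[of _ "k # \<beta>"] exI[of _ "B ^ k * (u + B * b)"] exI[of _ p']) auto
qed

definition AnnR :: "'a \<Rightarrow> 'a fcr set" where "AnnR w = {p. ev p \<otimes> w = \<zero>}"

text \<open>An annihilating singular element supplies a unit form \<open>u\<close> through
  \<open>sing_component\<close>, and \<open>NN_wpar\<close> reads the vanishing of the class of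
  \<open>u g\<close> as a relation expressing \<open>u g\<close> by all words of length
  \<open>l\<close> with deeper coefficients. The system of these relations is brought to one degree
  and eliminated.\<close>

lemma chain_of_odd_word:
  assumes w: "w \<in> lsp R E0 (W l)" and FF: "\<And>\<mu>. length \<mu> = length Xs \<Longrightarrow> FF mm Xs \<mu> \<inter> AnnR w = {}"
  shows "\<exists>g\<in>W l. \<exists>P. pchain (AnnS (hc (0, l) g)) P (length Xs)"
proof (rule ccontr)
  assume no: "\<not> ?thesis"
  have gB: "g \<in> BP (0, l)" if "g \<in> W l" for g using that W_BB by auto
  define Pr where "Pr g k u \<longleftrightarrow> ev u \<otimes> g \<in> Lk (Suc k) l" for g k u
  have ex: "\<exists>k. \<exists>u\<in>Uf mm Xs k. Pr g k u" if g: "g \<in> W l" for g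
  proof -
    have gc: "g \<in> carrier R" using g W_carrier by blast
    have "sing Ts \<inter> AnnS (hc (0, l) g) \<noteq> {}"
      using no g chain_of_sing_disjoint[OF is_ideal_AnnS[OF hc_closed[OF gB[OF g]]], of Ts] by auto
    then obtain s where s: "s \<in> sing Ts" "evS s \<otimes>\<^bsub>S\<^esub> hc (0, l) g = \<zero>\<^bsub>S\<^esub>" by (auto simp: AnnS_def)
    obtain \<beta> u p where *: "length \<beta> = length Xs" "u \<in> Gf (replicate (length ([] :: 'a fcr list)) 0 @ \<beta>)" "good p" "range p \<subseteq> E0"
      "evS s = cls p" "p (sum_list \<beta>, 0) = ev u" using sing_component[of "[]" Xs s] s(1) by auto
    let ?k = "sum_list \<beta>" and ?h = "hom_elt (0, l) g"
    have gh: "good ?h" by (rule good_hom_elt[OF gB[OF g]])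
    have "cls (conv R p ?h) = cls (\<lambda>u. \<zero>)" using s(2) unfolding *(5) hc_def cls_mult[OF *(3) gh] cls_zero .
    \<comment> \<open>Only this component of the vanishing product is used; it isolates the
      controlled component of the singular element.\<close>
    then have z: "cl (?k, l) (conv R p ?h (?k, l)) = NP (?k, l)" by (simp add: cls_def fun_eq_iff cl_zero)
    have "conv R p ?h (?k, l) = conv R ?h p (?k, l)" by (rule conv_commute[OF *(4) good_carrier[OF gh]])
    also have "\<dots> = g \<otimes> p (?k, 0)" using conv_hom_left[OF gc good_carrier[OF *(3)], of "(0, l)" "(?k, l)"] by simp
    also have "\<dots> = ev u \<otimes> g" using even_central[OF ev_even gc, of u] *(6) by simp
    finally have "cl (?k, l) (ev u \<otimes> g) = NP (?k, l)" using z by simp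
    then have "ev u \<otimes> g \<in> NN ?k l" using cl_eq_zero_iff[of "ev u \<otimes> g" "(?k, l)"] gc by simp
    moreover have "ev u \<otimes> g \<in> wpar l" by (rule wpar_even[OF ev_even subsetD[OF W_wpar g]])
    ultimately have "Pr g ?k u" unfolding Pr_def by (rule NN_wpar)
    moreover have "u \<in> Uf mm Xs ?k" using *(1,2) Gf_Uf by auto
    ultimately show ?thesis by blast
  qed
  have stable: "Pr g (k + k') (u * v)" if "Pr g k u" "u \<in> Uf mm Xs k" "v \<in> Uf mm Xs k'" "g \<in> W l" for g k k' u v
  proof -
    have gc: "g \<in> carrier R" using that W_carrier by blast
    have vC: "v \<in> Cf Xs k'" using that Uf_Cf by blast
    have "ev v \<otimes> (ev u \<otimes> g) \<in> lsp R (ev ` Cf Xs (Suc (k + k'))) (W l)"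
    proof (rule lsp_smult[OF _ ev_carrier _ ev_Cf(2) W_carrier])
      show "ev u \<otimes> g \<in> Lk (Suc k) l" using that by (simp add: Pr_def)
      show "ev v \<otimes> a \<in> ev ` Cf Xs (Suc (k + k'))" if "a \<in> ev ` Cf Xs (Suc k)" for a
        using that Cf_mult[OF vC, of _ "Suc k"] by (auto simp add: add.commute simp flip: ev_mult)
    qed
    moreover have "ev v \<otimes> (ev u \<otimes> g) = ev (u * v) \<otimes> g"
      using gc by (simp add: mult.commute[of u v] ev_mult m_assoc)
    ultimately show ?thesis by (simp add: Pr_def)
  qed
  have fW: "finite (W l)" by (rule finite_words[OF Y(1)])
  have "\<exists>k. (\<exists>v. v \<in> Uf mm Xs k) \<and> (\<forall>g\<in>W l. \<exists>u\<in>Uf mm Xs k. Pr g k u)"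
    by (rule uniform_degree[OF Uf_mult[OF L.idm] Uf_one stable fW ex])
  then obtain k where k: "\<And>g. g \<in> W l \<Longrightarrow> \<exists>u\<in>Uf mm Xs k. Pr g k u" by blast
  have "\<exists>k. \<exists>u\<in>Uf mm Xs k. \<forall>g\<in>W l. ev u \<otimes> g = \<zero>"
  proof (rule elimination[where e = ev and C = "Cf Xs" and k = k])
    show "\<exists>u\<in>Uf mm Xs k. ev u \<otimes> g \<in> lsp R (ev ` Cf Xs (Suc k)) (W l)" if "g \<in> W l" for g
      using k[OF that] by (simp add: Pr_def)
    show "u - a \<in> Uf mm Xs k" if "u \<in> Uf mm Xs k" "a \<in> Cf Xs (Suc k)" for k u a
      using Uf_diff[OF L.xs_m that] .
  qed (use fW W_carrier Uf_Cf Uf_mult[OF L.idm] Uf_one Cf_mult Cf_antimono is_idealD(1,2)[OF is_ideal_Cf]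
       in \<open>auto simp: ev_add ev_mult ev_zero ev_diff\<close>)
  then obtain k u where u: "u \<in> Uf mm Xs k" "\<forall>g\<in>W l. ev u \<otimes> g = \<zero>" by blast
  \<comment> \<open>Elimination yields a unit form only up to \<open>R_1^2\<close>; a multiple of it
    agrees in \<open>R_0\<close> with an element of \<open>FF\<close>, to which the hypothesis
    applies.\<close>
  obtain \<mu> f c where f: "length \<mu> = length Xs" "f \<in> FF mm Xs \<mu>" "f - c * u \<in> Ker" using Uf_power_FF[OF L.idm u(1)] by blast
  have evf: "ev f = ev c \<otimes> ev u"
    using f(3) by (simp add: Ker_def ev_diff ev_mult r_right_minus_eq)
  have "ev f \<otimes> w = \<zero>" using w
  proof (induction w rule: lsp.induct)
    case (lsp_step a g s)
    have c: "a \<in> carrier R" "g \<in> carrier R" "s \<in> carrier R"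
      using lsp_step even_carrier subsetD[OF W_carrier] subsetD[OF lsp_closed[OF E0_carrier W_carrier]] by auto
    have "ev f \<otimes> (a \<otimes> g \<oplus> s) = (ev f \<otimes> a) \<otimes> g \<oplus> ev f \<otimes> s" using c by (simp add: r_distr m_assoc)
    also have "ev f \<otimes> a = a \<otimes> ev f" using even_central[OF ev_even c(1)] .
    also have "a \<otimes> ev f \<otimes> g = a \<otimes> (ev c \<otimes> (ev u \<otimes> g))" using c by (simp add: evf m_assoc)
    finally show ?case using lsp_step u(2) c by simp
  qed simp
  then show False using FF[OF f(1)] f(2) by (auto simp: AnnR_def)
qed

end

section \<open>Chains of primes in the even part of \<open>bgr\<close>\<close>

context special_bgr
begin

interpretation L: noeth_local Ker mm Xs by (rule loc)

lemma KerS_vimage: "KerS = {z. evS z = \<zero>\<^bsub>even_ring S\<^esub>}"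
  by (simp add: KerS_def S_even_simps)

lemma is_ideal_KerS: "is_ideal KerS"
proof -
  interpret S: cring "even_ring S" by (rule cring_even_S)
  show ?thesis using is_ideal_vimage[OF evS_hom S.zeroideal] by (simp add: KerS_vimage)
qed

lemma KerS_AnnS: "f \<in> carrier S \<Longrightarrow> KerS \<subseteq> AnnS f"
proof -
  interpret S: ring S by (rule ring_S)
  show "f \<in> carrier S \<Longrightarrow> KerS \<subseteq> AnnS f" by (auto simp: KerS_def AnnS_def)
qed

lemma evS_eq_KerS: "evS z = evS z' \<Longrightarrow> z - z' \<in> KerS"
proof -
  interpret S: cring "even_ring S" by (rule cring_even_S)
  show "evS z = evS z' \<Longrightarrow> z - z' \<in> KerS"
    using hom_diff[OF evS_hom, of z z'] hom_closed[OF evS_hom, of z'] by (simp add: KerS_vimage a_minus_def S.r_neg)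
qed

lemma evS_hc: "ev a \<in> BP v \<Longrightarrow> \<exists>z. evS z = hc v (ev a)"
  by (rule evS_surj[OF hc_even]) simp_all

lemma hc_00: "ev a \<in> BP (0, 0)" by (simp add: BB_0_0)

lemma evS_hc_add: "evS z = hc v (ev a) \<Longrightarrow> evS z' = hc v (ev b) \<Longrightarrow> ev a \<in> BP v \<Longrightarrow> ev b \<in> BP v \<Longrightarrow>
  evS (z + z') = hc v (ev (a + b))"
  by (simp add: evS_add hc_add ev_add)

lemma evS_hc_mult: "evS z = hc (k, l) (ev a) \<Longrightarrow> evS z' = hc (k', l') (ev b) \<Longrightarrow> ev a \<in> BP (k, l) \<Longrightarrow> ev b \<in> BP (k', l') \<Longrightarrow>
  evS (z * z') = hc (k + k', l + l') (ev (a * b)) \<and> ev (a * b) \<in> BP (k + k', l + l')"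
  using hc_mult[of "ev a" "(k, l)" "ev b" "(k', l')"] BB_mult[of "ev a" k l "ev b" k' l'] by (simp add: evS_mult ev_mult)

lemma evS_hc_power:
  assumes z: "evS z = hc (k, l) (ev a)" "ev a \<in> BP (k, l)"
  shows "evS (z ^ n) = hc (n * k, n * l) (ev (a ^ n)) \<and> ev (a ^ n) \<in> BP (n * k, n * l)"
proof (induction n)
  case 0
  then show ?case by (simp add: evS_one ev_one hc_one BB_0_0)
next
  case (Suc n)
  from evS_hc_mult[OF z(1) conjunct1[OF Suc] z(2) conjunct2[OF Suc]] show ?case by simp
qed

lemma evS_mon:
  "length \<alpha> = length Zs \<Longrightarrow> set Zs \<subseteq> set Xs \<Longrightarrow>
    evS (mon (map xlift Zs) \<alpha>) = hc (sum_list \<alpha>, 0) (ev (mon Zs \<alpha>))"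
proof (induction Zs arbitrary: \<alpha>)
  case Nil
  then show ?case by (simp add: evS_one ev_one hc_one)
next
  case (Cons Z Zs)
  then obtain a \<alpha>' where \<alpha>: "\<alpha> = a # \<alpha>'" "length \<alpha>' = length Zs" by (cases \<alpha>) auto
  have Z: "evS (xlift Z) = hc (1, 0) (ev Z)" "ev Z \<in> BP (1, 0)"
    using Cons.prems evS_xlift Xs_I BB_1_0[of "ev Z"] by auto
  note p = evS_hc_power[OF Z, of a]
  have r: "evS (mon (map xlift Zs) \<alpha>') = hc (sum_list \<alpha>', 0) (ev (mon Zs \<alpha>'))" "ev (mon Zs \<alpha>') \<in> BP (sum_list \<alpha>', 0)"
    using Cons ev_mon_BB[of \<alpha>' Zs] \<alpha> by auto
  from evS_hc_mult[OF conjunct1[OF p] r(1) conjunct2[OF p] r(2)] show ?case by (simp add: \<alpha>(1))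
qed

text \<open>The ground ring for counting in \<open>bgr\<close>: classes of even elements in bidegree
  \<open>(0, 0)\<close>. Up to \<open>KerS\<close>, those coming from outside \<open>m\<close> are
  invertible and those from \<open>m\<close>, collected in \<open>mS\<close>, are nilpotent.\<close>

definition AS :: "(nat \<times> nat \<Rightarrow> 'a set) fcr set" where "AS = {z. \<exists>a. evS z = hc (0, 0) (ev a)}"
definition mS :: "(nat \<times> nat \<Rightarrow> 'a set) fcr set" where "mS = {z. \<exists>a\<in>mm. evS z = hc (0, 0) (ev a)}"

lemma hc_ev_zero: "hc v (ev 0) = \<zero>\<^bsub>S\<^esub>"
  using ideal_props(2)[OF NN_ideal] by (simp add: ev_zero hc_zero)

lemma AS_subring: "is_subring AS"
  unfolding is_subring_def
proof (intro conjI ballI)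
  show "0 \<in> AS" unfolding AS_def using hc_ev_zero[of "(0, 0)"] evS_zero by (intro CollectI exI[of _ 0]) simp
  show "1 \<in> AS" unfolding AS_def using hc_one evS_one by (intro CollectI exI[of _ 1]) (simp add: ev_one)
  \<comment> \<open>The lift of the class of \<open>-1\<close> is identified with \<open>- 1\<close>
    through its sum with \<open>1\<close>, which vanishes in \<open>bgr\<close>.\<close>
  obtain z where z: "evS z = hc (0, 0) (ev (-1))" using evS_hc[OF hc_00] by blast
  have "evS (z + 1) = hc (0, 0) (ev (-1 + 1))"
    by (rule evS_hc_add[OF z _ hc_00 hc_00]) (simp add: ev_one evS_one hc_one)
  then have "z + 1 \<in> KerS" using hc_ev_zero by (simp add: KerS_def)
  then have "- (z + 1) \<in> KerS" by (rule is_idealD(5)[OF is_ideal_KerS])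
  moreover have "- (z + 1) = - 1 - z" by (simp add: algebra_simps)
  ultimately have "- 1 - z \<in> KerS" by (simp only:)
  then have "evS (- 1 - z + z) = \<zero>\<^bsub>S\<^esub> \<oplus>\<^bsub>S\<^esub> evS z" unfolding evS_add by (simp add: KerS_def)
  also have "\<dots> = evS (0 + z)" by (simp add: evS_add evS_zero del: add_0)
  finally have "evS (- 1) = evS z" by simp
  then show "- 1 \<in> AS" unfolding AS_def using z by auto
  fix z z' assume "z \<in> AS" "z' \<in> AS"
  then obtain a b where ab: "evS z = hc (0, 0) (ev a)" "evS z' = hc (0, 0) (ev b)" by (auto simp: AS_def)
  show "z + z' \<in> AS" unfolding AS_def using evS_hc_add[OF ab hc_00 hc_00] by blast
  show "z * z' \<in> AS" unfolding AS_def using evS_hc_mult[OF ab hc_00 hc_00] by auto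
qed

text \<open>Some power of an element of \<open>m\<close> lies in the ideal of \<open>Xs\<close> and
  thus in the even part of \<open>I\<close>, which is zero in bidegree
  \<open>(0, 0)\<close>.\<close>

lemma ev_radical:
  assumes "a \<in> mm"
  shows "\<exists>n. hc (0, 0) (ev (a ^ n)) = \<zero>\<^bsub>S\<^esub>"
proof -
  obtain n where n: "a ^ n \<in> sp UNIV (set Xs \<union> Ker)" using L.rad[OF assms] ..
  note Ip = ideal_props[OF I_ideal]
  have "is_ideal {p. ev p \<in> I}" unfolding is_ideal_def
    using Ip(2) Ip(3) Ip(4)[OF _ ev_carrier] by (simp add: ev_zero ev_add ev_mult)
  moreover have "set Xs \<union> Ker \<subseteq> {p. ev p \<in> I}" using Xs_I I_zero by (auto simp: Ker_def)
  ultimately have "ev (a ^ n) \<in> I" using sp_ideal_subset n by blast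
  then have "ev (a ^ n) \<in> BB 1 0" by (intro BB_1_0) simp_all
  moreover have "ev (a ^ n) = ev (a ^ n) \<oplus> \<zero>" by simp
  ultimately have "ev (a ^ n) \<in> NP (0, 0)" using ideal_props(2)[OF BB_ideal] unfolding NN_iff by force
  then show ?thesis using hc_zero by blast
qed

context
  fixes P :: "nat \<Rightarrow> (nat \<times> nat \<Rightarrow> 'a set) fcr set" and n :: nat
  assumes P: "pchain KerS P n"
begin

lemma P0_prime: "is_prime (P 0)" and KerS_P0: "KerS \<subseteq> P 0"
  using P by (auto simp: pchain_def)

lemmas P0_ideal = is_primeD(1)[OF P0_prime]

lemma KerS_sp: "z \<in> KerS \<Longrightarrow> z \<in> sp AS (H \<union> P 0)"
  using KerS_P0 by (intro sp_base[OF AS_subring]) auto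

lemma nilpotent_P0:
  assumes "evS z = hc (k, l) (ev a)" "ev a \<in> BP (k, l)" "a \<in> Osq"
  shows "z \<in> P 0"
proof -
  obtain j where "a ^ j \<in> Ker" using Osq_nilpotent[OF assms(3)] ..
  then have "ev (a ^ j) = ev 0" by (simp add: Ker_def ev_zero)
  then have "evS (z ^ j) = \<zero>\<^bsub>S\<^esub>" using evS_hc_power[OF assms(1,2), of j] hc_ev_zero by metis
  then have "z ^ j \<in> P 0" using KerS_P0 by (auto simp: KerS_def)
  then show ?thesis by (rule is_prime_power[OF P0_prime])
qed

lemma mS_P0: "mS \<subseteq> P 0"
proof
  fix z assume "z \<in> mS"
  then obtain a where a: "a \<in> mm" "evS z = hc (0, 0) (ev a)" by (auto simp: mS_def)
  obtain j where "hc (0, 0) (ev (a ^ j)) = \<zero>\<^bsub>S\<^esub>" using ev_radical[OF a(1)] ..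
  then have "z ^ j \<in> P 0" using evS_hc_power[OF a(2) hc_00, of j] KerS_P0 by (auto simp: KerS_def)
  then show "z \<in> P 0" by (rule is_prime_power[OF P0_prime])
qed

text \<open>Carries a linear combination of degree \<open>k\<close> from \<open>R_0\<close> over to
  \<open>bgr\<close> modulo \<open>P 0\<close>, the coefficients going to bidegree
  \<open>(0, 0)\<close>. All lifts \<open>z\<close> are covered because they differ only by
  \<open>KerS\<close>, which lies in \<open>P 0\<close>.\<close>

lemma lift_sp:
  assumes G: "\<And>x. x \<in> G \<Longrightarrow> ev x \<in> BB k 0 \<and> (\<exists>z. evS z = hc (k, 0) (ev x) \<and> z \<in> sp AS (H \<union> P 0))"
    and y: "y \<in> sp UNIV G"
  shows "ev y \<in> BB k 0 \<and> (\<forall>z. evS z = hc (k, 0) (ev y) \<longrightarrow> z \<in> sp AS (H \<union> P 0))"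
  using y
proof (induction rule: sp.induct)
  case sp_zero
  have "z \<in> KerS" if "evS z = hc (k, 0) (ev 0)" for z using that by (simp add: KerS_def hc_ev_zero)
  then show ?case using ideal_props(2)[OF BB_ideal] KerS_sp by (simp add: ev_zero)
next
  case (sp_step a x s)
  obtain zx where zx: "evS zx = hc (k, 0) (ev x)" "zx \<in> sp AS (H \<union> P 0)" and x: "ev x \<in> BP (k, 0)" using G[OF sp_step(2)] by auto
  have s: "ev s \<in> BP (k, 0)" using sp_step.IH by simp
  obtain za where za: "evS za = hc (0, 0) (ev a)" using evS_hc[OF hc_00] by blast
  obtain zs where zs: "evS zs = hc (k, 0) (ev s)" using evS_hc[OF s] by blast
  have ax: "evS (za * zx) = hc (k, 0) (ev (a * x))" "ev (a * x) \<in> BP (k, 0)"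
    using evS_hc_mult[OF za zx(1) hc_00 x] by auto
  have e: "evS (za * zx + zs) = hc (k, 0) (ev (a * x + s))" by (rule evS_hc_add[OF ax(1) zs ax(2) s])
  have "za \<in> AS" using za by (auto simp: AS_def)
  then have m: "za * zx + zs \<in> sp AS (H \<union> P 0)" using sp_step.IH zs zx(2) by (intro sp_add sp_mult[OF AS_subring]) auto
  have "z \<in> sp AS (H \<union> P 0)" if "evS z = hc (k, 0) (ev (a * x + s))" for z
  proof -
    have "z - (za * zx + zs) \<in> KerS" using that e by (intro evS_eq_KerS) simp
    from sp_add[OF m KerS_sp[OF this]] show ?thesis by simp
  qed
  moreover have "ev (a * x + s) \<in> BB k 0" using ideal_props(3)[OF BB_ideal] ax(2) s by (simp add: ev_add)
  ultimately show ?case by blast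
qed

lemma lift_mon:
  assumes "\<alpha> \<in> expo (length Xs) k"
  shows "ev (mon Xs \<alpha>) \<in> BP (k, 0)" "evS (mon Ts \<alpha>) = hc (k, 0) (ev (mon Xs \<alpha>))"
  using assms ev_mon_BB[of \<alpha> Xs] evS_mon[of \<alpha> Xs] by (auto simp: expo_def)

lemma lift_Qp:
  assumes "q \<in> Qp Xs k" "evS z = hc (k, 0) (ev q)"
  shows "z \<in> Vp AS Ts (P 0) k"
proof -
  have "z \<in> sp AS (mon Ts ` expo (length Xs) k \<union> P 0)"
  proof (rule conjunct2[OF lift_sp[OF _ assms(1)[unfolded Qp_def]], rule_format, OF _ assms(2)])
    fix x assume "x \<in> mon Xs ` expo (length Xs) k"
    then obtain \<alpha> where \<alpha>: "x = mon Xs \<alpha>" "\<alpha> \<in> expo (length Xs) k" by blast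
    have "mon Ts \<alpha> \<in> sp AS (mon Ts ` expo (length Xs) k \<union> P 0)" using \<alpha> by (intro sp_base[OF AS_subring]) auto
    then show "ev x \<in> BB k 0 \<and> (\<exists>z. evS z = hc (k, 0) (ev x) \<and> z \<in> sp AS (mon Ts ` expo (length Xs) k \<union> P 0))"
      using lift_mon[OF \<alpha>(2)] \<alpha>(1) by auto
  qed
  also have "\<dots> \<subseteq> Vp AS Ts (P 0) k" unfolding Vp_def by (intro sp_mono) (auto simp: expo_def)
  finally show ?thesis .
qed

lemma Vp_add: "z \<in> Vp AS Ts (P 0) M \<Longrightarrow> z' \<in> Vp AS Ts (P 0) M' \<Longrightarrow> z + z' \<in> Vp AS Ts (P 0) (max M M')"
  using Vp_mono[of M "max M M'" AS Ts "P 0"] Vp_mono[of M' "max M M'" AS Ts "P 0"] unfolding Vp_def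
  by (intro sp_add) auto

lemma P0_Vp: "z \<in> P 0 \<Longrightarrow> z \<in> Vp AS Ts (P 0) M"
  unfolding Vp_def by (intro sp_base[OF AS_subring]) auto

lemma Vp_KerS:
  assumes "z' \<in> Vp AS Ts (P 0) M" "evS z = evS z'"
  shows "z \<in> Vp AS Ts (P 0) M"
  using Vp_add[OF assms(1) P0_Vp[OF subsetD[OF KerS_P0 evS_eq_KerS[OF assms(2)]], of M]] by simp

text \<open>In bidegree \<open>(k, 0)\<close> the element is a form of degree \<open>k\<close> in
  \<open>Xs\<close> plus an element of \<open>R_1^2\<close>, whose class is nilpotent and hence in
  \<open>P 0\<close>. For \<open>l > 0\<close> the whole element lies in
  \<open>R_1^2\<close>.\<close>

lemma lift_homogeneous:
  assumes a: "a \<in> BP (k, l)" "a \<in> E0" and z: "evS z = hc (k, l) a"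
  shows "\<exists>M. z \<in> Vp AS Ts (P 0) M"
proof (cases l)
  case 0
  obtain b where b: "b \<in> Cf Xs k" "ev b = a" using even_BB_0[of a k] a 0 by auto
  obtain q where q: "q \<in> Qp Xs k" "b - q \<in> Osq" using b(1) by (auto simp: Cf_def)
  have qB: "ev q \<in> BP (k, 0)" using ev_Qp_BB[OF q(1)] by simp
  have bB: "ev b \<in> BP (k, 0)" using a b 0 by simp
  have dB: "ev (b - q) \<in> BP (k, 0)" using ideal_props(3)[OF BB_ideal _ ideal_props(6)[OF BB_ideal]] qB bB
    by (simp add: ev_diff a_minus_def)
  obtain zq where zq: "evS zq = hc (k, 0) (ev q)" using evS_hc[OF qB] by blast
  obtain zd where zd: "evS zd = hc (k, 0) (ev (b - q))" using evS_hc[OF dB] by blast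
  have "zq + zd \<in> Vp AS Ts (P 0) (max k k)"
    by (rule Vp_add[OF lift_Qp[OF q(1) zq] P0_Vp[OF nilpotent_P0[OF zd dB q(2)]]])
  moreover have "evS z = evS (zq + zd)" using evS_hc_add[OF zq zd qB dB] z b 0 by simp
  ultimately show ?thesis using Vp_KerS by blast
next
  case (Suc j)
  obtain b where b: "ev b = a" using ev_surj[OF a(2)] ..
  have "a \<in> odd_sq R" using even_BB_Suc[of a k j] a Suc by simp
  then have "b \<in> Osq" using b by (simp add: Osq_def)
  then have "z \<in> P 0" using nilpotent_P0[of z k l b] z a(1) unfolding b by blast
  then show ?thesis using P0_Vp by blast
qed

lemma Vp_exhaustive: "\<exists>M. z \<in> Vp AS Ts (P 0) M"
proof -
  obtain p where p: "good p" "range p \<subseteq> E0" "evS z = cls p" by (rule evS_repE)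
  have "finite T \<Longrightarrow> good p \<Longrightarrow> range p \<subseteq> E0 \<Longrightarrow> {u. p u \<noteq> \<zero>} \<subseteq> T \<Longrightarrow> evS z = cls p \<Longrightarrow> \<exists>M. z \<in> Vp AS Ts (P 0) M" for T p z
  proof (induction T arbitrary: p z rule: finite_induct)
    case empty
    then have "p = (\<lambda>u. \<zero>)" by auto
    then have "z \<in> KerS" using empty by (simp add: KerS_def cls_zero)
    then show ?case using P0_Vp KerS_P0 by blast
  next
    case (insert u T)
    define q where "q = p(u := \<zero>)"
    have pB: "p u \<in> BP u" "p u \<in> E0" using good_BP[OF insert.prems(1)] insert.prems(2) by auto
    have q: "good q" "range q \<subseteq> E0" "{u. q u \<noteq> \<zero>} \<subseteq> T"
    proof -
      have "{u. q u \<noteq> \<zero>} \<subseteq> {u. p u \<noteq> \<zero>}" by (auto simp: q_def)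
      then show "good q" using insert.prems(1) ideal_props(2)[OF BB_ideal] by (auto simp: good_def q_def intro: finite_subset)
      show "range q \<subseteq> E0" using insert.prems(2) even_zero by (auto simp: q_def)
      show "{u. q u \<noteq> \<zero>} \<subseteq> T" using insert.prems(3) by (auto simp: q_def split: if_splits)
    qed
    have "cls q \<in> even_part S" unfolding even_S_iff using q by blast
    then obtain zq where zq: "evS zq = cls q" using evS_surj by blast
    obtain zu where zu: "evS zu = hc u (p u)" using evS_surj[OF hc_even[OF pB]] by blast
    have "p v \<in> carrier R" for v using insert.prems(2) even_carrier by blast
    then have "p v = q v \<oplus> hom_elt u (p u) v" for v by (auto simp: q_def hom_elt_def)
    then have "p = (\<lambda>v. q v \<oplus> hom_elt u (p u) v)" by blast
    then have "evS z = evS (zq + zu)" unfolding insert.prems(4) evS_add zq zu hc_def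
      using cls_add[OF q(1) good_hom_elt[OF pB(1)]] by simp
    moreover obtain M where M: "zq \<in> Vp AS Ts (P 0) M" using insert.IH[OF q zq] ..
    moreover obtain M' where "zu \<in> Vp AS Ts (P 0) M'"
      using lift_homogeneous[of "p u" "fst u" "snd u" zu] pB zu by auto
    ultimately show ?case using Vp_KerS Vp_add by blast
  qed
  moreover have "finite {u. p u \<noteq> \<zero>}" using p(1) by (simp add: good_def)
  ultimately show ?thesis using p by blast
qed

lemma graded_like_S: "graded_like AS mS Ts P n"
proof
  show "is_subring AS" by (rule AS_subring)
  show "pchain {} P n" using P by (simp add: pchain_def)
  show "AS \<inter> mS \<subseteq> P 0" using mS_P0 by blast
  show "\<exists>b\<in>AS. a * b - 1 \<in> P 0" if "a \<in> AS" "a \<notin> mS" for a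
  proof -
    obtain c where c: "evS a = hc (0, 0) (ev c)" using \<open>a \<in> AS\<close> by (auto simp: AS_def)
    then have "c \<notin> mm" using \<open>a \<notin> mS\<close> by (auto simp: mS_def)
    then obtain e where e: "c * e - 1 \<in> Ker" using L.unit by blast
    obtain b where b: "evS b = hc (0, 0) (ev e)" using evS_hc[OF hc_00] by blast
    have "ev (c * e) = \<one>" using e ev_diff[of "c * e" 1] ev_carrier[of "c * e"]
      by (simp add: Ker_def ev_one r_right_minus_eq)
    then have "evS (a * b) = evS 1" using evS_hc_mult[OF c b hc_00 hc_00] by (simp add: evS_one hc_one)
    then have "a * b - 1 \<in> P 0" using KerS_P0 evS_eq_KerS by blast
    then show ?thesis using b by (auto simp: AS_def)
  qed
  show "\<exists>M. z \<in> Vp AS Ts (P 0) M" for z by (rule Vp_exhaustive)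
qed

lemma chain_S_le: "n \<le> length Xs"
  using graded_like.chain_le[OF graded_like_S] by simp

text \<open>If the class of a unit form lay in \<open>P 0\<close>, it would express the monomial of
  \<open>\<mu>\<close> by larger ones over \<open>AS\<close>, since the terms with coefficients in
  \<open>m\<close> fall into \<open>P 0\<close>. For a chain of full length
  \<open>leading_form_disjoint\<close> excludes this.\<close>

lemma lift_FF:
  assumes n: "n = length Xs" and \<mu>: "length \<mu> = length Xs" and t: "t \<in> FF mm Xs \<mu>"
    and z: "evS z = hc (sum_list \<mu>, 0) (ev t)"
  shows "z \<notin> P 0"
proof
  assume zP: "z \<in> P 0"
  let ?k = "sum_list \<mu>" and ?H = "sp AS (GT Ts \<mu> \<union> P 0)"
  have y: "ev (t - mon Xs \<mu>) \<in> BB ?k 0 \<and> (\<forall>z. evS z = hc (?k, 0) (ev (t - mon Xs \<mu>)) \<longrightarrow> z \<in> ?H)"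
  proof (rule lift_sp[OF _ t[unfolded FF_def mem_Collect_eq]])
    fix x assume "x \<in> GT Xs \<mu> \<union> MQ mm Xs ?k"
    then show "ev x \<in> BB ?k 0 \<and> (\<exists>z. evS z = hc (?k, 0) (ev x) \<and> z \<in> ?H)"
    proof
      assume "x \<in> GT Xs \<mu>"
      then obtain \<gamma> where \<gamma>: "x = mon Xs \<gamma>" "\<gamma> \<in> expo (length Xs) ?k" "\<mu> < \<gamma>" by (auto simp: GT_def)
      have "mon Ts \<gamma> \<in> ?H" using \<gamma> by (intro sp_base[OF AS_subring]) (auto simp: GT_def)
      then show ?thesis using lift_mon[OF \<gamma>(2)] \<gamma>(1) by auto
    next
      assume "x \<in> MQ mm Xs ?k"
      then obtain a \<gamma> where a: "x = a * mon Xs \<gamma>" "a \<in> mm" "\<gamma> \<in> expo (length Xs) ?k" unfolding MQ_def by blast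
      obtain za where za: "evS za = hc (0, 0) (ev a)" using evS_hc[OF hc_00] by blast
      then have "za \<in> P 0" using a mS_P0 by (auto simp: mS_def)
      then have "za * mon Ts \<gamma> \<in> P 0" by (rule is_idealD(4)[OF P0_ideal])
      then have "za * mon Ts \<gamma> \<in> ?H" by (intro sp_base[OF AS_subring]) auto
      moreover have "evS (za * mon Ts \<gamma>) = hc (?k, 0) (ev x) \<and> ev x \<in> BP (?k, 0)"
        using evS_hc_mult[OF za lift_mon(2)[OF a(3)] hc_00 lift_mon(1)[OF a(3)]] a(1) by simp
      ultimately show ?thesis by auto
    qed
  qed
  then have yB: "ev (t - mon Xs \<mu>) \<in> BP (?k, 0)" by simp
  obtain zy where zy: "evS zy = hc (?k, 0) (ev (t - mon Xs \<mu>))" using evS_hc[OF yB] by blast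
  have \<mu>e: "\<mu> \<in> expo (length Xs) ?k" using \<mu> by (simp add: expo_def)
  have "evS (zy + mon Ts \<mu>) = evS z"
    using evS_hc_add[OF zy lift_mon(2)[OF \<mu>e] yB lift_mon(1)[OF \<mu>e]] z by simp
  then have "zy + mon Ts \<mu> - z \<in> KerS" by (rule evS_eq_KerS)
  then have "zy + mon Ts \<mu> - z \<in> ?H" by (rule KerS_sp)
  moreover have "z \<in> ?H" using zP by (intro sp_base[OF AS_subring]) auto
  moreover have "zy \<in> ?H" using y zy by blast
  ultimately have "(zy + mon Ts \<mu> - z) + z - zy \<in> ?H" by (rule sp_diff[OF AS_subring sp_add])
  then have "mon Ts \<mu> \<in> ?H" by simp
  then show False using graded_like.leading_form_disjoint[OF graded_like_S, of \<mu>] n \<mu> by simp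
qed

end

text \<open>Otherwise each word is killed by a unit form, and the product of these finitely many
  forms kills all words. Its class then kills \<open>cls p\<close> and lies in \<open>P 0\<close>,
  against \<open>lift_FF\<close>.\<close>

lemma odd_word_of_chain:
  assumes P: "pchain (AnnS (cls p)) P (length Xs)" and p: "good p" "range p \<subseteq> lsp R E0 (W l)"
  shows "\<exists>g\<in>W l. \<forall>\<mu>. length \<mu> = length Xs \<longrightarrow> FF mm Xs \<mu> \<inter> AnnR g = {}"
proof (rule ccontr)
  assume no: "\<not> ?thesis"
  have fW: "finite (W l)" by (rule finite_words[OF Y(1)])
  have "finite V \<Longrightarrow> V \<subseteq> W l \<Longrightarrow> \<exists>\<mu> t. length \<mu> = length Xs \<and> t \<in> FF mm Xs \<mu> \<and> (\<forall>g\<in>V. ev t \<otimes> g = \<zero>)" for V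
  proof (induction V rule: finite_induct)
    case empty
    show ?case using FF_one[of mm Xs] by (intro exI[of _ "replicate (length Xs) 0"] exI[of _ 1]) auto
  next
    case (insert g V)
    then obtain \<mu> t where t: "length \<mu> = length Xs" "t \<in> FF mm Xs \<mu>" "\<And>h. h \<in> V \<Longrightarrow> ev t \<otimes> h = \<zero>" by blast
    have "g \<in> W l" using insert.prems by simp
    then obtain \<nu> where \<nu>: "length \<nu> = length Xs" "FF mm Xs \<nu> \<inter> AnnR g \<noteq> {}" using no by blast
    then obtain s where "s \<in> FF mm Xs \<nu>" "s \<in> AnnR g" by blast
    with \<nu>(1) have s: "length \<nu> = length Xs" "s \<in> FF mm Xs \<nu>" "ev s \<otimes> g = \<zero>" by (auto simp: AnnR_def)
    have "ev (t * s) \<otimes> h = \<zero>" if h: "h \<in> insert g V" for h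
    proof (cases "h = g")
      case True
      have "h \<in> carrier R" using h insert.prems subsetD[OF W_carrier] by auto
      then have "ev (t * s) \<otimes> h = ev t \<otimes> (ev s \<otimes> h)" by (simp add: ev_mult m_assoc)
      then show ?thesis using True s by simp
    next
      case False
      have "h \<in> carrier R" using h insert.prems subsetD[OF W_carrier] by auto
      then have "ev (t * s) \<otimes> h = ev s \<otimes> (ev t \<otimes> h)" by (simp add: mult.commute[of t s] ev_mult m_assoc)
      then show ?thesis using False h t by simp
    qed
    then show ?case using FF_mult[OF L.idm t(1) s(1) t(2) s(2)] t(1) s(1)
      by (intro exI[of _ "padd \<mu> \<nu>"] exI[of _ "t * s"]) simp
  qed
  from this[OF fW subset_refl] obtain \<mu> t where t: "length \<mu> = length Xs" "t \<in> FF mm Xs \<mu>" "\<And>g. g \<in> W l \<Longrightarrow> ev t \<otimes> g = \<zero>"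
    by blast
  have kill: "ev t \<otimes> w = \<zero>" if "w \<in> lsp R E0 (W l)" for w
    using that
  proof (induction w rule: lsp.induct)
    case (lsp_step a g s)
    have c: "a \<in> carrier R" "g \<in> carrier R" "s \<in> carrier R"
      using lsp_step even_carrier subsetD[OF W_carrier] subsetD[OF lsp_closed[OF E0_carrier W_carrier]] by auto
    have "ev t \<otimes> (a \<otimes> g \<oplus> s) = (ev t \<otimes> a) \<otimes> g \<oplus> ev t \<otimes> s" using c by (simp add: r_distr m_assoc)
    also have "ev t \<otimes> a = a \<otimes> ev t" using even_central[OF ev_even c(1)] .
    finally show ?case using lsp_step t(3) c by (simp add: m_assoc)
  qed simp
  let ?v = "(sum_list \<mu>, 0)"
  have tB: "ev t \<in> BP ?v" using ev_Qp_BB[OF subsetD[OF FF_Qp[OF t(1)] t(2)]] by simp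
  have "conv R (hom_elt ?v (ev t)) p = (\<lambda>u. \<zero>)"
  proof
    fix u
    have "ev t \<otimes> p (pminus u ?v) = \<zero>" using kill p(2) by blast
    then show "conv R (hom_elt ?v (ev t)) p u = \<zero>"
      unfolding conv_hom_left[OF ev_carrier good_carrier[OF p(1)]] by simp
  qed
  then have z: "hc ?v (ev t) \<otimes>\<^bsub>S\<^esub> cls p = \<zero>\<^bsub>S\<^esub>"
    unfolding hc_def cls_mult[OF good_hom_elt[OF tB] p(1)] cls_zero by simp
  obtain t' where t': "evS t' = hc ?v (ev t)" using evS_hc[OF tB] by blast
  have "AnnS (cls p) \<subseteq> P 0" using P by (simp add: pchain_def)
  then have "t' \<in> P 0" using z t' by (auto simp: AnnS_def)
  moreover have "pchain KerS P (length Xs)" using P KerS_AnnS[OF cls_closed[OF p(1)]] by (auto simp: pchain_def)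
  ultimately show False using lift_FF[OF _ refl t(1,2) t'] by blast
qed

text \<open>Odd elements of \<open>bgr\<close> have odd representatives in every bidegree, so a
  product of \<open>l\<close> of them is represented inside the span of the words of length
  \<open>l\<close>, whatever the bidegrees of its components.\<close>

lemma odd_S_foldr:
  "set fs \<subseteq> odd_part S \<Longrightarrow>
    \<exists>p. good p \<and> range p \<subseteq> lsp R E0 (W (length fs)) \<and> foldr (\<otimes>\<^bsub>S\<^esub>) fs \<one>\<^bsub>S\<^esub> = cls p"
proof (induction fs)
  case Nil
  have "\<one> \<otimes> \<one> \<in> lsp R E0 (W 0)" using one_even E0_carrier by (intro lsp_base) auto
  then have "range (hom_elt (0, 0) \<one>) \<subseteq> lsp R E0 (W 0)" by (auto simp: hom_elt_def lsp.lsp_zero)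
  then show ?case using good_one by (intro exI[of _ "hom_elt (0, 0) \<one>"]) (simp add: cls_one)
next
  case (Cons f fs)
  then obtain q where q: "good q" "range q \<subseteq> lsp R E0 (W (length fs))" "foldr (\<otimes>\<^bsub>S\<^esub>) fs \<one>\<^bsub>S\<^esub> = cls q" by auto
  obtain p where p: "good p" "range p \<subseteq> E1" "f = cls p" using odd_S_rep[of f] Cons.prems by auto
  have "p v \<otimes> q w \<in> lsp R E0 (W (Suc (length fs)))" for v w
    by (rule odd_mult_lsp[OF Y(2,3) subset_refl]) (use p(2) q(2) even_even in auto)
  then have "range (conv R p q) \<subseteq> lsp R E0 (W (Suc (length fs)))"
    using lsp_closed[OF E0_carrier W_carrier] lsp_add[OF E0_carrier W_carrier] by (intro conv_in lsp.lsp_zero) (simp_all del: words.simps)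
  then show ?case using good_conv[OF p(1) q(1)] cls_mult[OF p(1) q(1)] p(3) q(3)
    by (intro exI[of _ "conv R p q"]) (simp del: words.simps)
qed

end

section \<open>Comparison of the dimensions of \<open>R\<close> and \<open>bgr\<close>\<close>

context special_bgr
begin

interpretation L: noeth_local Ker mm Xs by (rule loc)

lemma even_ann_ideal_R: "w \<in> carrier R \<Longrightarrow> ideal (even_ann R w) A0"
  unfolding ideal_even_iff even_ann_def
  by (auto simp: even_zero even_add even_even l_distr m_assoc even_carrier)

lemma AnnR_alt: "AnnR w = {p. ev p \<in> even_ann R w}"
  by (auto simp: AnnR_def even_ann_def)

lemma is_ideal_AnnR: "w \<in> carrier R \<Longrightarrow> is_ideal (AnnR w)"
  unfolding AnnR_alt by (rule is_ideal_vimage[OF ev_hom even_ann_ideal_R])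

lemma Ker_AnnR: "w \<in> carrier R \<Longrightarrow> Ker \<subseteq> AnnR w"
  by (auto simp: Ker_def AnnR_def)

lemma prime_chain_R: "prime_chain A0 n \<longleftrightarrow> (\<exists>P. pchain Ker P n)"
  using prime_chain_iff[OF ev_hom] by (simp add: Ker_def)

lemma prime_chain_S: "prime_chain (even_ring S) n \<longleftrightarrow> (\<exists>P. pchain KerS P n)"
  using prime_chain_iff[OF evS_hom] by (simp add: KerS_vimage)

lemma prime_chain_Quot_R: "w \<in> carrier R \<Longrightarrow> prime_chain (A0 Quot even_ann R w) n \<longleftrightarrow> (\<exists>P. pchain (AnnR w) P n)"
  unfolding AnnR_alt by (rule prime_chain_Quot_iff[OF ev_hom even_ann_ideal_R])

lemma prime_chain_Quot_S:
  "f \<in> carrier S \<Longrightarrow> prime_chain (even_ring S Quot even_ann S f) n \<longleftrightarrow> (\<exists>P. pchain (AnnS f) P n)"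
  unfolding AnnS_alt by (rule prime_chain_Quot_iff[OF evS_hom even_ann_ideal])

lemma pchain_base: "pchain J P n \<Longrightarrow> K \<subseteq> J \<Longrightarrow> pchain K P n"
  by (auto simp: pchain_def)

text \<open>Turns a condition on dimension into one on multiplication in \<open>R_0\<close> alone,
  the form in which it can be compared with \<open>bgr\<close>.\<close>

lemma FF_AnnR_iff:
  assumes w: "w \<in> carrier R"
  shows "(\<exists>P. pchain (AnnR w) P (length Xs)) \<longleftrightarrow> (\<forall>\<mu>. length \<mu> = length Xs \<longrightarrow> FF mm Xs \<mu> \<inter> AnnR w = {})"
proof
  assume "\<exists>P. pchain (AnnR w) P (length Xs)"
  then obtain P where P: "pchain (AnnR w) P (length Xs)" ..
  have "AnnR w \<subseteq> P 0" using P by (simp add: pchain_def)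
  then show "\<forall>\<mu>. length \<mu> = length Xs \<longrightarrow> FF mm Xs \<mu> \<inter> AnnR w = {}"
    using L.FF_disjoint_chain[OF pchain_base[OF P Ker_AnnR[OF w]]] by blast
next
  assume "\<forall>\<mu>. length \<mu> = length Xs \<longrightarrow> FF mm Xs \<mu> \<inter> AnnR w = {}"
  then show "\<exists>P. pchain (AnnR w) P (length Xs)"
    by (intro L.chain_of_FF_disjoint is_ideal_AnnR Ker_AnnR w) auto
qed

lemma words_foldr: "g \<in> W l \<longleftrightarrow> (\<exists>ys. length ys = l \<and> set ys \<subseteq> Y \<and> g = foldr (\<otimes>) ys \<one>)"
proof (induction l arbitrary: g)
  case (Suc l)
  show ?case
  proof
    assume "g \<in> W (Suc l)"
    then obtain y h where h: "y \<in> Y" "h \<in> W l" "g = y \<otimes> h" by auto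
    then obtain ys where "length ys = l" "set ys \<subseteq> Y" "h = foldr (\<otimes>) ys \<one>" using Suc by blast
    then show "\<exists>ys. length ys = Suc l \<and> set ys \<subseteq> Y \<and> g = foldr (\<otimes>) ys \<one>"
      using h by (intro exI[of _ "y # ys"]) auto
  next
    assume "\<exists>ys. length ys = Suc l \<and> set ys \<subseteq> Y \<and> g = foldr (\<otimes>) ys \<one>"
    then obtain ys where ys: "length ys = Suc l" "set ys \<subseteq> Y" "g = foldr (\<otimes>) ys \<one>" by blast
    then obtain y zs where y: "ys = y # zs" by (cases ys) auto
    then have "foldr (\<otimes>) zs \<one> \<in> W l" using ys Suc[of "foldr (\<otimes>) zs \<one>"] by auto
    then show "g \<in> W (Suc l)" using ys y by (auto intro!: image_eqI[of _ _ "(y, foldr (\<otimes>) zs \<one>)"])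
  qed
qed auto

lemma odd_foldr: "set ys \<subseteq> E1 \<Longrightarrow> foldr (\<otimes>) ys \<one> \<in> lsp R E0 (W (length ys))"
proof (induction ys)
  case Nil
  have "\<one> \<otimes> \<one> \<in> lsp R E0 (W 0)" using one_even E0_carrier by (intro lsp_base) auto
  then show ?case by simp
next
  case (Cons y ys)
  then have "foldr (\<otimes>) ys \<one> \<in> lsp R E0 (W (length ys))" "y \<in> E1" by auto
  from odd_mult_lsp[OF Y(2,3) subset_refl _ this(2,1)] show ?case using even_even by (simp del: words.simps)
qed

lemma hc_odd: "y \<in> Y \<Longrightarrow> hc (0, 1) y \<in> odd_part S"
  unfolding hc_def using Y(2) odd_I odd_zero BB_0_1[of y]
  by (intro odd_S_I good_hom_elt) (auto simp: hom_elt_def)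

lemma hc_foldr: "set ys \<subseteq> Y \<Longrightarrow> foldr (\<otimes>\<^bsub>S\<^esub>) (map (hc (0, 1)) ys) \<one>\<^bsub>S\<^esub> = hc (0, length ys) (foldr (\<otimes>) ys \<one>)"
proof (induction ys)
  case (Cons y ys)
  have y: "y \<in> BP (0, 1)" using Cons.prems Y(2) odd_I BB_0_1[of y] by auto
  have "foldr (\<otimes>) ys \<one> \<in> W (length ys)" unfolding words_foldr using Cons.prems by auto
  then have "foldr (\<otimes>) ys \<one> \<in> BP (0, length ys)" using W_BB by auto
  from hc_mult[OF y this] show ?case using Cons by simp
qed (simp add: hc_one)

context
  assumes d: "Kdim A0 = ereal (real (length Xs))"
begin

text \<open>The lower bound is the case of the empty product: no unit form kills \<open>1\<close> in
  \<open>R\<close>, and the only word of length zero is \<open>1\<close>, whose class is the unit of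
  \<open>bgr\<close>.\<close>

lemma Kdim_S: "Kdim (even_ring S) = ereal (real (length Xs))"
  unfolding Kdim_eq_iff
proof
  have A1: "AnnR \<one> = Ker" by (simp add: AnnR_def Ker_def)
  have "\<exists>P. pchain (AnnR \<one>) P (length Xs)" unfolding A1 using d prime_chain_R by (simp add: Kdim_eq_iff)
  then have F: "\<forall>\<mu>. length \<mu> = length Xs \<longrightarrow> FF mm Xs \<mu> \<inter> AnnR \<one> = {}" using FF_AnnR_iff by simp
  have "\<one> \<otimes> \<one> \<in> lsp R E0 (W 0)" using one_even E0_carrier by (intro lsp_base) auto
  then obtain g P where g: "g \<in> W 0" "pchain (AnnS (hc (0, 0) g)) P (length Xs)"
    using chain_of_odd_word[of \<one> 0] F by auto
  interpret S: ring S by (rule ring_S)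
  have "pchain KerS P (length Xs)"
    using pchain_base[OF g(2)] g(1) KerS_AnnS[OF S.one_closed] by (simp add: hc_one)
  then show "prime_chain (even_ring S) (length Xs)" unfolding prime_chain_S by blast
  show "\<not> prime_chain (even_ring S) (Suc (length Xs))" unfolding prime_chain_S using chain_S_le by force
qed

lemma Kdim_Quot_R:
  assumes "w \<in> carrier R"
  shows "Kdim (A0 Quot even_ann R w) = ereal (real (length Xs)) \<longleftrightarrow> (\<exists>P. pchain (AnnR w) P (length Xs))"
  using d pchain_base[OF _ Ker_AnnR[OF assms]] unfolding Kdim_eq_iff prime_chain_Quot_R[OF assms] prime_chain_R by blast

lemma Kdim_Quot_S:
  assumes "f \<in> carrier S"
  shows "Kdim (even_ring S Quot even_ann S f) = ereal (real (length Xs)) \<longleftrightarrow> (\<exists>P. pchain (AnnS f) P (length Xs))"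
  using Kdim_S pchain_base[OF _ KerS_AnnS[OF assms]] unfolding Kdim_eq_iff prime_chain_Quot_S[OF assms] prime_chain_S by blast

lemma odd_parameters_R: "odd_parameters R ys \<longleftrightarrow> ys \<noteq> [] \<and> set ys \<subseteq> E1 \<and> (\<exists>P. pchain (AnnR (foldr (\<otimes>) ys \<one>)) P (length Xs))"
proof -
  have "foldr (\<otimes>) ys \<one> \<in> carrier R" if "set ys \<subseteq> E1"
    using odd_foldr[OF that] subsetD[OF lsp_closed[OF E0_carrier W_carrier]] by blast
  then show ?thesis unfolding odd_parameters_def d using Kdim_Quot_R by auto
qed

lemma odd_parameters_S: "odd_parameters S fs \<longleftrightarrow> fs \<noteq> [] \<and> set fs \<subseteq> odd_part S \<and> (\<exists>P. pchain (AnnS (foldr (\<otimes>\<^bsub>S\<^esub>) fs \<one>\<^bsub>S\<^esub>)) P (length Xs))"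
proof -
  have "foldr (\<otimes>\<^bsub>S\<^esub>) fs \<one>\<^bsub>S\<^esub> \<in> carrier S" if "set fs \<subseteq> odd_part S"
    using odd_S_foldr[OF that] cls_closed by auto
  then show ?thesis unfolding odd_parameters_def Kdim_S using Kdim_Quot_S by auto
qed

lemma odd_parameters_R_S: "odd_parameters R ys \<Longrightarrow> \<exists>fs. odd_parameters S fs \<and> length fs = length ys"
proof -
  assume "odd_parameters R ys"
  then obtain P where ys: "ys \<noteq> []" "set ys \<subseteq> E1" and P: "pchain (AnnR (foldr (\<otimes>) ys \<one>)) P (length Xs)"
    unfolding odd_parameters_R by blast
  let ?l = "length ys"
  have w: "foldr (\<otimes>) ys \<one> \<in> lsp R E0 (W ?l)" by (rule odd_foldr[OF ys(2)])
  have wc: "foldr (\<otimes>) ys \<one> \<in> carrier R" using w subsetD[OF lsp_closed[OF E0_carrier W_carrier]] by blast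
  have "FF mm Xs \<mu> \<inter> AnnR (foldr (\<otimes>) ys \<one>) = {}" if "length \<mu> = length Xs" for \<mu>
    using FF_AnnR_iff[OF wc] P that by blast
  from chain_of_odd_word[OF w this] obtain g Q where g: "g \<in> W ?l" "pchain (AnnS (hc (0, ?l) g)) Q (length Xs)" by blast
  obtain zs where zs: "length zs = ?l" "set zs \<subseteq> Y" "g = foldr (\<otimes>) zs \<one>" using g(1) unfolding words_foldr by blast
  have "odd_parameters S (map (hc (0, 1)) zs)"
    unfolding odd_parameters_S hc_foldr[OF zs(2)] using zs ys(1) g(2) hc_odd by auto
  then show ?thesis using zs(1) by (intro exI[of _ "map (hc (0, 1)) zs"]) simp
qed

lemma odd_parameters_S_R: "odd_parameters S fs \<Longrightarrow> \<exists>ys. odd_parameters R ys \<and> length ys = length fs"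
proof -
  assume "odd_parameters S fs"
  then obtain P where fs: "fs \<noteq> []" "set fs \<subseteq> odd_part S" and P: "pchain (AnnS (foldr (\<otimes>\<^bsub>S\<^esub>) fs \<one>\<^bsub>S\<^esub>)) P (length Xs)"
    unfolding odd_parameters_S by blast
  obtain p where p: "good p" "range p \<subseteq> lsp R E0 (W (length fs))" "foldr (\<otimes>\<^bsub>S\<^esub>) fs \<one>\<^bsub>S\<^esub> = cls p"
    using odd_S_foldr[OF fs(2)] by blast
  obtain g where g: "g \<in> W (length fs)" "\<forall>\<mu>. length \<mu> = length Xs \<longrightarrow> FF mm Xs \<mu> \<inter> AnnR g = {}"
    using odd_word_of_chain[OF P[unfolded p(3)] p(1,2)] by blast
  then have Q: "\<exists>P. pchain (AnnR g) P (length Xs)" using FF_AnnR_iff[OF subsetD[OF W_carrier g(1)]] by blast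
  obtain ys where ys: "length ys = length fs" "set ys \<subseteq> Y" "g = foldr (\<otimes>) ys \<one>" using g(1) unfolding words_foldr by blast
  have "odd_parameters R ys" unfolding odd_parameters_R using ys Q fs(1) Y(2) by auto
  then show ?thesis using ys(1) by blast
qed

lemma Ksdim_bgr: "Ksdim S = Ksdim R"
proof -
  have "{enat (length ys) | ys. odd_parameters S ys} = {enat (length ys) | ys. odd_parameters R ys}"
    using odd_parameters_R_S odd_parameters_S_R by force
  then show ?thesis by (simp add: Ksdim_def Ksdim0_def Ksdim1_def Kdim_S d)
qed

end

end

section \<open>The main theorem\<close>

lemma set_Qp: "set Xs \<subseteq> Qp Xs 1"
proof
  fix B assume "B \<in> set Xs"
  then obtain As Bs where Xs: "Xs = As @ B # Bs" by (auto simp: in_set_conv_decomp)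
  have "mon Xs (replicate (length As) 0 @ 1 # replicate (length Bs) 0) = (Xs ! length As) ^ 1"
    by (rule mon_single) (simp add: Xs)
  moreover have "replicate (length As) 0 @ 1 # replicate (length Bs) 0 \<in> expo (length Xs) 1"
    by (simp add: Xs expo_def sum_list_replicate)
  ultimately show "B \<in> Qp Xs 1" using mon_Qp by (fastforce simp: Xs)
qed

context super_ring
begin

text \<open>A nonunit lies in an ideal that is maximal among the proper ones, by the chain
  condition; its image in \<open>R_0\<close> is a maximal ideal and so equals
  \<open>m\<close>.\<close>

lemma local_unit:
  assumes acc: "acc_above Ker" and loc: "local_ring A0 m" and a: "ev p \<notin> m"
  shows "\<exists>b. p * b - 1 \<in> Ker"
proof (rule ccontr)
  assume no: "\<not> ?thesis"
  let ?J = "sp UNIV (insert p Ker)"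
  have J1: "1 \<notin> ?J"
  proof
    assume "1 \<in> ?J"
    then obtain c where "1 - c * p \<in> sp UNIV Ker" using sp_insertD[OF is_subring_UNIV] by blast
    then have "1 - c * p \<in> Ker" by (simp add: sp_is_ideal[OF is_ideal_Ker])
    then have "- (1 - c * p) \<in> Ker" by (rule is_idealD(5)[OF is_ideal_Ker])
    then have "p * c - 1 \<in> Ker" by (simp add: mult.commute)
    then show False using no by blast
  qed
  have KJ: "Ker \<subseteq> ?J" "p \<in> ?J" using sp_base[OF is_subring_UNIV, of _ "insert p Ker"] by blast+
  obtain M where M': "is_ideal M \<and> ?J \<subseteq> M \<and> 1 \<notin> M"
    and max: "\<And>J. is_ideal J \<and> ?J \<subseteq> J \<and> 1 \<notin> J \<Longrightarrow> M \<subseteq> J \<Longrightarrow> J = M"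
  proof (rule acc_maximalE[OF acc, of "\<lambda>J. is_ideal J \<and> ?J \<subseteq> J \<and> 1 \<notin> J" ?J])
    show "is_ideal ?J \<and> ?J \<subseteq> ?J \<and> 1 \<notin> ?J" using is_ideal_sp J1 by simp
    show "is_ideal J \<and> Ker \<subseteq> J" if "is_ideal J \<and> ?J \<subseteq> J \<and> 1 \<notin> J" for J using that KJ(1) by (meson order_trans)
  qed (rule that)
  have M: "is_ideal M" "?J \<subseteq> M" "1 \<notin> M" using M' by simp_all
  have Kz: "{x. ev x = \<zero>\<^bsub>A0\<^esub>} \<subseteq> M" using KJ(1) M(2) by (auto simp: Ker_def)
  note vi = vimage_image[OF ev_hom M(1) Kz]
  have "maximalideal (ev ` M) A0"
  proof (rule maximalidealI)
    show "ideal (ev ` M) A0" by (rule ideal_image[OF ev_hom M(1)])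
    show "carrier A0 \<noteq> ev ` M" using vi[of 1] M(3) ev_even[of 1] by auto
    fix J' assume J': "ideal J' A0" "ev ` M \<subseteq> J'" "J' \<subseteq> carrier A0"
    interpret J': ideal J' A0 by fact
    have i: "is_ideal {x. ev x \<in> J'}" by (rule is_ideal_vimage[OF ev_hom J'(1)])
    have MJ: "M \<subseteq> {x. ev x \<in> J'}" using J'(2) by blast
    show "J' = ev ` M \<or> J' = carrier A0"
    proof (cases "\<one> \<in> J'")
      case True
      then show ?thesis using J'.one_imp_carrier by simp
    next
      case False
      have "?J \<subseteq> {x. ev x \<in> J'}" by (rule order_trans[OF M(2) MJ])
      with False i have "{x. ev x \<in> J'} = M" by (intro max[OF _ MJ]) (simp add: ev_one)
      moreover have "J' \<subseteq> ev ` {x. ev x \<in> J'}"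
      proof
        fix r assume r: "r \<in> J'"
        then obtain x where "ev x = r" using ev_surj J'(3) by fastforce
        then show "r \<in> ev ` {x. ev x \<in> J'}" using r by blast
      qed
      ultimately show ?thesis using J'(2) by auto
    qed
  qed
  then have "ev ` M \<in> {J. maximalideal J A0}" by simp
  also have "\<dots> = {m}" using loc by (simp add: local_ring_def)
  finally have evM: "ev ` M = m" by simp
  have "p \<in> M" by (rule subsetD[OF M(2) KJ(2)])
  then have "ev p \<in> ev ` M" by simp
  then show False using a evM by simp
qed

lemma special_bgr_exists:
  assumes loc: "local_ring A0 m" and noeth: "super_noetherian R"
    and special: "special_superideal R (m <+>\<^bsub>R\<^esub> E1) N"
  shows "\<exists>Xs Y. special_bgr R N m Xs Y \<and> Kdim A0 = ereal (real (length Xs))"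
proof -
  interpret A: cring A0 by (rule cring_even)
  have "maximalideal m A0" using loc by (auto simp: local_ring_def)
  then interpret m: maximalideal m A0 .
  have mE: "m \<subseteq> E0" using m.a_subset by simp
  have mM: "(m <+>\<^bsub>R\<^esub> E1) \<inter> E0 = m"
  proof
    show "(m <+>\<^bsub>R\<^esub> E1) \<inter> E0 \<subseteq> m"
    proof
      fix a assume a: "a \<in> (m <+>\<^bsub>R\<^esub> E1) \<inter> E0"
      then obtain x y where xy: "x \<in> m" "y \<in> E1" "a = x \<oplus> y" unfolding set_add_def' by blast
      have "a \<oplus> \<zero> = x \<oplus> y" using a xy even_carrier by simp
      then have "a = x" using parts_unique(1)[of a x \<zero> y] a xy mE odd_zero by blast
      then show "a \<in> m" using xy by simp
    qed
    show "m \<subseteq> (m <+>\<^bsub>R\<^esub> E1) \<inter> E0"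
    proof
      fix a assume a: "a \<in> m"
      then have "a = a \<oplus> \<zero>" using mE even_carrier by auto
      then show "a \<in> (m <+>\<^bsub>R\<^esub> E1) \<inter> E0" unfolding set_add_def' using a mE odd_zero by blast
    qed
  qed
  let ?N = "N \<inter> E0" and ?B = "bar_ring R" and ?\<phi> = "\<lambda>p. residue R (ev p)"
  have N: "superideal N R" "radical A0 ?N = m" and NE: "N \<inter> E1 = E1"
    using special mM by (auto simp: special_superideal_def primary_superideal_def primary_to_def)
  obtain xs where xs: "set xs \<subseteq> E0" and Kd: "ereal (real (length xs)) = Kdim ?B"
    and gen: "Idl\<^bsub>?B\<^esub> (set (map (residue R) xs)) = residue R ` (?N <+>\<^bsub>R\<^esub> odd_sq R)"
    using special unfolding special_superideal_def system_of_parameters_def by auto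
  have h: "surj_hom ?\<phi> ?B" unfolding residue_def bar_ring_def by (rule surj_hom_Quot[OF ev_hom odd_sq_ideal])
  have Ker_h: "{p. ?\<phi> p = \<zero>\<^bsub>?B\<^esub>} = Osq"
    unfolding residue_def bar_ring_def Quot_kernel[OF ev_hom odd_sq_ideal] Osq_def ..
  interpret B: cring ?B using h by (simp add: surj_hom_def)
  have \<phi>_eq: "?\<phi> p = ?\<phi> q" if "p - q \<in> Osq" for p q
  proof -
    have "?\<phi> (p - q) = \<zero>\<^bsub>?B\<^esub>" using that Ker_h by blast
    then have "?\<phi> (q + (p - q)) = ?\<phi> q" using hom_add[OF h, of q "p - q"] hom_closed[OF h, of q] by simp
    then show ?thesis by simp
  qed
  \<comment> \<open>The parameters are given by residue classes only; since each class meets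
    \<open>N + R_1^2\<close>, dropping the summand in \<open>R_1^2\<close> yields a representative
    inside \<open>N\<close> itself.\<close>
  have "\<exists>p. ev p \<in> N \<and> ?\<phi> p = residue R x" if "x \<in> set xs" for x
  proof -
    have "set (map (residue R) xs) \<subseteq> carrier ?B"
    proof (intro subsetI)
      fix r assume "r \<in> set (map (residue R) xs)"
      then obtain x where "x \<in> E0" "r = residue R x" using xs by auto
      then show "r \<in> carrier ?B" using ev_surj hom_closed[OF h] by metis
    qed
    then have "residue R x \<in> Idl\<^bsub>?B\<^esub> (set (map (residue R) xs))" using B.genideal_self that by auto
    then obtain n s where ns: "n \<in> ?N" "s \<in> odd_sq R" "residue R x = residue R (n \<oplus> s)"
      unfolding gen set_add_def' by blast
    have sE: "s \<in> E0" using ns(2) odd_sq_ideal unfolding ideal_even_iff by blast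
    obtain p where p: "ev p = n" using ev_surj ns(1) by blast
    obtain q where q: "ev q = s" using ev_surj[OF sE] ..
    have "(p + q) - p \<in> Osq" using q ns(2) by (simp add: Osq_def)
    from \<phi>_eq[OF this] show ?thesis using p q ns by (auto simp: ev_add)
  qed
  then obtain f where f: "\<And>x. x \<in> set xs \<Longrightarrow> ev (f x) \<in> N \<and> ?\<phi> (f x) = residue R x" by metis
  define Xs where "Xs = map f xs"
  have XsN: "ev p \<in> N" if "p \<in> set Xs" for p using that f by (auto simp: Xs_def)
  have Xs\<phi>: "set (map (residue R) xs) = ?\<phi> ` set Xs" using f by (force simp: Xs_def)
  have N_sub: "p \<in> sp UNIV (set Xs \<union> Osq)" if "ev p \<in> N" for p
  proof -
    let ?Q = "sp UNIV (set Xs \<union> Osq)"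
    have Q: "Osq \<subseteq> ?Q" "set Xs \<subseteq> ?Q" using sp_base[OF is_subring_UNIV, of _ "set Xs \<union> Osq"] by blast+
    have K: "{p. ?\<phi> p = \<zero>\<^bsub>?B\<^esub>} \<subseteq> ?Q" unfolding Ker_h by (rule Q(1))
    have "\<zero> \<in> odd_sq R" using odd_sq_ideal unfolding ideal_even_iff by simp
    then have "ev p \<oplus> \<zero> \<in> ?N <+>\<^bsub>R\<^esub> odd_sq R" unfolding set_add_def'
      by (intro UN_I[of "ev p"] UN_I[of \<zero>]) (use that in auto)
    then have "?\<phi> p \<in> Idl\<^bsub>?B\<^esub> (set (map (residue R) xs))" unfolding gen by auto
    moreover have "Idl\<^bsub>?B\<^esub> (set (map (residue R) xs)) \<subseteq> ?\<phi> ` ?Q" unfolding Xs\<phi>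
      by (rule B.genideal_minimal[OF ideal_image[OF h is_ideal_sp] image_mono[OF Q(2)]])
    ultimately show ?thesis using vimage_image[OF h is_ideal_sp K] by blast
  qed
  have N_split: "\<exists>u\<in>sp UNIV (set Xs). p - u \<in> Osq" if "ev p \<in> N" for p
    using sp_UnD[OF N_sub[OF that]] by (simp add: sp_is_ideal[OF is_ideal_Osq])
  have NmA: "a \<in> m" if "a \<in> N" "a \<in> E0" for a
  proof -
    have "a [^]\<^bsub>A0\<^esub> (1::nat) \<in> ?N" using that even_carrier by (simp add: even_ring_pow)
    moreover have "a \<in> carrier A0" using that by simp
    ultimately show ?thesis unfolding N(2)[symmetric] radical_def by blast
  qed
  have acc: "acc_above Ker" by (rule acc_even[OF noeth])
  have L: "noeth_local Ker {p. ev p \<in> m} Xs"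
  proof
    show "is_ideal Ker" by (rule is_ideal_Ker)
    show "is_ideal {p. ev p \<in> m}" by (rule is_ideal_vimage[OF ev_hom m.is_ideal])
    show "Ker \<subseteq> {p. ev p \<in> m}" using m.zero_closed by (auto simp: Ker_def)
    show "1 \<notin> {p. ev p \<in> m}" using m.one_imp_carrier m.I_notcarr by (auto simp: ev_one)
    show "\<exists>b. a * b - 1 \<in> Ker" if "a \<notin> {p. ev p \<in> m}" for a using local_unit[OF acc loc] that by simp
    show "acc_above Ker" by (rule acc)
    show "set Xs \<subseteq> {p. ev p \<in> m}" using XsN NmA by auto
    show "\<exists>n. a ^ n \<in> sp UNIV (set Xs \<union> Ker)" if "a \<in> {p. ev p \<in> m}" for a
    proof -
      have "ev a \<in> radical A0 ?N" using that N(2) by simp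
      then obtain n :: nat where "ev a [^]\<^bsub>A0\<^esub> n \<in> N" by (auto simp: radical_def)
      then have "ev (a ^ n) \<in> N" by (simp add: hom_power[OF ev_hom])
      then obtain u where u: "u \<in> sp UNIV (set Xs)" "a ^ n - u \<in> Osq" using N_split by blast
      obtain k where k: "(a ^ n - u) ^ k \<in> Ker" using Osq_nilpotent[OF u(2)] ..
      let ?H = "sp UNIV (set Xs \<union> Ker)"
      \<comment> \<open>A difference of equal powers is divisible by the difference of the bases,
        here \<open>u\<close>; as the second power vanishes in \<open>R_0\<close>, a power of
        \<open>a\<close> is a multiple of \<open>u\<close> there.\<close>
      obtain c where "(a ^ n) ^ k - (a ^ n - u) ^ k = (a ^ n - (a ^ n - u)) * c" using power_diff_sumr2 by blast
      then have e: "(a ^ n) ^ k = c * u + (a ^ n - u) ^ k" by (simp add: algebra_simps)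
      have "u \<in> ?H" using u(1) sp_mono[of "set Xs" "set Xs \<union> Ker" UNIV UNIV] by blast
      then have "c * u \<in> ?H" by (rule is_idealD(3)[OF is_ideal_sp])
      moreover have "(a ^ n - u) ^ k \<in> ?H" using k by (intro sp_base[OF is_subring_UNIV]) simp
      ultimately have "a ^ (n * k) \<in> ?H" unfolding power_mult e by (rule sp_add)
      then show ?thesis ..
    qed
  qed
  obtain Y where Y: "finite Y" "Y \<subseteq> E1" "E1 \<subseteq> lsp R E0 Y" using odd_finitely_generated[OF noeth] by blast
  have Cf1: "p \<in> Cf Xs 1" if pN: "ev p \<in> N" for p
  proof -
    obtain u where u: "u \<in> sp UNIV (set Xs)" "p - u \<in> Osq" using N_split[OF pN] by blast
    have "sp UNIV (set Xs) \<subseteq> Qp Xs 1" by (rule sp_ideal_subset[OF is_ideal_Qp set_Qp])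
    then show ?thesis using u by (auto simp: Cf_def)
  qed
  have Ni: "ideal N R" using N(1) by (simp add: superideal_def)
  have "special_bgr R N m Xs Y"
  proof (intro special_bgr.intro bigraded.intro bigraded_axioms.intro special_bgr_axioms.intro)
    show "E1 \<subseteq> N" using NE by blast
    show "ev p \<in> N" if "p \<in> set Xs" for p by (rule XsN[OF that])
    show "p \<in> Cf Xs 1" if "ev p \<in> N" for p by (rule Cf1[OF that])
  qed (rule super_ring_axioms Ni L Y)+
  moreover have "Kdim A0 = ereal (real (length Xs))"
  proof -
    \<comment> \<open>Every prime contains the nil ideal \<open>R_1^2\<close>, so \<open>R_0\<close>
      and its quotient by \<open>R_1^2\<close> have the same chains, and the number of parameters is
      the dimension of \<open>R_0\<close> as well.\<close>
    have "pchain Osq P n \<longleftrightarrow> pchain Ker P n" for P n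
    proof
      show "pchain Osq P n \<Longrightarrow> pchain Ker P n" using Ker_Osq unfolding pchain_def by (meson order_trans)
      assume P: "pchain Ker P n"
      then have "is_prime (P 0)" "Ker \<subseteq> P 0" unfolding pchain_def by (meson le0)+
      then have "Osq \<subseteq> P 0" by (rule Osq_sub_prime)
      then show "pchain Osq P n" using P unfolding pchain_def by simp
    qed
    then have "prime_chain ?B n \<longleftrightarrow> prime_chain A0 n" for n
      using prime_chain_iff[OF ev_hom] prime_chain_iff[OF h] unfolding Ker_h by (simp add: Ker_def)
    moreover have "Kdim ?B = ereal (real (length Xs))" using Kd by (simp add: Xs_def)
    ultimately show ?thesis by (simp add: Kdim_eq_iff)
  qed
  ultimately show ?thesis by blast
qed

end

theorem theorem6p10:
  fixes R :: "('a, 'm) superring_scheme"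
    and \<mm> \<MM> \<NN> :: "'a set"
  assumes "local_super_ring R \<mm> \<MM>"
    and "super_noetherian R"
    and "\<exists>K. subfield K R"
    and "special_superideal R \<MM> \<NN>"
  shows "Ksdim (bgr R \<NN>) = Ksdim R"
proof -
  interpret super_ring R using assms(1) by (simp add: local_super_ring_def)
  obtain Xs Y where "special_bgr R \<NN> \<mm> Xs Y" "Kdim (even_ring R) = ereal (real (length Xs))"
    using special_bgr_exists[of \<mm> \<NN>] assms by (auto simp: local_super_ring_def)
  then show ?thesis by (rule special_bgr.Ksdim_bgr)
qed

end
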